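(* Let $A$ be a separable recursive subhomogeneous C$^*$-algebra with a fixed decomposition of length $l$, base spaces $X_0,\dots,X_l$, subspaces $X_k^{(0)}\subseteq X_k$, and topological dimension function $d$. Let $a,b\in A$ be positive and suppose that \[ \mathrm{rank}(a(x))+\frac{d(x)-1}{2}\le \mathrm{rank}(b(x))\quad\text{for all } x\in X_k\setminus X_k^{(0)},\ k\in\{0,1,\dots,l\}. \] Then $a\precsim b$.
   Context: An RSH algebra with decomposition of length $l$: $A=[\cdots[[C_0\oplus_{C_1^{(0)}}C_1]\oplus_{C_2^{(0)}}C_2]\cdots]\oplus_{C_l^{(0)}}C_l$ with $C_k=\mathrm{M}_{n(k)}(\mathrm{C}(X_k))$, $X_k$ compact Hausdorff, $C_k^{(0)}=\mathrm{M}_{n(k)}(\mathrm{C}(X_k^{(0)}))$ for closed $X_k^{(0)}\subseteq X_k$ (possibly empty), each stage being the pullback along a unital $*$-homomorphism from the previous stage algebra into $C_k^{(0)}$ and the restriction map $C_k\to C_k^{(0)}$. $A$ sits inside $\bigoplus_k\mathrm{M}_{n(k)}(\mathrm{C}(X_k))$; for $x\in X_k$, $a(x)\in \mathrm{M}_{n(k)}$ denotes the $k$-th component of $a$ evaluated at $x$. $d(x)=\dim(X_k)$ (covering dimension) for $x\in X_k$. Cuntz subequivalence: $a\precsim b$ iff there are $v_n\in\mathrm{M}_\infty(A)$ with $\|v_nbv_n^*-a\|\to0$. *)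

theory Defs
  imports "HOL-Analysis.Analysis" "Jordan_Normal_Form.Schur_Decomposition" "Jordan_Normal_Form.DL_Rank"
begin

definition vnorm :: "complex Matrix.vec \<Rightarrow> real" where
  "vnorm v = sqrt (\<Sum>i<dim_vec v. (cmod (vec_index v i))\<^sup>2)"

definition opnorm :: "complex mat \<Rightarrow> real" where
  "opnorm M = Sup {vnorm (mult_mat_vec M v) | v. v \<in> carrier_vec (dim_col M) \<and> vnorm v \<le> 1}"

definition mrank :: "complex mat \<Rightarrow> nat" where
  "mrank M = vec_space.rank (dim_row M) M"

definition pos_mat :: "complex mat \<Rightarrow> bool" where
  "pos_mat M \<longleftrightarrow> mat_adjoint M = M \<and>
     (\<forall>c. eigenvalue M c \<longrightarrow> Im c = 0 \<and> 0 \<le> Re c)"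

definition covdim_le :: "'x topology \<Rightarrow> nat \<Rightarrow> bool" where
  "covdim_le X m \<longleftrightarrow>
    (\<forall>\<U>. finite \<U> \<and> (\<forall>U\<in>\<U>. openin X U) \<and> topspace X \<subseteq> \<Union>\<U> \<longrightarrow>
      (\<exists>\<V>. finite \<V> \<and> (\<forall>V\<in>\<V>. openin X V) \<and> topspace X \<subseteq> \<Union>\<V> \<and>
           (\<forall>V\<in>\<V>. \<exists>U\<in>\<U>. V \<subseteq> U) \<and>
           (\<forall>x\<in>topspace X. card {V\<in>\<V>. x \<in> V} \<le> m + 1)))"

text \<open>Lebesgue covering dimension (\<open>\<infinity>\<close> if no finite bound exists).\<close>
definition covdim :: "'x topology \<Rightarrow> enat" where
  "covdim X = (INF m\<in>{m. covdim_le X m}. enat m)"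

section \<open>Elements of the ambient algebra \<open>\<Oplus>_k M_{n(k)}(C(X_k))\<close>\<close>

text \<open>An element \<open>a\<close> is given by its components: \<open>a k x\<close> is the \<open>k\<close>-th component evaluated at \<open>x\<close>.\<close>
type_synonym 'x elt = "nat \<Rightarrow> 'x \<Rightarrow> complex mat"

definition cont_mat_fun :: "'x topology \<Rightarrow> nat \<Rightarrow> ('x \<Rightarrow> complex mat) \<Rightarrow> bool" where
  "cont_mat_fun T m f \<longleftrightarrow> (\<forall>x\<in>topspace T. f x \<in> carrier_mat m m) \<and>
     (\<forall>i<m. \<forall>j<m. continuous_map T euclidean (\<lambda>x. f x $$ (i,j)))"

definition ext_elt :: "(nat \<Rightarrow> nat) \<Rightarrow> (nat \<Rightarrow> 'x topology) \<Rightarrow> nat \<Rightarrow> 'x elt \<Rightarrow> bool" where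
  "ext_elt n X k a \<longleftrightarrow> (\<forall>j x. (k < j \<or> x \<notin> topspace (X j)) \<longrightarrow> a j x = 0\<^sub>m (n j) (n j))"

definition trunc :: "(nat \<Rightarrow> nat) \<Rightarrow> nat \<Rightarrow> 'x elt \<Rightarrow> 'x elt" where
  "trunc n k a = (\<lambda>j x. if j \<le> k then a j x else 0\<^sub>m (n j) (n j))"

definition eadd :: "'x elt \<Rightarrow> 'x elt \<Rightarrow> 'x elt" where
  "eadd a b = (\<lambda>j x. a j x + b j x)"
definition emult :: "'x elt \<Rightarrow> 'x elt \<Rightarrow> 'x elt" where
  "emult a b = (\<lambda>j x. a j x * b j x)"
definition esmult :: "complex \<Rightarrow> 'x elt \<Rightarrow> 'x elt" where
  "esmult c a = (\<lambda>j x. c \<cdot>\<^sub>m a j x)"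
definition eadj :: "'x elt \<Rightarrow> 'x elt" where
  "eadj a = (\<lambda>j x. mat_adjoint (a j x))"
definition eone :: "(nat \<Rightarrow> nat) \<Rightarrow> (nat \<Rightarrow> 'x topology) \<Rightarrow> nat \<Rightarrow> 'x elt" where
  "eone n X k = (\<lambda>j x. if j \<le> k \<and> x \<in> topspace (X j) then 1\<^sub>m (n j) else 0\<^sub>m (n j) (n j))"

text \<open>\<open>rsh_stage n X X0 \<phi> k\<close> is the algebra
  \<open>[\<cdots>[C_0 \<oplus>_{C_1^{(0)}} C_1] \<cdots>] \<oplus>_{C_k^{(0)}} C_k\<close>, where \<open>\<phi> k\<close> is the map from the
  previous stage into \<open>C_k^{(0)} = M_{n(k)}(C(X0 k))\<close> (only its values on \<open>X0 k\<close> matter).\<close>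
fun rsh_stage :: "(nat \<Rightarrow> nat) \<Rightarrow> (nat \<Rightarrow> 'x topology) \<Rightarrow> (nat \<Rightarrow> 'x set) \<Rightarrow>
    (nat \<Rightarrow> 'x elt \<Rightarrow> 'x \<Rightarrow> complex mat) \<Rightarrow> nat \<Rightarrow> 'x elt set" where
  "rsh_stage n X X0 \<phi> 0 = {a. ext_elt n X 0 a \<and> cont_mat_fun (X 0) (n 0) (a 0)}"
| "rsh_stage n X X0 \<phi> (Suc k) = {a. ext_elt n X (Suc k) a \<and>
      trunc n k a \<in> rsh_stage n X X0 \<phi> k \<and>
      cont_mat_fun (X (Suc k)) (n (Suc k)) (a (Suc k)) \<and>
      (\<forall>x\<in>X0 (Suc k). a (Suc k) x = \<phi> (Suc k) (trunc n k a) x)}"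

definition unital_star_hom :: "'x elt set \<Rightarrow> 'x elt \<Rightarrow> 'x topology \<Rightarrow> 'x set \<Rightarrow> nat \<Rightarrow>
    ('x elt \<Rightarrow> 'x \<Rightarrow> complex mat) \<Rightarrow> bool" where
  "unital_star_hom B e T Y m \<psi> \<longleftrightarrow>
     (\<forall>a\<in>B. cont_mat_fun (subtopology T Y) m (\<psi> a)) \<and>
     (\<forall>a\<in>B. \<forall>b\<in>B. \<forall>x\<in>Y. \<psi> (eadd a b) x = \<psi> a x + \<psi> b x) \<and>
     (\<forall>a\<in>B. \<forall>c. \<forall>x\<in>Y. \<psi> (esmult c a) x = c \<cdot>\<^sub>m \<psi> a x) \<and>
     (\<forall>a\<in>B. \<forall>b\<in>B. \<forall>x\<in>Y. \<psi> (emult a b) x = \<psi> a x * \<psi> b x) \<and>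
     (\<forall>a\<in>B. \<forall>x\<in>Y. \<psi> (eadj a) x = mat_adjoint (\<psi> a x)) \<and>
     (\<forall>x\<in>Y. \<psi> e x = 1\<^sub>m m)"

definition rsh_decomposition :: "(nat \<Rightarrow> nat) \<Rightarrow> (nat \<Rightarrow> 'x topology) \<Rightarrow> (nat \<Rightarrow> 'x set) \<Rightarrow>
    (nat \<Rightarrow> 'x elt \<Rightarrow> 'x \<Rightarrow> complex mat) \<Rightarrow> nat \<Rightarrow> bool" where
  "rsh_decomposition n X X0 \<phi> l \<longleftrightarrow>
     (\<forall>k\<le>l. 0 < n k \<and> compact_space (X k) \<and> Hausdorff_space (X k) \<and> closedin (X k) (X0 k)) \<and>
     X0 0 = {} \<and>
     (\<forall>k\<in>{1..l}. unital_star_hom (rsh_stage n X X0 \<phi> (k - 1)) (eone n X (k - 1))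
                     (X k) (X0 k) (n k) (\<phi> k))"

definition elt_norm :: "(nat \<Rightarrow> 'x topology) \<Rightarrow> nat \<Rightarrow> 'x elt \<Rightarrow> real" where
  "elt_norm X l a = Sup (insert 0 {opnorm (a k x) | k x. k \<le> l \<and> x \<in> topspace (X k)})"

definition separable_alg :: "(nat \<Rightarrow> 'x topology) \<Rightarrow> nat \<Rightarrow> 'x elt set \<Rightarrow> bool" where
  "separable_alg X l B \<longleftrightarrow> (\<exists>D\<subseteq>B. countable D \<and>
     (\<forall>a\<in>B. \<forall>\<epsilon>>0. \<exists>d\<in>D. elt_norm X l (eadd a (esmult (-1) d)) < \<epsilon>))"

definition positive_elt :: "(nat \<Rightarrow> 'x topology) \<Rightarrow> nat \<Rightarrow> 'x elt set \<Rightarrow> 'x elt \<Rightarrow> bool" where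
  "positive_elt X l B a \<longleftrightarrow> a \<in> B \<and> (\<forall>k\<le>l. \<forall>x\<in>topspace (X k). pos_mat (a k x))"

text \<open>An element \<open>W = (W p q)_{p,q<m}\<close> of \<open>M_m(A)\<close>, evaluated at \<open>x \<in> X_k\<close>, as an
  \<open>m n(k) \<times> m n(k)\<close> block matrix.\<close>
definition blockmat :: "(nat \<Rightarrow> nat) \<Rightarrow> nat \<Rightarrow> (nat \<Rightarrow> nat \<Rightarrow> 'x elt) \<Rightarrow> nat \<Rightarrow> 'x \<Rightarrow> complex mat" where
  "blockmat n m W k x = mat (m * n k) (m * n k)
      (\<lambda>(p, q). W (p div n k) (q div n k) k x $$ (p mod n k, q mod n k))"

definition corner :: "(nat \<Rightarrow> nat) \<Rightarrow> 'x elt \<Rightarrow> nat \<Rightarrow> nat \<Rightarrow> 'x elt" where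
  "corner n a = (\<lambda>p q. if p = 0 \<and> q = 0 then a else (\<lambda>j x. 0\<^sub>m (n j) (n j)))"

text \<open>C*-norm of an element of \<open>M_m(A) \<subseteq> \<Oplus>_k M_{m n(k)}(C(X_k))\<close>, given through its
  pointwise values.\<close>
definition sup_norm :: "(nat \<Rightarrow> 'x topology) \<Rightarrow> nat \<Rightarrow> (nat \<Rightarrow> 'x \<Rightarrow> complex mat) \<Rightarrow> real" where
  "sup_norm X l F = Sup (insert 0 {opnorm (F k x) | k x. k \<le> l \<and> x \<in> topspace (X k)})"

text \<open>Cuntz subequivalence \<open>a \<precsim> b\<close> in \<open>A\<close>: there are \<open>v_j \<in> M_\<infinity>(A)\<close> (here
  \<open>v_j \<in> M_{m_j}(A)\<close>) with \<open>\<parallel>v_j b v_j^* - a\<parallel> \<rightarrow> 0\<close>.\<close>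
definition cuntz_below :: "(nat \<Rightarrow> nat) \<Rightarrow> (nat \<Rightarrow> 'x topology) \<Rightarrow> nat \<Rightarrow> 'x elt set \<Rightarrow>
    'x elt \<Rightarrow> 'x elt \<Rightarrow> bool" where
  "cuntz_below n X l B a b \<longleftrightarrow>
     (\<exists>(m :: nat \<Rightarrow> nat) (v :: nat \<Rightarrow> nat \<Rightarrow> nat \<Rightarrow> 'x elt).
        (\<forall>j. 0 < m j \<and> (\<forall>p<m j. \<forall>q<m j. v j p q \<in> B)) \<and>
        (\<lambda>j. sup_norm X l (\<lambda>k x.
            blockmat n (m j) (v j) k x * blockmat n (m j) (corner n b) k x
              * mat_adjoint (blockmat n (m j) (v j) k x)
            - blockmat n (m j) (corner n a) k x)) \<longlonglongrightarrow> 0)"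

end

theory Submission
  imports Defs "Jordan_Normal_Form.Spectral_Radius"
begin

text \<open>Fix \<open>\<epsilon> > 0\<close>. It suffices to find \<open>s \<in> A\<close> and \<open>c \<ge> 0\<close> such that \<open>c s b s\<^sup>* + \<epsilon> - a\<close> is
  positive definite at every point of every base space: with \<open>h = c s b s\<^sup>*\<close> and polynomials
  \<open>p(t) \<approx> t\<^bsup>1/2\<^esup>\<close>, \<open>g(t) \<approx> (t + \<epsilon>)\<^bsup>-1/2\<^esup>\<close>, the element \<open>v = p(a) g(h) c\<^bsup>1/2\<^esup> s\<close> then satisfies
  \<open>\<parallel>v b v\<^sup>* - a\<parallel> \<le> 5 \<epsilon>\<close>.

  The element \<open>s\<close> is constructed stage by stage. Positive definiteness is an open condition, and a
  unital \<open>*\<close>-homomorphism preserves it, so the part of \<open>s\<close> already found prescribes good values on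
  \<open>X_k\<^sup>(\<^sup>0\<^sup>)\<close>. These are extended to \<open>X_k\<close> by Tietze's theorem and then perturbed away from \<open>X_k\<^sup>(\<^sup>0\<^sup>)\<close>.
  Near a point where \<open>a\<close> and \<open>b\<close> have ranks \<open>r\<close> and \<open>j\<close>, the condition follows, up to replacing
  \<open>s\<close> by \<open>a\<^sup>N s\<close>, from the linear independence of the \<open>r\<close> columns of a continuous
  \<open>j \<times> r\<close> matrix. Columns are made independent one after the other; modulo the previous
  columns, the last one is a function into a complex space of dimension \<open>j - r + 1\<close>, which
  can be moved off zero when \<open>dim X_k < 2 (j - r + 1)\<close>. This is the rank hypothesis.\<close>

section \<open>Hermitian matrices\<close>

text \<open>The rank hypothesis is silent on X_k^(0), and the values there are prescribed by an
  abstract homomorphism, so ranks cannot be carried from stage to stage. An inequality between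
  algebra elements can; this is why the slack \<epsilon> and positive definiteness appear from the
  outset. Ranks enter only near single points outside X_k^(0). At nearby points the rank of
  \<open>a\<close> may jump up, but the new eigenvalues are small and are covered by \<epsilon>:
  with \<phi> a cutoff that is 0 at 0 and 1 from \<epsilon>/2 on, the kernel of (1 - \<phi>)(a) has
  dimension at most r near a point of rank r. Only this kernel has to be served by \<open>b\<close>.
  The shape of the hypothesis comes from real dimensions: 2r + d \<le> 2j + 1 says that d is less
  than 2(j - r + 1), the real dimension of a complex space of dimension j - r + 1. In the final
  error 5\<epsilon>, one \<epsilon> comes from replacing a by p(a)^2, and 4\<epsilon> from g(h) h
  g(h) differing from 1.\<close>

lemma mat_adjoint_dim [simp]: "dim_row (mat_adjoint A) = dim_col A" "dim_col (mat_adjoint A) = dim_row A"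
  by (auto simp: mat_adjoint_def)

lemma mat_adjoint_index [simp]:
  fixes A :: "complex mat"
  shows "i < dim_col A \<Longrightarrow> j < dim_row A \<Longrightarrow> mat_adjoint A $$ (i, j) = cnj (A $$ (j, i))"
  by (auto simp: mat_adjoint_def mat_of_rows_index)

lemma mat_adjoint_carrier [simp]: "A \<in> carrier_mat m n \<Longrightarrow> mat_adjoint A \<in> carrier_mat n m"
  by (metis carrier_matD carrier_matI mat_adjoint_dim)

lemma mat_adjoint_adjoint [simp]: "mat_adjoint (mat_adjoint A) = (A :: complex mat)"
  by (rule eq_matI) auto

lemma mat_adjoint_one [simp]: "mat_adjoint (1\<^sub>m n :: complex mat) = 1\<^sub>m n"
  by (rule eq_matI) auto

lemma mat_adjoint_zero [simp]: "mat_adjoint (0\<^sub>m n m :: complex mat) = 0\<^sub>m m n"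
  by (rule eq_matI) auto

lemma mat_adjoint_smult [simp]: "mat_adjoint (c \<cdot>\<^sub>m A :: complex mat) = cnj c \<cdot>\<^sub>m mat_adjoint A"
  by (rule eq_matI) auto

lemma mat_adjoint_add:
  fixes A B :: "complex mat"
  assumes "A \<in> carrier_mat m n" "B \<in> carrier_mat m n"
  shows "mat_adjoint (A + B) = mat_adjoint A + mat_adjoint B"
  using assms by (intro eq_matI) auto

lemma mat_adjoint_minus:
  fixes A B :: "complex mat"
  assumes "A \<in> carrier_mat m n" "B \<in> carrier_mat m n"
  shows "mat_adjoint (A - B) = mat_adjoint A - mat_adjoint B"
  using assms by (intro eq_matI) auto

lemma mat_adjoint_mult:
  fixes A B :: "complex mat"
  assumes "A \<in> carrier_mat m n" "B \<in> carrier_mat n k"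
  shows "mat_adjoint (A * B) = mat_adjoint B * mat_adjoint A"
  using assms by (intro eq_matI) (auto simp: scalar_prod_def mult.commute intro!: sum.cong)

lemma cscalar_prod_sum:
  fixes u v :: "complex Matrix.vec"
  assumes "v \<in> carrier_vec n"
  shows "u \<bullet>c v = (\<Sum>i<n. vec_index u i * cnj (vec_index v i))"
  using assms by (auto simp: scalar_prod_def atLeast0LessThan intro!: sum.cong)

lemma mult_mat_vec_index_sum:
  fixes A :: "complex mat"
  assumes "A \<in> carrier_mat m n" "u \<in> carrier_vec n" "i < m"
  shows "vec_index (A *\<^sub>v u) i = (\<Sum>j<n. A $$ (i, j) * vec_index u j)"
  using assms by (auto simp: scalar_prod_def atLeast0LessThan intro!: sum.cong)

lemma mult_mat_index_sum:
  fixes A B :: "complex mat"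
  assumes "A \<in> carrier_mat m n" "B \<in> carrier_mat n k" "i < m" "j < k"
  shows "(A * B) $$ (i, j) = (\<Sum>l<n. A $$ (i, l) * B $$ (l, j))"
  using assms by (auto simp: scalar_prod_def atLeast0LessThan intro!: sum.cong)

lemma cscalar_prod_adjoint:
  fixes A :: "complex mat"
  assumes A: "A \<in> carrier_mat m n" and u: "u \<in> carrier_vec n" and w: "w \<in> carrier_vec m"
  shows "(A *\<^sub>v u) \<bullet>c w = u \<bullet>c (mat_adjoint A *\<^sub>v w)"
proof -
  have "(A *\<^sub>v u) \<bullet>c w = (\<Sum>i<m. \<Sum>j<n. A $$ (i, j) * vec_index u j * cnj (vec_index w i))"
    unfolding cscalar_prod_sum[OF w]
    using mult_mat_vec_index_sum[OF A u] by (simp add: sum_distrib_right)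
  also have "\<dots> = (\<Sum>j<n. \<Sum>i<m. A $$ (i, j) * vec_index u j * cnj (vec_index w i))"
    by (rule sum.swap)
  also have "\<dots> = u \<bullet>c (mat_adjoint A *\<^sub>v w)"
    using mult_mat_vec_index_sum[OF mat_adjoint_carrier[OF A] w] A mult_mat_vec_carrier[OF mat_adjoint_carrier[OF A] w]
    by (subst cscalar_prod_sum[of _ n]) (auto simp: sum_distrib_left mult_ac intro!: sum.cong)
  finally show ?thesis .
qed

lemma cscalar_prod_cnj:
  fixes u v :: "complex Matrix.vec"
  assumes "u \<in> carrier_vec n" "v \<in> carrier_vec n"
  shows "v \<bullet>c u = cnj (u \<bullet>c v)"
  using assms by (simp add: cscalar_prod_sum[of _ n] mult.commute)

text \<open>The square of \<open>vnorm\<close>. With squares, estimates in an eigenbasis become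
  comparisons of finite sums; the passage to \<open>opnorm\<close> is made once, in
  \<open>opnorm_le\<close>.\<close>

definition nsq :: "complex Matrix.vec \<Rightarrow> real" where
  "nsq u = (\<Sum>i<dim_vec u. (cmod (vec_index u i))\<^sup>2)"

text \<open>The real part loses nothing for Hermitian \<open>M\<close>, whose form is real, and it
  allows inequalities.\<close>

definition qform :: "complex mat \<Rightarrow> complex Matrix.vec \<Rightarrow> real" where
  "qform M u = Re ((M *\<^sub>v u) \<bullet>c u)"

lemma cscalar_prod_self: "u \<bullet>c u = complex_of_real (nsq u)"
  by (simp add: cscalar_prod_sum[of u "dim_vec u"] nsq_def flip: complex_norm_square)

lemma nsq_nonneg [simp]: "0 \<le> nsq u"
  by (simp add: nsq_def sum_nonneg)

lemma nsq_eq_0_iff: "u \<in> carrier_vec n \<Longrightarrow> nsq u = 0 \<longleftrightarrow> u = 0\<^sub>v n"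
  by (subst nsq_def, subst sum_nonneg_eq_0_iff) (auto intro!: eq_vecI)

lemma nsq_pos: "u \<in> carrier_vec n \<Longrightarrow> u \<noteq> 0\<^sub>v n \<Longrightarrow> 0 < nsq u"
  using nsq_eq_0_iff nsq_nonneg by (metis less_eq_real_def)

definition diagm :: "nat \<Rightarrow> (nat \<Rightarrow> complex) \<Rightarrow> complex mat" where
  "diagm n f = mat n n (\<lambda>(i, j). if i = j then f i else 0)"

lemma diagm_carrier [simp]: "diagm n f \<in> carrier_mat n n" "dim_row (diagm n f) = n" "dim_col (diagm n f) = n"
  by (auto simp: diagm_def)

lemma diagm_index [simp]: "i < n \<Longrightarrow> j < n \<Longrightarrow> diagm n f $$ (i, j) = (if i = j then f i else 0)"
  by (auto simp: diagm_def)

lemma diagm_mult: "diagm n f * diagm n g = diagm n (\<lambda>i. f i * g i)"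
proof (rule eq_matI)
  fix i j assume "i < dim_row (diagm n (\<lambda>i. f i * g i))" "j < dim_col (diagm n (\<lambda>i. f i * g i))"
  hence ij: "i < n" "j < n" by auto
  have "(diagm n f * diagm n g) $$ (i,j) = (\<Sum>l<n. if l = i then f i * (if i = j then g i else 0) else 0)"
    unfolding mult_mat_index_sum[OF diagm_carrier(1) diagm_carrier(1) ij]
    using ij by (intro sum.cong) auto
  also have "\<dots> = f i * (if i = j then g i else 0)" using ij by (subst sum.delta) auto
  finally show "(diagm n f * diagm n g) $$ (i,j) = diagm n (\<lambda>i. f i * g i) $$ (i,j)" using ij by auto
qed auto

lemma diagm_mult_vec:
  assumes "u \<in> carrier_vec n" shows "diagm n f *\<^sub>v u = vec n (\<lambda>i. f i * vec_index u i)"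
proof (rule eq_vecI)
  fix i assume "i < dim_vec (vec n (\<lambda>i. f i * vec_index u i))"
  hence i: "i < n" by auto
  have "vec_index (diagm n f *\<^sub>v u) i = (\<Sum>j<n. if j = i then f i * vec_index u i else 0)"
    unfolding mult_mat_vec_index_sum[OF diagm_carrier(1) assms i] using i by (intro sum.cong) auto
  also have "\<dots> = f i * vec_index u i" using i by (subst sum.delta) auto
  finally show "vec_index (diagm n f *\<^sub>v u) i = vec_index (vec n (\<lambda>i. f i * vec_index u i)) i" using i by auto
qed auto

lemma diagm_one: "diagm n (\<lambda>_. 1) = 1\<^sub>m n"
  by (rule eq_matI) auto

lemma diagm_adjoint [simp]: "mat_adjoint (diagm n f) = diagm n (\<lambda>i. cnj (f i))"
  by (rule eq_matI) auto

lemma diagm_add: "diagm n f + diagm n g = diagm n (\<lambda>i. f i + g i)"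
  by (rule eq_matI) auto

lemma diagm_smult: "c \<cdot>\<^sub>m diagm n f = diagm n (\<lambda>i. c * f i)"
  by (rule eq_matI) auto

section \<open>Unitary matrices and the spectral theorem\<close>

definition unitary_mat :: "nat \<Rightarrow> complex mat \<Rightarrow> bool" where
  "unitary_mat n U \<longleftrightarrow> U \<in> carrier_mat n n \<and> mat_adjoint U * U = 1\<^sub>m n \<and> U * mat_adjoint U = 1\<^sub>m n"

lemma unitary_matI:
  assumes U: "U \<in> carrier_mat n n" and "mat_adjoint U * U = 1\<^sub>m n"
  shows "unitary_mat n U"
  unfolding unitary_mat_def
  using assms mat_mult_left_right_inverse[OF mat_adjoint_carrier[OF U] U] by auto

lemma unitary_mat_adjoint: "unitary_mat n U \<Longrightarrow> unitary_mat n (mat_adjoint U)"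
  by (auto simp: unitary_mat_def)

lemma unitary_mat_mult:
  assumes "unitary_mat n U" "unitary_mat n V" shows "unitary_mat n (U * V)"
proof (rule unitary_matI)
  have U: "U \<in> carrier_mat n n" "mat_adjoint U * U = 1\<^sub>m n" and V: "V \<in> carrier_mat n n" "mat_adjoint V * V = 1\<^sub>m n"
    using assms by (auto simp: unitary_mat_def)
  note c = mat_adjoint_carrier[OF U(1)] mat_adjoint_carrier[OF V(1)]
  have "mat_adjoint U * (U * V) = V"
    using U V c by (simp flip: assoc_mult_mat[of _ n n _ n _ n])
  hence "mat_adjoint (U * V) * (U * V) = mat_adjoint V * V"
    using U V c by (simp add: mat_adjoint_mult[OF U(1) V(1)] assoc_mult_mat[of _ n n _ n _ n])
  thus "mat_adjoint (U * V) * (U * V) = 1\<^sub>m n" using U V c by simp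
qed (use assms in \<open>auto simp: unitary_mat_def\<close>)

text \<open>Gram-Schmidt applied to a basis that starts with \<open>v\<close> keeps its first
  vector. The result serves to split off an eigenvector in the spectral theorem.\<close>

lemma unitary_first_column:
  fixes v :: "complex Matrix.vec"
  assumes v: "v \<in> carrier_vec n" and v0: "v \<noteq> 0\<^sub>v n"
  obtains W c where "unitary_mat n W" "c \<noteq> 0" "col W 0 = c \<cdot>\<^sub>v v" "0 < n"
proof -
  interpret cof_vec_space n "TYPE(complex)" .
  define ws where "ws = gram_schmidt n (basis_completion v)"
  note bc = basis_completion[OF v v0]
  have n: "0 < n" using v v0 by (cases n) (auto intro!: eq_vecI)
  have ws: "set ws \<subseteq> carrier_vec n" "corthogonal ws" "length ws = n"
    using gram_schmidt_result[OF bc(2,4,5) ws_def] bc(6) by auto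
  have hd: "hd ws = v"
  proof -
    obtain w us where "basis_completion v = w # us" using bc(6) n by (cases "basis_completion v") auto
    with bc(7) have "basis_completion v = v # us" by auto
    thus ?thesis unfolding ws_def using gram_schmidt_hd[OF v] by simp
  qed
  \<comment> \<open>\<open>gram_schmidt\<close> yields orthogonal vectors that are not normalized,
    so each column is divided by its length.\<close>
  define W where "W = mat n n (\<lambda>(i, j). vec_index (ws ! j) i / complex_of_real (sqrt (nsq (ws ! j))))"
  have cw: "j < n \<Longrightarrow> ws ! j \<in> carrier_vec n" for j using ws by auto
  have orth: "ws ! i \<bullet>c ws ! j = 0 \<longleftrightarrow> i \<noteq> j" if "i < n" "j < n" for i j
    using corthogonalD[OF ws(2)] that ws(3) by auto
  have pos: "0 < nsq (ws ! j)" if "j < n" for j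
    using orth[OF that that] unfolding cscalar_prod_self by (smt (verit) nsq_nonneg of_real_0)
  have W: "W \<in> carrier_mat n n" by (auto simp: W_def)
  have "unitary_mat n W"
  proof (rule unitary_matI[OF W], rule eq_matI)
    fix i j assume "i < dim_row (1\<^sub>m n)" "j < dim_col (1\<^sub>m n)"
    hence ij: "i < n" "j < n" by auto
    have "(mat_adjoint W * W) $$ (i,j) = (\<Sum>l<n. cnj (W $$ (l, i)) * W $$ (l, j))"
      unfolding mult_mat_index_sum[OF mat_adjoint_carrier[OF W] W ij] using W ij by (intro sum.cong) auto
    also have "\<dots> = (ws ! j \<bullet>c ws ! i) / (complex_of_real (sqrt (nsq (ws ! j))) * complex_of_real (sqrt (nsq (ws ! i))))"
      unfolding cscalar_prod_sum[OF cw[OF ij(1)]] sum_divide_distrib using ij by (intro sum.cong) (auto simp: W_def field_simps)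
    also have "\<dots> = 1\<^sub>m n $$ (i,j)"
    proof (cases "i = j")
      case True
      have "complex_of_real (nsq (ws ! j)) = complex_of_real (sqrt (nsq (ws ! j))) * complex_of_real (sqrt (nsq (ws ! j)))"
        using pos[OF ij(2)] by (simp flip: of_real_mult)
      thus ?thesis using True ij pos[OF ij(2)] unfolding True cscalar_prod_self by (simp add: divide_simps)
    next
      case False
      thus ?thesis using orth[OF ij(2,1)] ij by auto
    qed
    finally show "(mat_adjoint W * W) $$ (i,j) = 1\<^sub>m n $$ (i,j)" .
  qed (use W in auto)
  moreover have "col W 0 = complex_of_real (inverse (sqrt (nsq v))) \<cdot>\<^sub>v v"
  proof -
    have "ws ! 0 = v" using hd ws(3) n by (metis hd_conv_nth length_greater_0_conv)
    thus ?thesis using v n by (intro eq_vecI) (auto simp: W_def divide_inverse)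
  qed
  moreover have "complex_of_real (inverse (sqrt (nsq v))) \<noteq> 0" using nsq_pos[OF v v0] by auto
  ultimately show thesis using that n by blast
qed

lemma hermitian_eigenvalue_real:
  assumes M: "M \<in> carrier_mat n n" and h: "mat_adjoint M = M" and v: "v \<in> carrier_vec n" "v \<noteq> 0\<^sub>v n"
    and e: "M *\<^sub>v v = e \<cdot>\<^sub>v v"
  shows "Im e = 0" "e * complex_of_real (nsq v) = (M *\<^sub>v v) \<bullet>c v"
proof -
  have 1: "(M *\<^sub>v v) \<bullet>c v = e * complex_of_real (nsq v)"
    unfolding e using v by (simp add: cscalar_prod_self)
  have "(M *\<^sub>v v) \<bullet>c v = v \<bullet>c (M *\<^sub>v v)" using cscalar_prod_adjoint[OF M v(1) v(1)] h by simp
  also have "\<dots> = cnj ((M *\<^sub>v v) \<bullet>c v)" using cscalar_prod_cnj[of "M *\<^sub>v v" n v] M v by auto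
  finally have "e * complex_of_real (nsq v) = cnj (e * complex_of_real (nsq v))" using 1 by simp
  hence "Im (e * complex_of_real (nsq v)) = 0" by (metis Reals_cnj_iff complex_is_Real_iff)
  thus "Im e = 0" using nsq_pos[OF v] by simp
  show "e * complex_of_real (nsq v) = (M *\<^sub>v v) \<bullet>c v" using 1 by simp
qed

lemma hermitian_form_swap:
  fixes M :: "complex mat"
  assumes M: "M \<in> carrier_mat n n" and h: "mat_adjoint M = M" and u: "u \<in> carrier_vec n" and v: "v \<in> carrier_vec n"
  shows "(M *\<^sub>v u) \<bullet>c v = u \<bullet>c (M *\<^sub>v v)"
  using cscalar_prod_adjoint[OF M u v] h by simp

lemma four_block_adjoint:
  fixes A D :: "complex mat"
  assumes "A \<in> carrier_mat m m" "D \<in> carrier_mat k k"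
  shows "mat_adjoint (four_block_mat A (0\<^sub>m m k) (0\<^sub>m k m) D)
    = four_block_mat (mat_adjoint A) (0\<^sub>m m k) (0\<^sub>m k m) (mat_adjoint D)"
  using assms by (intro eq_matI) auto

lemma four_block_mult_diag:
  fixes A D :: "complex mat"
  assumes "A \<in> carrier_mat m m" "D \<in> carrier_mat k k" "A' \<in> carrier_mat m m" "D' \<in> carrier_mat k k"
  shows "four_block_mat A (0\<^sub>m m k) (0\<^sub>m k m) D * four_block_mat A' (0\<^sub>m m k) (0\<^sub>m k m) D'
    = four_block_mat (A * A') (0\<^sub>m m k) (0\<^sub>m k m) (D * D')"
  using assms by (subst mult_four_block_mat[of _ m m _ k _ k _ _ m _ k]) auto

text \<open>Deflation. In an orthonormal basis that starts with an eigenvector, the first column of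
  \<open>N\<close> is \<open>e\<close> times the first unit vector; self-adjointness forces the same
  on the first row, and the remaining block is Hermitian of size \<open>m\<close>.\<close>

lemma hermitian_diagonalization_exists:
  fixes M :: "complex mat"
  assumes "M \<in> carrier_mat n n" "mat_adjoint M = M"
  shows "\<exists>U f. unitary_mat n U \<and> M = U * diagm n (\<lambda>i. complex_of_real (f i)) * mat_adjoint U"
  using assms
proof (induction n arbitrary: M)
  case 0
  have "unitary_mat 0 (1\<^sub>m 0)" by (rule unitary_matI) auto
  moreover have "M = 1\<^sub>m 0 * diagm 0 (\<lambda>i. complex_of_real 0) * mat_adjoint (1\<^sub>m 0)"
    using 0 by (intro eq_matI) auto
  ultimately show ?case by (intro exI[of _ "1\<^sub>m 0"] exI[of _ "\<lambda>_. 0"]) simp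
next
  case (Suc m)
  let ?n = "Suc m"
  note M = Suc.prems(1) and h = Suc.prems(2)
  from spectrum_non_empty[OF M] obtain e where "eigenvalue M e" by (auto simp: spectrum_def)
  then obtain v where v: "v \<in> carrier_vec ?n" "v \<noteq> 0\<^sub>v ?n" and ev: "M *\<^sub>v v = e \<cdot>\<^sub>v v"
    using M by (auto simp: eigenvalue_def eigenvector_def)
  from unitary_first_column[OF v] obtain W c where uW: "unitary_mat ?n W" and c: "c \<noteq> 0" and cW: "col W 0 = c \<cdot>\<^sub>v v"
    by metis
  hence W: "W \<in> carrier_mat ?n ?n" "mat_adjoint W * W = 1\<^sub>m ?n" "W * mat_adjoint W = 1\<^sub>m ?n"
    by (auto simp: unitary_mat_def)
  note W' = mat_adjoint_carrier[OF W(1)]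
  obtain r where e: "e = complex_of_real r"
    using hermitian_eigenvalue_real(1)[OF M h v ev] by (metis complex_is_Real_iff Reals_cases)
  define N where "N = mat_adjoint W * M * W"
  have N: "N \<in> carrier_mat ?n ?n" using W M W' by (auto simp: N_def)
  have hN: "mat_adjoint N = N"
    unfolding N_def using W M W' h
    by (simp add: mat_adjoint_mult[of _ ?n ?n _ ?n] assoc_mult_mat[of _ ?n ?n _ ?n _ ?n] mult_carrier_mat[of _ ?n ?n _ ?n])
  have col0: "col N 0 = e \<cdot>\<^sub>v unit_vec ?n 0"
  proof -
    have "col N 0 = mat_adjoint W *\<^sub>v (M *\<^sub>v col W 0)"
    proof -
      have "N = mat_adjoint W * (M * W)" unfolding N_def using W' M W(1) by (rule assoc_mult_mat)
      moreover have "col (mat_adjoint W * (M * W)) 0 = mat_adjoint W *\<^sub>v col (M * W) 0"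
        by (rule col_mult2[OF W' mult_carrier_mat[OF M W(1)]]) simp
      moreover have "col (M * W) 0 = M *\<^sub>v col W 0" by (rule col_mult2[OF M W(1)]) simp
      ultimately show ?thesis by (simp only:)
    qed
    also have "M *\<^sub>v col W 0 = e \<cdot>\<^sub>v col W 0"
      unfolding cW using M v ev by (simp add: mult_mat_vec smult_smult_assoc mult.commute)
    also have "mat_adjoint W *\<^sub>v (e \<cdot>\<^sub>v col W 0) = e \<cdot>\<^sub>v (mat_adjoint W *\<^sub>v col W 0)"
      using cW v by (intro mult_mat_vec[OF W']) auto
    also have "mat_adjoint W *\<^sub>v col W 0 = col (mat_adjoint W * W) 0"
      using W W' by (subst col_mult2[of _ ?n ?n _ ?n]) auto
    also have "\<dots> = unit_vec ?n 0" unfolding W(2) by simp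
    finally show ?thesis .
  qed
  have N0: "N $$ (i, 0) = (if i = 0 then e else 0)" if "i < ?n" for i
    using arg_cong[OF col0, of "\<lambda>w. vec_index w i"] that N by auto
  have N0': "N $$ (0, j) = (if j = 0 then e else 0)" if "j < ?n" for j
    using arg_cong[OF hN, of "\<lambda>A. A $$ (0, j)"] N0[OF that] that N e by auto
  define N3 where "N3 = mat m m (\<lambda>(i, j). N $$ (Suc i, Suc j))"
  have N3: "N3 \<in> carrier_mat m m" by (auto simp: N3_def)
  have hN3: "mat_adjoint N3 = N3"
  proof (rule eq_matI)
    fix i j assume "i < dim_row N3" "j < dim_col N3"
    hence ij: "i < m" "j < m" using N3 by auto
    have "mat_adjoint N $$ (Suc i, Suc j) = cnj (N $$ (Suc j, Suc i))" using N ij by auto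
    thus "mat_adjoint N3 $$ (i, j) = N3 $$ (i, j)" using hN ij N3 by (auto simp: N3_def)
  qed (use N3 in auto)
  from Suc.IH[OF N3 hN3] obtain V f where V: "unitary_mat m V"
    and N3V: "N3 = V * diagm m (\<lambda>i. complex_of_real (f i)) * mat_adjoint V" by blast
  hence Vc: "V \<in> carrier_mat m m" "mat_adjoint V * V = 1\<^sub>m m" by (auto simp: unitary_mat_def)
  define V' where "V' = four_block_mat (1\<^sub>m 1) (0\<^sub>m 1 m) (0\<^sub>m m 1) V"
  have V'c: "V' \<in> carrier_mat ?n ?n" using Vc by (auto simp: V'_def)
  have V'a: "mat_adjoint V' = four_block_mat (1\<^sub>m 1) (0\<^sub>m 1 m) (0\<^sub>m m 1) (mat_adjoint V)"
    unfolding V'_def using Vc by (subst four_block_adjoint) auto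
  have uV': "unitary_mat ?n V'"
  proof (rule unitary_matI[OF V'c])
    have "mat_adjoint V' * V' = four_block_mat (1\<^sub>m 1) (0\<^sub>m 1 m) (0\<^sub>m m 1) (1\<^sub>m m)"
      unfolding V'a using Vc unfolding V'_def by (subst four_block_mult_diag) auto
    also have "\<dots> = 1\<^sub>m ?n" by (rule eq_matI) auto
    finally show "mat_adjoint V' * V' = 1\<^sub>m ?n" .
  qed
  define f' where "f' = (\<lambda>i. case i of 0 \<Rightarrow> r | Suc i \<Rightarrow> f i)"
  have D: "diagm ?n (\<lambda>i. complex_of_real (f' i)) =
     four_block_mat (e \<cdot>\<^sub>m 1\<^sub>m 1) (0\<^sub>m 1 m) (0\<^sub>m m 1) (diagm m (\<lambda>i. complex_of_real (f i)))"
    by (rule eq_matI) (auto simp: f'_def e split: nat.splits)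
  have "N = four_block_mat (e \<cdot>\<^sub>m 1\<^sub>m 1) (0\<^sub>m 1 m) (0\<^sub>m m 1) N3"
  proof (rule eq_matI)
    fix i j assume "i < dim_row (four_block_mat (e \<cdot>\<^sub>m 1\<^sub>m 1) (0\<^sub>m 1 m) (0\<^sub>m m 1) N3)"
      "j < dim_col (four_block_mat (e \<cdot>\<^sub>m 1\<^sub>m 1) (0\<^sub>m 1 m) (0\<^sub>m m 1) N3)"
    hence "i < ?n" "j < ?n" using N3 by auto
    thus "N $$ (i, j) = four_block_mat (e \<cdot>\<^sub>m 1\<^sub>m 1) (0\<^sub>m 1 m) (0\<^sub>m m 1) N3 $$ (i, j)"
      using N0 N0' N3 by (cases i; cases j) (auto simp: N3_def)
  qed (use N N3 in auto)
  also have "\<dots> = V' * diagm ?n (\<lambda>i. complex_of_real (f' i)) * mat_adjoint V'"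
    unfolding V'a D unfolding V'_def N3V using Vc by (simp add: four_block_mult_diag)
  finally have NV: "N = V' * diagm ?n (\<lambda>i. complex_of_real (f' i)) * mat_adjoint V'" .
  have "W * N * mat_adjoint W = (W * mat_adjoint W) * M * (W * mat_adjoint W)"
    unfolding N_def using W(1) M W' by (simp add: assoc_mult_mat[of _ ?n ?n _ ?n _ ?n] mult_carrier_mat[of _ ?n ?n _ ?n])
  hence "M = W * N * mat_adjoint W" using W(3) M by simp
  also have "\<dots> = (W * V') * diagm ?n (\<lambda>i. complex_of_real (f' i)) * mat_adjoint (W * V')"
    unfolding NV using W(1) V'c mat_adjoint_carrier[OF V'c] W'
    by (simp add: assoc_mult_mat[of _ ?n ?n _ ?n _ ?n] mult_carrier_mat[of _ ?n ?n _ ?n] mat_adjoint_mult[of _ ?n ?n _ ?n])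
  finally show ?case using unitary_mat_mult[OF uW uV'] by blast
qed

lemma hermitian_diagonalization_permute:
  assumes U: "unitary_mat n U" and p: "bij_betw p {..<n} {..<n}"
  defines "V \<equiv> mat n n (\<lambda>(i, j). U $$ (i, p j))"
  shows "unitary_mat n V" "U * diagm n f * mat_adjoint U = V * diagm n (\<lambda>i. f (p i)) * mat_adjoint V"
proof -
  have Uc: "U \<in> carrier_mat n n" "mat_adjoint U * U = 1\<^sub>m n" using U by (auto simp: unitary_mat_def)
  have V: "V \<in> carrier_mat n n" by (auto simp: V_def)
  have pn: "p i < n" if "i < n" for i using p that by (auto simp: bij_betw_def)
  have inj: "p i = p j \<longleftrightarrow> i = j" if "i < n" "j < n" for i j
    using p that by (auto simp: bij_betw_def inj_on_def)
  show "unitary_mat n V"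
  proof (rule unitary_matI[OF V], rule eq_matI)
    fix i j assume "i < dim_row (1\<^sub>m n)" "j < dim_col (1\<^sub>m n)"
    hence ij: "i < n" "j < n" by auto
    have "(mat_adjoint V * V) $$ (i, j) = (mat_adjoint U * U) $$ (p i, p j)"
      using ij pn Uc V by (subst (1 2) mult_mat_index_sum[of _ n n _ n]) (auto simp: V_def intro!: sum.cong)
    thus "(mat_adjoint V * V) $$ (i, j) = 1\<^sub>m n $$ (i, j)" using ij pn inj Uc(2) by auto
  qed (use V in auto)
  have gen: "(W * diagm n g * mat_adjoint W) $$ (i, j) = (\<Sum>l<n. W $$ (i, l) * g l * cnj (W $$ (j, l)))"
    if W: "W \<in> carrier_mat n n" and ij: "i < n" "j < n" for W g i j
  proof -
    have "(W * diagm n g) $$ (i, l) = W $$ (i, l) * g l" if "l < n" for l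
    proof -
      have "(W * diagm n g) $$ (i, l) = (\<Sum>k<n. if k = l then W $$ (i, l) * g l else 0)"
        unfolding mult_mat_index_sum[OF W diagm_carrier(1) ij(1) that] using that by (intro sum.cong) auto
      thus ?thesis using that by simp
    qed
    thus ?thesis using W ij
      by (subst mult_mat_index_sum[of _ n n _ n]) (auto intro!: sum.cong)
  qed
  show "U * diagm n f * mat_adjoint U = V * diagm n (\<lambda>i. f (p i)) * mat_adjoint V"
  proof (rule eq_matI)
    fix i j assume "i < dim_row (V * diagm n (\<lambda>i. f (p i)) * mat_adjoint V)" "j < dim_col (V * diagm n (\<lambda>i. f (p i)) * mat_adjoint V)"
    hence ij: "i < n" "j < n" using V by auto
    show "(U * diagm n f * mat_adjoint U) $$ (i, j) = (V * diagm n (\<lambda>i. f (p i)) * mat_adjoint V) $$ (i, j)"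
      unfolding gen[OF Uc(1) ij] gen[OF V ij]
      using sum.reindex_bij_betw[OF p, of "\<lambda>l. U $$ (i, l) * f l * cnj (U $$ (j, l))"] ij
      by (auto simp: V_def)
  qed (use Uc V in auto)
qed

text \<open>The order of the eigenvalues is free, so the nonzero ones are put first. Then
  \<open>r\<close> is the rank (\<open>rank_unitary_diag\<close>), and the range of \<open>M\<close>
  corresponds to the leading coordinates.\<close>

lemma hermitian_diagonalization:
  fixes M :: "complex mat"
  assumes M: "M \<in> carrier_mat n n" "mat_adjoint M = M"
  obtains U f r where "unitary_mat n U" "M = U * diagm n (\<lambda>i. complex_of_real (f i)) * mat_adjoint U"
    "r \<le> n" "\<And>i. i < n \<Longrightarrow> f i \<noteq> 0 \<longleftrightarrow> i < r"
proof -
  from hermitian_diagonalization_exists[OF M] obtain U f where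
    U: "unitary_mat n U" "M = U * diagm n (\<lambda>i. complex_of_real (f i)) * mat_adjoint U" by blast
  define A where "A = {i. i < n \<and> f i \<noteq> 0}"
  define B where "B = {i. i < n \<and> f i = 0}"
  have fin: "finite A" "finite B" by (auto simp: A_def B_def)
  define r where "r = card A"
  have AB: "A \<union> B = {..<n}" "A \<inter> B = {}" by (auto simp: A_def B_def)
  have cB: "card A + card B = n" using card_Un_disjoint[OF fin AB(2)] AB(1) by simp
  hence rn: "r \<le> n" by (simp add: r_def)
  obtain pA where pA: "bij_betw pA {..<r} A"
    using ex_bij_betw_nat_finite[OF fin(1)] by (auto simp: r_def atLeast0LessThan)
  obtain pB where pB: "bij_betw pB {r..<n} B"
  proof -
    have "card {r..<n} = card B" using cB by (simp add: r_def)
    thus thesis using that finite_same_card_bij[OF _ fin(2)] by blast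
  qed
  define p where "p = (\<lambda>i. if i < r then pA i else pB i)"
  have p1: "bij_betw p {..<r} A" using pA by (rule iffD1[OF bij_betw_cong, rotated]) (auto simp: p_def)
  have p2: "bij_betw p {r..<n} B" using pB by (rule iffD1[OF bij_betw_cong, rotated]) (auto simp: p_def)
  have "{..<r} \<union> {r..<n} = {..<n}" using rn by auto
  hence p: "bij_betw p {..<n} {..<n}" using bij_betw_combine[OF p1 p2 AB(2)] AB(1) by simp
  have "f (p i) \<noteq> 0 \<longleftrightarrow> i < r" if "i < n" for i
  proof (cases "i < r")
    case True
    hence "p i \<in> A" using p1 by (auto simp: bij_betw_def)
    thus ?thesis using True by (auto simp: A_def)
  next
    case False
    hence "p i \<in> B" using p2 that by (auto simp: bij_betw_def)
    thus ?thesis using False by (auto simp: B_def)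
  qed
  thus thesis
    using that[OF hermitian_diagonalization_permute(1)[OF U(1) p], of "\<lambda>i. f (p i)" r]
      hermitian_diagonalization_permute(2)[OF U(1) p, of "\<lambda>i. complex_of_real (f i)"] U(2) rn by simp
qed

section \<open>Computations in an eigenbasis\<close>

lemma mult_mat_vec_cancel:
  fixes A B :: "complex mat"
  assumes "A \<in> carrier_mat n n" "B \<in> carrier_mat n n" "A * B = 1\<^sub>m n" "u \<in> carrier_vec n"
  shows "A *\<^sub>v (B *\<^sub>v u) = u"
  using assms assoc_mult_mat_vec[of A n n B n u] by simp

lemma mult_mat_zero_vec:
  fixes A :: "complex mat"
  shows "A \<in> carrier_mat n n \<Longrightarrow> A *\<^sub>v 0\<^sub>v n = 0\<^sub>v n"
  by (intro eq_vecI) auto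

text \<open>Column \<open>i\<close> of \<open>U\<close>, which is an eigenvector of every
  \<open>U * diagm n f * mat_adjoint U\<close>. Evaluating a form at it reads off the eigenvalue
  \<open>f i\<close>.\<close>

lemma unitary_basis_vector:
  assumes U: "unitary_mat n U" and i: "i < n"
  shows "U *\<^sub>v unit_vec n i \<in> carrier_vec n" "mat_adjoint U *\<^sub>v (U *\<^sub>v unit_vec n i) = unit_vec n i"
    "U *\<^sub>v unit_vec n i \<noteq> 0\<^sub>v n"
proof -
  have Uc: "U \<in> carrier_mat n n" "mat_adjoint U * U = 1\<^sub>m n" using U by (auto simp: unitary_mat_def)
  show "U *\<^sub>v unit_vec n i \<in> carrier_vec n" using Uc by auto
  show e: "mat_adjoint U *\<^sub>v (U *\<^sub>v unit_vec n i) = unit_vec n i"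
    using Uc by (intro mult_mat_vec_cancel[of _ n]) auto
  show "U *\<^sub>v unit_vec n i \<noteq> 0\<^sub>v n"
  proof
    assume "U *\<^sub>v unit_vec n i = 0\<^sub>v n"
    hence "unit_vec n i = (0\<^sub>v n :: complex Matrix.vec)"
      using e mult_mat_zero_vec[OF mat_adjoint_carrier[OF Uc(1)]] by simp
    thus False using i by (metis index_unit_vec(1) index_zero_vec(1) zero_neq_one)
  qed
qed

lemma nsq_sum: "u \<in> carrier_vec n \<Longrightarrow> nsq u = (\<Sum>i<n. (cmod (vec_index u i))\<^sup>2)"
  by (auto simp: nsq_def)

lemma nsq_unitary:
  assumes U: "unitary_mat n U" and u: "u \<in> carrier_vec n"
  shows "nsq (U *\<^sub>v u) = nsq u" "nsq (mat_adjoint U *\<^sub>v u) = nsq u"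
proof -
  have gen: "nsq (V *\<^sub>v u) = nsq u" if "unitary_mat n V" for V
  proof -
    have V: "V \<in> carrier_mat n n" "mat_adjoint V * V = 1\<^sub>m n" using that by (auto simp: unitary_mat_def)
    have "(V *\<^sub>v u) \<bullet>c (V *\<^sub>v u) = u \<bullet>c (mat_adjoint V *\<^sub>v (V *\<^sub>v u))"
      using V u by (intro cscalar_prod_adjoint) auto
    also have "mat_adjoint V *\<^sub>v (V *\<^sub>v u) = u"
      using V u by (intro mult_mat_vec_cancel[of _ n]) auto
    finally show ?thesis unfolding cscalar_prod_self by simp
  qed
  show "nsq (U *\<^sub>v u) = nsq u" "nsq (mat_adjoint U *\<^sub>v u) = nsq u"
    using gen[OF U] gen[OF unitary_mat_adjoint[OF U]] by auto
qed

lemma unitary_diag_apply: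
  assumes U: "unitary_mat n U" and u: "u \<in> carrier_vec n"
  shows "mat_adjoint U *\<^sub>v ((U * diagm n f * mat_adjoint U) *\<^sub>v u) = diagm n f *\<^sub>v (mat_adjoint U *\<^sub>v u)"
proof -
  have Uc: "U \<in> carrier_mat n n" "mat_adjoint U * U = 1\<^sub>m n" using U by (auto simp: unitary_mat_def)
  note U' = mat_adjoint_carrier[OF Uc(1)]
  have "mat_adjoint U *\<^sub>v ((U * diagm n f * mat_adjoint U) *\<^sub>v u)
      = (mat_adjoint U * (U * diagm n f * mat_adjoint U)) *\<^sub>v u"
    using Uc U' u by (intro assoc_mult_mat_vec[symmetric, of _ n n _ n]) auto
  also have "mat_adjoint U * (U * diagm n f * mat_adjoint U) = (mat_adjoint U * U) * (diagm n f * mat_adjoint U)"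
    using Uc(1) U' by (simp add: assoc_mult_mat[of _ n n _ n _ n] mult_carrier_mat[of _ n n _ n])
  finally show ?thesis using Uc(2) U' u by (simp add: assoc_mult_mat_vec[of _ n n _ n])
qed

lemma nsq_unitary_diag:
  assumes U: "unitary_mat n U" and u: "u \<in> carrier_vec n"
  shows "nsq ((U * diagm n f * mat_adjoint U) *\<^sub>v u)
    = (\<Sum>i<n. (cmod (f i))\<^sup>2 * (cmod (vec_index (mat_adjoint U *\<^sub>v u) i))\<^sup>2)"
proof -
  have Uc: "U \<in> carrier_mat n n" using U by (auto simp: unitary_mat_def)
  note U' = mat_adjoint_carrier[OF Uc(1)]
  have "nsq ((U * diagm n f * mat_adjoint U) *\<^sub>v u) = nsq (mat_adjoint U *\<^sub>v ((U * diagm n f * mat_adjoint U) *\<^sub>v u))"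
    using nsq_unitary(2)[OF U] Uc U' u by (metis diagm_carrier(1) mult_carrier_mat mult_mat_vec_carrier)
  also have "\<dots> = nsq (vec n (\<lambda>i. f i * vec_index (mat_adjoint U *\<^sub>v u) i))"
    unfolding unitary_diag_apply[OF U u] using U' u by (subst diagm_mult_vec) auto
  finally show ?thesis by (simp add: nsq_sum[of _ n] norm_mult power_mult_distrib)
qed

lemma qform_unitary_diag:
  assumes U: "unitary_mat n U" and u: "u \<in> carrier_vec n"
  shows "qform (U * diagm n (\<lambda>i. complex_of_real (f i)) * mat_adjoint U) u
    = (\<Sum>i<n. f i * (cmod (vec_index (mat_adjoint U *\<^sub>v u) i))\<^sup>2)"
proof -
  have Uc: "U \<in> carrier_mat n n" using U by (auto simp: unitary_mat_def)
  note U' = mat_adjoint_carrier[OF Uc(1)]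
  let ?f = "\<lambda>i. complex_of_real (f i)"
  define w where "w = mat_adjoint U *\<^sub>v u"
  have w: "w \<in> carrier_vec n" using U' u by (auto simp: w_def)
  have "(U * diagm n ?f * mat_adjoint U) *\<^sub>v u = U *\<^sub>v (diagm n ?f *\<^sub>v w)"
    using Uc U' u w[unfolded w_def] by (simp add: w_def assoc_mult_mat_vec[of _ n n _ n] mult_carrier_mat[of _ n n _ n] mult_mat_vec_carrier[of _ n n])
  hence "((U * diagm n ?f * mat_adjoint U) *\<^sub>v u) \<bullet>c u = (diagm n ?f *\<^sub>v w) \<bullet>c w"
    using cscalar_prod_adjoint[OF Uc _ u, of "diagm n ?f *\<^sub>v w"] w by (simp add: w_def[symmetric] mult_mat_vec_carrier[OF diagm_carrier(1)])
  also have "\<dots> = (\<Sum>i<n. complex_of_real (f i * (cmod (vec_index w i))\<^sup>2))"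
    unfolding cscalar_prod_sum[OF w] diagm_mult_vec[OF w]
    by (intro sum.cong) (auto simp: mult.assoc complex_norm_square of_real_mult simp del: of_real_power)
  finally show ?thesis by (simp add: qform_def w_def)
qed

lemma nsq_unitary_coords:
  assumes U: "unitary_mat n U" and u: "u \<in> carrier_vec n"
  shows "nsq u = (\<Sum>i<n. (cmod (vec_index (mat_adjoint U *\<^sub>v u) i))\<^sup>2)"
proof -
  have "mat_adjoint U \<in> carrier_mat n n" using U by (simp add: unitary_mat_def)
  thus ?thesis using nsq_unitary(2)[OF U u] nsq_sum[OF mult_mat_vec_carrier[OF _ u]] by simp
qed

lemma unitary_diag_carrier: "unitary_mat n U \<Longrightarrow> U * diagm n f * mat_adjoint U \<in> carrier_mat n n"
  by (auto simp: unitary_mat_def)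

lemma unitary_diag_mult:
  assumes U: "unitary_mat n U"
  shows "(U * diagm n f * mat_adjoint U) * (U * diagm n g * mat_adjoint U) = U * diagm n (\<lambda>i. f i * g i) * mat_adjoint U"
proof -
  have Uc: "U \<in> carrier_mat n n" "mat_adjoint U * U = 1\<^sub>m n" using U by (auto simp: unitary_mat_def)
  note U' = mat_adjoint_carrier[OF Uc(1)]
  have 1: "mat_adjoint U * (U * X) = X" if "X \<in> carrier_mat n n" for X
    using Uc U' that by (simp flip: assoc_mult_mat[of _ n n _ n _ n])
  have 2: "diagm n f * (diagm n g * X) = diagm n (\<lambda>i. f i * g i) * X" if "X \<in> carrier_mat n n" for X
    using that by (simp flip: diagm_mult assoc_mult_mat[of _ n n _ n _ n])
  show ?thesis
    using Uc(1) U' by (simp add: 1 2 assoc_mult_mat[of _ n n _ n _ n] mult_carrier_mat[of _ n n _ n])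
qed

lemma unitary_diag_add:
  assumes U: "unitary_mat n U"
  shows "(U * diagm n f * mat_adjoint U) + (U * diagm n g * mat_adjoint U) = U * diagm n (\<lambda>i. f i + g i) * mat_adjoint U"
proof -
  have Uc: "U \<in> carrier_mat n n" "mat_adjoint U * U = 1\<^sub>m n" using U by (auto simp: unitary_mat_def)
  note U' = mat_adjoint_carrier[OF Uc(1)]
  show ?thesis using Uc(1) U'
    by (simp flip: diagm_add add: mult_add_distrib_mat[of _ n n _ n] add_mult_distrib_mat[of _ n n _ _ n])
qed

lemma unitary_diag_const:
  assumes U: "unitary_mat n U"
  shows "U * diagm n (\<lambda>_. c) * mat_adjoint U = c \<cdot>\<^sub>m 1\<^sub>m n"
proof -
  have Uc: "U \<in> carrier_mat n n" "U * mat_adjoint U = 1\<^sub>m n" using U by (auto simp: unitary_mat_def)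
  have "diagm n (\<lambda>_. c) = c \<cdot>\<^sub>m 1\<^sub>m n" by (simp add: diagm_smult flip: diagm_one)
  thus ?thesis using Uc mat_adjoint_carrier[OF Uc(1)]
    by (simp add: mult_smult_distrib[of _ n n _ n] mult_smult_assoc_mat[of _ n n _ n])
qed

section \<open>Algebra of quadratic forms and positivity\<close>

lemma qform_add:
  assumes "A \<in> carrier_mat n n" "B \<in> carrier_mat n n" "u \<in> carrier_vec n"
  shows "qform (A + B) u = qform A u + qform B u"
  using assms by (simp add: qform_def add_mult_distrib_mat_vec[of _ n n] add_scalar_prod_distrib[of _ n])

lemma qform_minus:
  assumes "A \<in> carrier_mat n n" "B \<in> carrier_mat n n" "u \<in> carrier_vec n"
  shows "qform (A - B) u = qform A u - qform B u"
  using assms by (simp add: qform_def minus_mult_distrib_mat_vec[of _ n n] minus_scalar_prod_distrib[of _ n])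

lemma qform_smult:
  assumes "A \<in> carrier_mat n n" "u \<in> carrier_vec n"
  shows "qform (complex_of_real c \<cdot>\<^sub>m A) u = c * qform A u"
proof -
  have "(complex_of_real c \<cdot>\<^sub>m A) *\<^sub>v u = complex_of_real c \<cdot>\<^sub>v (A *\<^sub>v u)"
    using assms by (intro eq_vecI) auto
  thus ?thesis using assms by (simp add: qform_def)
qed

lemma qform_one: "u \<in> carrier_vec n \<Longrightarrow> qform (1\<^sub>m n) u = nsq u"
  by (simp add: qform_def cscalar_prod_self)

lemma qform_congruence:
  assumes "S \<in> carrier_mat n n" "M \<in> carrier_mat n n" "u \<in> carrier_vec n"
  shows "qform (mat_adjoint S * M * S) u = qform M (S *\<^sub>v u)"
proof -
  have "(mat_adjoint S * M * S) *\<^sub>v u = mat_adjoint S *\<^sub>v (M *\<^sub>v (S *\<^sub>v u))"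
    using assms mat_adjoint_carrier[OF assms(1)]
    by (simp add: assoc_mult_mat_vec[of _ n n _ n] mult_carrier_mat[of _ n n _ n])
  moreover have "(mat_adjoint S *\<^sub>v (M *\<^sub>v (S *\<^sub>v u))) \<bullet>c u = (M *\<^sub>v (S *\<^sub>v u)) \<bullet>c (S *\<^sub>v u)"
    using cscalar_prod_adjoint[OF mat_adjoint_carrier[OF assms(1)], of "M *\<^sub>v (S *\<^sub>v u)" u] assms
    by (simp add: mult_mat_vec_carrier[of _ n n])
  ultimately show ?thesis by (simp add: qform_def)
qed

lemma qform_gram:
  assumes "S \<in> carrier_mat n n" "u \<in> carrier_vec n"
  shows "qform (mat_adjoint S * S) u = nsq (S *\<^sub>v u)"
  using qform_congruence[OF assms(1) one_carrier_mat assms(2)] assms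
    right_mult_one_mat[OF mat_adjoint_carrier[OF assms(1)]] qform_one[of "S *\<^sub>v u" n]
  by (simp add: mult_mat_vec_carrier[of _ n n])

lemma qform_smult_vec:
  assumes "A \<in> carrier_mat n n" "u \<in> carrier_vec n"
  shows "qform A (c \<cdot>\<^sub>v u) = (cmod c)\<^sup>2 * qform A u"
proof -
  have "(A *\<^sub>v (c \<cdot>\<^sub>v u)) \<bullet>c (c \<cdot>\<^sub>v u) = c * cnj c * ((A *\<^sub>v u) \<bullet>c u)"
    using assms by (simp add: mult_mat_vec[of _ n n] conjugate_smult_vec)
  also have "c * cnj c = complex_of_real ((cmod c)\<^sup>2)" by (simp only: complex_norm_square)
  finally show ?thesis by (simp add: qform_def del: of_real_power)
qed

lemma qform_parallelogram:
  assumes "A \<in> carrier_mat n n" "u \<in> carrier_vec n" "v \<in> carrier_vec n"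
  shows "qform A (u + v) + qform A (u - v) = 2 * qform A u + 2 * qform A v"
  using assms
  by (simp add: qform_def mult_add_distrib_mat_vec[of _ n n] mult_minus_distrib_mat_vec[of _ n n]
      cscalar_prod_sum[of _ n] algebra_simps sum.distrib sum_subtractf)

text \<open>Positivity by the form instead of by eigenvalues as in \<open>pos_mat\<close>; sums and
  congruences are easy to control in this version only.\<close>

definition psd :: "complex mat \<Rightarrow> bool" where
  "psd M \<longleftrightarrow> mat_adjoint M = M \<and> (\<forall>u\<in>carrier_vec (dim_row M). 0 \<le> qform M u)"

definition posdef :: "complex mat \<Rightarrow> bool" where
  "posdef M \<longleftrightarrow> mat_adjoint M = M \<and>
     (\<forall>u\<in>carrier_vec (dim_row M). u \<noteq> 0\<^sub>v (dim_row M) \<longrightarrow> 0 < qform M u)"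

lemma posdef_imp_psd:
  assumes "posdef M" shows "psd M"
proof -
  have "qform M (0\<^sub>v (dim_row M)) = 0"
    by (subst qform_def, subst cscalar_prod_sum[of _ "dim_row M"]) auto
  thus ?thesis using assms unfolding psd_def posdef_def by (metis less_eq_real_def)
qed

text \<open>\<open>\<delta>\<close> is the least eigenvalue. A uniform lower bound, unlike mere
  strict positivity of the form, visibly survives a perturbation of the matrix.\<close>

lemma posdef_bound:
  assumes M: "M \<in> carrier_mat n n" and pd: "posdef M"
  obtains \<delta> where "0 < \<delta>" "\<And>u. u \<in> carrier_vec n \<Longrightarrow> \<delta> * nsq u \<le> qform M u"
proof -
  have h: "mat_adjoint M = M" using pd by (simp add: posdef_def)
  obtain U f where U: "unitary_mat n U" "M = U * diagm n (\<lambda>i. complex_of_real (f i)) * mat_adjoint U"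
    using hermitian_diagonalization_exists[OF M h] by blast
  have Uc: "U \<in> carrier_mat n n" "mat_adjoint U * U = 1\<^sub>m n" using U by (auto simp: unitary_mat_def)
  have pos: "0 < f i" if i: "i < n" for i
  proof -
    let ?u = "U *\<^sub>v unit_vec n i"
    note u = unitary_basis_vector(1)[OF U(1) i] and e = unitary_basis_vector(2)[OF U(1) i]
      and nz = unitary_basis_vector(3)[OF U(1) i]
    have "0 < qform M ?u" using pd u nz M by (auto simp: posdef_def)
    also have "qform M ?u = (\<Sum>j<n. if j = i then f i else 0)"
      unfolding U(2) qform_unitary_diag[OF U(1) u] e using i by (intro sum.cong) auto
    finally show ?thesis using i by simp
  qed
  \<comment> \<open>The extra 1 keeps the minimum meaningful for \<open>n = 0\<close>.\<close>
  define \<delta> where "\<delta> = Min (insert 1 (f ` {..<n}))"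
  have d: "0 < \<delta>" "\<And>i. i < n \<Longrightarrow> \<delta> \<le> f i" using pos by (auto simp: \<delta>_def)
  show thesis
  proof (rule that[OF d(1)])
    fix u :: "complex Matrix.vec" assume u: "u \<in> carrier_vec n"
    show "\<delta> * nsq u \<le> qform M u"
      unfolding U(2) qform_unitary_diag[OF U(1) u] nsq_unitary_coords[OF U(1) u] sum_distrib_left
      using d(2) by (intro sum_mono mult_right_mono) auto
  qed
qed

text \<open>For a Hermitian matrix the form controls the norm, because every eigenvalue is the value
  of the form at a unit vector. The final operator norm estimate thus reduces to one of quadratic
  forms.\<close>

lemma hermitian_nsq_bound:
  assumes M: "M \<in> carrier_mat n n" and h: "mat_adjoint M = M" and c: "0 \<le> c"
    and b: "\<And>u. u \<in> carrier_vec n \<Longrightarrow> \<bar>qform M u\<bar> \<le> c * nsq u" and v: "v \<in> carrier_vec n"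
  shows "nsq (M *\<^sub>v v) \<le> c\<^sup>2 * nsq v"
proof -
  obtain U f where U: "unitary_mat n U" "M = U * diagm n (\<lambda>i. complex_of_real (f i)) * mat_adjoint U"
    using hermitian_diagonalization_exists[OF M h] by blast
  have Uc: "U \<in> carrier_mat n n" "mat_adjoint U * U = 1\<^sub>m n" using U by (auto simp: unitary_mat_def)
  have le: "\<bar>f i\<bar> \<le> c" if i: "i < n" for i
  proof -
    let ?u = "U *\<^sub>v unit_vec n i"
    note u = unitary_basis_vector(1)[OF U(1) i] and e = unitary_basis_vector(2)[OF U(1) i]
      and nz = unitary_basis_vector(3)[OF U(1) i]
    have "qform M ?u = (\<Sum>j<n. if j = i then f i else 0)"
      unfolding U(2) qform_unitary_diag[OF U(1) u] e using i by (intro sum.cong) auto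
    moreover have "nsq ?u = (\<Sum>j<n. if j = i then 1 else 0)"
      unfolding nsq_unitary_coords[OF U(1) u] e using i by (intro sum.cong) auto
    ultimately show ?thesis using b[OF u] i by simp
  qed
  have "(\<bar>f i\<bar>)\<^sup>2 \<le> c\<^sup>2" if "i < n" for i using le[OF that] c by (intro power_mono) auto
  thus ?thesis
    unfolding U(2) nsq_unitary_diag[OF U(1) v] nsq_unitary_coords[OF U(1) v] sum_distrib_left
    by (intro sum_mono mult_right_mono) auto
qed

text \<open>Every diagonal entry of a diagonalization is an eigenvalue, with a column of
  \<open>U\<close> as eigenvector. This is the only passage from the eigenvalue notion of positivity
  to the form.\<close>

lemma pos_mat_psd:
  assumes M: "M \<in> carrier_mat n n" and pm: "pos_mat M" shows "psd M"
proof -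
  have h: "mat_adjoint M = M" using pm by (simp add: pos_mat_def)
  obtain U f where U: "unitary_mat n U" "M = U * diagm n (\<lambda>i. complex_of_real (f i)) * mat_adjoint U"
    using hermitian_diagonalization_exists[OF M h] by blast
  have Uc: "U \<in> carrier_mat n n" "mat_adjoint U * U = 1\<^sub>m n" using U by (auto simp: unitary_mat_def)
  note U' = mat_adjoint_carrier[OF Uc(1)]
  have "0 \<le> f i" if i: "i < n" for i
  proof -
    let ?u = "U *\<^sub>v unit_vec n i"
    note u = unitary_basis_vector(1)[OF U(1) i] and e = unitary_basis_vector(2)[OF U(1) i]
      and nz = unitary_basis_vector(3)[OF U(1) i]
    have "M *\<^sub>v ?u = U *\<^sub>v (diagm n (\<lambda>i. complex_of_real (f i)) *\<^sub>v unit_vec n i)"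
      unfolding U(2) using Uc U' u e
      by (simp add: assoc_mult_mat_vec[of _ n n _ n] mult_carrier_mat[of _ n n _ n])
    also have "diagm n (\<lambda>i. complex_of_real (f i)) *\<^sub>v unit_vec n i = complex_of_real (f i) \<cdot>\<^sub>v unit_vec n i"
      by (subst diagm_mult_vec) (auto intro!: eq_vecI simp: unit_vec_def)
    also have "U *\<^sub>v (complex_of_real (f i) \<cdot>\<^sub>v unit_vec n i) = complex_of_real (f i) \<cdot>\<^sub>v ?u"
      using Uc by (intro mult_mat_vec) auto
    finally have "eigenvalue M (complex_of_real (f i))"
      unfolding eigenvalue_def eigenvector_def using u nz M by auto
    thus ?thesis using pm by (auto simp: pos_mat_def)
  qed
  hence "0 \<le> qform M u" if "u \<in> carrier_vec n" for u
    unfolding U(2) qform_unitary_diag[OF U(1) that] by (intro sum_nonneg) auto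
  thus ?thesis using h M by (auto simp: psd_def)
qed

lemma posdef_no_kernel:
  assumes M: "M \<in> carrier_mat n n" and "posdef M" and u: "u \<in> carrier_vec n" and "M *\<^sub>v u = 0\<^sub>v n"
  shows "u = 0\<^sub>v n"
proof (rule ccontr)
  assume "u \<noteq> 0\<^sub>v n"
  hence "0 < qform M u" using assms by (auto simp: posdef_def)
  moreover have "qform M u = 0" using assms(4) u by (simp add: qform_def cscalar_prod_sum[of _ n])
  ultimately show False by simp
qed

lemma posdef_det:
  assumes M: "M \<in> carrier_mat n n" and "posdef M" shows "Determinant.det M \<noteq> 0"
  using posdef_no_kernel[OF assms] det_0_iff_vec_prod_zero_field[OF M] by metis

section \<open>Continuous matrix-valued functions\<close>

text \<open>This norm is submultiplicative, bounds the form (\<open>qform_le_entry_norm\<close>) and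
  is continuous as soon as the entries are, so all topological arguments use it in place of
  \<open>opnorm\<close>.\<close>

definition entry_norm :: "complex mat \<Rightarrow> real" where
  "entry_norm M = (\<Sum>i<dim_row M. \<Sum>j<dim_col M. cmod (M $$ (i, j)))"

lemma entry_norm_nonneg [simp]: "0 \<le> entry_norm M"
  by (auto simp: entry_norm_def intro!: sum_nonneg)

lemma entry_norm_zero [simp]: "entry_norm (0\<^sub>m m n) = 0"
  by (simp add: entry_norm_def)

lemma entry_norm_entry_le: "i < dim_row M \<Longrightarrow> j < dim_col M \<Longrightarrow> cmod (M $$ (i, j)) \<le> entry_norm M"
proof -
  assume ij: "i < dim_row M" "j < dim_col M"
  have "cmod (M $$ (i, j)) \<le> (\<Sum>j<dim_col M. cmod (M $$ (i, j)))"
    using ij by (intro member_le_sum) auto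
  also have "\<dots> \<le> entry_norm M"
    unfolding entry_norm_def using ij by (intro member_le_sum[of i _ "\<lambda>i. \<Sum>j<dim_col M. cmod (M $$ (i, j))"]) (auto intro!: sum_nonneg)
  finally show ?thesis .
qed

lemma entry_norm_eq_0_iff:
  assumes "M \<in> carrier_mat m n" shows "entry_norm M = 0 \<longleftrightarrow> M = 0\<^sub>m m n"
proof
  assume 0: "entry_norm M = 0"
  show "M = 0\<^sub>m m n"
  proof (rule eq_matI)
    fix i j assume "i < dim_row (0\<^sub>m m n)" "j < dim_col (0\<^sub>m m n)"
    hence ij: "i < m" "j < n" by auto
    hence "cmod (M $$ (i, j)) \<le> 0" using entry_norm_entry_le[of i M j] 0 carrier_matD[OF assms] by simp
    thus "M $$ (i, j) = 0\<^sub>m m n $$ (i, j)" using ij by simp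
  qed (use carrier_matD[OF assms] in auto)
next
  assume M: "M = 0\<^sub>m m n"
  show "entry_norm M = 0" unfolding M by (rule entry_norm_zero)
qed

lemma entry_norm_add_le:
  assumes "A \<in> carrier_mat m n" "B \<in> carrier_mat m n"
  shows "entry_norm (A + B) \<le> entry_norm A + entry_norm B"
proof -
  have "entry_norm (A + B) = (\<Sum>i<m. \<Sum>j<n. cmod (A $$ (i, j) + B $$ (i, j)))"
    using assms by (simp add: entry_norm_def)
  also have "\<dots> \<le> (\<Sum>i<m. \<Sum>j<n. cmod (A $$ (i, j)) + cmod (B $$ (i, j)))"
    by (intro sum_mono norm_triangle_ineq)
  also have "\<dots> = entry_norm A + entry_norm B" using assms by (simp add: entry_norm_def sum.distrib)
  finally show ?thesis .
qed

lemma entry_norm_minus_commute: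
  assumes "A \<in> carrier_mat m n" "B \<in> carrier_mat m n"
  shows "entry_norm (A - B) = entry_norm (B - A)"
  using assms by (auto simp: entry_norm_def norm_minus_commute intro!: sum.cong)

lemma entry_norm_triangle:
  assumes "A \<in> carrier_mat m n" "B \<in> carrier_mat m n" "C \<in> carrier_mat m n"
  shows "entry_norm (A - C) \<le> entry_norm (A - B) + entry_norm (B - C)"
proof -
  have "A - C = (A - B) + (B - C)" using assms by (intro eq_matI) auto
  thus ?thesis using entry_norm_add_le[of "A - B" m n "B - C"] assms by (metis minus_carrier_mat)
qed

lemma entry_norm_smult: "entry_norm (c \<cdot>\<^sub>m A) = cmod c * entry_norm A"
  by (simp add: entry_norm_def norm_mult sum_distrib_left)

lemma entry_norm_mult_le:
  assumes "A \<in> carrier_mat m n" "B \<in> carrier_mat n k"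
  shows "entry_norm (A * B) \<le> entry_norm A * entry_norm B"
proof -
  have "entry_norm (A * B) = (\<Sum>i<m. \<Sum>j<k. cmod (\<Sum>l<n. A $$ (i, l) * B $$ (l, j)))"
    using assms by (auto simp: entry_norm_def mult_mat_index_sum[OF assms] simp del: index_mult_mat(1) intro!: sum.cong)
  also have "\<dots> \<le> (\<Sum>i<m. \<Sum>j<k. \<Sum>l<n. cmod (A $$ (i, l)) * cmod (B $$ (l, j)))"
    by (intro sum_mono) (auto simp flip: norm_mult intro!: norm_sum)
  also have "\<dots> = (\<Sum>i<m. \<Sum>l<n. cmod (A $$ (i, l)) * (\<Sum>j<k. cmod (B $$ (l, j))))"
    by (subst sum.swap) (simp add: sum_distrib_left)
  also have "\<dots> \<le> (\<Sum>i<m. \<Sum>l<n. cmod (A $$ (i, l)) * entry_norm B)"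
  proof (intro sum_mono mult_left_mono)
    fix l assume "l \<in> {..<n}"
    thus "(\<Sum>j<k. cmod (B $$ (l, j))) \<le> entry_norm B"
      unfolding entry_norm_def using assms
      by (auto intro!: member_le_sum[of l "{..<n}" "\<lambda>i. \<Sum>j<k. cmod (B $$ (i, j))"] sum_nonneg)
  qed auto
  also have "\<dots> = entry_norm A * entry_norm B" using assms by (simp add: entry_norm_def sum_distrib_right)
  finally show ?thesis .
qed

lemma vec_index_le_sqrt_nsq:
  assumes "u \<in> carrier_vec n" "i < n" shows "cmod (vec_index u i) \<le> sqrt (nsq u)"
proof -
  have "(cmod (vec_index u i))\<^sup>2 \<le> nsq u"
    unfolding nsq_sum[OF assms(1)] using assms(2)
    by (intro member_le_sum[of i _ "\<lambda>i. (cmod (vec_index u i))\<^sup>2"]) auto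
  thus ?thesis by (simp add: real_le_rsqrt)
qed

lemma qform_le_entry_norm:
  assumes E: "E \<in> carrier_mat n n" and u: "u \<in> carrier_vec n"
  shows "\<bar>qform E u\<bar> \<le> entry_norm E * nsq u"
proof -
  have "\<bar>qform E u\<bar> \<le> cmod ((E *\<^sub>v u) \<bullet>c u)" unfolding qform_def by (rule abs_Re_le_cmod)
  also have "(E *\<^sub>v u) \<bullet>c u = (\<Sum>i<n. \<Sum>j<n. E $$ (i, j) * vec_index u j * cnj (vec_index u i))"
    unfolding cscalar_prod_sum[OF u] using mult_mat_vec_index_sum[OF E u] by (simp add: sum_distrib_right)
  also have "cmod \<dots> \<le> (\<Sum>i<n. \<Sum>j<n. cmod (E $$ (i, j)) * nsq u)"
  proof (intro order_trans[OF norm_sum] sum_mono)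
    fix i j assume "i \<in> {..<n}" "j \<in> {..<n}"
    hence "cmod (vec_index u j) * cmod (vec_index u i) \<le> sqrt (nsq u) * sqrt (nsq u)"
      using vec_index_le_sqrt_nsq[OF u] by (intro mult_mono) auto
    thus "cmod (E $$ (i, j) * vec_index u j * cnj (vec_index u i)) \<le> cmod (E $$ (i, j)) * nsq u"
      by (simp add: norm_mult mult.assoc mult_left_mono)
  qed
  also have "\<dots> = entry_norm E * nsq u" using E by (simp add: entry_norm_def sum_distrib_right)
  finally show ?thesis .
qed

section \<open>Continuity of matrix operations\<close>

lemma continuous_map_compose_UNIV:
  assumes "continuous_on UNIV h" "continuous_map X euclidean f"
  shows "continuous_map X euclidean (\<lambda>x. h (f x))"
  using continuous_map_compose[OF assms(2), of euclidean h] assms(1) by (simp add: o_def)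

lemma continuous_map_mult_complex:
  fixes f g :: "'x \<Rightarrow> complex"
  assumes "continuous_map X euclidean f" "continuous_map X euclidean g"
  shows "continuous_map X euclidean (\<lambda>x. f x * g x)"
proof -
  have "continuous_map X (prod_topology euclidean euclidean) (\<lambda>x. (f x, g x))"
    using assms by (rule continuous_map_pairedI)
  hence "continuous_map X euclidean (\<lambda>x. (f x, g x))" by simp
  moreover have "continuous_on UNIV (\<lambda>p. fst p * snd p :: complex)" by (intro continuous_intros)
  ultimately show ?thesis using continuous_map_compose_UNIV by fastforce
qed

lemma continuous_map_prod_complex:
  fixes f :: "'x \<Rightarrow> 'i \<Rightarrow> complex"
  assumes "finite I" "\<And>i. i \<in> I \<Longrightarrow> continuous_map X euclidean (\<lambda>x. f x i)"
  shows "continuous_map X euclidean (\<lambda>x. prod (f x) I)"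
  using assms by (induction rule: finite_induct) (auto intro: continuous_map_mult_complex)

lemma cont_mat_funD:
  assumes "cont_mat_fun T m f"
  shows "x \<in> topspace T \<Longrightarrow> f x \<in> carrier_mat m m"
    "i < m \<Longrightarrow> j < m \<Longrightarrow> continuous_map T euclidean (\<lambda>x. f x $$ (i, j))"
  using assms by (auto simp: cont_mat_fun_def)

lemma cont_mat_fun_dim:
  assumes "cont_mat_fun T m f"
  shows "x \<in> topspace T \<Longrightarrow> dim_row (f x) = m" "x \<in> topspace T \<Longrightarrow> dim_col (f x) = m"
  using assms by (auto simp: cont_mat_fun_def)

lemma cont_mat_funI:
  assumes "\<And>x. x \<in> topspace T \<Longrightarrow> f x \<in> carrier_mat m m"
    "\<And>i j. i < m \<Longrightarrow> j < m \<Longrightarrow> continuous_map T euclidean (\<lambda>x. f x $$ (i, j))"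
  shows "cont_mat_fun T m f"
  using assms by (auto simp: cont_mat_fun_def)

lemma cont_mat_fun_cong:
  assumes "cont_mat_fun T m f" "\<And>x. x \<in> topspace T \<Longrightarrow> f x = g x"
  shows "cont_mat_fun T m g"
proof (rule cont_mat_funI)
  fix i j assume "i < m" "j < m"
  from cont_mat_funD(2)[OF assms(1) this] show "continuous_map T euclidean (\<lambda>x. g x $$ (i, j))"
    by (rule continuous_map_eq) (simp add: assms(2))
next
  fix x assume "x \<in> topspace T"
  from cont_mat_funD(1)[OF assms(1) this] assms(2)[OF this] show "g x \<in> carrier_mat m m" by simp
qed

lemma cont_mat_fun_const: "A \<in> carrier_mat m m \<Longrightarrow> cont_mat_fun T m (\<lambda>x. A)"
  by (auto simp: cont_mat_fun_def)

lemma cont_mat_fun_add: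
  assumes f: "cont_mat_fun T m f" and g: "cont_mat_fun T m g"
  shows "cont_mat_fun T m (\<lambda>x. f x + g x)"
proof (rule cont_mat_funI)
  fix i j assume ij: "i < m" "j < m"
  have "continuous_map T euclidean (\<lambda>x. f x $$ (i, j) + g x $$ (i, j))"
    using cont_mat_funD(2)[OF f ij] cont_mat_funD(2)[OF g ij] by (rule continuous_map_add)
  thus "continuous_map T euclidean (\<lambda>x. (f x + g x) $$ (i, j))"
    by (rule continuous_map_eq) (use cont_mat_funD(1)[OF g] cont_mat_fun_dim[OF g] ij in auto)
qed (use cont_mat_funD(1)[OF f] cont_mat_funD(1)[OF g] cont_mat_fun_dim[OF f] cont_mat_fun_dim[OF g] in auto)

lemma cont_mat_fun_smult_fun:
  assumes f: "cont_mat_fun T m f" and c: "continuous_map T euclidean c"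
  shows "cont_mat_fun T m (\<lambda>x. c x \<cdot>\<^sub>m f x)"
proof (rule cont_mat_funI)
  fix i j assume ij: "i < m" "j < m"
  have "continuous_map T euclidean (\<lambda>x. c x * f x $$ (i, j))"
    using c cont_mat_funD(2)[OF f ij] by (rule continuous_map_mult_complex)
  thus "continuous_map T euclidean (\<lambda>x. (c x \<cdot>\<^sub>m f x) $$ (i, j))"
    by (rule continuous_map_eq) (use cont_mat_funD(1)[OF f] cont_mat_fun_dim[OF f] ij in auto)
qed (use cont_mat_funD(1)[OF f] cont_mat_fun_dim[OF f] in auto)

lemma cont_mat_fun_smult: "cont_mat_fun T m f \<Longrightarrow> cont_mat_fun T m (\<lambda>x. c \<cdot>\<^sub>m f x)"
  by (rule cont_mat_fun_smult_fun) auto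

lemma cont_mat_fun_minus:
  assumes f: "cont_mat_fun T m f" and g: "cont_mat_fun T m g"
  shows "cont_mat_fun T m (\<lambda>x. f x - g x)"
proof -
  have "cont_mat_fun T m (\<lambda>x. f x + (-1) \<cdot>\<^sub>m g x)"
    using f g by (intro cont_mat_fun_add cont_mat_fun_smult)
  thus ?thesis
  proof (rule cont_mat_fun_cong)
    fix x assume x: "x \<in> topspace T"
    show "f x + (-1) \<cdot>\<^sub>m g x = f x - g x"
      using cont_mat_fun_dim[OF f x] cont_mat_fun_dim[OF g x] by (intro eq_matI) auto
  qed
qed

lemma cont_mat_fun_mult:
  assumes f: "cont_mat_fun T m f" and g: "cont_mat_fun T m g"
  shows "cont_mat_fun T m (\<lambda>x. f x * g x)"
proof (rule cont_mat_funI)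
  fix i j assume ij: "i < m" "j < m"
  have "continuous_map T euclidean (\<lambda>x. \<Sum>l<m. f x $$ (i, l) * g x $$ (l, j))"
    using cont_mat_funD(2)[OF f] cont_mat_funD(2)[OF g] ij
    by (intro continuous_map_sum continuous_map_mult_complex) auto
  thus "continuous_map T euclidean (\<lambda>x. (f x * g x) $$ (i, j))"
    by (rule continuous_map_eq) (rule mult_mat_index_sum[OF cont_mat_funD(1)[OF f] cont_mat_funD(1)[OF g] ij, symmetric])
qed (use cont_mat_funD(1)[OF f] cont_mat_funD(1)[OF g] cont_mat_fun_dim[OF f] cont_mat_fun_dim[OF g] in auto)

lemma cont_mat_fun_adjoint:
  assumes f: "cont_mat_fun T m f"
  shows "cont_mat_fun T m (\<lambda>x. mat_adjoint (f x))"
proof (rule cont_mat_funI)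
  fix i j assume ij: "i < m" "j < m"
  have "continuous_map T euclidean (\<lambda>x. cnj (f x $$ (j, i)))"
    by (rule continuous_map_compose_UNIV[OF _ cont_mat_funD(2)[OF f ij(2,1)]]) (intro continuous_intros)
  thus "continuous_map T euclidean (\<lambda>x. mat_adjoint (f x) $$ (i, j))"
    by (rule continuous_map_eq) (use cont_mat_funD(1)[OF f] cont_mat_fun_dim[OF f] ij in auto)
qed (use cont_mat_funD(1)[OF f] cont_mat_fun_dim[OF f] in auto)

lemma cont_mat_fun_pow:
  assumes f: "cont_mat_fun T m f"
  shows "cont_mat_fun T m (\<lambda>x. f x ^\<^sub>m N)"
proof (induction N)
  case 0
  have "cont_mat_fun T m (\<lambda>x. 1\<^sub>m m)" by (rule cont_mat_fun_const) simp
  thus ?case by (rule cont_mat_fun_cong) (use cont_mat_funD(1)[OF f] cont_mat_fun_dim[OF f] in auto)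
next
  case (Suc N) thus ?case using f by (auto intro: cont_mat_fun_mult)
qed

lemma cont_mat_fun_subtopology: "cont_mat_fun T m f \<Longrightarrow> cont_mat_fun (subtopology T S) m f"
  by (auto simp: cont_mat_fun_def intro: continuous_map_from_subtopology)

lemma continuous_map_entry_norm:
  assumes f: "cont_mat_fun T m f" shows "continuous_map T euclideanreal (\<lambda>x. entry_norm (f x))"
proof -
  have "continuous_map T euclideanreal (\<lambda>x. \<Sum>i<m. \<Sum>j<m. cmod (f x $$ (i, j)))"
    using cont_mat_funD(2)[OF f] by (intro continuous_map_sum continuous_map_norm) auto
  thus ?thesis by (rule continuous_map_eq) (simp add: entry_norm_def cont_mat_fun_dim[OF f])
qed

lemma continuous_map_det:
  assumes f: "cont_mat_fun T m f" shows "continuous_map T euclidean (\<lambda>x. Determinant.det (f x))"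
proof -
  have "continuous_map T euclidean (\<lambda>x. \<Sum>p | p permutes {0..<m}. of_int (sign p) * (\<Prod>i = 0..<m. f x $$ (i, p i)))"
  proof (intro continuous_map_sum continuous_map_mult_complex continuous_map_prod_complex)
    fix p i assume "p \<in> {p. p permutes {0..<m}}" "i \<in> {0..<m}"
    thus "continuous_map T euclidean (\<lambda>x. f x $$ (i, p i))"
      using permutes_in_image[of p "{0..<m}" i] by (intro cont_mat_funD(2)[OF f]) simp_all
  qed (auto simp: finite_permutations)
  thus ?thesis
    by (rule continuous_map_eq) (rule det_def'[OF cont_mat_funD(1)[OF f], symmetric])
qed

lemma continuous_map_inverse_complex:
  fixes f :: "'x \<Rightarrow> complex"
  assumes f: "continuous_map X euclidean f" and nz: "\<And>x. x \<in> topspace X \<Longrightarrow> f x \<noteq> 0"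
  shows "continuous_map X euclidean (\<lambda>x. inverse (f x))"
proof -
  have "continuous_map X (top_of_set (- {0})) f" using f nz by (auto simp: continuous_map_in_subtopology)
  moreover have "continuous_map (top_of_set (- {0})) euclidean (inverse :: complex \<Rightarrow> complex)"
    by (auto simp: continuous_map_iff_continuous intro!: continuous_intros)
  ultimately show ?thesis using continuous_map_compose[of X _ f euclidean inverse] by (simp add: o_def)
qed

text \<open>Cramer's rule, taken because cofactors are polynomial in the entries, which makes
  continuity of the inverse immediate.\<close>

definition matinv :: "complex mat \<Rightarrow> complex mat" where
  "matinv M = inverse (Determinant.det M) \<cdot>\<^sub>m adj_mat M"

lemma matinv:
  assumes M: "M \<in> carrier_mat n n" and d: "Determinant.det M \<noteq> 0"
  shows "matinv M \<in> carrier_mat n n" "M * matinv M = 1\<^sub>m n" "matinv M * M = 1\<^sub>m n"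
proof -
  have *: "inverse (Determinant.det M) \<cdot>\<^sub>m (Determinant.det M \<cdot>\<^sub>m 1\<^sub>m n) = 1\<^sub>m n"
    using d by (intro eq_matI) auto
  show "matinv M \<in> carrier_mat n n" using adj_mat[OF M] by (simp add: matinv_def)
  show "M * matinv M = 1\<^sub>m n" "matinv M * M = 1\<^sub>m n"
    using adj_mat[OF M] M
    by (simp_all add: matinv_def mult_smult_distrib[of _ n n _ n] mult_smult_assoc_mat[of _ n n _ n] *)
qed

lemma matinv_unique:
  assumes M: "M \<in> carrier_mat m m" and N: "N \<in> carrier_mat m m" and MN: "M * N = 1\<^sub>m m"
  shows "Determinant.det M \<noteq> 0" "matinv M = N"
proof -
  show d: "Determinant.det M \<noteq> 0" using det_mult[OF M N] MN by auto
  note i = matinv[OF M d]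
  have "matinv M * (M * N) = (matinv M * M) * N" using i(1) M N by (rule assoc_mult_mat[symmetric])
  thus "matinv M = N" unfolding MN i(3) using i(1) N by simp
qed

lemma cont_mat_fun_inverse:
  assumes f: "cont_mat_fun T m f" and d: "\<And>x. x \<in> topspace T \<Longrightarrow> Determinant.det (f x) \<noteq> 0"
  shows "cont_mat_fun T m (\<lambda>x. matinv (f x))"
proof -
  have "cont_mat_fun T m (\<lambda>x. adj_mat (f x))"
  proof (rule cont_mat_funI)
    fix i j assume ij: "i < m" "j < m"
    have del: "cont_mat_fun T (m - 1) (\<lambda>x. mat_delete (f x) j i)"
    proof (rule cont_mat_funI)
      fix x assume "x \<in> topspace T"
      thus "mat_delete (f x) j i \<in> carrier_mat (m - 1) (m - 1)"
        using cont_mat_funD(1)[OF f] mat_delete_carrier by blast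
    next
      fix k l assume kl: "k < m - 1" "l < m - 1"
      have "continuous_map T euclidean (\<lambda>x. f x $$ (if k < j then k else Suc k, if l < i then l else Suc l))"
        using kl by (intro cont_mat_funD(2)[OF f]) auto
      thus "continuous_map T euclidean (\<lambda>x. mat_delete (f x) j i $$ (k, l))"
        by (rule continuous_map_eq) (use cont_mat_funD(1)[OF f] cont_mat_fun_dim[OF f] kl in \<open>auto simp: mat_delete_def cont_mat_fun_dim[OF f]\<close>)
    qed
    have "continuous_map T euclidean (\<lambda>x. (-1) ^ (j + i) * Determinant.det (mat_delete (f x) j i))"
      by (intro continuous_map_mult_complex continuous_map_det[OF del]) auto
    thus "continuous_map T euclidean (\<lambda>x. adj_mat (f x) $$ (i, j))"
      by (rule continuous_map_eq) (use cont_mat_funD(1)[OF f] cont_mat_fun_dim[OF f] ij in \<open>auto simp: adj_mat_def cofactor_def\<close>)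
  next
    fix x assume "x \<in> topspace T" thus "adj_mat (f x) \<in> carrier_mat m m"
      using cont_mat_funD(1)[OF f] adj_mat(1) by blast
  qed
  moreover have "continuous_map T euclidean (\<lambda>x. inverse (Determinant.det (f x)))"
    using continuous_map_det[OF f] d by (rule continuous_map_inverse_complex)
  ultimately show ?thesis unfolding matinv_def by (rule cont_mat_fun_smult_fun)
qed

section \<open>Invertibility and positive definiteness as open conditions\<close>

lemma openin_real_less:
  assumes "continuous_map T euclideanreal f" shows "openin T {x \<in> topspace T. f x < c}"
  using openin_continuous_map_preimage[OF assms, of "{..<c}"] by simp

lemma openin_det_nonzero:
  assumes f: "cont_mat_fun T m f" shows "openin T {x \<in> topspace T. Determinant.det (f x) \<noteq> 0}"
  using openin_continuous_map_preimage[OF continuous_map_det[OF f], of "-{0}"] by (simp add: open_Compl)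

text \<open>The form of the perturbation is at most its \<open>entry_norm\<close> times the squared
  length, so a lower bound \<open>\<delta>\<close> for the form of \<open>M\<close> absorbs
  it.\<close>

lemma posdef_perturb:
  assumes M: "M \<in> carrier_mat n n" and N: "N \<in> carrier_mat n n" and h: "mat_adjoint N = N"
    and d: "\<And>u. u \<in> carrier_vec n \<Longrightarrow> \<delta> * nsq u \<le> qform M u" and e: "entry_norm (N - M) < \<delta>"
  shows "posdef N"
  unfolding posdef_def
proof (intro conjI ballI impI h)
  fix u :: "complex Matrix.vec" assume "u \<in> carrier_vec (dim_row N)" "u \<noteq> 0\<^sub>v (dim_row N)"
  hence u: "u \<in> carrier_vec n" "u \<noteq> 0\<^sub>v n" using N by auto
  have "\<bar>qform (N - M) u\<bar> \<le> entry_norm (N - M) * nsq u" using M N u by (intro qform_le_entry_norm) auto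
  hence "entry_norm (N - M) * nsq u \<ge> qform M u - qform N u" using M N u by (auto simp: qform_minus[of _ n])
  moreover have "entry_norm (N - M) * nsq u < \<delta> * nsq u" using e nsq_pos[OF u] by simp
  ultimately show "0 < qform N u" using d[OF u(1)] by linarith
qed

lemma openin_posdef:
  assumes f: "cont_mat_fun T m f" and h: "\<And>x. x \<in> topspace T \<Longrightarrow> mat_adjoint (f x) = f x"
  shows "openin T {x \<in> topspace T. posdef (f x)}"
proof (subst openin_subopen, intro ballI)
  fix x0 assume "x0 \<in> {x \<in> topspace T. posdef (f x)}"
  hence x0: "x0 \<in> topspace T" "posdef (f x0)" by auto
  note c = cont_mat_funD(1)[OF f]
  obtain \<delta> where d: "0 < \<delta>" "\<And>u. u \<in> carrier_vec m \<Longrightarrow> \<delta> * nsq u \<le> qform (f x0) u"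
    using posdef_bound[OF c[OF x0(1)] x0(2)] by blast
  have "cont_mat_fun T m (\<lambda>x. f x - f x0)"
    using f cont_mat_fun_const[OF c[OF x0(1)]] by (intro cont_mat_fun_minus) auto
  from openin_real_less[OF continuous_map_entry_norm[OF this], of \<delta>]
  have "openin T {x \<in> topspace T. entry_norm (f x - f x0) < \<delta>}" .
  moreover have "x0 \<in> {x \<in> topspace T. entry_norm (f x - f x0) < \<delta>}"
    using x0 d(1) c[OF x0(1)] entry_norm_eq_0_iff[of "f x0 - f x0" m m] by auto
  moreover have "{x \<in> topspace T. entry_norm (f x - f x0) < \<delta>} \<subseteq> {x \<in> topspace T. posdef (f x)}"
    using posdef_perturb[OF c[OF x0(1)] c h d(2)] by auto
  ultimately show "\<exists>U. openin T U \<and> x0 \<in> U \<and> U \<subseteq> {x \<in> topspace T. posdef (f x)}" by blast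
qed

section \<open>General position and covering dimension\<close>

text \<open>Gaussian elimination, one equation at a time. It is used over the reals to find a
  hyperplane containing few given vectors, and over the complex numbers to find a vector orthogonal
  to given columns.\<close>

lemma underdetermined_system:
  fixes A :: "'j \<Rightarrow> 'i \<Rightarrow> 'a::field"
  assumes "finite J" "finite I" "card J < card I"
  shows "\<exists>c. (\<exists>i\<in>I. c i \<noteq> 0) \<and> (\<forall>j\<in>J. (\<Sum>i\<in>I. c i * A j i) = 0)"
  using assms
proof (induction J arbitrary: I A rule: finite_induct)
  case empty
  then obtain i where "i \<in> I" by (metis card.empty card_gt_0_iff ex_in_conv)
  thus ?case by (intro exI[of _ "\<lambda>_. 1"]) auto
next
  case (insert j J)
  show ?case
  proof (cases "\<forall>i\<in>I. A j i = 0")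
    case True
    have "card J < card I" using insert by simp
    from insert.IH[OF insert.prems(1) this, of A] True show ?thesis by auto
  next
    case False
    then obtain i0 where i0: "i0 \<in> I" "A j i0 \<noteq> 0" by auto
    let ?I = "I - {i0}"
    \<comment> \<open>Equation \<open>j\<close> is solved for the unknown \<open>i0\<close>;
      \<open>B\<close> is the coefficient matrix of the other equations after this
      substitution.\<close>
    define B where "B k i = A k i - A k i0 * A j i / A j i0" for k i
    have "card J < card ?I" using insert i0 by (simp add: card_Diff_singleton)
    from insert.IH[OF _ this, of B] insert.prems(1) obtain c where
      c: "\<exists>i\<in>?I. c i \<noteq> 0" "\<forall>k\<in>J. (\<Sum>i\<in>?I. c i * B k i) = 0" by auto
    define S where "S = (\<Sum>i\<in>?I. c i * A j i)"
    define c' where "c' = c(i0 := - S / A j i0)"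
    have sum: "(\<Sum>i\<in>I. c' i * A k i) = - S / A j i0 * A k i0 + (\<Sum>i\<in>?I. c i * A k i)" for k
      unfolding sum.remove[OF insert.prems(1) i0(1)] by (simp add: c'_def)
    have "(\<Sum>i\<in>I. c' i * A k i) = 0" if "k \<in> J" for k
    proof -
      have "(\<Sum>i\<in>?I. c i * B k i) = (\<Sum>i\<in>?I. c i * A k i) - A k i0 / A j i0 * S"
        by (simp add: B_def S_def algebra_simps sum_subtractf sum_distrib_left)
      thus ?thesis using c(2) that sum[of k] by (simp add: field_simps)
    qed
    moreover have "(\<Sum>i\<in>I. c' i * A j i) = 0" using sum[of j] i0 by (simp add: S_def)
    moreover have "\<exists>i\<in>I. c' i \<noteq> 0" using c(1) by (auto simp: c'_def)
    ultimately show ?thesis by auto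
  qed
qed

text \<open>A finite union of hyperplanes has dense complement. One coordinate \<open>i0\<close> is
  shifted by \<open>t\<close>; each functional either rules out a single \<open>t\<close> or does
  not notice the shift, and in the latter case the induction hypothesis covers it.\<close>

lemma avoid_hyperplanes:
  fixes w :: "'i \<Rightarrow> real"
  assumes "finite C" "finite I" "0 < \<eta>" "\<And>c. c \<in> C \<Longrightarrow> \<exists>i\<in>I. c i \<noteq> 0"
  shows "\<exists>v. (\<forall>i. \<bar>v i - w i\<bar> < \<eta>) \<and> (\<forall>c\<in>C. (\<Sum>i\<in>I. c i * v i) \<noteq> 0)"
  using assms
proof (induction C arbitrary: \<eta> rule: finite_induct)
  case empty
  thus ?case by (intro exI[of _ w]) auto
next
  case (insert c C)
  from insert.IH[of "\<eta>/2"] insert.prems obtain v where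
    v: "\<forall>i. \<bar>v i - w i\<bar> < \<eta>/2" "\<forall>c\<in>C. (\<Sum>i\<in>I. c i * v i) \<noteq> 0" by auto
  from insert.prems obtain i0 where i0: "i0 \<in> I" "c i0 \<noteq> 0" by auto
  \<comment> \<open>The shifts at which some functional would vanish. A functional with entry 0 at
    \<open>i0\<close> contributes the value 0, by division by zero, which a positive
    \<open>t\<close> avoids anyway.\<close>
  let ?bad = "(\<lambda>c. - (\<Sum>i\<in>I. c i * v i) / c i0) ` insert c C"
  have "infinite ({0<..<\<eta>/2} - ?bad)"
    using insert.hyps insert.prems by (intro Diff_infinite_finite infinite_Ioo) auto
  then obtain t where t: "0 < t" "t < \<eta>/2" "t \<notin> ?bad"
    by (metis (no_types, lifting) Diff_iff finite.emptyI greaterThanLessThan_iff ex_in_conv)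
  define v' where "v' = v(i0 := v i0 + t)"
  have sum: "(\<Sum>i\<in>I. c i * v' i) = (\<Sum>i\<in>I. c i * v i) + t * c i0" for c
  proof -
    have "(\<Sum>i\<in>I. c i * v' i) = (\<Sum>i\<in>I. c i * v i + (if i = i0 then t * c i0 else 0))"
      by (intro sum.cong) (auto simp: v'_def algebra_simps)
    thus ?thesis using insert.prems i0 by (simp add: sum.distrib)
  qed
  have "(\<Sum>i\<in>I. c' i * v' i) \<noteq> 0" if c': "c' \<in> insert c C" for c'
  proof
    assume z: "(\<Sum>i\<in>I. c' i * v' i) = 0"
    show False
    proof (cases "c' i0 = 0")
      case True
      hence "c' \<in> C" using c' i0 by auto
      thus False using z sum[of c'] v(2) True by auto
    next
      case False
      hence "t = - (\<Sum>i\<in>I. c' i * v i) / c' i0" using z sum[of c'] by (simp add: field_simps)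
      thus False using t(3) c' by blast
    qed
  qed
  moreover have "\<bar>v' i - w i\<bar> < \<eta>" for i
  proof (cases "i = i0")
    case True
    have "\<bar>v i0 - w i0\<bar> < \<eta>/2" using v(1) by blast
    hence "\<bar>v i0 + t - w i0\<bar> < \<eta>" using t(1,2) by linarith
    thus ?thesis using True by (simp add: v'_def)
  next
    case False
    have "\<bar>v i - w i\<bar> < \<eta>/2" using v(1) by blast
    thus ?thesis using False insert.prems(2) by (simp add: v'_def)
  qed
  ultimately show ?case by blast
qed

text \<open>In dimension above \<open>d\<close>, any \<open>d\<close> vectors lie in a hyperplane
  through 0. Each new vector is placed off the hyperplanes chosen for all sets of at most
  \<open>d\<close> earlier vectors, so it cannot take part in a vanishing combination of
  \<open>d + 1\<close> vectors. The coefficients are positive because they will be values of a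
  partition of unity.\<close>

lemma general_position:
  fixes w :: "nat \<Rightarrow> 'i \<Rightarrow> real"
  assumes I: "finite I" "d < card I" and \<eta>: "0 < \<eta>"
  shows "\<exists>v. (\<forall>p i. \<bar>v p i - w p i\<bar> < \<eta>) \<and>
    (\<forall>S\<subseteq>{..<q}. \<forall>t. S \<noteq> {} \<and> card S \<le> Suc d \<and> (\<forall>p\<in>S. 0 < t p) \<longrightarrow> (\<exists>i\<in>I. (\<Sum>p\<in>S. t p * v p i) \<noteq> 0))"
proof (induction q)
  case 0
  show ?case by (intro exI[of _ w]) (auto simp: \<eta>)
next
  case (Suc q)
  then obtain v where vv: "\<forall>p i. \<bar>v p i - w p i\<bar> < \<eta>"
    "\<forall>S\<subseteq>{..<q}. \<forall>t. S \<noteq> {} \<and> card S \<le> Suc d \<and> (\<forall>p\<in>S. 0 < t p) \<longrightarrow> (\<exists>i\<in>I. (\<Sum>p\<in>S. t p * v p i) \<noteq> 0)"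
    by blast
  note v = vv(1)[rule_format]
  have v2: "\<exists>i\<in>I. (\<Sum>p\<in>S. t p * v p i) \<noteq> 0"
    if "S \<subseteq> {..<q}" "S \<noteq> {}" "card S \<le> Suc d" "\<forall>p\<in>S. 0 < t p" for S t
    using vv(2)[rule_format, OF that(1), of t] that(2-4) by simp
  let ?P = "\<lambda>S. S \<subseteq> {..<q} \<and> card S \<le> d"
  have "\<forall>S. \<exists>c. ?P S \<longrightarrow> (\<exists>i\<in>I. c i \<noteq> 0) \<and> (\<forall>p\<in>S. (\<Sum>i\<in>I. c i * v p i) = 0)"
  proof
    fix S
    show "\<exists>c. ?P S \<longrightarrow> (\<exists>i\<in>I. c i \<noteq> 0) \<and> (\<forall>p\<in>S. (\<Sum>i\<in>I. c i * v p i) = 0)"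
    proof (cases "?P S")
      case True
      hence "finite S" "card S < card I" using I(2) finite_subset by auto
      from underdetermined_system[OF this(1) I(1) this(2), of v] show ?thesis by blast
    qed blast
  qed
  then obtain c where c: "\<And>S. ?P S \<Longrightarrow> \<exists>i\<in>I. c S i \<noteq> 0"
    "\<And>S p. ?P S \<Longrightarrow> p \<in> S \<Longrightarrow> (\<Sum>i\<in>I. c S i * v p i) = 0" by metis
  have fin: "finite (c ` {S. ?P S})" by (rule finite_imageI, rule finite_subset[of _ "Pow {..<q}"]) auto
  have "\<exists>i\<in>I. c' i \<noteq> 0" if "c' \<in> c ` {S. ?P S}" for c' using that c(1) by blast
  from avoid_hyperplanes[OF fin I(1) \<eta> this, of "w q"] obtain u where
    u: "\<And>i. \<bar>u i - w q i\<bar> < \<eta>" "\<And>S. ?P S \<Longrightarrow> (\<Sum>i\<in>I. c S i * u i) \<noteq> 0" by blast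
  define v' where "v' = v(q := u)"
  have "\<exists>i\<in>I. (\<Sum>p\<in>S. t p * v' p i) \<noteq> 0"
    if S: "S \<subseteq> {..<Suc q}" "S \<noteq> {}" "card S \<le> Suc d" "\<forall>p\<in>S. 0 < t p" for S t
  proof (cases "q \<in> S")
    case False
    hence "S \<subseteq> {..<q}" using S(1) by (auto simp: less_Suc_eq)
    moreover have "(\<Sum>p\<in>S. t p * v' p i) = (\<Sum>p\<in>S. t p * v p i)" for i
      using False by (intro sum.cong) (auto simp: v'_def)
    ultimately show ?thesis using v2[of S t] S by auto
  next
    case True
    let ?S = "S - {q}"
    have finS: "finite S" using S(1) finite_subset by blast
    have P: "?P ?S" using S True finS by (auto simp: card_Diff_singleton less_Suc_eq)
    show ?thesis
    proof (rule ccontr)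
      assume "\<not> ?thesis"
      hence z: "\<And>i. i \<in> I \<Longrightarrow> (\<Sum>p\<in>S. t p * v' p i) = 0" by auto
      \<comment> \<open>The functional belonging to the other vectors of \<open>S\<close> kills all
        terms but the one of the new vector.\<close>
      have "0 = (\<Sum>i\<in>I. c ?S i * (\<Sum>p\<in>S. t p * v' p i))" using z by simp
      also have "\<dots> = (\<Sum>p\<in>S. t p * (\<Sum>i\<in>I. c ?S i * v' p i))"
        unfolding sum_distrib_left by (subst sum.swap) (simp add: mult_ac)
      also have "\<dots> = t q * (\<Sum>i\<in>I. c ?S i * u i) + (\<Sum>p\<in>?S. t p * (\<Sum>i\<in>I. c ?S i * v p i))"
        unfolding sum.remove[OF finS True] by (simp add: v'_def)
      also have "(\<Sum>p\<in>?S. t p * (\<Sum>i\<in>I. c ?S i * v p i)) = 0"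
        using c(2)[OF P] by (intro sum.neutral) auto
      finally show False using u(2)[OF P] S(4) True by auto
    qed
  qed
  moreover have "\<bar>v' p i - w p i\<bar> < \<eta>" for p i using v u(1) by (auto simp: v'_def)
  ultimately show ?case by (intro exI[of _ v']) blast
qed

section \<open>Compactness and partitions of unity\<close>

lemma openin_real_greater:
  assumes "continuous_map T euclideanreal f" shows "openin T {x \<in> topspace T. c < f x}"
  using openin_continuous_map_preimage[OF assms, of "{c<..}"] by simp

lemma compactin_finite_subcover:
  assumes K: "compactin X K" and U: "\<And>x. x \<in> K \<Longrightarrow> openin X (U x)" "\<And>x. x \<in> K \<Longrightarrow> x \<in> U x"
  obtains F where "F \<subseteq> K" "finite F" "K \<subseteq> (\<Union>x\<in>F. U x)"
proof -
  have "(\<forall>V\<in>U ` K. openin X V) \<and> K \<subseteq> \<Union>(U ` K)" using U by blast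
  then obtain \<F> where F: "finite \<F>" "\<F> \<subseteq> U ` K" "K \<subseteq> \<Union>\<F>"
    using K unfolding compactin_def by meson
  obtain F where "F \<subseteq> K" "finite F" "\<F> = U ` F" using finite_subset_image[OF F(1,2)] by auto
  thus thesis using that F(3) by blast
qed

lemma compact_space_finite_subcover:
  assumes K: "compact_space X" and U: "\<And>x. x \<in> topspace X \<Longrightarrow> openin X (U x)" "\<And>x. x \<in> topspace X \<Longrightarrow> x \<in> U x"
  obtains F where "F \<subseteq> topspace X" "finite F" "topspace X \<subseteq> (\<Union>x\<in>F. U x)"
  using compactin_finite_subcover[of X "topspace X" U] assms unfolding compact_space_def by blast

text \<open>Urysohn functions, one per point, are cut down by compactness to a finite family without
  common zero; each is charged to one member of the cover, and the sums are normalized. The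
  functions vanish outside their \<open>V\<close>, which is weaker than having closed support in
  \<open>V\<close> but is all that the order of the cover can see.\<close>

lemma partition_of_unity_finite_cover:
  assumes X: "compact_space X" "Hausdorff_space X" and fin: "finite \<V>"
    and op: "\<And>V. V \<in> \<V> \<Longrightarrow> openin X V" and cov: "topspace X \<subseteq> \<Union>\<V>"
  obtains L :: "'x set \<Rightarrow> 'x \<Rightarrow> real" where
    "\<forall>V\<in>\<V>. continuous_map X euclideanreal (L V)" "\<forall>V. \<forall>x\<in>topspace X. 0 \<le> L V x"
    "\<forall>V. \<forall>x\<in>topspace X. 0 < L V x \<longrightarrow> x \<in> V"
    "\<forall>x\<in>topspace X. (\<Sum>V\<in>\<V>. L V x) = 1"
proof -
  have norm: "normal_space X" using X compact_Hausdorff_or_regular_imp_normal_space by blast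
  define P where "P x V h \<longleftrightarrow> V \<in> \<V> \<and> continuous_map X euclideanreal h \<and> h x = 1 \<and>
      (\<forall>y\<in>topspace X. 0 \<le> h y) \<and> (\<forall>y\<in>topspace X. y \<notin> V \<longrightarrow> h y = 0)" for x :: 'x and V and h :: "'x \<Rightarrow> real"
  have ex: "\<exists>V h. P x V h" if True: "x \<in> topspace X" for x
  proof -
    obtain V where V: "V \<in> \<V>" "x \<in> V" using cov True by auto
    have c1: "closedin X {x}" using True X(2) by (simp add: closedin_Hausdorff_singleton)
    have c2: "closedin X (topspace X - V)" using op[OF V(1)] by (simp add: openin_closedin_eq)
    have dj: "disjnt (topspace X - V) {x}" using V(2) by (simp add: disjnt_def)
    obtain h where h: "continuous_map X (top_of_set {0..1::real}) h" "h ` (topspace X - V) \<subseteq> {0}" "h ` {x} \<subseteq> {1}"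
      by (rule Urysohn_lemma[OF norm c2 c1 dj zero_le_one])
    have "continuous_map X euclideanreal h" "\<And>y. y \<in> topspace X \<Longrightarrow> 0 \<le> h y"
      using h(1) unfolding continuous_map_in_subtopology by force+
    moreover have "h x = 1" "\<And>y. y \<in> topspace X \<Longrightarrow> y \<notin> V \<Longrightarrow> h y = 0" using h(2,3) by blast+
    ultimately have "P x V h" unfolding P_def using V(1) by blast
    thus ?thesis by blast
  qed
  have "\<exists>V h. \<forall>x\<in>topspace X. P x (V x) (h x)" using ex by metis
  then obtain V h where P: "\<And>x. x \<in> topspace X \<Longrightarrow> P x (V x) (h x)" by blast
  hence Vh: "\<And>x. x \<in> topspace X \<Longrightarrow> V x \<in> \<V>"
    "\<And>x. x \<in> topspace X \<Longrightarrow> continuous_map X euclideanreal (h x)" "\<And>x. x \<in> topspace X \<Longrightarrow> h x x = 1"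
    "\<And>x y. x \<in> topspace X \<Longrightarrow> y \<in> topspace X \<Longrightarrow> 0 \<le> h x y"
    "\<And>x y. x \<in> topspace X \<Longrightarrow> y \<in> topspace X \<Longrightarrow> y \<notin> V x \<Longrightarrow> h x y = 0"
    unfolding P_def by blast+
  have ho: "openin X {y \<in> topspace X. 0 < h x y}" "x \<in> {y \<in> topspace X. 0 < h x y}" if "x \<in> topspace X" for x
    using openin_real_greater[OF Vh(2)[OF that]] Vh(3)[OF that] that by auto
  obtain F where F: "F \<subseteq> topspace X" "finite F" "topspace X \<subseteq> (\<Union>x\<in>F. {y \<in> topspace X. 0 < h x y})"
    by (rule compact_space_finite_subcover[OF X(1) ho])
  \<comment> \<open>Several Urysohn functions may have chosen the same member of the cover.\<close>
  define g where "g U y = (\<Sum>x | x \<in> F \<and> V x = U. h x y)" for U y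
  define G where "G y = (\<Sum>U\<in>\<V>. g U y)" for y
  have g0: "0 \<le> g U y" if "y \<in> topspace X" for U y
    unfolding g_def using that Vh(4) F by (intro sum_nonneg) auto
  have gU: "y \<in> U" if "y \<in> topspace X" "0 < g U y" for U y
  proof (rule ccontr)
    assume "y \<notin> U"
    hence "g U y = 0" unfolding g_def using that Vh(5) F by (intro sum.neutral) auto
    thus False using that by simp
  qed
  have G0: "0 < G y" if y: "y \<in> topspace X" for y
  proof -
    obtain x where x: "x \<in> F" "0 < h x y" using F(3) y by auto
    have "h x y \<le> g (V x) y" unfolding g_def
      using F x y Vh(4) by (intro member_le_sum[of x _ "\<lambda>x. h x y"]) auto
    also have "\<dots> \<le> G y" unfolding G_def using fin Vh(1) x F g0[OF y] by (intro member_le_sum) auto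
    finally show ?thesis using x by simp
  qed
  have gc: "continuous_map X euclideanreal (g U)" for U
    unfolding g_def using F Vh(2) by (intro continuous_map_sum) auto
  have Gc: "continuous_map X euclideanreal G"
    unfolding G_def using fin gc by (intro continuous_map_sum) auto
  show thesis
  proof (rule that[of "\<lambda>U y. g U y / G y"]; intro ballI allI impI)
    show "continuous_map X euclideanreal (\<lambda>y. g U y / G y)" for U
      using gc Gc G0 by (intro continuous_map_real_divide) force+
    show "0 \<le> g U y / G y" if "y \<in> topspace X" for U y using g0[OF that] G0[OF that] by simp
    show "y \<in> U" if "y \<in> topspace X" "0 < g U y / G y" for U y
      using gU[OF that(1), of U] G0[OF that(1)] that(2) by (simp add: zero_less_divide_iff)
    show "(\<Sum>U\<in>\<V>. g U y / G y) = 1" if "y \<in> topspace X" for y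
      using G0[OF that] by (simp add: G_def flip: sum_divide_distrib)
  qed
qed

lemma covdim_leE:
  assumes dim: "covdim_le X d" and fin: "finite \<U>" and op: "\<forall>U\<in>\<U>. openin X U" and cov: "topspace X \<subseteq> \<Union>\<U>"
  obtains \<V> where "finite \<V>" "\<forall>V\<in>\<V>. openin X V" "topspace X \<subseteq> \<Union>\<V>" "\<forall>V\<in>\<V>. \<exists>U\<in>\<U>. V \<subseteq> U"
    "\<forall>x\<in>topspace X. card {V\<in>\<V>. x \<in> V} \<le> d + 1"
proof -
  have "\<exists>\<V>. finite \<V> \<and> (\<forall>V\<in>\<V>. openin X V) \<and> topspace X \<subseteq> \<Union>\<V> \<and> (\<forall>V\<in>\<V>. \<exists>U\<in>\<U>. V \<subseteq> U) \<and>
           (\<forall>x\<in>topspace X. card {V\<in>\<V>. x \<in> V} \<le> d + 1)"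
    by (rule mp[OF spec[OF dim[unfolded covdim_le_def]]]) (intro conjI fin op cov)
  thus thesis by (elim exE conjE) (rule that)
qed

text \<open>The approximation factors through the nerve of a fine cover of order at most
  \<open>d + 1\<close>: each value of \<open>g\<close> is a convex combination of at most
  \<open>d + 1\<close> vertices. With the vertices in general position in a space of dimension above
  \<open>d\<close>, it cannot be 0.\<close>

theorem nonvanishing_approximation:
  fixes f :: "'i \<Rightarrow> 'x \<Rightarrow> real"
  assumes X: "compact_space X" "Hausdorff_space X" and dim: "covdim_le X d"
    and I: "finite I" "d < card I" and f: "\<And>i. i \<in> I \<Longrightarrow> continuous_map X euclideanreal (f i)" and \<eta>: "0 < \<eta>"
  obtains g where "\<And>i. i \<in> I \<Longrightarrow> continuous_map X euclideanreal (g i)"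
    "\<And>i x. i \<in> I \<Longrightarrow> x \<in> topspace X \<Longrightarrow> \<bar>g i x - f i x\<bar> < \<eta>"
    "\<And>x. x \<in> topspace X \<Longrightarrow> \<exists>i\<in>I. g i x \<noteq> 0"
proof -
  \<comment> \<open>Any two points of \<open>N x\<close> differ in each \<open>f i\<close> by less
    than \<open>\<eta>/4\<close>. The vertices will be within another \<open>\<eta>/4\<close> of
    sampled values, for a total error of at most \<open>\<eta>/2\<close>.\<close>
  define N where "N x = (\<Inter>i\<in>I. {y \<in> topspace X. \<bar>f i y - f i x\<bar> < \<eta>/8}) \<inter> topspace X" for x
  have No: "openin X (N x)" for x
  proof -
    have "openin X {y \<in> topspace X. \<bar>f i y - f i x\<bar> < \<eta>/8}" if "i \<in> I" for i
      using f[OF that] by (intro openin_real_less continuous_map_real_abs continuous_map_diff) auto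
    thus ?thesis unfolding N_def using I(1)
      by (cases "I = {}") (auto intro!: openin_Int openin_INT)
  qed
  have Nx: "x \<in> N x" if "x \<in> topspace X" for x using that \<eta> by (auto simp: N_def)
  obtain F where F: "F \<subseteq> topspace X" "finite F" "topspace X \<subseteq> (\<Union>x\<in>F. N x)"
    by (rule compact_space_finite_subcover[OF X(1) No Nx])
  define \<U> where "\<U> = N ` F"
  have U: "finite \<U>" "\<U> \<subseteq> N ` topspace X" "topspace X \<subseteq> \<Union>\<U>" using F by (auto simp: \<U>_def)
  have Uo: "\<forall>U\<in>\<U>. openin X U" using No by (auto simp: \<U>_def)
  obtain \<V> where V: "finite \<V>" "\<forall>V\<in>\<V>. openin X V" "topspace X \<subseteq> \<Union>\<V>"
    "\<forall>V\<in>\<V>. \<exists>U\<in>\<U>. V \<subseteq> U" "\<forall>x\<in>topspace X. card {V\<in>\<V>. x \<in> V} \<le> d + 1"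
    by (rule covdim_leE[OF dim U(1) Uo U(3)])
  have close: "\<bar>f i y - f i x\<bar> < \<eta>/4" if V': "V \<in> \<V>" "x \<in> V" "y \<in> V" "i \<in> I" for V x y i
  proof -
    obtain z where "V \<subseteq> N z" using bspec[OF V(4) V'(1)] U(2) by blast
    hence "x \<in> N z" "y \<in> N z" using V' by auto
    hence "\<bar>f i x - f i z\<bar> < \<eta>/8" "\<bar>f i y - f i z\<bar> < \<eta>/8" using V'(4) by (auto simp: N_def)
    thus ?thesis by linarith
  qed
  obtain e where e: "bij_betw e {..<card \<V>} \<V>"
    using ex_bij_betw_nat_finite[OF V(1)] by (auto simp: atLeast0LessThan)
  define q where "q = card \<V>"
  \<comment> \<open>For an empty member of the cover \<open>p k\<close> is arbitrary; the weight of
    that member is 0 at every point, so this does no harm.\<close>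
  define p where "p k = (SOME x. x \<in> e k)" for k
  have pe: "p k \<in> e k" if "x \<in> e k" for k x unfolding p_def using that by (metis someI)
  obtain L where LL: "\<forall>V\<in>\<V>. continuous_map X euclideanreal (L V)" "\<forall>V. \<forall>x\<in>topspace X. 0 \<le> L V x"
    "\<forall>V. \<forall>x\<in>topspace X. 0 < L V x \<longrightarrow> x \<in> V" "\<forall>x\<in>topspace X. (\<Sum>V\<in>\<V>. L V x) = 1"
    by (rule partition_of_unity_finite_cover[OF X V(1) bspec[OF V(2)] V(3)])
  note L = bspec[OF LL(1)] bspec[OF spec[OF LL(2)]] mp[OF bspec[OF spec[OF LL(3)]]] bspec[OF LL(4)]
  have eV: "e k \<in> \<V>" if "k < q" for k using e that by (auto simp: bij_betw_def q_def)
  have L1: "(\<Sum>k<q. L (e k) x) = 1" if "x \<in> topspace X" for x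
    using L(4)[OF that] sum.reindex_bij_betw[OF e, of "\<lambda>V. L V x"] by (simp add: q_def)
  have "0 < \<eta>/4" using \<eta> by simp
  from general_position[OF I this, of "\<lambda>k i. f i (p k)" q] obtain v where
    vv: "\<forall>k i. \<bar>v k i - f i (p k)\<bar> < \<eta>/4"
    "\<forall>S\<subseteq>{..<q}. \<forall>t. S \<noteq> {} \<and> card S \<le> Suc d \<and> (\<forall>p\<in>S. 0 < t p) \<longrightarrow> (\<exists>i\<in>I. (\<Sum>p\<in>S. t p * v p i) \<noteq> 0)"
    by blast
  note v1 = spec[OF spec[OF vv(1)]]
  have v2: "\<exists>i\<in>I. (\<Sum>k\<in>S. t k * v k i) \<noteq> 0"
    if "S \<subseteq> {..<q}" "S \<noteq> {}" "card S \<le> Suc d" "\<forall>k\<in>S. 0 < t k" for S t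
    using vv(2)[rule_format, OF that(1), of t] that(2-4) by simp
  define g where "g i x = (\<Sum>k<q. L (e k) x * v k i)" for i x
  show thesis
  proof (rule that[of g])
    show "continuous_map X euclideanreal (g i)" if "i \<in> I" for i
      unfolding g_def using eV L(1) by (intro continuous_map_sum continuous_map_real_mult) auto
  next
    fix i x assume i: "i \<in> I" and x: "x \<in> topspace X"
    have "\<bar>g i x - f i x\<bar> = \<bar>\<Sum>k<q. L (e k) x * (v k i - f i x)\<bar>"
      using L1[OF x] by (simp add: g_def right_diff_distrib sum_subtractf flip: sum_distrib_right)
    also have "\<dots> \<le> (\<Sum>k<q. \<bar>L (e k) x * (v k i - f i x)\<bar>)" by (rule sum_abs)
    also have "\<dots> \<le> (\<Sum>k<q. L (e k) x * (\<eta>/2))"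
    proof (rule sum_mono)
      fix k assume k: "k \<in> {..<q}"
      show "\<bar>L (e k) x * (v k i - f i x)\<bar> \<le> L (e k) x * (\<eta>/2)"
      proof (cases "0 < L (e k) x")
        case True
        hence xk: "x \<in> e k" using L(3)[OF x] by blast
        have "\<bar>f i (p k) - f i x\<bar> < \<eta>/4" using close[OF eV xk pe[OF xk] i] k by auto
        hence "\<bar>v k i - f i x\<bar> \<le> \<eta>/2" using v1[of k i] by linarith
        thus ?thesis using True by (simp add: abs_mult mult_left_mono)
      next
        case False
        hence "L (e k) x = 0" using L(2)[OF x, of "e k"] by simp
        thus ?thesis by simp
      qed
    qed
    also have "\<dots> = \<eta>/2" using L1[OF x] by (simp flip: sum_distrib_right sum_divide_distrib)
    finally show "\<bar>g i x - f i x\<bar> < \<eta>" using \<eta> by simp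
  next
    fix x assume x: "x \<in> topspace X"
    \<comment> \<open>The members of positive weight at \<open>x\<close>. They all contain
      \<open>x\<close>, so the order of the cover bounds their number.\<close>
    define S where "S = {k. k < q \<and> 0 < L (e k) x}"
    have gS: "g i x = (\<Sum>k\<in>S. L (e k) x * v k i)" for i
      unfolding g_def S_def using L(2)[OF x] by (intro sum.mono_neutral_right) (auto simp: less_le)
    have "S \<noteq> {}"
    proof
      assume "S = {}"
      hence "L (e k) x \<le> 0" if "k < q" for k using that by (force simp: S_def)
      hence "(\<Sum>k<q. L (e k) x) \<le> 0" by (intro sum_nonpos) auto
      thus False using L1[OF x] by simp
    qed
    moreover have "card S \<le> Suc d"
    proof -
      have "inj_on e S" using e by (auto simp: bij_betw_def S_def q_def inj_on_def)
      hence "card S = card (e ` S)" by (simp add: card_image)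
      also have "\<dots> \<le> card {V\<in>\<V>. x \<in> V}"
        using V(1) eV L(3)[OF x] by (intro card_mono) (auto simp: S_def)
      finally show ?thesis using bspec[OF V(5) x] by simp
    qed
    ultimately show "\<exists>i\<in>I. g i x \<noteq> 0" unfolding gS by (intro v2) (auto simp: S_def)
  qed
qed

text \<open>An open cover of \<open>W\<close> is lifted to \<open>X\<close> and completed by the
  complement of \<open>W\<close>. The lemma is needed because functions are perturbed on closed
  neighbourhoods and not on all of \<open>X\<close>.\<close>

lemma covdim_le_closed_subspace:
  assumes dim: "covdim_le X d" and W: "closedin X W"
  shows "covdim_le (subtopology X W) d"
  unfolding covdim_le_def
proof (intro allI impI, elim conjE)
  fix \<U> assume U: "finite \<U>" "\<forall>U\<in>\<U>. openin (subtopology X W) U" "topspace (subtopology X W) \<subseteq> \<Union>\<U>"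
  have WX: "W \<subseteq> topspace X" using W closedin_subset by blast
  obtain E where E: "\<And>U. U \<in> \<U> \<Longrightarrow> openin X (E U)" "\<And>U. U \<in> \<U> \<Longrightarrow> U = E U \<inter> W"
    using U(2) unfolding openin_subtopology by metis
  let ?A = "insert (topspace X - W) (E ` \<U>)"
  have "topspace X \<subseteq> \<Union>?A"
  proof
    fix x assume x: "x \<in> topspace X"
    show "x \<in> \<Union>?A"
    proof (cases "x \<in> W")
      case True
      then obtain U' where "U' \<in> \<U>" "x \<in> U'"
        using U(3) x by (metis Int_iff UnionE subsetD topspace_subtopology)
      thus ?thesis using E(2)[of U'] by blast
    qed (use x in simp)
  qed
  moreover have "finite ?A" using U(1) by simp
  moreover have "\<forall>U\<in>?A. openin X U" using E(1) W by (simp add: closedin_def)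
  ultimately have A: "finite ?A" "\<forall>U\<in>?A. openin X U" "topspace X \<subseteq> \<Union>?A" by simp_all
  obtain \<V> where V: "finite \<V>" "\<forall>V\<in>\<V>. openin X V" "topspace X \<subseteq> \<Union>\<V>" "\<forall>V\<in>\<V>. \<exists>U\<in>?A. V \<subseteq> U"
    "\<forall>x\<in>topspace X. card {V\<in>\<V>. x \<in> V} \<le> d + 1"
    by (rule covdim_leE[OF dim A])
  \<comment> \<open>Members that miss \<open>W\<close> are dropped: only these can lie in the added
    complement, so the others refine the given cover.\<close>
  define \<V>' where "\<V>' = (\<lambda>V. V \<inter> W) ` {V \<in> \<V>. V \<inter> W \<noteq> {}}"
  have "\<exists>U\<in>\<U>. V' \<subseteq> U" if V': "V' \<in> \<V>'" for V'
  proof -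
    obtain V where v: "V \<in> \<V>" "V \<inter> W \<noteq> {}" "V' = V \<inter> W" using V' unfolding \<V>'_def by blast
    then obtain U where "U \<in> \<U>" "V \<subseteq> E U" using bspec[OF V(4) v(1)] by blast
    thus ?thesis using E(2) v by blast
  qed
  moreover have "card {V\<in>\<V>'. x \<in> V} \<le> d + 1" if x: "x \<in> topspace (subtopology X W)" for x
  proof -
    have "{V\<in>\<V>'. x \<in> V} \<subseteq> (\<lambda>V. V \<inter> W) ` {V\<in>\<V>. x \<in> V}" by (auto simp: \<V>'_def)
    hence "card {V\<in>\<V>'. x \<in> V} \<le> card {V\<in>\<V>. x \<in> V}" using V(1) by (intro surj_card_le) auto
    also have "\<dots> \<le> d + 1" using bspec[OF V(5)] x by simp
    finally show ?thesis .
  qed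
  moreover have "finite \<V>'" using V(1) by (simp add: \<V>'_def)
  moreover have "\<forall>V\<in>\<V>'. openin (subtopology X W) V"
    using V(2) unfolding \<V>'_def openin_subtopology by blast
  moreover have "topspace (subtopology X W) \<subseteq> \<Union>\<V>'"
  proof
    fix x assume "x \<in> topspace (subtopology X W)"
    hence x: "x \<in> topspace X" "x \<in> W" by auto
    then obtain V where "V \<in> \<V>" "x \<in> V" using V(3) by blast
    thus "x \<in> \<Union>\<V>'" using x by (auto simp: \<V>'_def)
  qed
  ultimately show "\<exists>\<V>. finite \<V> \<and> (\<forall>V\<in>\<V>. openin (subtopology X W) V) \<and> topspace (subtopology X W) \<subseteq> \<Union>\<V> \<and>
      (\<forall>V\<in>\<V>. \<exists>U\<in>\<U>. V \<subseteq> U) \<and> (\<forall>x\<in>topspace (subtopology X W). card {V\<in>\<V>. x \<in> V} \<le> d + 1)"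
    by blast
qed

section \<open>Perturbing matrix functions relative to a closed set\<close>

text \<open>Openness of the set of good pairs in the product of \<open>X\<close> with the
  \<open>m\<close> by \<open>m\<close> matrices, spelled out with \<open>entry_norm\<close> because
  perturbation estimates use it in this form.\<close>

definition open_condition :: "'x topology \<Rightarrow> nat \<Rightarrow> ('x \<Rightarrow> complex mat \<Rightarrow> bool) \<Rightarrow> bool" where
  "open_condition X m G \<longleftrightarrow> (\<forall>x\<in>topspace X. \<forall>M\<in>carrier_mat m m. G x M \<longrightarrow>
     (\<exists>U \<eta>. openin X U \<and> x \<in> U \<and> 0 < \<eta> \<and> (\<forall>y\<in>U. \<forall>N\<in>carrier_mat m m. entry_norm (N - M) < \<eta> \<longrightarrow> G y N)))"

lemma open_conditionE:
  assumes "open_condition X m G" "x \<in> topspace X" "M \<in> carrier_mat m m" "G x M"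
  obtains U \<eta> where "openin X U" "x \<in> U" "0 < \<eta>" "\<forall>y\<in>U. \<forall>N\<in>carrier_mat m m. entry_norm (N - M) < \<eta> \<longrightarrow> G y N"
  using mp[OF bspec[OF bspec[OF assms(1)[unfolded open_condition_def] assms(2)] assms(3)] assms(4)]
  by (elim exE conjE) (rule that)

lemma cont_mat_fun_near:
  assumes s: "cont_mat_fun X m s" and x: "x \<in> topspace X" and e: "0 < e"
  shows "openin X {y \<in> topspace X. entry_norm (s y - s x) < e}" "x \<in> {y \<in> topspace X. entry_norm (s y - s x) < e}"
proof -
  note c = cont_mat_funD(1)[OF s x]
  have "cont_mat_fun X m (\<lambda>y. s y - s x)" using s cont_mat_fun_const[OF c] by (rule cont_mat_fun_minus)
  from openin_real_less[OF continuous_map_entry_norm[OF this]]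
  show "openin X {y \<in> topspace X. entry_norm (s y - s x) < e}" .
  have "s x - s x = 0\<^sub>m m m" using c by (intro eq_matI) auto
  thus "x \<in> {y \<in> topspace X. entry_norm (s y - s x) < e}" using x e by simp
qed

text \<open>A Lebesgue number argument on the compact set \<open>K\<close>. One tolerance for all
  points ensures that later small corrections do not destroy what has been achieved on
  \<open>K\<close>.\<close>

lemma open_condition_margin:
  assumes G: "open_condition X m G" and s: "cont_mat_fun X m s" and K: "compactin X K"
    and GK: "\<And>x. x \<in> K \<Longrightarrow> G x (s x)"
  obtains \<eta> where "0 < \<eta>" "\<forall>x\<in>K. \<forall>N\<in>carrier_mat m m. entry_norm (N - s x) < \<eta> \<longrightarrow> G x N"
proof -
  have KX: "K \<subseteq> topspace X" using K by (rule compactin_subset_topspace)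
  define P where "P x U \<eta> \<longleftrightarrow> openin X U \<and> x \<in> U \<and> 0 < \<eta> \<and> (\<forall>y\<in>U. \<forall>N\<in>carrier_mat m m. entry_norm (N - s y) < \<eta> \<longrightarrow> G y N)"
    for x U and \<eta> :: real
  have "\<exists>U \<eta>. P x U \<eta>" if xK: "x \<in> K" for x
  proof -
    have x: "x \<in> topspace X" using xK KX by blast
    note c = cont_mat_funD(1)[OF s x]
    obtain U \<eta> where U: "openin X U" "x \<in> U" "0 < \<eta>" "\<forall>y\<in>U. \<forall>N\<in>carrier_mat m m. entry_norm (N - s x) < \<eta> \<longrightarrow> G y N"
      by (rule open_conditionE[OF G x c GK[OF xK]])
    \<comment> \<open>Half of the tolerance is spent on the variation of \<open>s\<close> near
      \<open>x\<close>, the other half is left for \<open>N\<close>.\<close>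
    let ?V = "{y \<in> topspace X. entry_norm (s y - s x) < \<eta>/2}"
    have V: "openin X ?V" "x \<in> ?V" using cont_mat_fun_near[OF s x, of "\<eta>/2"] U(3) by auto
    have "P x (U \<inter> ?V) (\<eta>/2)"
      unfolding P_def
    proof (intro conjI ballI impI)
      fix y N assume y: "y \<in> U \<inter> ?V" and N: "N \<in> carrier_mat m m" "entry_norm (N - s y) < \<eta>/2"
      have cy: "s y \<in> carrier_mat m m" using cont_mat_funD(1)[OF s] y by auto
      have "entry_norm (N - s x) \<le> entry_norm (N - s y) + entry_norm (s y - s x)"
        by (rule entry_norm_triangle[OF N(1) cy c])
      hence "entry_norm (N - s x) < \<eta>" using N(2) y by auto
      thus "G y N" using U(4) y N(1) by blast
    qed (use U V in auto)
    thus ?thesis by blast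
  qed
  then obtain U \<eta> where P: "\<And>x. x \<in> K \<Longrightarrow> P x (U x) (\<eta> x)" by metis
  have op: "openin X (U x)" "x \<in> U x" if "x \<in> K" for x using P[OF that] unfolding P_def by auto
  obtain F where F: "F \<subseteq> K" "finite F" "K \<subseteq> (\<Union>x\<in>F. U x)"
    by (rule compactin_finite_subcover[OF K op])
  define e where "e = Min (insert 1 (\<eta> ` F))"
  have eF: "e \<le> \<eta> x" if "x \<in> F" for x using F(2) that by (simp add: e_def)
  have "0 < \<eta> x" if "x \<in> F" for x using P that F(1) unfolding P_def by blast
  hence e0: "0 < e" using F(2) by (auto simp: e_def)
  show thesis
  proof (rule that[OF e0], intro ballI impI)
    fix y N assume y: "y \<in> K" and N: "N \<in> carrier_mat m m" "entry_norm (N - s y) < e"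
    obtain x where x: "x \<in> F" "y \<in> U x" using F(3) y by blast
    hence "P x (U x) (\<eta> x)" using P F(1) by blast
    moreover have "entry_norm (N - s y) < \<eta> x" using N(2) eF[OF x(1)] by simp
    ultimately show "G y N" using x(2) N(1) unfolding P_def by blast
  qed
qed

lemma open_condition_openin:
  assumes G: "open_condition X m G" and s: "cont_mat_fun X m s"
  shows "openin X {x \<in> topspace X. G x (s x)}"
proof (subst openin_subopen, intro ballI)
  fix x assume "x \<in> {x \<in> topspace X. G x (s x)}"
  hence x: "x \<in> topspace X" "G x (s x)" by auto
  note c = cont_mat_funD(1)[OF s x(1)]
  obtain U \<eta> where U: "openin X U" "x \<in> U" "0 < \<eta>" "\<forall>y\<in>U. \<forall>N\<in>carrier_mat m m. entry_norm (N - s x) < \<eta> \<longrightarrow> G y N"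
    by (rule open_conditionE[OF G x(1) c x(2)])
  let ?V = "{y \<in> topspace X. entry_norm (s y - s x) < \<eta>}"
  have V: "openin X ?V" "x \<in> ?V" using cont_mat_fun_near[OF s x(1) U(3)] by auto
  have "U \<inter> ?V \<subseteq> {x \<in> topspace X. G x (s x)}" using U(4) cont_mat_funD(1)[OF s] by auto
  thus "\<exists>T. openin X T \<and> x \<in> T \<and> T \<subseteq> {x \<in> topspace X. G x (s x)}"
    using openin_Int[OF U(1) V(1)] U(2) V(2) by blast
qed

text \<open>Tietze's theorem is applied to the real and imaginary part of each entry. The
  \<open>m * m\<close> entries of modulus at most \<open>2 * \<eta>\<close> account for the factor
  in the bound.\<close>

lemma matrix_Tietze_extension:
  assumes norm: "normal_space X" and S: "closedin X S" and f: "cont_mat_fun (subtopology X S) m f"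
    and b: "\<And>x. x \<in> S \<Longrightarrow> entry_norm (f x) \<le> \<eta>" and \<eta>: "0 \<le> \<eta>"
  obtains g where "cont_mat_fun X m g" "\<forall>x\<in>S. g x = f x" "\<forall>x\<in>topspace X. entry_norm (g x) \<le> real (2 * m * m) * \<eta>"
proof -
  have SX: "S \<subseteq> topspace X" using S by (rule closedin_subset)
  hence top: "topspace (subtopology X S) = S" by auto
  note c = cont_mat_funD(1)[OF f, unfolded top] and ce = cont_mat_funD(2)[OF f]
  have ext: "\<exists>g. continuous_map X euclideanreal g \<and> g ` topspace X \<subseteq> {-\<eta>..\<eta>} \<and> (\<forall>x\<in>S. g x = h (f x $$ (i, j)))"
    if ij: "i < m" "j < m" and h: "continuous_on UNIV h" "\<And>z. \<bar>h z\<bar> \<le> cmod z" for i j and h :: "complex \<Rightarrow> real"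
  proof -
    have 1: "continuous_map (subtopology X S) euclideanreal (\<lambda>x. h (f x $$ (i, j)))"
      by (rule continuous_map_compose_UNIV[OF h(1) ce[OF ij]])
    have 2: "(\<lambda>x. h (f x $$ (i, j))) ` S \<subseteq> {-\<eta>..\<eta>}"
    proof
      fix y assume "y \<in> (\<lambda>x. h (f x $$ (i, j))) ` S"
      then obtain x where x: "x \<in> S" "y = h (f x $$ (i, j))" by auto
      have "cmod (f x $$ (i, j)) \<le> entry_norm (f x)" using c[OF x(1)] ij by (intro entry_norm_entry_le) auto
      hence "\<bar>y\<bar> \<le> \<eta>" using h(2)[of "f x $$ (i, j)"] b[OF x(1)] x(2) by linarith
      thus "y \<in> {-\<eta>..\<eta>}" by auto
    qed
    have 3: "- \<eta> \<le> \<eta>" using \<eta> by simp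
    obtain g where "continuous_map X euclideanreal g" "\<And>x. x \<in> S \<Longrightarrow> g x = h (f x $$ (i, j))" "g ` topspace X \<subseteq> {-\<eta>..\<eta>}"
      using Tietze_extension_closed_real_interval[OF norm S 1 2 3] by metis
    thus ?thesis by blast
  qed
  define P where "P h i j g \<longleftrightarrow> continuous_map X euclideanreal g \<and> g ` topspace X \<subseteq> {-\<eta>..\<eta>} \<and> (\<forall>x\<in>S. g x = h (f x $$ (i, j)))"
    for h :: "complex \<Rightarrow> real" and i j and g :: "'a \<Rightarrow> real"
  have "\<exists>g. P Re i j g" if "i < m" "j < m" for i j
    unfolding P_def by (rule ext[OF that]) (auto intro!: continuous_intros abs_Re_le_cmod)
  then obtain g1 where g1: "\<And>i j. i < m \<Longrightarrow> j < m \<Longrightarrow> P Re i j (g1 i j)" by metis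
  have "\<exists>g. P Im i j g" if "i < m" "j < m" for i j
    unfolding P_def by (rule ext[OF that]) (auto intro!: continuous_intros abs_Im_le_cmod)
  then obtain g2 where g2: "\<And>i j. i < m \<Longrightarrow> j < m \<Longrightarrow> P Im i j (g2 i j)" by metis
  define g where "g x = mat m m (\<lambda>(i, j). complex_of_real (g1 i j x) + \<i> * complex_of_real (g2 i j x))" for x
  show thesis
  proof (rule that[of g])
    show "cont_mat_fun X m g"
    proof (rule cont_mat_funI)
      fix i j assume ij: "i < m" "j < m"
      have "continuous_map X euclideanreal (g1 i j)" "continuous_map X euclideanreal (g2 i j)"
        using g1[OF ij] g2[OF ij] unfolding P_def by auto
      hence "continuous_map X euclidean (\<lambda>x. complex_of_real (g1 i j x) + \<i> * complex_of_real (g2 i j x))"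
        by (intro continuous_map_add continuous_map_mult_complex continuous_map_compose_UNIV[of complex_of_real])
          (auto intro!: continuous_intros)
      thus "continuous_map X euclidean (\<lambda>x. g x $$ (i, j))" using ij by (simp add: g_def)
    qed (simp add: g_def)
    show "\<forall>x\<in>S. g x = f x"
    proof
      fix x assume x: "x \<in> S"
      show "g x = f x"
      proof (rule eq_matI)
        fix i j assume "i < dim_row (f x)" "j < dim_col (f x)"
        hence ij: "i < m" "j < m" using c[OF x] by auto
        have "g1 i j x = Re (f x $$ (i, j))" "g2 i j x = Im (f x $$ (i, j))"
          using g1[OF ij] g2[OF ij] x unfolding P_def by auto
        thus "g x $$ (i, j) = f x $$ (i, j)" using ij by (simp add: g_def complex_eq_iff)
      qed (use c[OF x] in \<open>auto simp: g_def\<close>)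
    qed
    show "\<forall>x\<in>topspace X. entry_norm (g x) \<le> real (2 * m * m) * \<eta>"
    proof
      fix x assume x: "x \<in> topspace X"
      have "cmod (g x $$ (i, j)) \<le> 2 * \<eta>" if ij: "i < m" "j < m" for i j
      proof -
        have "\<bar>g1 i j x\<bar> \<le> \<eta>" "\<bar>g2 i j x\<bar> \<le> \<eta>"
          using g1[OF ij] g2[OF ij] x unfolding P_def by (auto simp: image_subset_iff abs_le_iff)
        moreover have "cmod (g x $$ (i, j)) \<le> \<bar>g1 i j x\<bar> + \<bar>g2 i j x\<bar>"
          using ij cmod_le[of "g x $$ (i, j)"] by (simp add: g_def)
        ultimately show ?thesis by linarith
      qed
      hence "entry_norm (g x) \<le> (\<Sum>i<m. \<Sum>j<m. 2 * \<eta>)"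
        unfolding entry_norm_def by (simp only: g_def dim_row_mat dim_col_mat) (intro sum_mono, auto simp: g_def)
      thus "entry_norm (g x) \<le> real (2 * m * m) * \<eta>" by (simp add: algebra_simps)
    qed
  qed
qed

text \<open>Density on \<open>W\<close> alone, with no constraint from the values elsewhere;
  \<open>perturb_on_closed\<close> makes it relative.\<close>

definition perturbable :: "'x topology \<Rightarrow> nat \<Rightarrow> ('x \<Rightarrow> complex mat \<Rightarrow> bool) \<Rightarrow> 'x set \<Rightarrow> bool" where
  "perturbable X m G W \<longleftrightarrow> (\<forall>s \<eta>. cont_mat_fun (subtopology X W) m s \<and> 0 < \<eta> \<longrightarrow>
     (\<exists>t. cont_mat_fun (subtopology X W) m t \<and> (\<forall>x\<in>W. entry_norm (t x - s x) < \<eta>) \<and> (\<forall>x\<in>W. G x (t x))))"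

text \<open>What is extended from \<open>W\<close> is the small correction \<open>t - s\<close>, not
  the function \<open>t\<close>. Multiplied by a Urysohn function that is 0 on \<open>Y\<close> and
  1 on \<open>W\<close>, it leaves \<open>Y\<close> untouched, gives \<open>t\<close> on
  \<open>W\<close>, and stays within the margin on \<open>K\<close>.\<close>

lemma perturb_on_closed:
  assumes X: "compact_space X" "Hausdorff_space X" and G: "open_condition X m G" and s: "cont_mat_fun X m s"
    and K: "closedin X K" and GK: "\<And>x. x \<in> K \<Longrightarrow> G x (s x)" and Y: "closedin X Y"
    and W: "closedin X W" "W \<inter> Y = {}" "perturbable X m G W" and \<epsilon>: "0 < \<epsilon>"
  obtains t where "cont_mat_fun X m t" "\<forall>x\<in>Y. t x = s x" "\<forall>x\<in>topspace X. entry_norm (t x - s x) < \<epsilon>"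
    "\<forall>x\<in>K \<union> W. G x (t x)"
proof -
  have norm: "normal_space X" using X compact_Hausdorff_or_regular_imp_normal_space by blast
  note cs = cont_mat_funD(1)[OF s]
  obtain \<eta>0 where \<eta>0: "0 < \<eta>0" "\<forall>x\<in>K. \<forall>N\<in>carrier_mat m m. entry_norm (N - s x) < \<eta>0 \<longrightarrow> G x N"
    by (rule open_condition_margin[OF G s closedin_compact_space[OF X(1) K] GK])
  define e where "e = min \<epsilon> \<eta>0"
  \<comment> \<open>The factor lost in the Tietze extension is divided out in advance. The added 1
    keeps the quotient defined for \<open>m = 0\<close> and the estimate strict.\<close>
  define \<eta> where "\<eta> = e / (real (2 * m * m) + 1)"
  have e0: "0 < e" using \<epsilon> \<eta>0 by (simp add: e_def)
  have \<eta>: "0 < \<eta>" using e0 by (simp add: \<eta>_def add_nonneg_pos)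
  have \<eta>e: "real (2 * m * m) * \<eta> < e"
  proof -
    have "(real (2 * m * m) + 1) * \<eta> = e"
      using add_nonneg_pos[of "real (2 * m * m)" 1] by (simp add: \<eta>_def del: of_nat_mult)
    hence "real (2 * m * m) * \<eta> + \<eta> = e" by (simp add: distrib_right)
    thus ?thesis using \<eta> by linarith
  qed
  have WX: "W \<subseteq> topspace X" using W(1) by (rule closedin_subset)
  hence topW: "topspace (subtopology X W) = W" by auto
  have sW: "cont_mat_fun (subtopology X W) m s" using s by (rule cont_mat_fun_subtopology)
  obtain t where t: "cont_mat_fun (subtopology X W) m t" "\<forall>x\<in>W. entry_norm (t x - s x) < \<eta>" "\<forall>x\<in>W. G x (t x)"
    using W(3)[unfolded perturbable_def, rule_format, of s \<eta>] sW \<eta> by auto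
  note ct = cont_mat_funD(1)[OF t(1), unfolded topW]
  have "cont_mat_fun (subtopology X W) m (\<lambda>x. t x - s x)" using t(1) sW by (rule cont_mat_fun_minus)
  from matrix_Tietze_extension[OF norm W(1) this, of \<eta>] t(2) \<eta> obtain g where
    g: "cont_mat_fun X m g" "\<forall>x\<in>W. g x = t x - s x" "\<forall>x\<in>topspace X. entry_norm (g x) \<le> real (2 * m * m) * \<eta>"
    by (auto simp: less_imp_le)
  note cg = cont_mat_funD(1)[OF g(1)]
  have dj: "disjnt Y W" using W(2) by (auto simp: disjnt_def)
  obtain \<mu> where \<mu>: "continuous_map X (top_of_set {0..1::real}) \<mu>" "\<mu> ` Y \<subseteq> {0}" "\<mu> ` W \<subseteq> {1}"
    by (rule Urysohn_lemma[OF norm Y W(1) dj zero_le_one])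
  have \<mu>c: "continuous_map X euclideanreal \<mu>" "\<And>x. x \<in> topspace X \<Longrightarrow> \<bar>\<mu> x\<bar> \<le> 1"
    using \<mu>(1) unfolding continuous_map_in_subtopology by force+
  have \<mu>cc: "continuous_map X euclidean (\<lambda>x. complex_of_real (\<mu> x))"
    by (rule continuous_map_compose_UNIV[OF _ \<mu>c(1)]) (auto intro!: continuous_intros)
  define t' where "t' x = s x + complex_of_real (\<mu> x) \<cdot>\<^sub>m g x" for x
  have t': "cont_mat_fun X m t'"
    unfolding t'_def by (intro cont_mat_fun_add cont_mat_fun_smult_fun s g \<mu>cc)
  have diff: "t' x - s x = complex_of_real (\<mu> x) \<cdot>\<^sub>m g x" if "x \<in> topspace X" for x
    using cs[OF that] cg[OF that] by (intro eq_matI) (auto simp: t'_def)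
  have near: "entry_norm (t' x - s x) < e" if x: "x \<in> topspace X" for x
  proof -
    have "entry_norm (t' x - s x) = \<bar>\<mu> x\<bar> * entry_norm (g x)"
      unfolding diff[OF x] by (simp add: entry_norm_smult)
    also have "\<dots> \<le> 1 * entry_norm (g x)" using \<mu>c(2)[OF x] by (intro mult_right_mono) auto
    also have "\<dots> \<le> real (2 * m * m) * \<eta>" using g(3) x by simp
    finally show ?thesis using \<eta>e by simp
  qed
  show thesis
  proof (rule that[OF t'])
    have YX: "Y \<subseteq> topspace X" using Y by (rule closedin_subset)
    show "\<forall>x\<in>Y. t' x = s x"
    proof
      fix x assume x: "x \<in> Y"
      hence "\<mu> x = 0" using \<mu>(2) by blast
      thus "t' x = s x" using cs[of x] cg[of x] x YX by (intro eq_matI) (auto simp: t'_def)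
    qed
    show "\<forall>x\<in>topspace X. entry_norm (t' x - s x) < \<epsilon>" using near by (simp add: e_def)
    have KX: "K \<subseteq> topspace X" using K by (rule closedin_subset)
    show "\<forall>x\<in>K \<union> W. G x (t' x)"
    proof
      fix x assume x: "x \<in> K \<union> W"
      show "G x (t' x)"
      proof (cases "x \<in> W")
        case True
        hence "\<mu> x = 1" using \<mu>(3) by blast
        hence "t' x = t x" using cs[of x] ct[OF True] True WX g(2) by (intro eq_matI) (auto simp: t'_def)
        thus ?thesis using t(3) True by simp
      next
        case False
        hence xK: "x \<in> K" "x \<in> topspace X" using x KX by auto
        have "entry_norm (t' x - s x) < \<eta>0" using near[OF xK(2)] by (simp add: e_def)
        thus ?thesis using \<eta>0(2) xK(1) cont_mat_funD(1)[OF t' xK(2)] by blast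
      qed
    qed
  qed
qed

text \<open>The sets are treated one by one. A finished set joins the protected set
  \<open>K\<close>, and the tolerance is halved each time.\<close>

lemma perturb_on_finite_union:
  assumes X: "compact_space X" "Hausdorff_space X" and G: "open_condition X m G"
    and K: "closedin X K" and Y: "closedin X Y" and F: "finite F"
    and W: "\<And>W. W \<in> F \<Longrightarrow> closedin X W \<and> W \<inter> Y = {} \<and> perturbable X m G W"
    and s: "cont_mat_fun X m s" and GK: "\<forall>x\<in>K. G x (s x)" and \<epsilon>: "0 < \<epsilon>"
  shows "\<exists>t. cont_mat_fun X m t \<and> (\<forall>x\<in>Y. t x = s x) \<and> (\<forall>x\<in>topspace X. entry_norm (t x - s x) < \<epsilon>) \<and>
    (\<forall>x\<in>K \<union> \<Union>F. G x (t x))"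
  using F W \<epsilon>
proof (induction F arbitrary: \<epsilon> rule: finite_induct)
  case empty
  have "entry_norm (s x - s x) = 0" if "x \<in> topspace X" for x
    using cont_mat_funD(1)[OF s that] entry_norm_eq_0_iff[of "s x - s x" m m] by auto
  thus ?case using s GK empty by (intro exI[of _ s]) auto
next
  case (insert W F)
  have "0 < \<epsilon>/2" using insert.prems by simp
  with insert.IH[of "\<epsilon>/2"] insert.prems obtain t where
    t: "cont_mat_fun X m t" "\<forall>x\<in>Y. t x = s x" "\<forall>x\<in>topspace X. entry_norm (t x - s x) < \<epsilon>/2" "\<forall>x\<in>K \<union> \<Union>F. G x (t x)"
    by auto
  have W: "closedin X W" "W \<inter> Y = {}" "perturbable X m G W" using insert.prems(1)[of W] by auto
  have "closedin X (\<Union>F)" using insert.hyps insert.prems(1) by (intro closedin_Union) auto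
  hence cl: "closedin X (K \<union> \<Union>F)" using K by (intro closedin_Un)
  obtain u where u: "cont_mat_fun X m u" "\<forall>x\<in>Y. u x = t x" "\<forall>x\<in>topspace X. entry_norm (u x - t x) < \<epsilon>/2"
    "\<forall>x\<in>(K \<union> \<Union>F) \<union> W. G x (u x)"
    by (rule perturb_on_closed[OF X G t(1) cl bspec[OF t(4)] Y W \<open>0 < \<epsilon>/2\<close>])
  have "entry_norm (u x - s x) < \<epsilon>" if x: "x \<in> topspace X" for x
  proof -
    have "entry_norm (u x - s x) \<le> entry_norm (u x - t x) + entry_norm (t x - s x)"
      by (rule entry_norm_triangle) (use cont_mat_funD(1)[OF u(1) x] cont_mat_funD(1)[OF t(1) x] cont_mat_funD(1)[OF s x] in auto)
    thus ?thesis using bspec[OF u(3) x] bspec[OF t(3) x] by linarith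
  qed
  moreover have "\<forall>x\<in>Y. u x = s x" using u(2) t(2) by simp
  moreover have "\<forall>x\<in>K \<union> \<Union>(insert W F). G x (u x)" using u(4) by blast
  ultimately show ?case using u(1) by blast
qed

text \<open>All closed subsets of \<open>U\<close> are asked for, so that \<open>U\<close> may
  afterwards be shrunk away from \<open>Y\<close>.\<close>

definition locally_perturbable :: "'x topology \<Rightarrow> nat \<Rightarrow> ('x \<Rightarrow> complex mat \<Rightarrow> bool) \<Rightarrow> 'x \<Rightarrow> bool" where
  "locally_perturbable X m G x \<longleftrightarrow>
     (\<exists>U. openin X U \<and> x \<in> U \<and> (\<forall>W. closedin X W \<and> W \<subseteq> U \<longrightarrow> perturbable X m G W))"

text \<open>As \<open>G\<close> is open, it already holds for \<open>s\<close> on a neighbourhood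
  \<open>N\<close> of \<open>Y\<close>. The complement of \<open>N\<close> is compact and is covered
  by finitely many closed sets that miss \<open>Y\<close>; only on these does \<open>G\<close>
  remain to be achieved.\<close>

theorem relative_perturbation:
  assumes X: "compact_space X" "Hausdorff_space X" and G: "open_condition X m G"
    and Y: "closedin X Y" and s: "cont_mat_fun X m s" and GY: "\<And>x. x \<in> Y \<Longrightarrow> G x (s x)"
    and loc: "\<And>x. x \<in> topspace X \<Longrightarrow> x \<notin> Y \<Longrightarrow> locally_perturbable X m G x" and \<epsilon>: "0 < \<epsilon>"
  obtains t where "cont_mat_fun X m t" "\<forall>x\<in>Y. t x = s x" "\<forall>x\<in>topspace X. entry_norm (t x - s x) < \<epsilon>"
    "\<forall>x\<in>topspace X. G x (t x)"
proof -
  have reg: "neighbourhood_base_of (closedin X) X"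
    using X compact_Hausdorff_imp_regular_space neighbourhood_base_of_closedin by blast
  have YX: "Y \<subseteq> topspace X" using Y by (rule closedin_subset)
  define N where "N = {x \<in> topspace X. G x (s x)}"
  have N: "openin X N" unfolding N_def by (rule open_condition_openin[OF G s])
  have YN: "Y \<subseteq> N" using YX GY by (auto simp: N_def)
  let ?C = "topspace X - N"
  have C: "compactin X ?C" using N by (intro closedin_compact_space[OF X(1)]) auto
  define P where "P x V W \<longleftrightarrow> openin X V \<and> x \<in> V \<and> V \<subseteq> W \<and> closedin X W \<and> W \<inter> Y = {} \<and> perturbable X m G W" for x V W
  have "\<exists>V W. P x V W" if x: "x \<in> ?C" for x
  proof -
    have "x \<in> topspace X" "x \<notin> Y" using x YN by auto
    from loc[OF this] obtain U where U: "openin X U" "x \<in> U" "\<And>W. closedin X W \<Longrightarrow> W \<subseteq> U \<Longrightarrow> perturbable X m G W"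
      unfolding locally_perturbable_def by blast
    have "openin X (U - Y)" "x \<in> U - Y" using U Y \<open>x \<notin> Y\<close> by auto
    then obtain V W where "openin X V" "closedin X W" "x \<in> V" "V \<subseteq> W" "W \<subseteq> U - Y"
      using reg unfolding neighbourhood_base_of by meson
    hence "P x V W" using U(3) unfolding P_def by blast
    thus ?thesis by blast
  qed
  then obtain V W where P: "\<And>x. x \<in> ?C \<Longrightarrow> P x (V x) (W x)" by metis
  have op: "openin X (V x)" "x \<in> V x" if "x \<in> ?C" for x using P[OF that] by (auto simp: P_def)
  obtain F where F: "F \<subseteq> ?C" "finite F" "?C \<subseteq> (\<Union>x\<in>F. V x)"
    by (rule compactin_finite_subcover[OF C op])
  \<comment> \<open>The chosen open sets cover the complement of \<open>N\<close>, so
    \<open>s\<close> is good on this closed remainder, which is the initial protected set.\<close>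
  let ?K = "topspace X - (\<Union>x\<in>F. V x)"
  have K: "closedin X ?K" using op F(1) by (intro closedin_diff) auto
  have GK: "\<forall>x\<in>?K. G x (s x)" using F(3) by (auto simp: N_def)
  have PF: "closedin X W' \<and> W' \<inter> Y = {} \<and> perturbable X m G W'" if "W' \<in> W ` F" for W'
    using that P F(1) unfolding P_def by blast
  from perturb_on_finite_union[OF X G K Y finite_imageI[OF F(2)] PF s GK \<epsilon>] obtain t where
    t: "cont_mat_fun X m t" "\<forall>x\<in>Y. t x = s x" "\<forall>x\<in>topspace X. entry_norm (t x - s x) < \<epsilon>"
    "\<forall>x\<in>?K \<union> \<Union>(W ` F). G x (t x)" by blast
  have "topspace X \<subseteq> ?K \<union> \<Union>(W ` F)"
  proof
    fix x assume x: "x \<in> topspace X"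
    show "x \<in> ?K \<union> \<Union>(W ` F)"
    proof (cases "x \<in> (\<Union>x\<in>F. V x)")
      case True
      then obtain y where "y \<in> F" "x \<in> V y" by blast
      thus ?thesis using P[of y] F(1) unfolding P_def by blast
    qed (use x in blast)
  qed
  hence "\<forall>x\<in>topspace X. G x (t x)" using t(4) by blast
  thus thesis by (rule that[OF t(1-3)])
qed

section \<open>Conditions depending on a point and a matrix\<close>

lemma cont_mat_fun_compose:
  assumes h: "continuous_map T T' h" and f: "cont_mat_fun T' m f"
  shows "cont_mat_fun T m (\<lambda>x. f (h x))"
proof (rule cont_mat_funI)
  fix x assume "x \<in> topspace T"
  hence "h x \<in> topspace T'" using h by (auto simp: continuous_map_def)
  thus "f (h x) \<in> carrier_mat m m" by (rule cont_mat_funD(1)[OF f])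
next
  fix i j assume ij: "i < m" "j < m"
  from continuous_map_compose[OF h cont_mat_funD(2)[OF f ij]]
  show "continuous_map T euclidean (\<lambda>x. f (h x) $$ (i, j))" by (simp add: o_def)
qed

text \<open>A topology on square matrices of one size lets the pair of a point and a matrix range
  over a product space, so that the results on \<open>cont_mat_fun\<close> apply jointly to
  both.\<close>

definition mat_open :: "nat \<Rightarrow> complex mat set \<Rightarrow> bool" where
  "mat_open m U \<longleftrightarrow> U \<subseteq> carrier_mat m m \<and> (\<forall>M\<in>U. \<exists>r>0. \<forall>N\<in>carrier_mat m m. entry_norm (N - M) < r \<longrightarrow> N \<in> U)"

definition mat_topology :: "nat \<Rightarrow> complex mat topology" where
  "mat_topology m = topology (mat_open m)"

lemma openin_mat_topology: "openin (mat_topology m) = mat_open m"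
  unfolding mat_topology_def
proof (rule topology_inverse')
  show "istopology (mat_open m)"
    unfolding istopology_def
  proof (intro conjI allI impI)
    fix S T assume S: "mat_open m S" and T: "mat_open m T"
    show "mat_open m (S \<inter> T)"
      unfolding mat_open_def
    proof (intro conjI ballI)
      fix M assume M: "M \<in> S \<inter> T"
      obtain r where r: "r > 0" "\<forall>N\<in>carrier_mat m m. entry_norm (N - M) < r \<longrightarrow> N \<in> S"
        using S M unfolding mat_open_def by (meson IntD1)
      obtain q where q: "q > 0" "\<forall>N\<in>carrier_mat m m. entry_norm (N - M) < q \<longrightarrow> N \<in> T"
        using T M unfolding mat_open_def by (meson IntD2)
      show "\<exists>r>0. \<forall>N\<in>carrier_mat m m. entry_norm (N - M) < r \<longrightarrow> N \<in> S \<inter> T"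
        using r q by (intro exI[of _ "min r q"]) simp
    qed (use S in \<open>auto simp: mat_open_def\<close>)
  next
    fix \<K> assume K: "\<forall>S\<in>\<K>. mat_open m S"
    show "mat_open m (\<Union>\<K>)"
      unfolding mat_open_def
    proof (intro conjI ballI)
      show "\<Union>\<K> \<subseteq> carrier_mat m m" using K unfolding mat_open_def by blast
      fix M assume "M \<in> \<Union>\<K>"
      then obtain S where S: "S \<in> \<K>" "M \<in> S" by blast
      then obtain r where "r > 0" "\<forall>N\<in>carrier_mat m m. entry_norm (N - M) < r \<longrightarrow> N \<in> S"
        using bspec[OF K S(1)] unfolding mat_open_def by meson
      thus "\<exists>r>0. \<forall>N\<in>carrier_mat m m. entry_norm (N - M) < r \<longrightarrow> N \<in> \<Union>\<K>"
        using S(1) by (intro exI[of _ r]) auto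
    qed
  qed
qed

lemma topspace_mat_topology [simp]: "topspace (mat_topology m) = carrier_mat m m"
proof
  show "topspace (mat_topology m) \<subseteq> carrier_mat m m"
    using openin_topspace[of "mat_topology m"] unfolding openin_mat_topology mat_open_def by (rule conjunct1)
  have "mat_open m (carrier_mat m m)" unfolding mat_open_def by (intro conjI ballI exI[of _ 1]) simp_all
  thus "carrier_mat m m \<subseteq> topspace (mat_topology m)"
    by (intro openin_subset) (simp add: openin_mat_topology)
qed

lemma cont_mat_fun_id: "cont_mat_fun (mat_topology m) m (\<lambda>M. M)"
proof (rule cont_mat_funI)
  fix i j assume ij: "i < m" "j < m"
  show "continuous_map (mat_topology m) euclidean (\<lambda>M. M $$ (i, j))"
    unfolding continuous_map_def
  proof (intro conjI allI impI)
    fix U :: "complex set" assume "openin euclidean U"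
    hence U: "open U" by simp
    show "openin (mat_topology m) {M \<in> topspace (mat_topology m). M $$ (i, j) \<in> U}"
      unfolding openin_mat_topology mat_open_def
    proof (intro conjI ballI)
      fix M assume M: "M \<in> {M \<in> topspace (mat_topology m). M $$ (i, j) \<in> U}"
      hence "M $$ (i, j) \<in> U" by simp
      with U obtain r where r: "r > 0" "ball (M $$ (i, j)) r \<subseteq> U" by (rule openE)
      have "N $$ (i, j) \<in> U" if N: "N \<in> carrier_mat m m" "entry_norm (N - M) < r" for N
      proof -
        have "cmod ((N - M) $$ (i, j)) \<le> entry_norm (N - M)"
          using M N(1) ij by (intro entry_norm_entry_le) auto
        moreover have "(N - M) $$ (i, j) = N $$ (i, j) - M $$ (i, j)" using M ij by auto
        ultimately have "N $$ (i, j) \<in> ball (M $$ (i, j)) r"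
          using N(2) by (simp add: dist_norm norm_minus_commute)
        thus ?thesis using r(2) by blast
      qed
      thus "\<exists>r>0. \<forall>N\<in>carrier_mat m m. entry_norm (N - M) < r \<longrightarrow> N \<in> {M \<in> topspace (mat_topology m). M $$ (i, j) \<in> U}"
        using r(1) by (intro exI[of _ r]) simp
    qed simp
  qed simp
qed simp

lemma cont_mat_fun_fst: "cont_mat_fun X m s \<Longrightarrow> cont_mat_fun (prod_topology X T) m (\<lambda>p. s (fst p))"
  by (rule cont_mat_fun_compose[OF continuous_map_fst])

lemma cont_mat_fun_snd: "cont_mat_fun (prod_topology X (mat_topology m)) m (\<lambda>p. snd p)"
  by (rule cont_mat_fun_compose[OF continuous_map_snd cont_mat_fun_id])

text \<open>Positive definiteness is open on the product of \<open>X\<close> with the matrices; a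
  box around a good pair supplies both \<open>U\<close> and the tolerance.\<close>

lemma open_condition_posdef:
  assumes c: "cont_mat_fun (prod_topology X (mat_topology m)) k (\<lambda>p. \<Phi> (fst p) (snd p))"
    and h: "\<And>x M. x \<in> topspace X \<Longrightarrow> M \<in> carrier_mat m m \<Longrightarrow> mat_adjoint (\<Phi> x M) = \<Phi> x M"
  shows "open_condition X m (\<lambda>x M. posdef (\<Phi> x M))"
  unfolding open_condition_def
proof (intro ballI impI)
  fix x M assume x: "x \<in> topspace X" and M: "M \<in> carrier_mat m m" and p: "posdef (\<Phi> x M)"
  let ?T = "prod_topology X (mat_topology m)"
  have "openin ?T {p \<in> topspace ?T. posdef (\<Phi> (fst p) (snd p))}"
    by (rule openin_posdef[OF c]) (use h in auto)
  moreover have "(x, M) \<in> {p \<in> topspace ?T. posdef (\<Phi> (fst p) (snd p))}" using x M p by simp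
  ultimately obtain U V where UV: "openin X U" "openin (mat_topology m) V" "x \<in> U" "M \<in> V"
    "U \<times> V \<subseteq> {p \<in> topspace ?T. posdef (\<Phi> (fst p) (snd p))}"
    unfolding openin_prod_topology_alt by meson
  obtain r where r: "r > 0" "\<forall>N\<in>carrier_mat m m. entry_norm (N - M) < r \<longrightarrow> N \<in> V"
    using UV(2,4) unfolding openin_mat_topology mat_open_def by meson
  show "\<exists>U \<eta>. openin X U \<and> x \<in> U \<and> 0 < \<eta> \<and> (\<forall>y\<in>U. \<forall>N\<in>carrier_mat m m. entry_norm (N - M) < \<eta> \<longrightarrow> posdef (\<Phi> y N))"
  proof (intro exI[of _ U] exI[of _ r] conjI ballI impI UV(1,3) r(1))
    fix y N assume "y \<in> U" "N \<in> carrier_mat m m" "entry_norm (N - M) < r"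
    hence "(y, N) \<in> U \<times> V" using r(2) by simp
    hence "(y, N) \<in> {p \<in> topspace ?T. posdef (\<Phi> (fst p) (snd p))}" by (rule subsetD[OF UV(5)])
    thus "posdef (\<Phi> y N)" by simp
  qed
qed

lemma cont_mat_fun_bounded:
  assumes X: "compact_space X" and f: "cont_mat_fun X m f"
  obtains B where "0 < B" "\<forall>x\<in>topspace X. entry_norm (f x) \<le> B"
proof -
  have "compactin euclideanreal ((\<lambda>x. entry_norm (f x)) ` topspace X)"
    using X unfolding compact_space_def by (rule image_compactin) (rule continuous_map_entry_norm[OF f])
  hence "bounded ((\<lambda>x. entry_norm (f x)) ` topspace X)" by (simp add: compact_imp_bounded)
  then obtain B where "\<forall>y\<in>(\<lambda>x. entry_norm (f x)) ` topspace X. norm y \<le> B" by (auto simp: bounded_iff)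
  hence "\<forall>x\<in>topspace X. entry_norm (f x) \<le> max B 1" by force
  thus thesis using that[of "max B 1"] by simp
qed

section \<open>Independent columns\<close>

text \<open>Only the upper left \<open>j\<close> by \<open>k\<close> block of \<open>R\<close>
  matters. It is kept inside an \<open>n\<close> by \<open>n\<close> matrix so that
  \<open>cont_mat_fun\<close> applies.\<close>

definition indep_cols :: "nat \<Rightarrow> nat \<Rightarrow> complex mat \<Rightarrow> bool" where
  "indep_cols j k R \<longleftrightarrow> (\<forall>u. (\<forall>i<j. (\<Sum>l<k. R $$ (i, l) * u l) = 0) \<longrightarrow> (\<forall>l<k. u l = 0))"

lemma qform_diagm:
  assumes "w \<in> carrier_vec n"
  shows "qform (diagm n (\<lambda>i. complex_of_real (f i))) w = (\<Sum>i<n. f i * (cmod (vec_index w i))\<^sup>2)"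
proof -
  have "diagm n (\<lambda>i. complex_of_real (f i)) = 1\<^sub>m n * diagm n (\<lambda>i. complex_of_real (f i)) * mat_adjoint (1\<^sub>m n)" by simp
  moreover have "unitary_mat n (1\<^sub>m n)" by (rule unitary_matI) auto
  ultimately show ?thesis using qform_unitary_diag[of n "1\<^sub>m n" w f] assms by simp
qed

abbreviation indicator_diagm :: "nat \<Rightarrow> (nat \<Rightarrow> bool) \<Rightarrow> complex mat" where
  "indicator_diagm n P \<equiv> diagm n (\<lambda>i. complex_of_real (if P i then 1 else 0))"

text \<open>The form of this matrix at \<open>u\<close> is the squared length of the first
  \<open>j\<close> coordinates of \<open>R\<close> applied to \<open>u\<close>, plus that of the
  coordinates of \<open>u\<close> from \<open>k\<close> on. It vanishes exactly at the linear
  relations between the truncated columns, which turns independence into positive definiteness and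
  so into an open condition.\<close>

definition block_gram :: "nat \<Rightarrow> nat \<Rightarrow> nat \<Rightarrow> complex mat \<Rightarrow> complex mat" where
  "block_gram n j k R = mat_adjoint R * indicator_diagm n (\<lambda>i. i < j) * R + indicator_diagm n (\<lambda>i. \<not> i < k)"

lemma block_gram_carrier: "R \<in> carrier_mat n n \<Longrightarrow> block_gram n j k R \<in> carrier_mat n n"
  by (auto simp: block_gram_def)

lemma block_gram_hermitian:
  assumes R: "R \<in> carrier_mat n n" shows "mat_adjoint (block_gram n j k R) = block_gram n j k R"
proof -
  define D where "D = indicator_diagm n (\<lambda>i. i < j)"
  define E where "E = indicator_diagm n (\<lambda>i. \<not> i < k)"
  have D: "D \<in> carrier_mat n n" "mat_adjoint D = D" and E: "E \<in> carrier_mat n n" "mat_adjoint E = E"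
    by (simp_all add: D_def E_def)
  have "mat_adjoint (mat_adjoint R * D * R) = mat_adjoint R * D * R"
    using R D by (simp add: mat_adjoint_mult[of _ n n _ n] assoc_mult_mat[of _ n n _ n _ n])
  thus ?thesis using R D E unfolding block_gram_def D_def[symmetric] E_def[symmetric]
    by (simp add: mat_adjoint_add[of _ n n] mult_carrier_mat[of _ n n _ n])
qed

lemma qform_block_gram:
  assumes R: "R \<in> carrier_mat n n" and u: "u \<in> carrier_vec n" and j: "j \<le> n"
  shows "qform (block_gram n j k R) u
    = (\<Sum>i<j. (cmod (vec_index (R *\<^sub>v u) i))\<^sup>2) + (\<Sum>i\<in>{k..<n}. (cmod (vec_index u i))\<^sup>2)"
proof -
  have "qform (block_gram n j k R) u
      = qform (indicator_diagm n (\<lambda>i. i < j)) (R *\<^sub>v u) + qform (indicator_diagm n (\<lambda>i. \<not> i < k)) u"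
    unfolding block_gram_def using R u by (simp add: qform_add[of _ n] qform_congruence[of _ n] mult_carrier_mat[of _ n n _ n])
  also have "qform (indicator_diagm n (\<lambda>i. i < j)) (R *\<^sub>v u) = (\<Sum>i<j. (cmod (vec_index (R *\<^sub>v u) i))\<^sup>2)"
    unfolding qform_diagm[OF mult_mat_vec_carrier[OF R u]] using j by (intro sum.mono_neutral_cong_right) auto
  also have "qform (indicator_diagm n (\<lambda>i. \<not> i < k)) u = (\<Sum>i\<in>{k..<n}. (cmod (vec_index u i))\<^sup>2)"
    unfolding qform_diagm[OF u] by (intro sum.mono_neutral_cong_right) auto
  finally show ?thesis .
qed

lemma posdef_block_gram_iff:
  assumes R: "R \<in> carrier_mat n n" and j: "j \<le> n" and k: "k \<le> n"
  shows "posdef (block_gram n j k R) \<longleftrightarrow> indep_cols j k R"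
proof
  assume p: "posdef (block_gram n j k R)"
  show "indep_cols j k R"
    unfolding indep_cols_def
  proof (intro allI impI)
    fix u l assume u0: "\<forall>i<j. (\<Sum>l<k. R $$ (i, l) * u l) = 0" and l: "l < k"
    define w where "w = vec n (\<lambda>l. if l < k then u l else 0)"
    have w: "w \<in> carrier_vec n" by (simp add: w_def)
    have "vec_index (R *\<^sub>v w) i = 0" if i: "i < j" for i
    proof -
      have "vec_index (R *\<^sub>v w) i = (\<Sum>l<n. R $$ (i, l) * vec_index w l)"
        using i j by (intro mult_mat_vec_index_sum[OF R w]) simp
      also have "\<dots> = (\<Sum>l<k. R $$ (i, l) * u l)"
        using k by (intro sum.mono_neutral_cong_right) (auto simp: w_def)
      finally show ?thesis using u0 i by simp
    qed
    moreover have "vec_index w i = 0" if "i \<in> {k..<n}" for i using that by (simp add: w_def)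
    ultimately have "qform (block_gram n j k R) w = 0" unfolding qform_block_gram[OF R w j] by simp
    moreover have "0 < qform (block_gram n j k R) w" if "w \<noteq> 0\<^sub>v n"
      using p w that block_gram_carrier[OF R, of j k] by (simp add: posdef_def)
    ultimately have "w = 0\<^sub>v n" by fastforce
    hence "vec_index w l = 0" using l k by simp
    thus "u l = 0" using l k by (simp add: w_def)
  qed
next
  assume i: "indep_cols j k R"
  show "posdef (block_gram n j k R)"
    unfolding posdef_def
  proof (intro conjI ballI impI block_gram_hermitian[OF R])
    fix u :: "complex Matrix.vec"
    assume "u \<in> carrier_vec (dim_row (block_gram n j k R))" "u \<noteq> 0\<^sub>v (dim_row (block_gram n j k R))"
    hence u: "u \<in> carrier_vec n" "u \<noteq> 0\<^sub>v n" using block_gram_carrier[OF R, of j k] by auto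
    show "0 < qform (block_gram n j k R) u"
    proof (rule ccontr)
      assume neg: "\<not> 0 < qform (block_gram n j k R) u"
      let ?a = "\<Sum>i<j. (cmod (vec_index (R *\<^sub>v u) i))\<^sup>2" and ?b = "\<Sum>i\<in>{k..<n}. (cmod (vec_index u i))\<^sup>2"
      have "?a + ?b \<le> 0" "0 \<le> ?a" "0 \<le> ?b"
        using neg unfolding qform_block_gram[OF R u(1) j] by (auto intro: sum_nonneg)
      hence ab: "?a = 0" "?b = 0" by linarith+
      have b: "vec_index u i = 0" if "k \<le> i" "i < n" for i
        using ab(2) that by (simp add: sum_nonneg_eq_0_iff)
      have a: "vec_index (R *\<^sub>v u) i = 0" if "i < j" for i
        using ab(1) that by (simp add: sum_nonneg_eq_0_iff)
      have "(\<Sum>l<k. R $$ (i, l) * vec_index u l) = 0" if ij: "i < j" for i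
      proof -
        have "vec_index (R *\<^sub>v u) i = (\<Sum>l<n. R $$ (i, l) * vec_index u l)"
          using ij j by (intro mult_mat_vec_index_sum[OF R u(1)]) simp
        also have "\<dots> = (\<Sum>l<k. R $$ (i, l) * vec_index u l)"
          using k b by (intro sum.mono_neutral_cong_right) auto
        finally show ?thesis using a[OF ij] by simp
      qed
      hence "\<forall>l<k. vec_index u l = 0" using i unfolding indep_cols_def by blast
      hence "u = 0\<^sub>v n" using b u(1) by (intro eq_vecI) (auto, metis not_le)
      thus False using u(2) by simp
    qed
  qed
qed

text \<open>Fewer than \<open>j\<close> columns leave a nonzero vector orthogonal to all of them in
  the first \<open>j\<close> coordinates; it becomes the new column. The linear system carries no
  conjugation, so its solution has to be conjugated.\<close>

lemma indep_cols_extend: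
  assumes A: "A \<in> carrier_mat n n" and jk: "k < j" "j \<le> n" and i: "indep_cols j k A"
  obtains w where "indep_cols j (Suc k) (mat n n (\<lambda>(i, l). if l = k then w i else A $$ (i, l)))"
proof -
  have "finite {..<k}" "finite {..<j}" "card {..<k} < card {..<j}" using jk by auto
  from underdetermined_system[OF this, of "\<lambda>l i. A $$ (i, l)"] obtain c where
    c: "\<exists>i\<in>{..<j}. c i \<noteq> 0" "\<forall>l\<in>{..<k}. (\<Sum>i<j. c i * A $$ (i, l)) = 0" by blast
  let ?B = "mat n n (\<lambda>(i, l). if l = k then cnj (c i) else A $$ (i, l))"
  have "indep_cols j (Suc k) ?B"
    unfolding indep_cols_def
  proof (intro allI impI)
    fix u l assume u: "\<forall>i<j. (\<Sum>l<Suc k. ?B $$ (i, l) * u l) = 0" and l: "l < Suc k"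
    have eq: "(\<Sum>l<k. A $$ (i, l) * u l) + cnj (c i) * u k = 0" if "i < j" for i
      using u[rule_format, OF that] jk that by simp
    \<comment> \<open>Pairing the relation with \<open>c\<close> kills the old columns and leaves
      \<open>u k\<close> times the squared length of \<open>c\<close>.\<close>
    have "0 = (\<Sum>i<j. c i * ((\<Sum>l<k. A $$ (i, l) * u l) + cnj (c i) * u k))" using eq by simp
    also have "\<dots> = (\<Sum>i<j. \<Sum>l<k. c i * A $$ (i, l) * u l) + u k * (\<Sum>i<j. c i * cnj (c i))"
      by (simp add: distrib_left sum.distrib sum_distrib_left mult_ac)
    also have "(\<Sum>i<j. \<Sum>l<k. c i * A $$ (i, l) * u l) = (\<Sum>l<k. (\<Sum>i<j. c i * A $$ (i, l)) * u l)"
      by (subst sum.swap) (simp add: sum_distrib_right)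
    also have "\<dots> = 0" using c(2) by simp
    also have "(\<Sum>i<j. c i * cnj (c i)) = complex_of_real (\<Sum>i<j. (cmod (c i))\<^sup>2)"
      by (simp flip: complex_norm_square)
    finally have "u k * complex_of_real (\<Sum>i<j. (cmod (c i))\<^sup>2) = 0" by simp
    moreover have "(\<Sum>i<j. (cmod (c i))\<^sup>2) \<noteq> 0"
      using c(1) by (subst sum_nonneg_eq_0_iff) auto
    ultimately have uk: "u k = 0" by (metis mult_eq_0_iff of_real_eq_0_iff)
    hence "\<forall>i<j. (\<Sum>l<k. A $$ (i, l) * u l) = 0" using eq by simp
    hence "\<forall>l<k. u l = 0" using i unfolding indep_cols_def by blast
    thus "u l = 0" using uk l by (cases "l = k") auto
  qed
  thus thesis by (rule that)
qed

text \<open>Columns are added one at a time, so the induction runs from \<open>j\<close> down to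
  \<open>k\<close>. The result completes the columns at one point to a basis.\<close>

lemma indep_cols_completion:
  assumes A: "A \<in> carrier_mat n n" and jk: "k \<le> j" "j \<le> n" and i: "indep_cols j k A"
  shows "\<exists>B\<in>carrier_mat n n. indep_cols j j B \<and> (\<forall>i<n. \<forall>l<k. B $$ (i, l) = A $$ (i, l))"
  using jk(1) A i
proof (induction k arbitrary: A rule: inc_induct)
  case base
  thus ?case by blast
next
  case (step k)
  obtain w where w: "indep_cols j (Suc k) (mat n n (\<lambda>(i, l). if l = k then w i else A $$ (i, l)))"
    by (rule indep_cols_extend[OF step.prems(1) step.hyps(2) jk(2) step.prems(2)])
  from step.IH[OF mat_carrier w] obtain B where B: "B \<in> carrier_mat n n" "indep_cols j j B"
    "\<forall>i<n. \<forall>l<Suc k. B $$ (i, l) = mat n n (\<lambda>(i, l). if l = k then w i else A $$ (i, l)) $$ (i, l)" by blast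
  have "B $$ (i, l) = A $$ (i, l)" if "i < n" "l < k" for i l
    using B(3)[rule_format, of i l] that step.hyps(2) jk(2) by simp
  thus ?case using B by blast
qed

lemma cont_mat_fun_mat:
  assumes "\<And>i j. i < m \<Longrightarrow> j < m \<Longrightarrow> continuous_map T euclidean (\<lambda>x. f x i j)"
  shows "cont_mat_fun T m (\<lambda>x. mat m m (\<lambda>(i, j). f x i j))"
  using assms by (intro cont_mat_funI) simp_all

lemma sum_lessThan_split:
  fixes h :: "nat \<Rightarrow> complex"
  assumes "k \<le> j" shows "(\<Sum>l<j. h l) = (\<Sum>l<k. h l) + (\<Sum>l\<in>{k..<j}. h l)"
  using sum.atLeastLessThan_concat[of 0 k j h] assms by (simp add: lessThan_atLeast0)

text \<open>Near \<open>x1\<close> the first \<open>k\<close> columns of \<open>R x\<close> and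
  fixed further columns from a completion at \<open>x1\<close> form a moving basis
  \<open>\<Theta> x\<close>. In this basis a new column is independent of the old ones iff one of
  its coordinates \<open>k\<close> to \<open>j - 1\<close> is nonzero. These coordinates are
  \<open>2 * (j - k)\<close> real functions, more than the dimension, and can be freed from common
  zeros.\<close>

lemma indep_cols_locally_perturbable:
  assumes X: "compact_space X" "Hausdorff_space X" and dim: "covdim_le X d"
    and jk: "k < j" "j \<le> n" and d: "d < 2 * (j - k)"
    and R: "cont_mat_fun X n R" and x1: "x1 \<in> topspace X" and ind: "indep_cols j k (R x1)"
  shows "locally_perturbable X n
    (\<lambda>x M. indep_cols j (Suc k) (mat n n (\<lambda>(i, l). if l = k then M $$ (i, l) else R x $$ (i, l)))) x1"
proof -
  note cR = cont_mat_funD(1)[OF R]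
  have kn: "k < n" using jk by simp
  obtain B where B: "B \<in> carrier_mat n n" "indep_cols j j B" "\<forall>i<n. \<forall>l<k. B $$ (i, l) = R x1 $$ (i, l)"
    using indep_cols_completion[OF cR[OF x1] less_imp_le[OF jk(1)] jk(2) ind] by blast
  \<comment> \<open>From row and column \<open>j\<close> on this is the identity, so that
    invertibility of the moving basis is the nonvanishing of one determinant of size
    \<open>n\<close>.\<close>
  define \<Theta> where "\<Theta> x = mat n n (\<lambda>(i, l). if l < k then (if i < j then R x $$ (i, l) else 0)
     else if l < j then (if i < j then B $$ (i, l) else 0) else if i = l then 1 else 0)" for x
  have Tc: "\<Theta> x \<in> carrier_mat n n" for x by (simp add: \<Theta>_def)
  have T: "cont_mat_fun X n \<Theta>"
    unfolding \<Theta>_def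
  proof (rule cont_mat_fun_mat)
    fix i l assume "i < n" "l < n"
    thus "continuous_map X euclidean (\<lambda>x. if l < k then (if i < j then R x $$ (i, l) else 0)
     else if l < j then (if i < j then B $$ (i, l) else 0) else if i = l then 1 else 0)"
      using cont_mat_funD(2)[OF R, of i l] by auto
  qed
  have Tidx: "vec_index (\<Theta> x *\<^sub>v z) i = (if i < j then (\<Sum>l<k. R x $$ (i, l) * vec_index z l) + (\<Sum>l\<in>{k..<j}. B $$ (i, l) * vec_index z l)
      else vec_index z i)" if z: "z \<in> carrier_vec n" and i: "i < n" for x z i
  proof -
    have "vec_index (\<Theta> x *\<^sub>v z) i = (\<Sum>l<n. \<Theta> x $$ (i, l) * vec_index z l)"
      by (rule mult_mat_vec_index_sum[OF Tc z i])
    also have "\<dots> = (if i < j then (\<Sum>l<k. R x $$ (i, l) * vec_index z l) + (\<Sum>l\<in>{k..<j}. B $$ (i, l) * vec_index z l)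
      else vec_index z i)"
    proof (cases "i < j")
      case True
      have "(\<Sum>l<n. \<Theta> x $$ (i, l) * vec_index z l) = (\<Sum>l<j. \<Theta> x $$ (i, l) * vec_index z l)"
        using jk True by (intro sum.mono_neutral_right) (auto simp: \<Theta>_def)
      also have "\<dots> = (\<Sum>l<k. \<Theta> x $$ (i, l) * vec_index z l) + (\<Sum>l\<in>{k..<j}. \<Theta> x $$ (i, l) * vec_index z l)"
        by (rule sum_lessThan_split[OF less_imp_le[OF jk(1)]])
      also have "(\<Sum>l<k. \<Theta> x $$ (i, l) * vec_index z l) = (\<Sum>l<k. R x $$ (i, l) * vec_index z l)"
        using True i jk by (intro sum.cong) (auto simp: \<Theta>_def)
      also have "(\<Sum>l\<in>{k..<j}. \<Theta> x $$ (i, l) * vec_index z l) = (\<Sum>l\<in>{k..<j}. B $$ (i, l) * vec_index z l)"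
        using True i jk by (intro sum.cong) (auto simp: \<Theta>_def)
      finally show ?thesis using True by simp
    next
      case False
      have "(\<Sum>l<n. \<Theta> x $$ (i, l) * vec_index z l) = (\<Sum>l<n. if l = i then vec_index z i else 0)"
        using False i jk by (intro sum.cong) (auto simp: \<Theta>_def)
      thus ?thesis using False i by simp
    qed
    finally show ?thesis .
  qed
  have det1: "Determinant.det (\<Theta> x1) \<noteq> 0"
  proof
    assume "Determinant.det (\<Theta> x1) = 0"
    then obtain z where z: "z \<in> carrier_vec n" "z \<noteq> 0\<^sub>v n" "\<Theta> x1 *\<^sub>v z = 0\<^sub>v n"
      using det_0_iff_vec_prod_zero_field[OF Tc] by blast
    have hi: "vec_index z i = 0" if "j \<le> i" "i < n" for i
      using Tidx[OF z(1) that(2), of x1] z(3) that by simp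
    have "(\<Sum>l<j. B $$ (i, l) * vec_index z l) = 0" if i: "i < j" for i
    proof -
      have "(\<Sum>l<j. B $$ (i, l) * vec_index z l) = (\<Sum>l<k. B $$ (i, l) * vec_index z l) + (\<Sum>l\<in>{k..<j}. B $$ (i, l) * vec_index z l)"
        by (rule sum_lessThan_split[OF less_imp_le[OF jk(1)]])
      also have "(\<Sum>l<k. B $$ (i, l) * vec_index z l) = (\<Sum>l<k. R x1 $$ (i, l) * vec_index z l)"
        using B(3) i jk by (intro sum.cong) auto
      finally show ?thesis using Tidx[OF z(1), of i x1] z(3) i jk by simp
    qed
    hence "\<forall>l<j. vec_index z l = 0" using B(2) unfolding indep_cols_def by (metis (no_types))
    hence "z = 0\<^sub>v n" using hi z(1) by (intro eq_vecI) (auto, metis not_le)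
    thus False using z(2) by simp
  qed
  define U where "U = {x \<in> topspace X. Determinant.det (\<Theta> x) \<noteq> 0}"
  have U: "openin X U" "x1 \<in> U" using openin_det_nonzero[OF T] x1 det1 by (auto simp: U_def)
  show ?thesis
    unfolding locally_perturbable_def
  proof (intro exI[of _ U] conjI U allI impI, elim conjE)
    fix W assume W: "closedin X W" "W \<subseteq> U"
    define S where "S = subtopology X W"
    have WX: "W \<subseteq> topspace X" using W(1) by (rule closedin_subset)
    have topS: "topspace S = W" using WX by (auto simp: S_def)
    have S: "compact_space S" "Hausdorff_space S" "covdim_le S d"
      using closedin_compact_space[OF X(1) W(1)] X(2) covdim_le_closed_subspace[OF dim W(1)]
      by (auto simp: S_def compact_space_subtopology Hausdorff_space_subtopology)
    have TS: "cont_mat_fun S n \<Theta>" unfolding S_def using T by (rule cont_mat_fun_subtopology)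
    have dS: "Determinant.det (\<Theta> x) \<noteq> 0" if "x \<in> topspace S" for x
      using that W(2) unfolding topS U_def by blast
    note inv = matinv[OF Tc dS]
    have TI: "cont_mat_fun S n (\<lambda>x. matinv (\<Theta> x))" by (rule cont_mat_fun_inverse[OF TS dS])
    obtain b where b: "0 < b" "\<forall>x\<in>topspace S. entry_norm (\<Theta> x) \<le> b" by (rule cont_mat_fun_bounded[OF S(1) TS])
    show "perturbable X n (\<lambda>x M. indep_cols j (Suc k) (mat n n (\<lambda>(i, l). if l = k then M $$ (i, l) else R x $$ (i, l)))) W"
      unfolding perturbable_def S_def[symmetric]
    proof (intro allI impI, elim conjE)
      fix s and \<eta> :: real assume s: "cont_mat_fun S n s" and \<eta>: "0 < \<eta>"
      note cs = cont_mat_funD(1)[OF s]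
      \<comment> \<open>Rows from \<open>j\<close> on play no part in the condition; cutting them
        off makes the coordinates of the column from \<open>j\<close> on vanish as well.\<close>
      define D where "D = indicator_diagm n (\<lambda>i. i < j)"
      have Dc: "D \<in> carrier_mat n n" by (simp add: D_def)
      define y where "y x = matinv (\<Theta> x) * (D * s x)" for x
      have y: "cont_mat_fun S n y" unfolding y_def
        by (intro cont_mat_fun_mult TI s cont_mat_fun_const[OF Dc])
      \<comment> \<open>The Boolean selects the real or the imaginary part, so the index set has
        \<open>2 * (j - k)\<close> elements.\<close>
      define f where "f p x = (if snd p then Re (y x $$ (fst p, k)) else Im (y x $$ (fst p, k)))" for p :: "nat \<times> bool" and x
      \<comment> \<open>The correction \<open>\<Theta> x * \<Delta> x\<close> has norm at most
        \<open>b\<close> times \<open>n * n\<close> entries of size \<open>2 * e\<close>. The added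
        1 makes this strictly less than \<open>\<eta>/2\<close> and covers
        \<open>n = 0\<close>.\<close>
      define e where "e = \<eta> / (2 * b * (2 * real n * real n + 1))"
      have e: "0 < e" using \<eta> b(1) by (simp add: e_def add_nonneg_pos)
      have fc: "continuous_map S euclideanreal (f p)" if "p \<in> {k..<j} \<times> UNIV" for p
      proof -
        have "fst p < n" using that jk by auto
        from cont_mat_funD(2)[OF y this kn]
        have "continuous_map S euclideanreal (\<lambda>x. Re (y x $$ (fst p, k)))" "continuous_map S euclideanreal (\<lambda>x. Im (y x $$ (fst p, k)))"
          by (auto intro!: continuous_map_compose_UNIV[of Re] continuous_map_compose_UNIV[of Im] continuous_intros)
        thus ?thesis unfolding f_def by (cases "snd p") simp_all
      qed
      have fin: "finite ({k..<j} \<times> (UNIV :: bool set))" by simp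
      have card: "d < card ({k..<j} \<times> (UNIV :: bool set))" using d by (simp add: card_cartesian_product)
      obtain g where g: "\<And>p. p \<in> {k..<j} \<times> UNIV \<Longrightarrow> continuous_map S euclideanreal (g p)"
        "\<And>p x. p \<in> {k..<j} \<times> UNIV \<Longrightarrow> x \<in> topspace S \<Longrightarrow> \<bar>g p x - f p x\<bar> < e"
        "\<And>x. x \<in> topspace S \<Longrightarrow> \<exists>p\<in>{k..<j} \<times> (UNIV::bool set). g p x \<noteq> 0"
        by (rule nonvanishing_approximation[OF S fin card fc e]) blast+
      define v where "v x i = complex_of_real (g (i, True) x) + \<i> * complex_of_real (g (i, False) x)" for x i
      have vc: "continuous_map S euclidean (\<lambda>x. v x i)" if "i \<in> {k..<j}" for i
        unfolding v_def using that
        by (intro continuous_map_add continuous_map_mult_complex continuous_map_compose_UNIV[of complex_of_real] g(1))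
          (auto intro!: continuous_intros)
      have vy: "cmod (v x i - y x $$ (i, k)) \<le> 2 * e" if "i \<in> {k..<j}" "x \<in> topspace S" for x i
      proof -
        have "\<bar>g (i, True) x - Re (y x $$ (i, k))\<bar> < e" "\<bar>g (i, False) x - Im (y x $$ (i, k))\<bar> < e"
          using g(2)[of "(i, True)" x] g(2)[of "(i, False)" x] that by (simp_all add: f_def)
        moreover have "cmod (v x i - y x $$ (i, k)) \<le> \<bar>g (i, True) x - Re (y x $$ (i, k))\<bar> + \<bar>g (i, False) x - Im (y x $$ (i, k))\<bar>"
          using cmod_le[of "v x i - y x $$ (i, k)"] by (simp add: v_def)
        ultimately show ?thesis by linarith
      qed
      define \<Delta> where "\<Delta> x = mat n n (\<lambda>(i, l). if l = k \<and> k \<le> i \<and> i < j then v x i - y x $$ (i, k) else 0)" for x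
      have \<Delta>c: "\<Delta> x \<in> carrier_mat n n" for x by (simp add: \<Delta>_def)
      have \<Delta>: "cont_mat_fun S n \<Delta>"
        unfolding \<Delta>_def
      proof (rule cont_mat_fun_mat)
        fix i l assume il: "i < n" "l < n"
        have "continuous_map S euclidean (\<lambda>x. v x i - y x $$ (i, k))" if "k \<le> i \<and> i < j"
          using that vc cont_mat_funD(2)[OF y il(1) kn] by (intro continuous_map_diff) auto
        thus "continuous_map S euclidean (\<lambda>x. if l = k \<and> k \<le> i \<and> i < j then v x i - y x $$ (i, k) else 0)"
          by (cases "l = k \<and> k \<le> i \<and> i < j") auto
      qed
      have \<Delta>b: "entry_norm (\<Delta> x) \<le> real n * real n * (2 * e)" if "x \<in> topspace S" for x
      proof -
        have "entry_norm (\<Delta> x) = (\<Sum>i<n. \<Sum>l<n. cmod (\<Delta> x $$ (i, l)))" by (simp add: entry_norm_def \<Delta>_def)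
        also have "\<dots> \<le> (\<Sum>i<n. \<Sum>l<n. 2 * e)"
          using vy[OF _ that] e by (intro sum_mono) (auto simp: \<Delta>_def)
        finally show ?thesis by (simp add: algebra_simps)
      qed
      \<comment> \<open>Seen in the moving basis, this replaces the coordinates \<open>k\<close> to
        \<open>j - 1\<close> of column \<open>k\<close> by the values \<open>v\<close> without
        common zero and leaves the others alone.\<close>
      define t where "t x = s x + \<Theta> x * \<Delta> x" for x
      have t: "cont_mat_fun S n t" unfolding t_def by (intro cont_mat_fun_add cont_mat_fun_mult s TS \<Delta>)
      show "\<exists>t. cont_mat_fun S n t \<and> (\<forall>x\<in>W. entry_norm (t x - s x) < \<eta>) \<and>
         (\<forall>x\<in>W. indep_cols j (Suc k) (mat n n (\<lambda>(i, l). if l = k then t x $$ (i, l) else R x $$ (i, l))))"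
      proof (intro exI[of _ t] conjI t ballI)
        fix x assume xW: "x \<in> W"
        hence x: "x \<in> topspace S" by (simp add: topS)
        have "t x - s x = \<Theta> x * \<Delta> x"
          unfolding t_def using cs[OF x] Tc[of x] \<Delta>c[of x] by (intro eq_matI) auto
        hence "entry_norm (t x - s x) \<le> entry_norm (\<Theta> x) * entry_norm (\<Delta> x)"
          using entry_norm_mult_le[OF Tc \<Delta>c] by simp
        also have "\<dots> \<le> b * (real n * real n * (2 * e))"
          using b(2) x \<Delta>b[OF x] b(1) by (intro mult_mono) auto
        also have "\<dots> < b * ((2 * real n * real n + 1) * e)" using b(1) e by (simp add: algebra_simps)
        also have "\<dots> = \<eta> / 2"
          using b(1) add_nonneg_pos[of "2 * real n * real n" 1] by (simp add: e_def)
        finally show "entry_norm (t x - s x) < \<eta>" using \<eta> by simp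
        define y' where "y' = vec n (\<lambda>i. if k \<le> i \<and> i < j then v x i else y x $$ (i, k))"
        have y'c: "y' \<in> carrier_vec n" by (simp add: y'_def)
        have yc: "y x \<in> carrier_mat n n" using cont_mat_funD(1)[OF y x] .
        have y'eq: "y' = col (y x) k + col (\<Delta> x) k"
          using yc \<Delta>c[of x] kn by (intro eq_vecI) (auto simp: y'_def \<Delta>_def)
        have Ty: "\<Theta> x * y x = D * s x"
        proof -
          have "\<Theta> x * y x = (\<Theta> x * matinv (\<Theta> x)) * (D * s x)"
            unfolding y_def using Tc[of x] inv(1)[OF x] Dc cs[OF x]
            by (simp add: assoc_mult_mat[of _ n n _ n _ n] mult_carrier_mat[of _ n n _ n])
          thus ?thesis using inv(2)[OF x] Dc cs[OF x] by (simp add: mult_carrier_mat[of _ n n _ n])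
        qed
        have Ty': "\<Theta> x *\<^sub>v y' = col (D * s x) k + col (\<Theta> x * \<Delta> x) k"
        proof -
          have "\<Theta> x *\<^sub>v y' = \<Theta> x *\<^sub>v col (y x) k + \<Theta> x *\<^sub>v col (\<Delta> x) k"
            unfolding y'eq using yc \<Delta>c[of x] by (intro mult_add_distrib_mat_vec[OF Tc]) auto
          also have "\<Theta> x *\<^sub>v col (y x) k = col (\<Theta> x * y x) k" using col_mult2[OF Tc yc kn] by simp
          also have "\<Theta> x *\<^sub>v col (\<Delta> x) k = col (\<Theta> x * \<Delta> x) k" using col_mult2[OF Tc \<Delta>c kn] by simp
          finally show ?thesis by (simp only: Ty)
        qed
        have Ds: "(D * s x) $$ (i, k) = (if i < j then s x $$ (i, k) else 0)" if "i < n" for i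
        proof -
          have "(D * s x) $$ (i, k) = (\<Sum>l<n. D $$ (i, l) * s x $$ (l, k))"
            by (rule mult_mat_index_sum[OF Dc cs[OF x] that kn])
          also have "\<dots> = (\<Sum>l<n. if l = i then (if i < j then s x $$ (i, k) else 0) else 0)"
            using that by (intro sum.cong) (auto simp: D_def)
          finally show ?thesis using that by simp
        qed
        have tk: "vec_index (\<Theta> x *\<^sub>v y') i = t x $$ (i, k)" if "i < j" for i
        proof -
          have i: "i < n" using that jk by simp
          have "vec_index (\<Theta> x *\<^sub>v y') i = (D * s x) $$ (i, k) + (\<Theta> x * \<Delta> x) $$ (i, k)"
            unfolding Ty' using i kn Dc cs[OF x] Tc[of x] \<Delta>c[of x] by auto
          thus ?thesis using Ds[OF i] that i kn cs[OF x] Tc[of x] \<Delta>c[of x] by (simp add: t_def)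
        qed
        have y'hi: "vec_index y' i = 0" if "j \<le> i" "i < n" for i
        proof -
          have D0: "vec_index (col (\<Delta> x) k) l = 0" if "l < n" "j \<le> l \<or> l < k" for l using that kn
            by (auto simp: \<Delta>_def)
          have "vec_index (\<Theta> x *\<^sub>v col (\<Delta> x) k) i = 0"
            using Tidx[of "col (\<Delta> x) k" i x] that D0 \<Delta>c[of x] by auto
          hence "(\<Theta> x * \<Delta> x) $$ (i, k) = 0"
            using col_mult2[OF Tc \<Delta>c kn, of x x] that kn Tc[of x] \<Delta>c[of x] by (metis carrier_matD(1) carrier_matD(2) index_col index_mult_mat(2,3))
          hence "vec_index (\<Theta> x *\<^sub>v y') i = 0"
            unfolding Ty' using that kn Dc cs[OF x] Tc[of x] \<Delta>c[of x] Ds[OF that(2)] by auto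
          thus ?thesis using Tidx[OF y'c that(2), of x] that by simp
        qed
        let ?C = "mat n n (\<lambda>(i, l). if l = k then t x $$ (i, l) else R x $$ (i, l))"
        show "indep_cols j (Suc k) ?C"
          unfolding indep_cols_def
        proof (intro allI impI)
          fix u l assume u: "\<forall>i<j. (\<Sum>l<Suc k. ?C $$ (i, l) * u l) = 0" and l: "l < Suc k"
          have eq: "(\<Sum>l<k. R x $$ (i, l) * u l) + t x $$ (i, k) * u k = 0" if "i < j" for i
            using u[rule_format, OF that] jk that by simp
          define w where "w = vec n (\<lambda>l. if l < k then u l else 0)"
          \<comment> \<open>The coordinates, in the moving basis, of the combination of columns with
            coefficients \<open>u\<close>. A relation gives \<open>z = 0\<close>; its coordinates
            \<open>k\<close> to \<open>j - 1\<close> are \<open>u k * v x i\<close>, so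
            \<open>u k\<close> is 0, and then so are the others.\<close>
          define z where "z = w + u k \<cdot>\<^sub>v y'"
          have wc: "w \<in> carrier_vec n" by (simp add: w_def)
          have zc: "z \<in> carrier_vec n" using wc y'c by (simp add: z_def)
          have Tz: "\<Theta> x *\<^sub>v z = \<Theta> x *\<^sub>v w + u k \<cdot>\<^sub>v (\<Theta> x *\<^sub>v y')"
            unfolding z_def using wc y'c Tc[of x]
            by (simp add: mult_add_distrib_mat_vec[of _ n n] mult_mat_vec[of _ n n])
          have "\<Theta> x *\<^sub>v z = 0\<^sub>v n"
          proof (rule eq_vecI)
            fix i assume "i < dim_vec (0\<^sub>v n)"
            hence i: "i < n" by simp
            show "vec_index (\<Theta> x *\<^sub>v z) i = vec_index (0\<^sub>v n) i"
            proof (cases "i < j")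
              case True
              have "vec_index (\<Theta> x *\<^sub>v w) i = (\<Sum>l<k. R x $$ (i, l) * u l)"
                unfolding Tidx[OF wc i] using True jk by (simp add: w_def)
              moreover have "vec_index (\<Theta> x *\<^sub>v z) i = vec_index (\<Theta> x *\<^sub>v w) i + u k * vec_index (\<Theta> x *\<^sub>v y') i"
                unfolding Tz using i Tc[of x] by simp
              ultimately show ?thesis using eq[OF True] tk[OF True] i by (simp add: mult.commute)
            next
              case False
              have "vec_index z i = 0" using y'hi[of i] False i jk y'c by (simp add: z_def w_def)
              thus ?thesis using Tidx[OF zc i, of x] False i by simp
            qed
          qed (use Tc[of x] in simp)
          hence z0: "z = 0\<^sub>v n" using det_0_iff_vec_prod_zero_field[OF Tc, of x] dS[OF x] zc by metis
          have uv: "u k * v x i = 0" if "i \<in> {k..<j}" for i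
          proof -
            have "vec_index z i = 0" using z0 that jk by simp
            thus ?thesis using that jk y'c by (simp add: z_def w_def y'_def)
          qed
          obtain p where p: "p \<in> {k..<j} \<times> (UNIV::bool set)" "g p x \<noteq> 0" using g(3)[OF x] by blast
          hence "v x (fst p) \<noteq> 0" by (cases p; cases "snd p") (auto simp: v_def complex_eq_iff)
          hence uk: "u k = 0" using uv[of "fst p"] p(1) by auto
          have "u l = 0" if "l < k" for l
          proof -
            have "vec_index z l = 0" using z0 that kn by simp
            thus ?thesis using uk that kn y'c by (simp add: z_def w_def)
          qed
          thus "u l = 0" using uk l by (cases "l = k") auto
        qed
      qed
    qed
  qed
qed

text \<open>Columns are corrected one after the other. For \<open>k\<close> columns the bound
  \<open>d < 2 * (j + 1 - k)\<close> is the one required by the last of them; for earlier columns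
  more room is left.\<close>

theorem indep_cols_dense:
  assumes X: "compact_space X" "Hausdorff_space X" and dim: "covdim_le X d"
    and jk: "k \<le> j" "j \<le> n" and d: "k = 0 \<or> d < 2 * (j + 1 - k)" and R: "cont_mat_fun X n R" and \<eta>: "0 < \<eta>"
  shows "\<exists>S. cont_mat_fun X n S \<and> (\<forall>x\<in>topspace X. entry_norm (S x - R x) < \<eta>) \<and> (\<forall>x\<in>topspace X. indep_cols j k (S x))"
  using jk(1) d \<eta>
proof (induction k arbitrary: \<eta>)
  case 0
  have "entry_norm (R x - R x) = 0" if "x \<in> topspace X" for x
    using cont_mat_funD(1)[OF R that] entry_norm_eq_0_iff[of "R x - R x" n n] by auto
  thus ?case using R 0 by (intro exI[of _ R]) (simp add: indep_cols_def)
next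
  case (Suc k)
  have kj: "k < j" "k \<le> j" "k < n" using Suc.prems jk by auto
  have d': "d < 2 * (j - k)" using Suc.prems by simp
  have "0 < \<eta>/2" using Suc.prems by simp
  moreover have "d < 2 * (j + 1 - k)" using d' by linarith
  ultimately obtain S where S: "cont_mat_fun X n S" "\<forall>x\<in>topspace X. entry_norm (S x - R x) < \<eta>/2"
    "\<forall>x\<in>topspace X. indep_cols j k (S x)" using Suc.IH[of "\<eta>/2"] kj(2) by auto
  note cS = cont_mat_funD(1)[OF S(1)]
  \<comment> \<open>Only column \<open>k\<close> is taken from \<open>M\<close>, so the independence
    of the earlier columns is not affected by the choice of \<open>M\<close>.\<close>
  define C where "C x M = mat n n (\<lambda>(i, l). if l = k then M $$ (i, l) else S x $$ (i, l))" for x and M :: "complex mat"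
  have Cc: "C x M \<in> carrier_mat n n" for x M by (simp add: C_def)
  define G where "G x M = indep_cols j (Suc k) (C x M)" for x M
  have G: "open_condition X n G"
  proof -
    have cC: "cont_mat_fun (prod_topology X (mat_topology n)) n (\<lambda>p. C (fst p) (snd p))"
      unfolding C_def
    proof (rule cont_mat_fun_mat)
      fix i l assume il: "i < n" "l < n"
      show "continuous_map (prod_topology X (mat_topology n)) euclidean
          (\<lambda>p. if l = k then snd p $$ (i, l) else S (fst p) $$ (i, l))"
        using cont_mat_funD(2)[OF cont_mat_fun_snd il] cont_mat_funD(2)[OF cont_mat_fun_fst[OF S(1)] il]
        by (cases "l = k") auto
    qed
    have "cont_mat_fun (prod_topology X (mat_topology n)) n (\<lambda>p. block_gram n j (Suc k) (C (fst p) (snd p)))"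
      unfolding block_gram_def
      by (intro cont_mat_fun_add cont_mat_fun_mult cont_mat_fun_adjoint cC cont_mat_fun_const) simp_all
    from open_condition_posdef[OF this block_gram_hermitian[OF Cc]]
    have "open_condition X n (\<lambda>x M. posdef (block_gram n j (Suc k) (C x M)))" .
    moreover have "posdef (block_gram n j (Suc k) (C x M)) \<longleftrightarrow> G x M" for x M
      unfolding G_def using posdef_block_gram_iff[OF Cc jk(2)] kj by simp
    ultimately show ?thesis by simp
  qed
  have loc: "locally_perturbable X n G x" if "x \<in> topspace X" for x
    using indep_cols_locally_perturbable[OF X dim kj(1) jk(2) d' S(1) that bspec[OF S(3) that]]
    unfolding G_def C_def .
  obtain t where t: "cont_mat_fun X n t" "\<forall>x\<in>{}. t x = S x" "\<forall>x\<in>topspace X. entry_norm (t x - S x) < \<eta>/2"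
    "\<forall>x\<in>topspace X. G x (t x)"
    by (rule relative_perturbation[OF X G closedin_empty S(1) _ loc \<open>0 < \<eta>/2\<close>]) simp
  note ct = cont_mat_funD(1)[OF t(1)]
  have S': "cont_mat_fun X n (\<lambda>x. C x (t x))"
    unfolding C_def
  proof (rule cont_mat_fun_mat)
    fix i l assume il: "i < n" "l < n"
    show "continuous_map X euclidean (\<lambda>x. if l = k then t x $$ (i, l) else S x $$ (i, l))"
      using cont_mat_funD(2)[OF t(1) il] cont_mat_funD(2)[OF S(1) il] by (cases "l = k") auto
  qed
  have near: "entry_norm (C x (t x) - R x) < \<eta>" if x: "x \<in> topspace X" for x
  proof -
    have "entry_norm (C x (t x) - S x) \<le> entry_norm (t x - S x)"
      using ct[OF x] cS[OF x] unfolding entry_norm_def by (simp add: C_def) (intro sum_mono, auto)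
    moreover have "entry_norm (C x (t x) - R x) \<le> entry_norm (C x (t x) - S x) + entry_norm (S x - R x)"
      by (rule entry_norm_triangle[OF Cc cS[OF x] cont_mat_funD(1)[OF R x]])
    ultimately show ?thesis using bspec[OF S(2) x] bspec[OF t(3) x] by linarith
  qed
  show ?case using S' near t(4) unfolding G_def by blast
qed

section \<open>Rank, eigenvalues and kernels of diagonalized matrices\<close>

lemma unitary_diag_mult_vec:
  assumes U: "unitary_mat n U" and u: "u \<in> carrier_vec n"
  shows "(U * diagm n h * mat_adjoint U) *\<^sub>v u = U *\<^sub>v (diagm n h *\<^sub>v (mat_adjoint U *\<^sub>v u))"
proof -
  have Uc: "U \<in> carrier_mat n n" using U by (simp add: unitary_mat_def)
  note U' = mat_adjoint_carrier[OF Uc] and v = mult_mat_vec_carrier[OF mat_adjoint_carrier[OF Uc] u]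
  have "(U * diagm n h * mat_adjoint U) *\<^sub>v u = (U * diagm n h) *\<^sub>v (mat_adjoint U *\<^sub>v u)"
    using Uc U' u by (intro assoc_mult_mat_vec) auto
  also have "\<dots> = U *\<^sub>v (diagm n h *\<^sub>v (mat_adjoint U *\<^sub>v u))"
    using Uc v by (intro assoc_mult_mat_vec) auto
  finally show ?thesis .
qed

lemma unitary_diag_index:
  assumes U: "unitary_mat n U" and il: "i < n" "l < n"
  shows "(U * diagm n h * mat_adjoint U) $$ (i, l) = (\<Sum>k<n. U $$ (i, k) * h k * cnj (U $$ (l, k)))"
proof -
  have Uc: "U \<in> carrier_mat n n" using U by (simp add: unitary_mat_def)
  have 1: "(U * diagm n h) $$ (i, k) = U $$ (i, k) * h k" if k: "k < n" for k
  proof -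
    have "(U * diagm n h) $$ (i, k) = (\<Sum>m<n. if m = k then U $$ (i, k) * h k else 0)"
      unfolding mult_mat_index_sum[OF Uc diagm_carrier(1) il(1) k] using k by (intro sum.cong) auto
    thus ?thesis using k by simp
  qed
  have "(U * diagm n h * mat_adjoint U) $$ (i, l) = (\<Sum>k<n. (U * diagm n h) $$ (i, k) * mat_adjoint U $$ (k, l))"
    using Uc il by (intro mult_mat_index_sum) auto
  also have "\<dots> = (\<Sum>k<n. U $$ (i, k) * h k * cnj (U $$ (l, k)))"
    using Uc il 1 by (intro sum.cong) auto
  finally show ?thesis .
qed

text \<open>Each diagonal entry contributes a matrix of rank at most one, and rank is
  subadditive.\<close>

lemma rank_unitary_diag_le:
  assumes U: "unitary_mat n U" and S: "finite S" "{k. k < n \<and> h k \<noteq> 0} \<subseteq> S"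
  shows "vec_space.rank n (U * diagm n h * mat_adjoint U) \<le> card S"
  using S
proof (induction S arbitrary: h rule: finite_induct)
  interpret vec_space "TYPE(complex)" n .
  case empty
  hence "U * diagm n h * mat_adjoint U = 0\<^sub>m n n"
    using U unitary_diag_index[OF U] by (intro eq_matI) (auto simp: unitary_mat_def intro!: sum.neutral)
  thus ?case using rank_0I by simp
next
  interpret vec_space "TYPE(complex)" n .
  case (insert m S)
  define h1 where "h1 = (\<lambda>k. if k = m then h k else 0)"
  define h2 where "h2 = (\<lambda>k. if k = m then 0 else h k)"
  note cc = unitary_diag_carrier[OF U]
  have "U * diagm n h * mat_adjoint U = U * diagm n h1 * mat_adjoint U + U * diagm n h2 * mat_adjoint U"
    unfolding unitary_diag_add[OF U] by (auto simp: h1_def h2_def intro!: arg_cong[of _ _ "\<lambda>z. U * diagm n z * mat_adjoint U"])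
  hence "rank (U * diagm n h * mat_adjoint U) \<le> rank (U * diagm n h1 * mat_adjoint U) + rank (U * diagm n h2 * mat_adjoint U)"
    using rank_subadditive[OF cc cc] by simp
  moreover have "rank (U * diagm n h1 * mat_adjoint U) \<le> 1"
  proof (rule rank_le_1_product_entries[OF cc])
    fix i l assume "i < dim_row (U * diagm n h1 * mat_adjoint U)" "l < dim_col (U * diagm n h1 * mat_adjoint U)"
    hence il: "i < n" "l < n" using cc[of h1] by auto
    show "(U * diagm n h1 * mat_adjoint U) $$ (i, l) = (if m < n then U $$ (i, m) * h m else 0) * cnj (U $$ (l, m))"
    proof -
      have "(U * diagm n h1 * mat_adjoint U) $$ (i, l) = (\<Sum>k<n. if k = m then U $$ (i, m) * h m * cnj (U $$ (l, m)) else 0)"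
        unfolding unitary_diag_index[OF U il] by (intro sum.cong) (auto simp: h1_def)
      thus ?thesis by simp
    qed
  qed
  moreover have "rank (U * diagm n h2 * mat_adjoint U) \<le> card S"
    by (rule insert.IH) (use insert.prems in \<open>auto simp: h2_def\<close>)
  ultimately show ?case using insert.hyps by simp
qed

text \<open>For the lower bound, the projection onto the remaining eigenvectors, of rank at most
  \<open>n - r\<close>, is added. The sum is invertible, so subadditivity leaves at least
  \<open>r\<close> for the original matrix.\<close>

lemma rank_unitary_diag:
  assumes U: "unitary_mat n U" and f: "\<And>i. i < n \<Longrightarrow> f i \<noteq> 0 \<longleftrightarrow> i < r" and r: "r \<le> n"
  shows "vec_space.rank n (U * diagm n f * mat_adjoint U) = r"
proof (rule antisym)
  interpret vec_space "TYPE(complex)" n .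
  have "{k. k < n \<and> f k \<noteq> 0} \<subseteq> {..<r}" using f by auto
  from rank_unitary_diag_le[OF U finite_lessThan this]
  show "rank (U * diagm n f * mat_adjoint U) \<le> r" by simp
  define g :: "nat \<Rightarrow> complex" where "g = (\<lambda>i. if i < r then 0 else 1)"
  define h where "h = (\<lambda>i. f i + g i)"
  note cc = unitary_diag_carrier[OF U]
  have "{k. k < n \<and> g k \<noteq> 0} \<subseteq> {r..<n}" by (auto simp: g_def)
  from rank_unitary_diag_le[OF U finite_atLeastLessThan this]
  have g: "rank (U * diagm n g * mat_adjoint U) \<le> n - r" by simp
  have "h i \<noteq> 0" if "i < n" for i using f[OF that] by (auto simp: h_def g_def)
  hence "(U * diagm n h * mat_adjoint U) * (U * diagm n (\<lambda>i. inverse (h i)) * mat_adjoint U) = 1\<^sub>m n"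
  proof -
    assume nz: "\<And>i. i < n \<Longrightarrow> h i \<noteq> 0"
    have "diagm n (\<lambda>i. h i * inverse (h i)) = diagm n (\<lambda>_. 1)" using nz by (intro eq_matI) auto
    moreover have "(1::complex) \<cdot>\<^sub>m 1\<^sub>m n = 1\<^sub>m n" by (intro eq_matI) auto
    ultimately show ?thesis using unitary_diag_const[OF U, of 1] by (simp add: unitary_diag_mult[OF U])
  qed
  hence "Determinant.det (U * diagm n h * mat_adjoint U) * Determinant.det (U * diagm n (\<lambda>i. inverse (h i)) * mat_adjoint U) = 1"
    using det_mult[OF cc cc] by (metis det_one)
  hence "Determinant.det (U * diagm n h * mat_adjoint U) \<noteq> 0" by auto
  hence "rank (U * diagm n h * mat_adjoint U) = n" using det_rank_iff[OF cc] by blast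
  moreover have "rank (U * diagm n h * mat_adjoint U) \<le> rank (U * diagm n f * mat_adjoint U) + rank (U * diagm n g * mat_adjoint U)"
    using rank_subadditive[OF cc cc, of f g] unfolding unitary_diag_add[OF U] h_def by simp
  ultimately show "r \<le> rank (U * diagm n f * mat_adjoint U)" using g r by linarith
qed

lemma psd_eigenvalue_bounds:
  assumes U: "unitary_mat n U" and M: "M = U * diagm n (\<lambda>i. complex_of_real (f i)) * mat_adjoint U"
    and p: "psd M" and i: "i < n"
  shows "0 \<le> f i" "f i \<le> entry_norm M"
proof -
  have Mc: "M \<in> carrier_mat n n" unfolding M by (rule unitary_diag_carrier[OF U])
  let ?u = "U *\<^sub>v unit_vec n i"
  note u = unitary_basis_vector(1)[OF U i] and e = unitary_basis_vector(2)[OF U i]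
  have q: "qform M ?u = f i"
  proof -
    have "qform M ?u = (\<Sum>j<n. if j = i then f i else 0)"
      unfolding M qform_unitary_diag[OF U u] e using i by (intro sum.cong) auto
    thus ?thesis using i by simp
  qed
  have nu: "nsq ?u = 1"
  proof -
    have "nsq ?u = (\<Sum>j<n. if j = i then 1 else 0)"
      unfolding nsq_unitary_coords[OF U u] e using i by (intro sum.cong) auto
    thus ?thesis using i by simp
  qed
  show "0 \<le> f i" using p u Mc q unfolding psd_def by force
  show "f i \<le> entry_norm M" using qform_le_entry_norm[OF Mc u] q nu by simp
qed

text \<open>In an eigenbasis the form is a sum of nonnegative terms, so \<open>u\<close> has no
  coordinate along a nonzero eigenvalue.\<close>

lemma psd_zero_form:
  assumes M: "M \<in> carrier_mat n n" and p: "psd M" and u: "u \<in> carrier_vec n" and z: "qform M u = 0"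
  shows "M *\<^sub>v u = 0\<^sub>v n"
proof -
  have h: "mat_adjoint M = M" using p by (simp add: psd_def)
  obtain U f where U: "unitary_mat n U" "M = U * diagm n (\<lambda>i. complex_of_real (f i)) * mat_adjoint U"
    using hermitian_diagonalization_exists[OF M h] by blast
  note f0 = psd_eigenvalue_bounds(1)[OF U p]
  have "(\<Sum>i<n. f i * (cmod (vec_index (mat_adjoint U *\<^sub>v u) i))\<^sup>2) = 0"
    using z unfolding U(2) qform_unitary_diag[OF U(1) u] .
  hence "\<forall>i\<in>{..<n}. f i * (cmod (vec_index (mat_adjoint U *\<^sub>v u) i))\<^sup>2 = 0"
    using f0 by (subst (asm) sum_nonneg_eq_0_iff) auto
  hence "nsq (M *\<^sub>v u) = 0"
    unfolding U(2) nsq_unitary_diag[OF U(1) u] by (intro sum.neutral) auto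
  thus ?thesis using nsq_eq_0_iff[OF mult_mat_vec_carrier[OF M u]] by simp
qed

lemma psd_congruence:
  assumes "M \<in> carrier_mat n n" "psd M" "S \<in> carrier_mat n n"
  shows "psd (mat_adjoint S * M * S)"
  unfolding psd_def
proof (intro conjI ballI)
  have h: "mat_adjoint M = M" using assms by (simp add: psd_def)
  show "mat_adjoint (mat_adjoint S * M * S) = mat_adjoint S * M * S"
    using assms h by (simp add: mat_adjoint_mult[of _ n n _ n] assoc_mult_mat[of _ n n _ n _ n] mult_carrier_mat[of _ n n _ n])
  fix u :: "complex Matrix.vec" assume "u \<in> carrier_vec (dim_row (mat_adjoint S * M * S))"
  hence u: "u \<in> carrier_vec n" using assms by simp
  show "0 \<le> qform (mat_adjoint S * M * S) u"
    unfolding qform_congruence[OF assms(3,1) u] using assms mult_mat_vec_carrier[OF assms(3) u]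
    by (simp add: psd_def)
qed

lemma unitary_diag_pow:
  assumes U: "unitary_mat n U"
  shows "(U * diagm n h * mat_adjoint U) ^\<^sub>m N = U * diagm n (\<lambda>i. h i ^ N) * mat_adjoint U"
proof (induction N)
  case 0
  have "dim_row U = n" using U by (auto simp: unitary_mat_def)
  moreover have "(1::complex) \<cdot>\<^sub>m 1\<^sub>m n = 1\<^sub>m n" by (intro eq_matI) auto
  ultimately show ?case using unitary_diag_const[OF U, of 1] by simp
next
  case (Suc N)
  thus ?case by (simp add: unitary_diag_mult[OF U] mult.commute)
qed

section \<open>Domination up to a positive constant\<close>

text \<open>The factors \<open>A\<^sup>N\<close> make the condition hold for large \<open>N\<close> and \<open>c\<close> without controlling the
  eigenvalues of \<open>A\<close> between \<open>0\<close> and \<open>\<epsilon>\<close>. They do no harm: by \<open>dominate_absorb\<close> they can be moved into \<open>S\<close>.\<close>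

definition dominate :: "real \<Rightarrow> nat \<Rightarrow> real \<Rightarrow> complex mat \<Rightarrow> complex mat \<Rightarrow> complex mat \<Rightarrow> complex mat" where
  "dominate \<epsilon> N c A B S = complex_of_real c \<cdot>\<^sub>m (A ^\<^sub>m N * S * B * mat_adjoint S * A ^\<^sub>m N)
     + complex_of_real \<epsilon> \<cdot>\<^sub>m 1\<^sub>m (dim_row A) - A"

lemma pow_mat_hermitian:
  fixes A :: "complex mat"
  assumes A: "A \<in> carrier_mat n n" and h: "mat_adjoint A = A"
  shows "mat_adjoint (A ^\<^sub>m N) = A ^\<^sub>m N"
proof (induction N)
  case 0 thus ?case using A by simp
next
  case (Suc N)
  have "A * A ^\<^sub>m N = A ^\<^sub>m N * A"
  proof (induction N)
    case (Suc N)
    have "A * (A ^\<^sub>m N * A) = (A * A ^\<^sub>m N) * A" using A by (intro assoc_mult_mat[symmetric]) auto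
    thus ?case using Suc by simp
  qed (use A in simp)
  thus ?case using A h Suc by (simp add: mat_adjoint_mult[of _ n n _ n])
qed

lemma dominate_carrier:
  "A \<in> carrier_mat n n \<Longrightarrow> B \<in> carrier_mat n n \<Longrightarrow> S \<in> carrier_mat n n \<Longrightarrow> dominate \<epsilon> N c A B S \<in> carrier_mat n n"
  unfolding dominate_def by (rule minus_carrier_mat)

lemma dominate_hermitian:
  assumes A: "A \<in> carrier_mat n n" "mat_adjoint A = A" and B: "B \<in> carrier_mat n n" "mat_adjoint B = B"
    and S: "S \<in> carrier_mat n n"
  shows "mat_adjoint (dominate \<epsilon> N c A B S) = dominate \<epsilon> N c A B S"
proof -
  note p = pow_mat_hermitian[OF A, of N] and pc = pow_carrier_mat[OF A(1), of N]
  define H where "H = A ^\<^sub>m N * S * B * mat_adjoint S * A ^\<^sub>m N"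
  have H: "H \<in> carrier_mat n n" "mat_adjoint H = H"
    using A B S p pc
    by (simp_all add: H_def mat_adjoint_mult[of _ n n _ n] assoc_mult_mat[of _ n n _ n _ n] mult_carrier_mat[of _ n n _ n])
  have 1: "complex_of_real c \<cdot>\<^sub>m H + complex_of_real \<epsilon> \<cdot>\<^sub>m 1\<^sub>m n \<in> carrier_mat n n" using H(1) by simp
  have d: "dim_row A = n" using A(1) by simp
  show ?thesis unfolding dominate_def H_def[symmetric] d mat_adjoint_minus[OF 1 A(1)]
    using H A by (simp add: mat_adjoint_add[of _ n n])
qed

lemma qform_dominate:
  assumes A: "A \<in> carrier_mat n n" "mat_adjoint A = A" and B: "B \<in> carrier_mat n n" and S: "S \<in> carrier_mat n n"
    and u: "u \<in> carrier_vec n"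
  shows "qform (dominate \<epsilon> N c A B S) u
    = c * qform B (mat_adjoint S *\<^sub>v (A ^\<^sub>m N *\<^sub>v u)) + \<epsilon> * nsq u - qform A u"
proof -
  note p = pow_mat_hermitian[OF A, of N] and pc = pow_carrier_mat[OF A(1), of N]
  define T where "T = mat_adjoint S * A ^\<^sub>m N"
  have T: "T \<in> carrier_mat n n" "mat_adjoint T = A ^\<^sub>m N * S" using S p pc
    by (simp_all add: T_def mat_adjoint_mult[of _ n n _ n] mult_carrier_mat[of _ n n _ n])
  have e: "A ^\<^sub>m N * S * B * mat_adjoint S * A ^\<^sub>m N = mat_adjoint T * B * T"
    unfolding T(2) unfolding T_def using A B S pc by (simp add: assoc_mult_mat[of _ n n _ n _ n] mult_carrier_mat[of _ n n _ n])
  have Tu: "T *\<^sub>v u = mat_adjoint S *\<^sub>v (A ^\<^sub>m N *\<^sub>v u)"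
    unfolding T_def using S pc u by (intro assoc_mult_mat_vec) auto
  define K where "K = mat_adjoint T * B * T"
  have K: "K \<in> carrier_mat n n" "qform K u = qform B (T *\<^sub>v u)"
    using qform_congruence[OF T(1) B u] T(1) B by (simp_all add: K_def mult_carrier_mat[of _ n n _ n])
  have 1: "complex_of_real c \<cdot>\<^sub>m K + complex_of_real \<epsilon> \<cdot>\<^sub>m 1\<^sub>m n \<in> carrier_mat n n" using K(1) by simp
  have d: "dim_row A = n" using A(1) by simp
  show ?thesis
    unfolding dominate_def e Tu[symmetric] K_def[symmetric] d qform_minus[OF 1 A(1) u]
    using K u by (simp add: qform_add[of _ n] qform_smult[of _ n] qform_one)
qed

text \<open>The parallelogram law for \<open>u + v\<close> and \<open>v\<close> with one nonnegative
  term dropped. It replaces a Cauchy-Schwarz bound for the mixed term, at the price of the factor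
  1/2.\<close>

lemma qform_triangle:
  assumes H: "H \<in> carrier_mat n n" and p: "psd H" and u: "u \<in> carrier_vec n" "v \<in> carrier_vec n"
  shows "qform H u / 2 - qform H v \<le> qform H (u + v)"
proof -
  have "qform H ((u + v) + v) + qform H ((u + v) - v) = 2 * qform H (u + v) + 2 * qform H v"
    using u by (intro qform_parallelogram[OF H]) auto
  moreover have "(u + v) - v = u" using u by (intro eq_vecI) auto
  moreover have "0 \<le> qform H ((u + v) + v)" using p H u by (simp add: psd_def)
  ultimately show ?thesis by simp
qed

text \<open>By \<open>inj\<close>, the forms of \<open>H\<close> and of
  \<open>mat_adjoint E * E\<close> have no common zero, so their sum is bounded below by some
  \<open>\<delta>\<close>. On eigenvectors of \<open>A\<close> with eigenvalue at least
  \<open>\<epsilon>/2\<close> the matrix \<open>E\<close> vanishes and \<open>H\<close> alone has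
  this bound. On the others \<open>H\<close> may spoil the estimate through mixed terms, but
  \<open>A ^\<^sub>m N\<close> makes them smaller by the factor \<open>2 ^ N\<close> than what is
  gained at eigenvalues from \<open>\<epsilon>\<close> on.\<close>

theorem dominate_posdef_exists:
  assumes U: "unitary_mat n U" and A: "A = U * diagm n (\<lambda>i. complex_of_real (f i)) * mat_adjoint U" "psd A"
    and B: "B \<in> carrier_mat n n" "psd B" and S: "S \<in> carrier_mat n n" and \<epsilon>: "0 < \<epsilon>"
    and \<phi>: "\<And>t. \<epsilon> / 2 \<le> t \<Longrightarrow> \<phi> t = 1"
    and inj: "\<And>v. v \<in> carrier_vec n \<Longrightarrow> (U * diagm n (\<lambda>i. complex_of_real (1 - \<phi> (f i))) * mat_adjoint U) *\<^sub>v v = 0\<^sub>v n \<Longrightarrow>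
      B *\<^sub>v (mat_adjoint S *\<^sub>v v) = 0\<^sub>v n \<Longrightarrow> v = 0\<^sub>v n"
  shows "\<exists>N c. 0 \<le> c \<and> posdef (dominate \<epsilon> N c A B S)"
proof -
  have Uc: "U \<in> carrier_mat n n" "mat_adjoint U * U = 1\<^sub>m n" "U * mat_adjoint U = 1\<^sub>m n"
    using U by (auto simp: unitary_mat_def)
  note U' = mat_adjoint_carrier[OF Uc(1)]
  have Ac: "A \<in> carrier_mat n n" unfolding A(1) by (rule unitary_diag_carrier[OF U])
  have Ah: "mat_adjoint A = A" using A(2) by (simp add: psd_def)
  have Bh: "mat_adjoint B = B" using B(2) by (simp add: psd_def)
  note S' = mat_adjoint_carrier[OF S]
  define H where "H = S * B * mat_adjoint S"
  have Hpsd: "psd H" using psd_congruence[OF B S'] by (simp add: H_def)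
  have H: "H \<in> carrier_mat n n" using S B by (simp add: H_def mult_carrier_mat[of _ n n _ n])
  have qH: "qform H v = qform B (mat_adjoint S *\<^sub>v v)" if "v \<in> carrier_vec n" for v
    using qform_congruence[OF S' B(1) that] by (simp add: H_def)
  define E where "E = U * diagm n (\<lambda>i. complex_of_real (1 - \<phi> (f i))) * mat_adjoint U"
  have E: "E \<in> carrier_mat n n" unfolding E_def by (rule unitary_diag_carrier[OF U])
  have EE: "mat_adjoint E * E \<in> carrier_mat n n" using E by (intro mult_carrier_mat) auto
  have "posdef (H + mat_adjoint E * E)"
    unfolding posdef_def
  proof (intro conjI ballI impI)
    show "mat_adjoint (H + mat_adjoint E * E) = H + mat_adjoint E * E"
      using H E EE Hpsd by (simp add: mat_adjoint_add[of _ n n] mat_adjoint_mult[of _ n n _ n] psd_def)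
    fix u :: "complex Matrix.vec"
    assume "u \<in> carrier_vec (dim_row (H + mat_adjoint E * E))" "u \<noteq> 0\<^sub>v (dim_row (H + mat_adjoint E * E))"
    hence u: "u \<in> carrier_vec n" "u \<noteq> 0\<^sub>v n" using E by auto
    have q: "qform (H + mat_adjoint E * E) u = qform H u + nsq (E *\<^sub>v u)"
      using qform_add[OF H EE u(1)] qform_gram[OF E u(1)] by simp
    have h0: "0 \<le> qform H u" using Hpsd H u(1) by (simp add: psd_def)
    show "0 < qform (H + mat_adjoint E * E) u"
    proof (rule ccontr)
      assume "\<not> ?thesis"
      hence "qform H u = 0" "nsq (E *\<^sub>v u) = 0" using q h0 nsq_nonneg[of "E *\<^sub>v u"] by linarith+
      hence "B *\<^sub>v (mat_adjoint S *\<^sub>v u) = 0\<^sub>v n" "E *\<^sub>v u = 0\<^sub>v n"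
        using psd_zero_form[OF B, of "mat_adjoint S *\<^sub>v u"] qH[OF u(1)] mult_mat_vec_carrier[OF S' u(1)]
          nsq_eq_0_iff[OF mult_mat_vec_carrier[OF E u(1)]] by simp_all
      hence "u = 0\<^sub>v n" using inj[OF u(1)] by (simp add: E_def)
      thus False using u(2) by simp
    qed
  qed
  then obtain \<delta> where \<delta>: "0 < \<delta>" "\<And>u. u \<in> carrier_vec n \<Longrightarrow> \<delta> * nsq u \<le> qform (H + mat_adjoint E * E) u"
    using posdef_bound[of "H + mat_adjoint E * E" n] H EE by (metis add_carrier_mat)
  have f0: "0 \<le> f i" "f i \<le> entry_norm A" if "i < n" for i
    using psd_eigenvalue_bounds[OF U A(1,2) that] by auto
  define M where "M = entry_norm A + \<epsilon>"
  have M: "0 < M" "f i \<le> M" if "i < n" for i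
    using \<epsilon> f0[OF that] entry_norm_nonneg[of A] by (auto simp: M_def add_nonneg_pos)
  have M0: "0 < M" using \<epsilon> entry_norm_nonneg[of A] by (simp add: M_def add_nonneg_pos)
  define \<mu> where "\<mu> = entry_norm H"
  have \<mu>0: "0 \<le> \<mu>" by (simp add: \<mu>_def)
  \<comment> \<open>With \<open>c\<close> as defined below, the left side equals
    \<open>c * \<mu> * (\<epsilon> / 2) ^ (2 * N)\<close>, the most that eigenvalues under
    \<open>\<epsilon>/2\<close> can cost.\<close>
  obtain N where N: "2 * M * \<mu> / \<delta> * (1/4) ^ N < \<epsilon> / 2"
  proof -
    have "(\<lambda>N. 2 * M * \<mu> / \<delta> * (1/4) ^ N) \<longlonglongrightarrow> 2 * M * \<mu> / \<delta> * 0"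
      by (intro tendsto_intros LIMSEQ_power_zero) simp
    hence "eventually (\<lambda>N. 2 * M * \<mu> / \<delta> * (1/4) ^ N < \<epsilon> / 2) sequentially"
      using \<epsilon> by (intro order_tendstoD) auto
    thus thesis using that by (auto simp: eventually_sequentially)
  qed
  \<comment> \<open>Chosen so that the gain \<open>c * (\<delta> / 2) * t ^ (2 * N)\<close> equals
    \<open>M\<close> at \<open>t = \<epsilon>\<close>; from there on it outweighs every eigenvalue
    of \<open>A\<close>.\<close>
  define c where "c = 2 * M / (\<delta> * \<epsilon> ^ (2 * N))"
  have c0: "0 < c" using M0 \<delta>(1) \<epsilon> by (simp add: c_def)
  define hi where "hi i \<longleftrightarrow> \<epsilon> / 2 \<le> f i" for i
  \<comment> \<open>A lower bound for the contribution of eigenvalue \<open>f i\<close> to the form,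
    with \<open>\<delta> / 2\<close> coming from \<open>qform_triangle\<close>. Between
    \<open>\<epsilon>/2\<close> and \<open>\<epsilon>\<close> it is positive because
    \<open>\<epsilon> - f i\<close> already is.\<close>
  define br where "br i = (if hi i then c * (\<delta> / 2) * f i ^ (2 * N) else - c * \<mu> * f i ^ (2 * N)) + \<epsilon> - f i" for i
  have br: "0 < br i" if i: "i < n" for i
  proof -
    consider "\<epsilon> \<le> f i" | "\<epsilon> / 2 \<le> f i" "f i < \<epsilon>" | "f i < \<epsilon> / 2" by linarith
    thus ?thesis
    proof cases
      case 1
      have "\<epsilon> ^ (2 * N) \<le> f i ^ (2 * N)" using 1 \<epsilon> by (intro power_mono) auto
      hence "c * (\<delta> / 2) * \<epsilon> ^ (2 * N) \<le> c * (\<delta> / 2) * f i ^ (2 * N)"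
        using c0 \<delta>(1) by (intro mult_left_mono) auto
      moreover have "c * (\<delta> / 2) * \<epsilon> ^ (2 * N) = M" using \<delta>(1) \<epsilon> by (simp add: c_def)
      moreover have "hi i" using 1 \<epsilon> by (simp add: hi_def)
      ultimately show ?thesis using M(2)[OF i] \<epsilon> by (simp add: br_def)
    next
      case 2
      have "0 \<le> c * (\<delta> / 2) * f i ^ (2 * N)" using c0 \<delta>(1) f0[OF i] by simp
      thus ?thesis using 2 by (simp add: br_def hi_def)
    next
      case 3
      have "f i ^ (2 * N) \<le> (\<epsilon> / 2) ^ (2 * N)" using 3 f0[OF i] by (intro power_mono) auto
      hence "c * \<mu> * f i ^ (2 * N) \<le> c * \<mu> * (\<epsilon> / 2) ^ (2 * N)" using c0 \<mu>0 by (intro mult_left_mono) auto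
      also have "(\<epsilon> / 2) ^ (2 * N) = \<epsilon> ^ (2 * N) * (1/4) ^ N"
        by (simp add: power_mult power2_eq_square power_divide)
      also have "c * \<mu> * (\<epsilon> ^ (2 * N) * (1/4) ^ N) = 2 * M * \<mu> / \<delta> * (1/4) ^ N"
        using \<epsilon> \<delta>(1) by (simp add: c_def field_simps)
      finally have "c * \<mu> * f i ^ (2 * N) < \<epsilon> / 2" using N by linarith
      thus ?thesis using 3 by (simp add: br_def hi_def)
    qed
  qed
  have "posdef (dominate \<epsilon> N c A B S)"
    unfolding posdef_def
  proof (intro conjI ballI impI)
    show "mat_adjoint (dominate \<epsilon> N c A B S) = dominate \<epsilon> N c A B S"
      by (rule dominate_hermitian[OF Ac Ah B(1) Bh S])
    fix u :: "complex Matrix.vec"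
    assume "u \<in> carrier_vec (dim_row (dominate \<epsilon> N c A B S))" "u \<noteq> 0\<^sub>v (dim_row (dominate \<epsilon> N c A B S))"
    hence u: "u \<in> carrier_vec n" "u \<noteq> 0\<^sub>v n" using dominate_carrier[OF Ac B(1) S, of \<epsilon> N c] by auto
    define y where "y = mat_adjoint U *\<^sub>v u"
    have y: "y \<in> carrier_vec n" using U' u by (simp add: y_def)
    define w1 where "w1 = U *\<^sub>v vec n (\<lambda>i. if hi i then complex_of_real (f i ^ N) * vec_index y i else 0)"
    define w2 where "w2 = U *\<^sub>v vec n (\<lambda>i. if hi i then 0 else complex_of_real (f i ^ N) * vec_index y i)"
    have w: "w1 \<in> carrier_vec n" "w2 \<in> carrier_vec n" using Uc by (simp_all add: w1_def w2_def)
    have pw: "(cmod (complex_of_real (f i ^ N) * z))\<^sup>2 = f i ^ (2 * N) * (cmod z)\<^sup>2" for i z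
    proof -
      have "(cmod (complex_of_real (f i ^ N) * z))\<^sup>2 = (\<bar>f i ^ N\<bar>)\<^sup>2 * (cmod z)\<^sup>2"
        by (simp only: norm_mult norm_of_real power_mult_distrib)
      thus ?thesis by (simp only: power2_abs power_mult[symmetric] mult.commute[of N 2])
    qed
    have n1: "nsq w1 = (\<Sum>i<n. if hi i then f i ^ (2 * N) * (cmod (vec_index y i))\<^sup>2 else 0)"
    proof -
      have "nsq w1 = nsq (vec n (\<lambda>i. if hi i then complex_of_real (f i ^ N) * vec_index y i else 0))"
        unfolding w1_def by (rule nsq_unitary(1)[OF U]) simp
      also have "\<dots> = (\<Sum>i<n. if hi i then f i ^ (2 * N) * (cmod (vec_index y i))\<^sup>2 else 0)"
        by (subst nsq_sum[of _ n]) (auto simp: pw simp del: of_real_power intro!: sum.cong)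
      finally show ?thesis .
    qed
    have n2: "nsq w2 = (\<Sum>i<n. if hi i then 0 else f i ^ (2 * N) * (cmod (vec_index y i))\<^sup>2)"
    proof -
      have "nsq w2 = nsq (vec n (\<lambda>i. if hi i then 0 else complex_of_real (f i ^ N) * vec_index y i))"
        unfolding w2_def by (rule nsq_unitary(1)[OF U]) simp
      also have "\<dots> = (\<Sum>i<n. if hi i then 0 else f i ^ (2 * N) * (cmod (vec_index y i))\<^sup>2)"
        by (subst nsq_sum[of _ n]) (auto simp: pw simp del: of_real_power intro!: sum.cong)
      finally show ?thesis .
    qed
    have ANu: "A ^\<^sub>m N *\<^sub>v u = w1 + w2"
    proof -
      have "A ^\<^sub>m N = U * diagm n (\<lambda>i. complex_of_real (f i) ^ N) * mat_adjoint U"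
        unfolding A(1) by (rule unitary_diag_pow[OF U])
      hence "A ^\<^sub>m N *\<^sub>v u = U *\<^sub>v (diagm n (\<lambda>i. complex_of_real (f i) ^ N) *\<^sub>v y)"
        by (simp only: unitary_diag_mult_vec[OF U u(1)] y_def)
      also have "diagm n (\<lambda>i. complex_of_real (f i) ^ N) *\<^sub>v y
          = vec n (\<lambda>i. if hi i then complex_of_real (f i ^ N) * vec_index y i else 0)
          + vec n (\<lambda>i. if hi i then 0 else complex_of_real (f i ^ N) * vec_index y i)"
        unfolding diagm_mult_vec[OF y] by (intro eq_vecI) auto
      also have "U *\<^sub>v \<dots> = w1 + w2"
        unfolding w1_def w2_def by (intro mult_add_distrib_mat_vec[OF Uc(1)]) auto
      finally show ?thesis .
    qed
    have Ew1: "E *\<^sub>v w1 = 0\<^sub>v n"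
    proof -
      let ?z = "vec n (\<lambda>i. if hi i then complex_of_real (f i ^ N) * vec_index y i else 0)"
      have "E *\<^sub>v w1 = U *\<^sub>v (diagm n (\<lambda>i. complex_of_real (1 - \<phi> (f i))) *\<^sub>v (mat_adjoint U *\<^sub>v w1))"
        unfolding E_def by (rule unitary_diag_mult_vec[OF U w(1)])
      also have "mat_adjoint U *\<^sub>v w1 = ?z"
        unfolding w1_def using Uc(1,2) U' by (intro mult_mat_vec_cancel[of _ n]) auto
      also have "diagm n (\<lambda>i. complex_of_real (1 - \<phi> (f i))) *\<^sub>v ?z = 0\<^sub>v n"
        by (subst diagm_mult_vec) (auto intro!: eq_vecI simp: hi_def \<phi>)
      finally show ?thesis using mult_mat_zero_vec[OF Uc(1)] by simp
    qed
    have "\<delta> * nsq w1 \<le> qform H w1"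
      using \<delta>(2)[OF w(1)] qform_add[OF H EE w(1)] qform_gram[OF E w(1)] Ew1 by (simp add: nsq_def)
    moreover have "qform H w2 \<le> \<mu> * nsq w2" using qform_le_entry_norm[OF H w(2)] by (simp add: \<mu>_def)
    moreover have "qform H w1 / 2 - qform H w2 \<le> qform H (w1 + w2)" by (rule qform_triangle[OF H Hpsd w])
    ultimately have "\<delta> / 2 * nsq w1 - \<mu> * nsq w2 \<le> qform H (w1 + w2)" by linarith
    hence "c * (\<delta> / 2 * nsq w1 - \<mu> * nsq w2) \<le> c * qform H (w1 + w2)" using c0 by simp
    also have "qform H (w1 + w2) = qform B (mat_adjoint S *\<^sub>v (A ^\<^sub>m N *\<^sub>v u))"
      using qH[of "w1 + w2"] w ANu by simp
    finally have 1: "c * (\<delta> / 2 * nsq w1 - \<mu> * nsq w2) + \<epsilon> * nsq u - qform A u \<le> qform (dominate \<epsilon> N c A B S) u"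
      unfolding qform_dominate[OF Ac Ah B(1) S u(1)] by simp
    have nu: "nsq u = (\<Sum>i<n. (cmod (vec_index y i))\<^sup>2)" unfolding y_def
      by (rule nsq_unitary_coords[OF U u(1)])
    have qA: "qform A u = (\<Sum>i<n. f i * (cmod (vec_index y i))\<^sup>2)"
      unfolding y_def A(1) by (rule qform_unitary_diag[OF U u(1)])
    have 2: "c * (\<delta> / 2 * nsq w1 - \<mu> * nsq w2) + \<epsilon> * nsq u - qform A u = (\<Sum>i<n. br i * (cmod (vec_index y i))\<^sup>2)"
      unfolding n1 n2 nu qA sum_distrib_left sum_subtractf[symmetric] sum.distrib[symmetric]
      by (intro sum.cong) (auto simp: br_def algebra_simps)
    have "0 < (\<Sum>i<n. br i * (cmod (vec_index y i))\<^sup>2)"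
    proof -
      obtain i where i: "i < n" "vec_index y i \<noteq> 0"
      proof (rule ccontr)
        assume "\<not> thesis"
        hence "nsq u = 0" unfolding nu using that by (intro sum.neutral) auto
        thus False using nsq_pos[OF u] by simp
      qed
      show ?thesis
      proof (rule sum_pos2[of _ i])
        show "0 < br i * (cmod (vec_index y i))\<^sup>2" using i br by simp
        show "0 \<le> br k * (cmod (vec_index y k))\<^sup>2" if "k \<in> {..<n}" for k
          using br[of k] that by (simp add: less_imp_le)
      qed (use i in auto)
    qed
    thus "0 < qform (dominate \<epsilon> N c A B S) u" using 1 2 by linarith
  qed
  thus ?thesis using c0 by (intro exI[of _ N] exI[of _ c]) simp
qed

section \<open>Functional calculus\<close>

lemma continuous_map_uniform_approx:
  fixes g :: "'x \<Rightarrow> complex"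
  assumes "\<And>e. 0 < e \<Longrightarrow> \<exists>h. continuous_map X euclidean h \<and> (\<forall>x\<in>topspace X. cmod (g x - h x) < e)"
  shows "continuous_map X euclidean g"
  unfolding continuous_map_def
proof (intro conjI allI impI)
  fix U :: "complex set" assume "openin euclidean U"
  hence U: "open U" by simp
  show "openin X {x \<in> topspace X. g x \<in> U}"
  proof (subst openin_subopen, intro ballI)
    fix x assume "x \<in> {x \<in> topspace X. g x \<in> U}"
    hence x: "x \<in> topspace X" "g x \<in> U" by auto
    obtain e where e: "0 < e" "ball (g x) e \<subseteq> U" using U x(2) by (rule openE)
    have "0 < e/3" using e by simp
    from assms[OF this] obtain h where h: "continuous_map X euclidean h" "\<forall>x\<in>topspace X. cmod (g x - h x) < e/3" by blast
    have "continuous_map X euclideanreal (\<lambda>y. cmod (h y - h x))"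
      using h(1) by (intro continuous_map_norm continuous_map_diff) auto
    from openin_real_less[OF this] have "openin X {y \<in> topspace X. cmod (h y - h x) < e/3}" .
    moreover have "x \<in> {y \<in> topspace X. cmod (h y - h x) < e/3}" using x e by simp
    moreover have "{y \<in> topspace X. cmod (h y - h x) < e/3} \<subseteq> {x \<in> topspace X. g x \<in> U}"
    proof
      fix y assume "y \<in> {y \<in> topspace X. cmod (h y - h x) < e/3}"
      hence y: "y \<in> topspace X" "cmod (h y - h x) < e/3" by auto
      have "g y - g x = (g y - h y) + (h y - h x) - (g x - h x)" by simp
      hence "cmod (g y - g x) \<le> cmod ((g y - h y) + (h y - h x)) + cmod (g x - h x)"
        by (simp only: norm_triangle_ineq4)
      moreover have "cmod ((g y - h y) + (h y - h x)) \<le> cmod (g y - h y) + cmod (h y - h x)"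
        by (rule norm_triangle_ineq)
      ultimately have "cmod (g y - g x) < e" using y(2) bspec[OF h(2) x(1)] bspec[OF h(2) y(1)] by linarith
      hence "g y \<in> ball (g x) e" by (simp add: dist_norm norm_minus_commute)
      thus "y \<in> {x \<in> topspace X. g x \<in> U}" using e(2) y(1) by blast
    qed
    ultimately show "\<exists>T. openin X T \<and> x \<in> T \<and> T \<subseteq> {x \<in> topspace X. g x \<in> U}" by blast
  qed
qed simp

text \<open>Real coefficients keep Hermitian matrices Hermitian. The corresponding operation on
  algebra elements is \<open>epoly\<close>.\<close>

primrec mpoly :: "(nat \<Rightarrow> real) \<Rightarrow> nat \<Rightarrow> complex mat \<Rightarrow> complex mat" where
  "mpoly c 0 M = complex_of_real (c 0) \<cdot>\<^sub>m 1\<^sub>m (dim_row M)"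
| "mpoly c (Suc N) M = mpoly c N M + complex_of_real (c (Suc N)) \<cdot>\<^sub>m (M ^\<^sub>m Suc N)"

lemma mpoly_carrier: "M \<in> carrier_mat n n \<Longrightarrow> mpoly c N M \<in> carrier_mat n n"
  by (induction N) (auto intro!: add_carrier_mat smult_carrier_mat mult_carrier_mat)

lemma unitary_diag_smult:
  assumes U: "unitary_mat n U"
  shows "z \<cdot>\<^sub>m (U * diagm n h * mat_adjoint U) = U * diagm n (\<lambda>i. z * h i) * mat_adjoint U"
proof -
  have Uc: "U \<in> carrier_mat n n" using U by (simp add: unitary_mat_def)
  show ?thesis using Uc mat_adjoint_carrier[OF Uc]
    by (simp add: mult_smult_distrib[of _ n n _ n] mult_smult_assoc_mat[of _ n n _ n] mult_carrier_mat[of _ n n _ n] flip: diagm_smult)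
qed

lemma mpoly_unitary_diag:
  assumes U: "unitary_mat n U"
  shows "mpoly c N (U * diagm n (\<lambda>i. complex_of_real (f i)) * mat_adjoint U)
    = U * diagm n (\<lambda>i. complex_of_real (\<Sum>k\<le>N. c k * f i ^ k)) * mat_adjoint U"
proof (induction N)
  case 0
  have "dim_row U = n" using U by (auto simp: unitary_mat_def)
  thus ?case using unitary_diag_const[OF U, of "complex_of_real (c 0)"] by simp
next
  case (Suc N)
  show ?case
    unfolding mpoly.simps Suc.IH unitary_diag_pow[OF U] unitary_diag_smult[OF U] unitary_diag_add[OF U]
    by simp
qed

lemma cont_mat_fun_mpoly: "cont_mat_fun X m f \<Longrightarrow> cont_mat_fun X m (\<lambda>x. mpoly c N (f x))"
proof (induction N)
  case 0
  have "cont_mat_fun X m (\<lambda>x. complex_of_real (c 0) \<cdot>\<^sub>m 1\<^sub>m m)" by (rule cont_mat_fun_const) simp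
  thus ?case by (rule cont_mat_fun_cong) (use cont_mat_fun_dim[OF 0] in simp)
next
  case (Suc N)
  show ?case unfolding mpoly.simps
    by (intro cont_mat_fun_add cont_mat_fun_smult cont_mat_fun_pow Suc)
qed

lemma polynomial_approximation:
  fixes \<phi> :: "real \<Rightarrow> real"
  assumes "continuous_on {l..u} \<phi>" "0 < e"
  obtains c N where "\<forall>t\<in>{l..u}. \<bar>\<phi> t - (\<Sum>k\<le>N. c k * t ^ k)\<bar> < e"
proof -
  obtain g where g: "real_polynomial_function g" "\<And>x. x \<in> {l..u} \<Longrightarrow> \<bar>\<phi> x - g x\<bar> < e"
    using Stone_Weierstrass_real_polynomial_function[of "{l..u}" \<phi> e] assms by auto
  from real_polynomial_function_imp_sum[OF g(1)] obtain c N where "g = (\<lambda>x. \<Sum>k\<le>N. c k * x ^ k)" by blast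
  hence "\<forall>t\<in>{l..u}. \<bar>\<phi> t - (\<Sum>k\<le>N. c k * t ^ k)\<bar> < e" using g(2) by simp
  thus thesis by (rule that)
qed

lemma unitary_entry_le:
  assumes U: "unitary_mat n U" and ik: "i < n" "k < n"
  shows "cmod (U $$ (i, k)) \<le> 1"
proof -
  have Uc: "U \<in> carrier_mat n n" using U by (simp add: unitary_mat_def)
  have u: "unit_vec n k \<in> carrier_vec n" by simp
  have n1: "nsq (unit_vec n k) = 1"
  proof -
    have "nsq (unit_vec n k) = (\<Sum>i<n. if i = k then 1 else 0)"
      unfolding nsq_sum[OF u] using ik by (intro sum.cong) auto
    thus ?thesis using ik by simp
  qed
  have "vec_index (U *\<^sub>v unit_vec n k) i = (\<Sum>j<n. if j = k then U $$ (i, k) else 0)"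
    unfolding mult_mat_vec_index_sum[OF Uc u ik(1)] using ik by (intro sum.cong) auto
  hence "vec_index (U *\<^sub>v unit_vec n k) i = U $$ (i, k)" using ik by simp
  thus ?thesis
    using vec_index_le_sqrt_nsq[OF mult_mat_vec_carrier[OF Uc u] ik(1)] nsq_unitary(1)[OF U u] n1 by simp
qed

text \<open>Entries of unitaries have modulus at most 1, so each of the \<open>n * n\<close> entries
  is a sum of \<open>n\<close> terms bounded by \<open>e\<close>. The crude constant is harmless
  because \<open>e\<close> will be arbitrarily small.\<close>

lemma entry_norm_unitary_diag_le:
  assumes U: "unitary_mat n U" and h: "\<And>i. i < n \<Longrightarrow> cmod (h i) \<le> e"
  shows "entry_norm (U * diagm n h * mat_adjoint U) \<le> real n * real n * real n * e"
proof -
  have "cmod ((U * diagm n h * mat_adjoint U) $$ (i, l)) \<le> real n * e" if il: "i < n" "l < n" for i l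
  proof -
    have "cmod (U $$ (i, k) * h k * cnj (U $$ (l, k))) \<le> e" if k: "k < n" for k
    proof -
      have e0: "0 \<le> e" using h[OF k] norm_ge_zero order_trans by blast
      have "cmod (U $$ (i, k)) * cmod (h k) * cmod (U $$ (l, k)) \<le> 1 * e * 1"
        using unitary_entry_le[OF U il(1) k] unitary_entry_le[OF U il(2) k] h[OF k] e0
        by (intro mult_mono) auto
      thus ?thesis by (simp add: norm_mult)
    qed
    hence "cmod (\<Sum>k<n. U $$ (i, k) * h k * cnj (U $$ (l, k))) \<le> (\<Sum>k<n. e)"
      by (intro sum_norm_le) auto
    thus ?thesis unfolding unitary_diag_index[OF U il] by simp
  qed
  moreover have "entry_norm (U * diagm n h * mat_adjoint U) = (\<Sum>i<n. \<Sum>l<n. cmod ((U * diagm n h * mat_adjoint U) $$ (i, l)))"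
    using carrier_matD[OF unitary_diag_carrier[OF U, of h]] unfolding entry_norm_def by (simp only:)
  ultimately have "entry_norm (U * diagm n h * mat_adjoint U) \<le> (\<Sum>i<n. \<Sum>l<n. real n * e)"
    by (simp only:) (intro sum_mono, auto)
  thus ?thesis by (simp add: mult.assoc)
qed

lemma unitary_diag_minus:
  assumes U: "unitary_mat n U"
  shows "(U * diagm n f * mat_adjoint U) - (U * diagm n g * mat_adjoint U) = U * diagm n (\<lambda>i. f i - g i) * mat_adjoint U"
proof -
  note c = unitary_diag_carrier[OF U]
  have "(U * diagm n f * mat_adjoint U) - (U * diagm n g * mat_adjoint U)
      = (U * diagm n f * mat_adjoint U) + (-1) \<cdot>\<^sub>m (U * diagm n g * mat_adjoint U)"
    using carrier_matD[OF c[of f]] carrier_matD[OF c[of g]] by (intro eq_matI) auto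
  also have "\<dots> = U * diagm n (\<lambda>i. f i - g i) * mat_adjoint U"
    unfolding unitary_diag_smult[OF U] unitary_diag_add[OF U] by simp
  finally show ?thesis .
qed

lemma mpoly_approx:
  assumes U: "unitary_mat n U" and M: "M = U * diagm n (\<lambda>i. complex_of_real (f i)) * mat_adjoint U"
    and e: "\<And>i. i < n \<Longrightarrow> \<bar>\<phi> (f i) - (\<Sum>k\<le>N. c k * f i ^ k)\<bar> \<le> e"
  shows "entry_norm (U * diagm n (\<lambda>i. complex_of_real (\<phi> (f i))) * mat_adjoint U - mpoly c N M) \<le> real n * real n * real n * e"
  unfolding M mpoly_unitary_diag[OF U] unitary_diag_minus[OF U]
  by (rule entry_norm_unitary_diag_le[OF U]) (simp only: of_real_diff[symmetric] norm_of_real e)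

text \<open>Independence of the chosen diagonalization, for continuous \<open>\<phi>\<close>, is \<open>fcalc_eq\<close>.\<close>

definition fcalc :: "nat \<Rightarrow> (real \<Rightarrow> real) \<Rightarrow> complex mat \<Rightarrow> complex mat" where
  "fcalc n \<phi> M = (SOME Z. \<exists>U f. unitary_mat n U \<and> M = U * diagm n (\<lambda>i. complex_of_real (f i)) * mat_adjoint U \<and>
     Z = U * diagm n (\<lambda>i. complex_of_real (\<phi> (f i))) * mat_adjoint U)"

lemma fcalcE:
  assumes "M \<in> carrier_mat n n" "mat_adjoint M = M"
  obtains U f where "unitary_mat n U" "M = U * diagm n (\<lambda>i. complex_of_real (f i)) * mat_adjoint U"
    "fcalc n \<phi> M = U * diagm n (\<lambda>i. complex_of_real (\<phi> (f i))) * mat_adjoint U"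
proof -
  let ?P = "\<lambda>Z. \<exists>U f. unitary_mat n U \<and> M = U * diagm n (\<lambda>i. complex_of_real (f i)) * mat_adjoint U \<and>
     Z = U * diagm n (\<lambda>i. complex_of_real (\<phi> (f i))) * mat_adjoint U"
  have "\<exists>Z. ?P Z" using hermitian_diagonalization_exists[OF assms] by metis
  hence "?P (fcalc n \<phi> M)" unfolding fcalc_def by (rule someI_ex)
  thus thesis using that by blast
qed

text \<open>\<open>mpoly c N M\<close> depends on \<open>M\<close> only. Approximating
  \<open>\<phi>\<close> uniformly by polynomials on an interval that contains both lists of
  eigenvalues brings the results of the two diagonalizations arbitrarily close to each
  other.\<close>

lemma fcalc_eq:
  assumes U: "unitary_mat n U" and M: "M = U * diagm n (\<lambda>i. complex_of_real (f i)) * mat_adjoint U"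
    and h: "mat_adjoint M = M" and \<phi>: "continuous_on UNIV \<phi>"
  shows "fcalc n \<phi> M = U * diagm n (\<lambda>i. complex_of_real (\<phi> (f i))) * mat_adjoint U"
proof -
  have Mc: "M \<in> carrier_mat n n" unfolding M by (rule unitary_diag_carrier[OF U])
  obtain V g where V: "unitary_mat n V" "M = V * diagm n (\<lambda>i. complex_of_real (g i)) * mat_adjoint V"
    "fcalc n \<phi> M = V * diagm n (\<lambda>i. complex_of_real (\<phi> (g i))) * mat_adjoint V" by (rule fcalcE[OF Mc h])
  let ?Z = "U * diagm n (\<lambda>i. complex_of_real (\<phi> (f i))) * mat_adjoint U"
  have Zc: "?Z \<in> carrier_mat n n" "fcalc n \<phi> M \<in> carrier_mat n n"
    unfolding V(3) by (rule unitary_diag_carrier[OF U], rule unitary_diag_carrier[OF V(1)])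
  define B where "B = Max (insert 0 ((\<lambda>i. \<bar>f i\<bar>) ` {..<n} \<union> (\<lambda>i. \<bar>g i\<bar>) ` {..<n}))"
  have B: "f i \<in> {-B..B}" "g i \<in> {-B..B}" if "i < n" for i
  proof -
    have "\<bar>f i\<bar> \<le> B" "\<bar>g i\<bar> \<le> B" unfolding B_def using that by (intro Max_ge; simp)+
    thus "f i \<in> {-B..B}" "g i \<in> {-B..B}" by auto
  qed
  have small: "entry_norm (fcalc n \<phi> M - ?Z) \<le> 2 * (real n * real n * real n * e)" if e: "0 < e" for e
  proof -
    have co: "continuous_on {-B..B} \<phi>" using \<phi> by (rule continuous_on_subset) simp
    obtain c N where c: "\<forall>t\<in>{-B..B}. \<bar>\<phi> t - (\<Sum>k\<le>N. c k * t ^ k)\<bar> < e"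
      by (rule polynomial_approximation[OF co e])
    have 1: "entry_norm (?Z - mpoly c N M) \<le> real n * real n * real n * e"
      by (rule mpoly_approx[OF U M less_imp_le[OF bspec[OF c B(1)]]])
    have 2: "entry_norm (fcalc n \<phi> M - mpoly c N M) \<le> real n * real n * real n * e"
      unfolding V(3) by (rule mpoly_approx[OF V(1,2) less_imp_le[OF bspec[OF c B(2)]]])
    have "entry_norm (fcalc n \<phi> M - ?Z) \<le> entry_norm (fcalc n \<phi> M - mpoly c N M) + entry_norm (mpoly c N M - ?Z)"
      by (rule entry_norm_triangle[OF Zc(2) mpoly_carrier[OF Mc] Zc(1)])
    also have "entry_norm (mpoly c N M - ?Z) = entry_norm (?Z - mpoly c N M)"
      by (rule entry_norm_minus_commute[OF mpoly_carrier[OF Mc] Zc(1)])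
    finally show ?thesis using 1 2 by linarith
  qed
  have "entry_norm (fcalc n \<phi> M - ?Z) \<le> 0"
  proof (rule field_le_epsilon)
    fix e :: real assume e: "0 < e"
    define q where "q = 2 * (real n * real n * real n) + 1"
    have q: "0 < q" by (simp add: q_def add_nonneg_pos)
    have "entry_norm (fcalc n \<phi> M - ?Z) \<le> (q - 1) * (e / q)" using small[of "e / q"] e q by (simp add: q_def)
    also have "\<dots> \<le> q * (e / q)" using e q by (intro mult_right_mono) auto
    finally show "entry_norm (fcalc n \<phi> M - ?Z) \<le> 0 + e" using q by simp
  qed
  hence "entry_norm (fcalc n \<phi> M - ?Z) = 0" using entry_norm_nonneg by (simp add: antisym)
  hence z: "fcalc n \<phi> M - ?Z = 0\<^sub>m n n"
    using entry_norm_eq_0_iff[of "fcalc n \<phi> M - ?Z" n n] minus_carrier_mat[OF Zc(1)] by blast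
  show ?thesis
  proof (rule eq_matI)
    fix i l assume "i < dim_row ?Z" "l < dim_col ?Z"
    hence il: "i < n" "l < n" using carrier_matD[OF Zc(1)] by (simp_all only:)
    have "(fcalc n \<phi> M - ?Z) $$ (i, l) = 0" unfolding z using il by simp
    moreover have "(fcalc n \<phi> M - ?Z) $$ (i, l) = fcalc n \<phi> M $$ (i, l) - ?Z $$ (i, l)"
      using il carrier_matD[OF Zc(1)] by (intro index_minus_mat(1)) (simp_all only:)
    ultimately have "fcalc n \<phi> M $$ (i, l) - ?Z $$ (i, l) = 0" by (rule trans[OF sym, rotated])
    thus "fcalc n \<phi> M $$ (i, l) = ?Z $$ (i, l)" by (simp only: right_minus_eq)
  qed (use carrier_matD[OF Zc(1)] carrier_matD[OF Zc(2)] in \<open>simp_all only:\<close>)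
qed

text \<open>The eigenvalues of all \<open>a x\<close> lie in one interval \<open>{0..B}\<close>, so
  the polynomial approximations are uniform in \<open>x\<close>, and a uniform limit of continuous
  functions is continuous.\<close>

lemma cont_mat_fun_fcalc:
  assumes X: "compact_space X" and a: "cont_mat_fun X n a" and p: "\<And>x. x \<in> topspace X \<Longrightarrow> psd (a x)"
    and \<phi>: "continuous_on UNIV \<phi>"
  shows "cont_mat_fun X n (\<lambda>x. fcalc n \<phi> (a x))"
proof -
  note ca = cont_mat_funD(1)[OF a]
  have h: "mat_adjoint (a x) = a x" if "x \<in> topspace X" for x using p[OF that] by (simp add: psd_def)
  have fc: "fcalc n \<phi> (a x) \<in> carrier_mat n n" if x: "x \<in> topspace X" for x
  proof -
    obtain U f where U: "unitary_mat n U" "a x = U * diagm n (\<lambda>i. complex_of_real (f i)) * mat_adjoint U"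
      "fcalc n \<phi> (a x) = U * diagm n (\<lambda>i. complex_of_real (\<phi> (f i))) * mat_adjoint U" by (rule fcalcE[OF ca[OF x] h[OF x]])
    show ?thesis unfolding U(3) by (rule unitary_diag_carrier[OF U(1)])
  qed
  obtain B where B: "0 < B" "\<forall>x\<in>topspace X. entry_norm (a x) \<le> B" by (rule cont_mat_fun_bounded[OF X a])
  show ?thesis
  proof (rule cont_mat_funI[OF fc])
    fix i l assume il: "i < n" "l < n"
    show "continuous_map X euclidean (\<lambda>x. fcalc n \<phi> (a x) $$ (i, l))"
    proof (rule continuous_map_uniform_approx)
      fix e :: real assume e: "0 < e"
      define q where "q = real n * real n * real n + 1"
      have q: "0 < q" by (simp add: q_def add_nonneg_pos)
      have eq: "0 < e / q" using e q by simp
      have co: "continuous_on {0..B} \<phi>" using \<phi> by (rule continuous_on_subset) simp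
      obtain c N where c: "\<forall>t\<in>{0..B}. \<bar>\<phi> t - (\<Sum>k\<le>N. c k * t ^ k)\<bar> < e / q"
        by (rule polynomial_approximation[OF co eq])
      have "cmod (fcalc n \<phi> (a x) $$ (i, l) - mpoly c N (a x) $$ (i, l)) < e" if x: "x \<in> topspace X" for x
      proof -
        obtain U f where U: "unitary_mat n U" "a x = U * diagm n (\<lambda>i. complex_of_real (f i)) * mat_adjoint U"
          "fcalc n \<phi> (a x) = U * diagm n (\<lambda>i. complex_of_real (\<phi> (f i))) * mat_adjoint U" by (rule fcalcE[OF ca[OF x] h[OF x]])
        have f: "f i \<in> {0..B}" if "i < n" for i
          using psd_eigenvalue_bounds[OF U(1,2) p[OF x] that] B(2) x by force
        note mc = mpoly_carrier[OF ca[OF x], of c N]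
        have "entry_norm (fcalc n \<phi> (a x) - mpoly c N (a x)) \<le> real n * real n * real n * (e / q)"
          unfolding U(3) by (rule mpoly_approx[OF U(1,2) less_imp_le[OF bspec[OF c f]]])
        also have "\<dots> < q * (e / q)" using eq by (simp add: q_def distrib_right del: times_divide_eq_right)
        also have "\<dots> = e" using q by simp
        finally have "entry_norm (fcalc n \<phi> (a x) - mpoly c N (a x)) < e" .
        moreover have "cmod ((fcalc n \<phi> (a x) - mpoly c N (a x)) $$ (i, l)) \<le> entry_norm (fcalc n \<phi> (a x) - mpoly c N (a x))"
          using il mc by (intro entry_norm_entry_le) auto
        ultimately show ?thesis using il mc by auto
      qed
      thus "\<exists>h. continuous_map X euclidean h \<and> (\<forall>x\<in>topspace X. cmod (fcalc n \<phi> (a x) $$ (i, l) - h x) < e)"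
        using cont_mat_funD(2)[OF cont_mat_fun_mpoly[OF a] il] by blast
    qed
  qed
qed

section \<open>From ranks at a point to domination near it\<close>

lemma entry_norm_adjoint [simp]:
  fixes A :: "complex mat"
  shows "entry_norm (mat_adjoint A) = entry_norm A"
proof -
  have "entry_norm (mat_adjoint A) = (\<Sum>i<dim_col A. \<Sum>j<dim_row A. cmod (A $$ (j, i)))"
    unfolding entry_norm_def by (simp only: mat_adjoint_dim) (intro sum.cong refl, simp)
  also have "\<dots> = entry_norm A" unfolding entry_norm_def by (rule sum.swap)
  finally show ?thesis .
qed

lemma diagonal_det_nonzero:
  assumes "\<And>i. i < n \<Longrightarrow> h i \<noteq> 0" shows "Determinant.det (diagm n h) \<noteq> 0"
proof
  assume "Determinant.det (diagm n h) = 0"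
  then obtain v where v: "v \<in> carrier_vec n" "v \<noteq> 0\<^sub>v n" "diagm n h *\<^sub>v v = 0\<^sub>v n"
    using det_0_iff_vec_prod_zero_field[OF diagm_carrier(1)] by blast
  have "vec_index v i = 0" if i: "i < n" for i
  proof -
    have "vec_index (diagm n h *\<^sub>v v) i = h i * vec_index v i"
      unfolding diagm_mult_vec[OF v(1)] using i by simp
    thus ?thesis using v(3) assms[OF i] i by simp
  qed
  hence "v = 0\<^sub>v n" using v(1) by (intro eq_vecI) auto
  thus False using v(2) by simp
qed

lemma unitary_det_nonzero:
  assumes U: "unitary_mat n U" shows "Determinant.det U \<noteq> 0"
proof
  assume z: "Determinant.det U = 0"
  have Uc: "U \<in> carrier_mat n n" "U * mat_adjoint U = 1\<^sub>m n" using U by (auto simp: unitary_mat_def)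
  have "Determinant.det (U * mat_adjoint U) = 0"
    using det_mult[OF Uc(1) mat_adjoint_carrier[OF Uc(1)]] z by simp
  thus False using Uc(2) by simp
qed

text \<open>Linear between 0 and \<open>\<epsilon>/2\<close>. The function
  \<open>1 - cutoff \<epsilon>\<close> is 1 at eigenvalue 0 and vanishes at the eigenvalues that
  have to be dominated.\<close>

definition cutoff :: "real \<Rightarrow> real \<Rightarrow> real" where
  "cutoff \<epsilon> t = min 1 (max 0 (2 * t / \<epsilon>))"

lemma continuous_on_cutoff: "continuous_on UNIV (cutoff \<epsilon>)"
proof -
  have "continuous_on UNIV (\<lambda>t. min 1 (max 0 (t * (2 / \<epsilon>))))"
    by (intro continuous_on_min continuous_on_max continuous_intros)
  thus ?thesis by (simp add: cutoff_def[abs_def] mult.commute)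
qed

lemma cutoff_eq_1: "0 < \<epsilon> \<Longrightarrow> \<epsilon> / 2 \<le> t \<Longrightarrow> cutoff \<epsilon> t = 1"
  by (simp add: cutoff_def min_def max_def field_simps)

lemma cutoff_0 [simp]: "cutoff \<epsilon> 0 = 0"
  by (simp add: cutoff_def)

lemma indicator_diagm_mult_index:
  assumes A: "A \<in> carrier_mat n n" and "i < n" "l < n"
  shows "(indicator_diagm n P * A) $$ (i, l) = (if P i then A $$ (i, l) else 0)"
proof -
  have "(indicator_diagm n P * A) $$ (i, l) = (\<Sum>k<n. if k = i then (if P i then A $$ (i, l) else 0) else 0)"
    unfolding mult_mat_index_sum[OF diagm_carrier(1) A assms(2,3)] using assms by (intro sum.cong) auto
  thus ?thesis using assms by simp
qed

lemma indicator_diagm_mult_vec: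
  assumes "v \<in> carrier_vec n" "i < n"
  shows "vec_index (indicator_diagm n P *\<^sub>v v) i = (if P i then vec_index v i else 0)"
  unfolding diagm_mult_vec[OF assms(1)] using assms by simp

text \<open>Two coordinate changes, invertible near \<open>x0\<close>, reduce \<open>inj\<close> of
  \<open>dominate_posdef_exists\<close> to a statement on columns. In the coordinates
  \<open>L x\<close> the kernel of \<open>E x\<close> lies in the span of the first \<open>r\<close>
  axes; and \<open>BB x\<close> together with \<open>V\<close> sends the kernel of
  \<open>b x\<close> into the vectors whose first \<open>j\<close> coordinates vanish. So it is
  enough that the first \<open>r\<close> columns of the first \<open>j\<close> rows of the
  transformed matrix are independent.\<close>

lemma dominate_locally_perturbable:
  assumes X: "compact_space X" "Hausdorff_space X" and dim: "covdim_le X d"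
    and a: "cont_mat_fun X n a" "\<And>x. x \<in> topspace X \<Longrightarrow> psd (a x)"
    and b: "cont_mat_fun X n b" "\<And>x. x \<in> topspace X \<Longrightarrow> psd (b x)"
    and x0: "x0 \<in> topspace X" and \<epsilon>: "0 < \<epsilon>"
    and rk: "mrank (a x0) \<le> mrank (b x0)" "d < 2 * (mrank (b x0) + 1 - mrank (a x0))"
  shows "locally_perturbable X n (\<lambda>x S. \<exists>N c. 0 \<le> c \<and> posdef (dominate \<epsilon> N c (a x) (b x) S)) x0"
proof -
  note ca = cont_mat_funD(1)[OF a(1)] and cb = cont_mat_funD(1)[OF b(1)]
  have ha: "mat_adjoint (a x) = a x" and hb: "mat_adjoint (b x) = b x" if "x \<in> topspace X" for x
    using a(2)[OF that] b(2)[OF that] by (simp_all add: psd_def)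
  obtain U f r where U: "unitary_mat n U" "a x0 = U * diagm n (\<lambda>i. complex_of_real (f i)) * mat_adjoint U"
    "r \<le> n" "\<And>i. i < n \<Longrightarrow> f i \<noteq> 0 \<longleftrightarrow> i < r"
    using hermitian_diagonalization[OF ca[OF x0] ha[OF x0]] by metis
  obtain V g j where V: "unitary_mat n V" "b x0 = V * diagm n (\<lambda>i. complex_of_real (g i)) * mat_adjoint V"
    "j \<le> n" "\<And>i. i < n \<Longrightarrow> g i \<noteq> 0 \<longleftrightarrow> i < j"
    using hermitian_diagonalization[OF cb[OF x0] hb[OF x0]] by metis
  have r: "mrank (a x0) = r" unfolding mrank_def carrier_matD(1)[OF ca[OF x0]]
    unfolding U(2) using U(4) by (intro rank_unitary_diag[OF U(1) _ U(3)]) simp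
  have j: "mrank (b x0) = j" unfolding mrank_def carrier_matD(1)[OF cb[OF x0]]
    unfolding V(2) using V(4) by (intro rank_unitary_diag[OF V(1) _ V(3)]) simp
  have rj: "r \<le> j" "d < 2 * (j + 1 - r)" using rk r j by auto
  have Uc: "U \<in> carrier_mat n n" "mat_adjoint U * U = 1\<^sub>m n" "U * mat_adjoint U = 1\<^sub>m n"
    using U(1) by (auto simp: unitary_mat_def)
  have Vc: "V \<in> carrier_mat n n" "mat_adjoint V * V = 1\<^sub>m n" "V * mat_adjoint V = 1\<^sub>m n"
    using V(1) by (auto simp: unitary_mat_def)
  note U' = mat_adjoint_carrier[OF Uc(1)] and V' = mat_adjoint_carrier[OF Vc(1)]
  define \<phi> where "\<phi> = cutoff \<epsilon>"
  have \<phi>: "continuous_on UNIV \<phi>" "\<And>t. \<epsilon> / 2 \<le> t \<Longrightarrow> \<phi> t = 1" "\<phi> 0 = 0"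
    using continuous_on_cutoff cutoff_eq_1[OF \<epsilon>] by (simp_all add: \<phi>_def)
  define E where "E x = fcalc n (\<lambda>t. 1 - \<phi> t) (a x)" for x
  have \<phi>1: "continuous_on UNIV (\<lambda>t. 1 - \<phi> t)" by (intro continuous_intros \<phi>(1))
  have E: "cont_mat_fun X n E" unfolding E_def by (rule cont_mat_fun_fcalc[OF X(1) a \<phi>1])
  note cE = cont_mat_funD(1)[OF E]
  \<comment> \<open>At \<open>x0\<close> the matrix \<open>E x0\<close> acts as 1 on the kernel of
    \<open>a x0\<close>, so the second summand supplies the missing rows and \<open>L x0\<close> is
    the adjoint of \<open>U\<close>, hence invertible. The rows from \<open>r\<close> on vanish on
    the kernel of \<open>E x\<close>.\<close>
  define L where "L x = indicator_diagm n (\<lambda>i. i < r) * mat_adjoint U + indicator_diagm n (\<lambda>i. \<not> i < r) * (mat_adjoint U * E x)" for x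
  have L: "cont_mat_fun X n L" unfolding L_def
    by (intro cont_mat_fun_add cont_mat_fun_mult cont_mat_fun_const E mult_carrier_mat[OF diagm_carrier(1) U'] U' diagm_carrier(1))
  \<comment> \<open>In the eigenbasis of \<open>b x0\<close> the nonzero eigenvalues fill the first
    \<open>j\<close> places, and the projection repairs the kernel; so \<open>BB x0\<close> is
    invertible.\<close>
  define BB where "BB x = mat_adjoint V * b x * V + indicator_diagm n (\<lambda>i. \<not> i < j)" for x
  have BB: "cont_mat_fun X n BB" unfolding BB_def
    by (intro cont_mat_fun_add cont_mat_fun_mult cont_mat_fun_const b(1) Vc(1) V' diagm_carrier(1))
  note cL = cont_mat_funD(1)[OF L] and cBB = cont_mat_funD(1)[OF BB]
  have L0: "Determinant.det (L x0) \<noteq> 0"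
  proof -
    have E0: "E x0 = U * diagm n (\<lambda>i. complex_of_real (1 - \<phi> (f i))) * mat_adjoint U"
      unfolding E_def by (rule fcalc_eq[OF U(1,2) ha[OF x0] \<phi>1])
    have "mat_adjoint U * E x0 = (mat_adjoint U * U) * (diagm n (\<lambda>i. complex_of_real (1 - \<phi> (f i))) * mat_adjoint U)"
      unfolding E0 using Uc(1) U' by (simp add: assoc_mult_mat[of _ n n _ n _ n] mult_carrier_mat[of _ n n _ n])
    also have "\<dots> = diagm n (\<lambda>i. complex_of_real (1 - \<phi> (f i))) * mat_adjoint U"
      unfolding Uc(2) using U' by (simp add: mult_carrier_mat[of _ n n _ n])
    finally have UE: "mat_adjoint U * E x0 = diagm n (\<lambda>i. complex_of_real (1 - \<phi> (f i))) * mat_adjoint U" .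
    have "L x0 = mat_adjoint U"
    proof (rule eq_matI)
      fix i l assume "i < dim_row (mat_adjoint U)" "l < dim_col (mat_adjoint U)"
      hence il: "i < n" "l < n" using Uc by auto
      have idx: "(diagm n (\<lambda>i. complex_of_real (1 - \<phi> (f i))) * mat_adjoint U) $$ (i, l) = mat_adjoint U $$ (i, l)" if "\<not> i < r"
      proof -
        have "f i = 0" using U(4)[OF il(1)] that by simp
        hence "(diagm n (\<lambda>i. complex_of_real (1 - \<phi> (f i))) * mat_adjoint U) $$ (i, l) = (\<Sum>k<n. if k = i then mat_adjoint U $$ (i, l) else 0)"
          unfolding mult_mat_index_sum[OF diagm_carrier(1) U' il] using il \<phi>(3) by (intro sum.cong) auto
        thus ?thesis using il by simp
      qed
      have c2: "diagm n (\<lambda>i. complex_of_real (1 - \<phi> (f i))) * mat_adjoint U \<in> carrier_mat n n"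
        by (rule mult_carrier_mat[OF diagm_carrier(1) U'])
      have "L x0 $$ (i, l) = (indicator_diagm n (\<lambda>i. i < r) * mat_adjoint U) $$ (i, l)
          + (indicator_diagm n (\<lambda>i. \<not> i < r) * (diagm n (\<lambda>i. complex_of_real (1 - \<phi> (f i))) * mat_adjoint U)) $$ (i, l)"
        unfolding L_def UE using il Uc by (intro index_add_mat(1)) auto
      thus "L x0 $$ (i, l) = mat_adjoint U $$ (i, l)"
        unfolding indicator_diagm_mult_index[OF U' il] indicator_diagm_mult_index[OF c2 il] using idx by simp
    qed (use cL[OF x0] Uc in auto)
    thus ?thesis using unitary_det_nonzero[OF unitary_mat_adjoint[OF U(1)]] by simp
  qed
  have B0: "Determinant.det (BB x0) \<noteq> 0"
  proof -
    let ?G = "diagm n (\<lambda>i. complex_of_real (g i))"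
    have "mat_adjoint V * b x0 * V = (mat_adjoint V * V) * ?G * (mat_adjoint V * V)"
      unfolding V(2) using Vc(1) V' by (simp add: assoc_mult_mat[of _ n n _ n _ n] mult_carrier_mat[of _ n n _ n])
    hence "mat_adjoint V * b x0 * V = ?G" unfolding Vc(2) by simp
    hence "BB x0 = diagm n (\<lambda>i. complex_of_real (g i) + complex_of_real (if \<not> i < j then 1 else 0))"
      unfolding BB_def by (simp only: diagm_add)
    moreover have "complex_of_real (g i) + complex_of_real (if \<not> i < j then 1 else 0) \<noteq> 0" if "i < n" for i
      using V(4)[OF that] by (cases "i < j") auto
    ultimately show ?thesis using diagonal_det_nonzero by simp
  qed
  define W0 where "W0 = {x \<in> topspace X. Determinant.det (L x) \<noteq> 0} \<inter> {x \<in> topspace X. Determinant.det (BB x) \<noteq> 0}"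
  have W0: "openin X W0" "x0 \<in> W0"
    unfolding W0_def using openin_det_nonzero[OF L] openin_det_nonzero[OF BB] x0 L0 B0 by auto
  show ?thesis
    unfolding locally_perturbable_def
  proof (intro exI[of _ W0] conjI W0 allI impI, elim conjE)
    fix W assume W: "closedin X W" "W \<subseteq> W0"
    define T where "T = subtopology X W"
    have WX: "W \<subseteq> topspace X" using W(1) by (rule closedin_subset)
    have topT: "topspace T = W" using WX by (auto simp: T_def)
    have T: "compact_space T" "Hausdorff_space T" "covdim_le T d"
      using closedin_compact_space[OF X(1) W(1)] X(2) covdim_le_closed_subspace[OF dim W(1)]
      by (auto simp: T_def compact_space_subtopology Hausdorff_space_subtopology)
    have xX: "x \<in> topspace X" if "x \<in> topspace T" for x using that WX topT by blast
    have dL: "Determinant.det (L x) \<noteq> 0" and dB: "Determinant.det (BB x) \<noteq> 0" if "x \<in> topspace T" for x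
      using that W(2) unfolding topT W0_def by blast+
    have LT: "cont_mat_fun T n L" and BT: "cont_mat_fun T n BB" unfolding T_def using L BB
      by (auto intro: cont_mat_fun_subtopology)
    have LI: "cont_mat_fun T n (\<lambda>x. matinv (L x))" by (rule cont_mat_fun_inverse[OF LT dL])
    have BI: "cont_mat_fun T n (\<lambda>x. matinv (BB x))" by (rule cont_mat_fun_inverse[OF BT dB])
    obtain l1 where l1: "0 < l1" "\<forall>x\<in>topspace T. entry_norm (L x) \<le> l1"
      by (rule cont_mat_fun_bounded[OF T(1) LT])
    obtain l2 where l2: "0 < l2" "\<forall>x\<in>topspace T. entry_norm (matinv (BB x)) \<le> l2"
      by (rule cont_mat_fun_bounded[OF T(1) BI])
    note invL = matinv[OF cL[OF xX] dL] and invB = matinv[OF cBB[OF xX] dB]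
    show "perturbable X n (\<lambda>x S. \<exists>N c. 0 \<le> c \<and> posdef (dominate \<epsilon> N c (a x) (b x) S)) W"
      unfolding perturbable_def T_def[symmetric]
    proof (intro allI impI, elim conjE)
      fix s and \<eta> :: real assume s: "cont_mat_fun T n s" and \<eta>: "0 < \<eta>"
      note cs = cont_mat_funD(1)[OF s]
      \<comment> \<open>The adjoint of \<open>s x\<close> in the two coordinate systems. The change
        is reversible, and \<open>t\<close> below carries the perturbed \<open>R'\<close>
        back.\<close>
      define R where "R x = BB x * (mat_adjoint V * (mat_adjoint (s x) * matinv (L x)))" for x
      have R: "cont_mat_fun T n R" unfolding R_def
        by (intro cont_mat_fun_mult BT cont_mat_fun_adjoint s LI cont_mat_fun_const V')
      \<comment> \<open>The denominator bounds the factors picked up on the way back; the 1 gives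
        strictness and covers \<open>n = 0\<close>.\<close>
      define \<eta>' where "\<eta>' = \<eta> / ((entry_norm V + 1) * l2 * l1)"
      have vp: "0 < (entry_norm V + 1) * l2 * l1"
        using l1 l2 entry_norm_nonneg[of V] by (intro mult_pos_pos) linarith+
      have \<eta>': "0 < \<eta>'" using \<eta> vp by (simp add: \<eta>'_def)
      have rc: "r = 0 \<or> d < 2 * (j + 1 - r)" using rj by simp
      obtain R' where R': "cont_mat_fun T n R'" "\<forall>x\<in>topspace T. entry_norm (R' x - R x) < \<eta>'" "\<forall>x\<in>topspace T. indep_cols j r (R' x)"
        using indep_cols_dense[OF T rj(1) V(3) rc R \<eta>'] by blast
      note cR = cont_mat_funD(1)[OF R] and cR' = cont_mat_funD(1)[OF R'(1)]
      define t where "t x = mat_adjoint (V * (matinv (BB x) * (R' x * L x)))" for x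
      have t: "cont_mat_fun T n t" unfolding t_def
        by (intro cont_mat_fun_adjoint cont_mat_fun_mult BI R'(1) LT cont_mat_fun_const Vc(1))
      show "\<exists>t. cont_mat_fun T n t \<and> (\<forall>x\<in>W. entry_norm (t x - s x) < \<eta>) \<and>
         (\<forall>x\<in>W. \<exists>N c. 0 \<le> c \<and> posdef (dominate \<epsilon> N c (a x) (b x) (t x)))"
      proof (intro exI[of _ t] conjI t ballI)
        fix x assume xW: "x \<in> W"
        hence x: "x \<in> topspace T" by (simp add: topT)
        note s' = mat_adjoint_carrier[OF cs[OF x]] and iL = invL[OF x x] and iB = invB[OF x x]
          and Lc = cL[OF xX[OF x]] and Bc = cBB[OF xX[OF x]]
        have prodc: "matinv (BB x) * (R' x * L x) \<in> carrier_mat n n" "matinv (BB x) * (R x * L x) \<in> carrier_mat n n"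
          using iB(1) cR'[OF x] cR[OF x] Lc by (simp_all add: mult_carrier_mat[of _ n n _ n])
        have sE: "mat_adjoint (s x) = V * (matinv (BB x) * (R x * L x))"
        proof -
          have "R x * L x = BB x * (mat_adjoint V * (mat_adjoint (s x) * (matinv (L x) * L x)))"
            unfolding R_def using Bc V' s' iL(1) Lc
            by (simp add: assoc_mult_mat[of _ n n _ n _ n] mult_carrier_mat[of _ n n _ n])
          also have "\<dots> = BB x * (mat_adjoint V * mat_adjoint (s x))"
            unfolding iL(3) by (simp only: right_mult_one_mat[OF s'])
          finally have "matinv (BB x) * (R x * L x) = (matinv (BB x) * BB x) * (mat_adjoint V * mat_adjoint (s x))"
            using Bc iB(1) V' s' by (simp add: assoc_mult_mat[of _ n n _ n _ n] mult_carrier_mat[of _ n n _ n])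
          hence "matinv (BB x) * (R x * L x) = mat_adjoint V * mat_adjoint (s x)"
            unfolding iB(3) by (simp only: left_mult_one_mat[OF mult_carrier_mat[OF V' s']])
          hence "V * (matinv (BB x) * (R x * L x)) = (V * mat_adjoint V) * mat_adjoint (s x)"
            using Vc(1) V' s' by (simp add: assoc_mult_mat[of _ n n _ n _ n])
          thus ?thesis unfolding Vc(3) by (simp only: left_mult_one_mat[OF s'])
        qed
        define t' where "t' = V * (matinv (BB x) * (R' x * L x))"
        have t'c: "t' \<in> carrier_mat n n" unfolding t'_def using Vc(1) prodc(1) by (rule mult_carrier_mat)
        have tt: "t x = mat_adjoint t'" "mat_adjoint (t x) = t'" by (simp_all add: t_def t'_def)
        have tc: "t x \<in> carrier_mat n n" unfolding tt using t'c by simp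
        have diff: "t' - mat_adjoint (s x) = V * (matinv (BB x) * ((R' x - R x) * L x))"
        proof -
          have "(R' x - R x) * L x = R' x * L x - R x * L x"
            using cR'[OF x] cR[OF x] Lc by (intro minus_mult_distrib_mat)
          moreover have "matinv (BB x) * (R' x * L x - R x * L x) = matinv (BB x) * (R' x * L x) - matinv (BB x) * (R x * L x)"
            by (rule mult_minus_distrib_mat[OF iB(1) mult_carrier_mat[OF cR'[OF x] Lc] mult_carrier_mat[OF cR[OF x] Lc]])
          moreover have "V * (matinv (BB x) * (R' x * L x) - matinv (BB x) * (R x * L x)) = t' - V * (matinv (BB x) * (R x * L x))"
            unfolding t'_def by (rule mult_minus_distrib_mat[OF Vc(1) prodc])
          ultimately show ?thesis by (simp only: sE)
        qed
        have "entry_norm (t x - s x) = entry_norm (mat_adjoint (t x - s x))" by simp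
        also have "mat_adjoint (t x - s x) = t' - mat_adjoint (s x)"
          using mat_adjoint_minus[OF tc cs[OF x]] tt by simp
        also have "entry_norm \<dots> \<le> entry_norm V * (entry_norm (matinv (BB x)) * (entry_norm (R' x - R x) * entry_norm (L x)))"
        proof -
          have c1: "(R' x - R x) \<in> carrier_mat n n" using cR[OF x] by (rule minus_carrier_mat)
          have c2: "(R' x - R x) * L x \<in> carrier_mat n n" using c1 Lc by (rule mult_carrier_mat)
          have "entry_norm (V * (matinv (BB x) * ((R' x - R x) * L x))) \<le> entry_norm V * entry_norm (matinv (BB x) * ((R' x - R x) * L x))"
            by (rule entry_norm_mult_le[OF Vc(1) mult_carrier_mat[OF iB(1) c2]])
          also have "\<dots> \<le> entry_norm V * (entry_norm (matinv (BB x)) * entry_norm ((R' x - R x) * L x))"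
            by (rule mult_left_mono[OF entry_norm_mult_le[OF iB(1) c2]]) simp
          also have "\<dots> \<le> entry_norm V * (entry_norm (matinv (BB x)) * (entry_norm (R' x - R x) * entry_norm (L x)))"
            by (intro mult_left_mono entry_norm_mult_le[OF c1 Lc]) simp_all
          finally show ?thesis unfolding diff .
        qed
        also have "\<dots> \<le> entry_norm V * (l2 * (\<eta>' * l1))"
          using l1 l2 R'(2) x \<eta>' by (intro mult_mono mult_nonneg_nonneg) (auto intro: less_imp_le)
        also have "\<dots> < (entry_norm V + 1) * (l2 * (\<eta>' * l1))"
          using l1 l2 \<eta>' by (intro mult_strict_right_mono) auto
        also have "\<dots> = \<eta>" using vp by (simp add: \<eta>'_def field_simps)
        finally show "entry_norm (t x - s x) < \<eta>" .
        note xx = xX[OF x]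
        obtain U1 f1 where U1: "unitary_mat n U1" "a x = U1 * diagm n (\<lambda>i. complex_of_real (f1 i)) * mat_adjoint U1"
          "fcalc n (\<lambda>t. 1 - \<phi> t) (a x) = U1 * diagm n (\<lambda>i. complex_of_real (1 - \<phi> (f1 i))) * mat_adjoint U1"
          by (rule fcalcE[OF ca[OF xx] ha[OF xx]])
        show "\<exists>N c. 0 \<le> c \<and> posdef (dominate \<epsilon> N c (a x) (b x) (t x))"
        proof (rule dominate_posdef_exists[where \<phi> = \<phi>, OF U1(1,2) a(2)[OF xx] cb[OF xx] b(2)[OF xx] tc \<epsilon> \<phi>(2)])
          fix v :: "complex Matrix.vec"
          assume v: "v \<in> carrier_vec n" and Ev: "(U1 * diagm n (\<lambda>i. complex_of_real (1 - \<phi> (f1 i))) * mat_adjoint U1) *\<^sub>v v = 0\<^sub>v n"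
            and bt: "b x *\<^sub>v (mat_adjoint (t x) *\<^sub>v v) = 0\<^sub>v n"
          define z where "z = L x *\<^sub>v v"
          have zc: "z \<in> carrier_vec n" unfolding z_def using Lc v by simp
          have Exv: "E x *\<^sub>v v = 0\<^sub>v n" using Ev U1(3) by (simp add: E_def)
          have z: "vec_index z i = 0" if i: "i < n" "\<not> i < r" for i
          proof -
            let ?A = "indicator_diagm n (\<lambda>i. i < r) * mat_adjoint U" and ?B = "indicator_diagm n (\<lambda>i. \<not> i < r) * (mat_adjoint U * E x)"
            have c1: "?A \<in> carrier_mat n n" by (rule mult_carrier_mat[OF diagm_carrier(1) U'])
            have c2: "mat_adjoint U * E x \<in> carrier_mat n n" by (rule mult_carrier_mat[OF U' cE[OF xx]])
            have c3: "?B \<in> carrier_mat n n" by (rule mult_carrier_mat[OF diagm_carrier(1) c2])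
            have "z = ?A *\<^sub>v v + ?B *\<^sub>v v" unfolding z_def L_def
              by (rule add_mult_distrib_mat_vec[OF c1 c3 v])
            moreover have "?A *\<^sub>v v = indicator_diagm n (\<lambda>i. i < r) *\<^sub>v (mat_adjoint U *\<^sub>v v)"
              by (rule assoc_mult_mat_vec[OF diagm_carrier(1) U' v])
            moreover have "?B *\<^sub>v v = 0\<^sub>v n"
            proof -
              have "?B *\<^sub>v v = indicator_diagm n (\<lambda>i. \<not> i < r) *\<^sub>v ((mat_adjoint U * E x) *\<^sub>v v)"
                by (rule assoc_mult_mat_vec[OF diagm_carrier(1) c2 v])
              also have "(mat_adjoint U * E x) *\<^sub>v v = mat_adjoint U *\<^sub>v (E x *\<^sub>v v)"
                by (rule assoc_mult_mat_vec[OF U' cE[OF xx] v])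
              finally show ?thesis
                unfolding Exv mult_mat_zero_vec[OF U'] mult_mat_zero_vec[OF diagm_carrier(1)] .
            qed
            ultimately have "z = indicator_diagm n (\<lambda>i. i < r) *\<^sub>v (mat_adjoint U *\<^sub>v v) + 0\<^sub>v n"
              by (simp only:)
            thus ?thesis
              using indicator_diagm_mult_vec[OF mult_mat_vec_carrier[OF U' v] i(1), of "\<lambda>i. i < r"] i by simp
          qed
          define y where "y = mat_adjoint V *\<^sub>v (t' *\<^sub>v v)"
          have t'v: "t' *\<^sub>v v \<in> carrier_vec n" using t'c v by simp
          have yc: "y \<in> carrier_vec n" unfolding y_def using V' t'v by simp
          have "BB x *\<^sub>v y = R' x *\<^sub>v z"
          proof -
            have "t' *\<^sub>v v = V *\<^sub>v ((matinv (BB x) * (R' x * L x)) *\<^sub>v v)" unfolding t'_def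
              by (rule assoc_mult_mat_vec[OF Vc(1) prodc(1) v])
            moreover have "(matinv (BB x) * (R' x * L x)) *\<^sub>v v = matinv (BB x) *\<^sub>v (R' x *\<^sub>v z)"
              unfolding z_def using assoc_mult_mat_vec[OF iB(1) mult_carrier_mat[OF cR'[OF x] Lc] v] assoc_mult_mat_vec[OF cR'[OF x] Lc v] by simp
            ultimately have "y = mat_adjoint V *\<^sub>v (V *\<^sub>v (matinv (BB x) *\<^sub>v (R' x *\<^sub>v z)))" unfolding y_def
              by (simp only:)
            also have "\<dots> = matinv (BB x) *\<^sub>v (R' x *\<^sub>v z)"
              using Vc V' iB(1) cR'[OF x] zc by (intro mult_mat_vec_cancel[of _ n]) auto
            finally have "BB x *\<^sub>v y = BB x *\<^sub>v (matinv (BB x) *\<^sub>v (R' x *\<^sub>v z))" by (simp only:)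
            also have "\<dots> = R' x *\<^sub>v z"
              using Bc iB cR'[OF x] zc by (intro mult_mat_vec_cancel[of _ n]) auto
            finally show ?thesis .
          qed
          \<comment> \<open>Since \<open>b x\<close> kills the vector, only the added projection
            acts, and it has no entries in the first \<open>j\<close> rows.\<close>
          moreover have "vec_index (BB x *\<^sub>v y) i = 0" if i: "i < j" for i
          proof -
            have iN: "i < n" using i V(3) by simp
            have c1: "mat_adjoint V * b x * V \<in> carrier_mat n n"
              using V' cb[OF xx] Vc(1) by (simp add: mult_carrier_mat[of _ n n _ n])
            have "BB x *\<^sub>v y = (mat_adjoint V * b x * V) *\<^sub>v y + indicator_diagm n (\<lambda>i. \<not> i < j) *\<^sub>v y"
              unfolding BB_def by (rule add_mult_distrib_mat_vec[OF c1 diagm_carrier(1) yc])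
            moreover have "(mat_adjoint V * b x * V) *\<^sub>v y = 0\<^sub>v n"
            proof -
              have "(mat_adjoint V * b x * V) *\<^sub>v y = (mat_adjoint V * b x) *\<^sub>v (V *\<^sub>v y)"
                by (rule assoc_mult_mat_vec[OF mult_carrier_mat[OF V' cb[OF xx]] Vc(1) yc])
              also have "V *\<^sub>v y = t' *\<^sub>v v" unfolding y_def using Vc V' t'v
                by (intro mult_mat_vec_cancel[of _ n]) auto
              also have "(mat_adjoint V * b x) *\<^sub>v (t' *\<^sub>v v) = mat_adjoint V *\<^sub>v (b x *\<^sub>v (t' *\<^sub>v v))"
                by (rule assoc_mult_mat_vec[OF V' cb[OF xx] t'v])
              also have "b x *\<^sub>v (t' *\<^sub>v v) = 0\<^sub>v n" using bt by (simp only: tt(2))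
              finally show ?thesis using mult_mat_zero_vec[OF V'] by simp
            qed
            ultimately have "BB x *\<^sub>v y = 0\<^sub>v n + indicator_diagm n (\<lambda>i. \<not> i < j) *\<^sub>v y" by (simp only:)
            thus ?thesis using indicator_diagm_mult_vec[OF yc iN, of "\<lambda>i. \<not> i < j"] i iN by simp
          qed
          ultimately have Rz: "vec_index (R' x *\<^sub>v z) i = 0" if "i < j" for i using that by simp
          have "(\<Sum>l<r. R' x $$ (i, l) * vec_index z l) = 0" if i: "i < j" for i
          proof -
            have "vec_index (R' x *\<^sub>v z) i = (\<Sum>l<n. R' x $$ (i, l) * vec_index z l)"
              using i V(3) by (intro mult_mat_vec_index_sum[OF cR'[OF x] zc]) simp
            also have "\<dots> = (\<Sum>l<r. R' x $$ (i, l) * vec_index z l)"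
              using U(3) z by (intro sum.mono_neutral_right) auto
            finally show ?thesis using Rz[OF i] by simp
          qed
          hence "\<forall>l<r. vec_index z l = 0"
            using bspec[OF R'(3) x] unfolding indep_cols_def by (metis (no_types))
          hence "z = 0\<^sub>v n" using z zc by (intro eq_vecI) auto
          thus "v = 0\<^sub>v n" using det_0_iff_vec_prod_zero_field[OF Lc] dL[OF x] v unfolding z_def by metis
        qed
      qed
    qed
  qed
qed

section \<open>Making the exponent and the constant uniform\<close>

lemma cont_mat_fun_dominate:
  assumes a: "cont_mat_fun T n a" and b: "cont_mat_fun T n b" and s: "cont_mat_fun T n s"
  shows "cont_mat_fun T n (\<lambda>x. dominate \<epsilon> N c (a x) (b x) (s x))"
proof -
  have "cont_mat_fun T n (\<lambda>x. complex_of_real c \<cdot>\<^sub>m (a x ^\<^sub>m N * s x * b x * mat_adjoint (s x) * a x ^\<^sub>m N)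
     + complex_of_real \<epsilon> \<cdot>\<^sub>m 1\<^sub>m n - a x)"
    by (intro cont_mat_fun_minus cont_mat_fun_add cont_mat_fun_smult cont_mat_fun_mult cont_mat_fun_pow
        cont_mat_fun_adjoint cont_mat_fun_const a b s one_carrier_mat)
  thus ?thesis by (rule cont_mat_fun_cong) (simp add: dominate_def cont_mat_fun_dim[OF a])
qed

text \<open>The \<open>N\<close> and \<open>c\<close> of one good pair serve for all nearby pairs,
  because positive definiteness with fixed parameters is open.\<close>

lemma open_condition_dominate:
  assumes a: "cont_mat_fun X n a" "\<And>x. x \<in> topspace X \<Longrightarrow> psd (a x)"
    and b: "cont_mat_fun X n b" "\<And>x. x \<in> topspace X \<Longrightarrow> psd (b x)"
  shows "open_condition X n (\<lambda>x S. \<exists>N c. 0 \<le> c \<and> posdef (dominate \<epsilon> N c (a x) (b x) S))"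
  unfolding open_condition_def
proof (intro ballI impI)
  fix x M assume x: "x \<in> topspace X" and M: "M \<in> carrier_mat n n"
    and "\<exists>N c. 0 \<le> c \<and> posdef (dominate \<epsilon> N c (a x) (b x) M)"
  then obtain N c where c: "0 \<le> c" "posdef (dominate \<epsilon> N c (a x) (b x) M)" by blast
  have oc: "open_condition X n (\<lambda>x S. posdef (dominate \<epsilon> N c (a x) (b x) S))"
  proof (rule open_condition_posdef)
    show "cont_mat_fun (prod_topology X (mat_topology n)) n (\<lambda>p. dominate \<epsilon> N c (a (fst p)) (b (fst p)) (snd p))"
      by (intro cont_mat_fun_dominate cont_mat_fun_fst cont_mat_fun_snd a b)
    show "mat_adjoint (dominate \<epsilon> N c (a y) (b y) S) = dominate \<epsilon> N c (a y) (b y) S"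
      if "y \<in> topspace X" "S \<in> carrier_mat n n" for y S
      using a(2)[OF that(1)] b(2)[OF that(1)] cont_mat_funD(1)[OF a(1) that(1)] cont_mat_funD(1)[OF b(1) that(1)] that(2)
      by (intro dominate_hermitian) (auto simp: psd_def)
  qed
  obtain U \<eta> where U: "openin X U" "x \<in> U" "0 < \<eta>"
    "\<forall>y\<in>U. \<forall>S\<in>carrier_mat n n. entry_norm (S - M) < \<eta> \<longrightarrow> posdef (dominate \<epsilon> N c (a y) (b y) S)"
    by (rule open_conditionE[OF oc x M c(2)])
  show "\<exists>U \<eta>. openin X U \<and> x \<in> U \<and> 0 < \<eta> \<and> (\<forall>y\<in>U. \<forall>S\<in>carrier_mat n n. entry_norm (S - M) < \<eta> \<longrightarrow>
      (\<exists>N c. 0 \<le> c \<and> posdef (dominate \<epsilon> N c (a y) (b y) S)))"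
    using U c(1) by (intro exI[of _ U] exI[of _ \<eta>]) blast
qed

lemma posdef_dominate_mono:
  assumes A: "A \<in> carrier_mat n n" "psd A" and B: "B \<in> carrier_mat n n" "psd B" and S: "S \<in> carrier_mat n n"
    and p: "posdef (dominate \<epsilon> N c A B S)" and c: "c \<le> c'"
  shows "posdef (dominate \<epsilon> N c' A B S)"
proof -
  have h: "mat_adjoint A = A" "mat_adjoint B = B" using A B by (simp_all add: psd_def)
  show ?thesis
    unfolding posdef_def
  proof (intro conjI ballI impI dominate_hermitian[OF A(1) h(1) B(1) h(2) S])
    fix u :: "complex Matrix.vec"
    assume "u \<in> carrier_vec (dim_row (dominate \<epsilon> N c' A B S))" "u \<noteq> 0\<^sub>v (dim_row (dominate \<epsilon> N c' A B S))"
    hence u: "u \<in> carrier_vec n" "u \<noteq> 0\<^sub>v n" using dominate_carrier[OF A(1) B(1) S, of \<epsilon> N c'] by auto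
    have "0 < qform (dominate \<epsilon> N c A B S) u"
      using p u dominate_carrier[OF A(1) B(1) S, of \<epsilon> N c] by (auto simp: posdef_def)
    moreover have "mat_adjoint S *\<^sub>v (A ^\<^sub>m N *\<^sub>v u) \<in> carrier_vec n"
      using mult_mat_vec_carrier[OF mat_adjoint_carrier[OF S] mult_mat_vec_carrier[OF pow_carrier_mat[OF A(1)] u(1)]] .
    hence "0 \<le> qform B (mat_adjoint S *\<^sub>v (A ^\<^sub>m N *\<^sub>v u))" using B by (simp add: psd_def)
    hence "c * qform B (mat_adjoint S *\<^sub>v (A ^\<^sub>m N *\<^sub>v u)) \<le> c' * qform B (mat_adjoint S *\<^sub>v (A ^\<^sub>m N *\<^sub>v u))"
      using c by (rule mult_right_mono[rotated])
    ultimately show "0 < qform (dominate \<epsilon> N c' A B S) u"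
      unfolding qform_dominate[OF A(1) h(1) B(1) S u(1)] by linarith
  qed
qed

text \<open>The new matrix is the old one multiplied by \<open>A\<close> from both sides and divided
  by \<open>\<epsilon>\<^sup>2\<close>, plus a function of \<open>A\<close>. With \<open>t\<close>
  for \<open>A\<close>, that function is \<open>\<epsilon> - t - t\<^sup>2 * (\<epsilon> - t) /
  \<epsilon>\<^sup>2\<close>, which factors as \<open>(\<epsilon> - t)\<^sup>2 * (\<epsilon> + t) /
  \<epsilon>\<^sup>2\<close> and is nonnegative for nonnegative \<open>t\<close>.\<close>

lemma posdef_dominate_Suc:
  assumes A: "A \<in> carrier_mat n n" "psd A" and B: "B \<in> carrier_mat n n" "psd B" and S: "S \<in> carrier_mat n n"
    and \<epsilon>: "0 < \<epsilon>" and p: "posdef (dominate \<epsilon> N c A B S)"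
  shows "posdef (dominate \<epsilon> (Suc N) (c / \<epsilon>\<^sup>2) A B S)"
proof -
  have h: "mat_adjoint A = A" "mat_adjoint B = B" using A B by (simp_all add: psd_def)
  obtain U f where U: "unitary_mat n U" "A = U * diagm n (\<lambda>i. complex_of_real (f i)) * mat_adjoint U"
    using hermitian_diagonalization_exists[OF A(1) h(1)] by blast
  note f0 = psd_eigenvalue_bounds(1)[OF U A(2)]
  have U': "mat_adjoint U \<in> carrier_mat n n" using U(1) by (simp add: unitary_mat_def)
  show ?thesis
    unfolding posdef_def
  proof (intro conjI ballI impI dominate_hermitian[OF A(1) h(1) B(1) h(2) S])
    fix u :: "complex Matrix.vec"
    assume "u \<in> carrier_vec (dim_row (dominate \<epsilon> (Suc N) (c / \<epsilon>\<^sup>2) A B S))" "u \<noteq> 0\<^sub>v (dim_row (dominate \<epsilon> (Suc N) (c / \<epsilon>\<^sup>2) A B S))"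
    hence u: "u \<in> carrier_vec n" "u \<noteq> 0\<^sub>v n"
      using dominate_carrier[OF A(1) B(1) S, of \<epsilon> "Suc N" "c / \<epsilon>\<^sup>2"] by auto
    have Au: "A *\<^sub>v u \<in> carrier_vec n" using A(1) u(1) by simp
    have ANu: "A ^\<^sub>m Suc N *\<^sub>v u = A ^\<^sub>m N *\<^sub>v (A *\<^sub>v u)"
      using A(1) u(1) by (simp add: assoc_mult_mat_vec[OF pow_carrier_mat[OF A(1)] A(1) u(1)])
    define y where "y i = (cmod (vec_index (mat_adjoint U *\<^sub>v u) i))\<^sup>2" for i
    have qA: "qform A u = (\<Sum>i<n. f i * y i)" unfolding U(2) qform_unitary_diag[OF U(1) u(1)] y_def ..
    have nu: "nsq u = (\<Sum>i<n. y i)" unfolding nsq_unitary_coords[OF U(1) u(1)] y_def ..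
    have yA: "(cmod (vec_index (mat_adjoint U *\<^sub>v (A *\<^sub>v u)) i))\<^sup>2 = (f i)\<^sup>2 * y i" if i: "i < n" for i
    proof -
      have "mat_adjoint U *\<^sub>v (A *\<^sub>v u) = diagm n (\<lambda>i. complex_of_real (f i)) *\<^sub>v (mat_adjoint U *\<^sub>v u)"
        unfolding U(2) by (rule unitary_diag_apply[OF U(1) u(1)])
      hence "vec_index (mat_adjoint U *\<^sub>v (A *\<^sub>v u)) i = complex_of_real (f i) * vec_index (mat_adjoint U *\<^sub>v u) i"
        unfolding diagm_mult_vec[OF mult_mat_vec_carrier[OF U' u(1)]] using i by simp
      thus ?thesis by (simp add: y_def norm_mult power_mult_distrib)
    qed
    have qAA: "qform A (A *\<^sub>v u) = (\<Sum>i<n. f i * ((f i)\<^sup>2 * y i))"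
      using qform_unitary_diag[OF U(1) Au, of f] yA unfolding U(2)[symmetric] by simp
    have nA: "nsq (A *\<^sub>v u) = (\<Sum>i<n. (f i)\<^sup>2 * y i)"
      using nsq_unitary_coords[OF U(1) Au] yA by simp
    define rem where "rem = (\<Sum>i<n. (\<epsilon> - f i)\<^sup>2 * (\<epsilon> + f i) / \<epsilon>\<^sup>2 * y i)"
    have rem0: "0 \<le> rem" unfolding rem_def y_def using f0 \<epsilon>
      by (intro sum_nonneg mult_nonneg_nonneg divide_nonneg_nonneg) (auto intro: add_nonneg_nonneg)
    have rem: "rem = \<epsilon> * nsq u - qform A u - nsq (A *\<^sub>v u) / \<epsilon> + qform A (A *\<^sub>v u) / \<epsilon>\<^sup>2"
    proof -
      have "rem = (\<Sum>i<n. \<epsilon> * y i - f i * y i - (f i)\<^sup>2 * y i / \<epsilon> + f i * ((f i)\<^sup>2 * y i) / \<epsilon>\<^sup>2)"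
        unfolding rem_def
      proof (rule sum.cong[OF refl])
        fix i
        show "(\<epsilon> - f i)\<^sup>2 * (\<epsilon> + f i) / \<epsilon>\<^sup>2 * y i = \<epsilon> * y i - f i * y i - (f i)\<^sup>2 * y i / \<epsilon> + f i * ((f i)\<^sup>2 * y i) / \<epsilon>\<^sup>2"
          using \<epsilon> by (simp add: field_simps power2_eq_square)
      qed
      thus ?thesis unfolding qA nu qAA nA
        by (simp add: sum.distrib sum_subtractf sum_distrib_left sum_divide_distrib)
    qed
    have key: "qform (dominate \<epsilon> (Suc N) (c / \<epsilon>\<^sup>2) A B S) u = qform (dominate \<epsilon> N c A B S) (A *\<^sub>v u) / \<epsilon>\<^sup>2 + rem"
      unfolding qform_dominate[OF A(1) h(1) B(1) S u(1)] qform_dominate[OF A(1) h(1) B(1) S Au] ANu rem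
      using \<epsilon> by (simp add: field_simps power2_eq_square)
    show "0 < qform (dominate \<epsilon> (Suc N) (c / \<epsilon>\<^sup>2) A B S) u"
    proof (cases "A *\<^sub>v u = 0\<^sub>v n")
      case False
      hence "0 < qform (dominate \<epsilon> N c A B S) (A *\<^sub>v u)"
        using p Au dominate_carrier[OF A(1) B(1) S, of \<epsilon> N c] by (auto simp: posdef_def)
      thus ?thesis unfolding key using rem0 \<epsilon> by (simp add: add_pos_nonneg)
    next
      \<comment> \<open>The first summand of \<open>key\<close> is 0 here, and the remainder is
        \<open>\<epsilon> * nsq u\<close>.\<close>
      case True
      have n0: "nsq (A *\<^sub>v u) = 0" using True nsq_eq_0_iff[OF Au] by simp
      have q0: "qform M (0\<^sub>v n) = 0" if "M \<in> carrier_mat n n" for M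
        using mult_mat_zero_vec[OF that] by (simp add: qform_def cscalar_prod_sum[of _ n])
      have "qform A u = 0" using True u(1) by (simp add: qform_def cscalar_prod_sum[of _ n])
      hence "rem = \<epsilon> * nsq u" unfolding rem True using n0 True q0[OF A(1)] by simp
      moreover have "qform (dominate \<epsilon> N c A B S) (A *\<^sub>v u) = 0"
        unfolding True by (rule q0[OF dominate_carrier[OF A(1) B(1) S]])
      ultimately show ?thesis unfolding key using \<epsilon> nsq_pos[OF u] by simp
    qed
  qed
qed

lemma posdef_dominate_add:
  assumes A: "A \<in> carrier_mat n n" "psd A" and B: "B \<in> carrier_mat n n" "psd B" and S: "S \<in> carrier_mat n n"
    and \<epsilon>: "0 < \<epsilon>" and p: "posdef (dominate \<epsilon> N c A B S)"
  shows "posdef (dominate \<epsilon> (N + k) (c / \<epsilon> ^ (2 * k)) A B S)"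
proof (induction k)
  case (Suc k)
  have e: "c / \<epsilon> ^ (2 * k) / \<epsilon>\<^sup>2 = c / \<epsilon> ^ (2 * Suc k)" by (simp add: power2_eq_square)
  show ?case using posdef_dominate_Suc[OF A B S \<epsilon> Suc] unfolding e add_Suc_right .
qed (use p in simp)

lemma dominate_absorb:
  assumes A: "A \<in> carrier_mat n n" "mat_adjoint A = A" and B: "B \<in> carrier_mat n n" and S: "S \<in> carrier_mat n n"
  shows "dominate \<epsilon> 0 c A B (A ^\<^sub>m N * S) = dominate \<epsilon> N c A B S"
proof -
  note p = pow_carrier_mat[OF A(1), of N] and ph = pow_mat_hermitian[OF A, of N]
  have d: "dim_row A = n" using A(1) by simp
  have 1: "mat_adjoint (A ^\<^sub>m N * S) = mat_adjoint S * A ^\<^sub>m N" using mat_adjoint_mult[OF p S] ph by simp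
  have c1: "A ^\<^sub>m N * S \<in> carrier_mat n n" using p S by (rule mult_carrier_mat)
  have c2: "A ^\<^sub>m N * S * B \<in> carrier_mat n n" using c1 B by (rule mult_carrier_mat)
  have c3: "mat_adjoint S * A ^\<^sub>m N \<in> carrier_mat n n"
    using mat_adjoint_carrier[OF S] p by (rule mult_carrier_mat)
  have "A ^\<^sub>m 0 * (A ^\<^sub>m N * S) * B * mat_adjoint (A ^\<^sub>m N * S) * A ^\<^sub>m 0 = A ^\<^sub>m N * S * B * (mat_adjoint S * A ^\<^sub>m N)"
    unfolding pow_mat.simps d 1 left_mult_one_mat[OF c1] right_mult_one_mat[OF mult_carrier_mat[OF c2 c3]] ..
  also have "\<dots> = A ^\<^sub>m N * S * B * mat_adjoint S * A ^\<^sub>m N"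
    by (rule assoc_mult_mat[OF c2 mat_adjoint_carrier[OF S] p, symmetric])
  finally show ?thesis unfolding dominate_def by (simp only:)
qed

text \<open>A finite infimum in \<open>enat\<close> is attained.\<close>

lemma covdim_eq_imp_le:
  assumes "covdim X = enat d" shows "covdim_le X d"
proof -
  let ?A = "enat ` {m. covdim_le X m}"
  have "?A \<noteq> {}" using assms unfolding covdim_def by (auto simp: Inf_enat_def split: if_splits)
  hence "Inf ?A \<in> ?A" by (simp add: Inf_enat_def) (metis LeastI_ex ex_in_conv mem_Collect_eq image_iff)
  thus ?thesis using assms unfolding covdim_def by auto
qed

text \<open>In the condition \<open>G\<close> the exponent and the constant may depend on the point,
  which suits both the prescribed values on \<open>Y\<close> and the local constructions.
  Compactness then yields common ones, since \<open>posdef_dominate_add\<close> raises exponents and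
  \<open>posdef_dominate_mono\<close> raises constants.\<close>

theorem dominate_extension:
  assumes X: "compact_space X" "Hausdorff_space X"
    and a: "cont_mat_fun X n a" "\<And>x. x \<in> topspace X \<Longrightarrow> psd (a x)"
    and b: "cont_mat_fun X n b" "\<And>x. x \<in> topspace X \<Longrightarrow> psd (b x)"
    and \<epsilon>: "0 < \<epsilon>" and Y: "closedin X Y" and sY: "cont_mat_fun (subtopology X Y) n sY"
    and domY: "\<And>x. x \<in> Y \<Longrightarrow> \<exists>c. 0 \<le> c \<and> posdef (dominate \<epsilon> 0 c (a x) (b x) (sY x))"
    and rk: "\<And>x. x \<in> topspace X - Y \<Longrightarrow> \<exists>d::nat. covdim X = enat d \<and>
      real (mrank (a x)) + (real d - 1) / 2 \<le> real (mrank (b x))"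
  obtains s N c where "cont_mat_fun X n s" "\<forall>x\<in>Y. s x = sY x" "0 \<le> c"
    "\<forall>x\<in>topspace X. posdef (dominate \<epsilon> N c (a x) (b x) (s x))"
proof -
  have norm: "normal_space X" using X compact_Hausdorff_or_regular_imp_normal_space by blast
  have YX: "Y \<subseteq> topspace X" using Y by (rule closedin_subset)
  have topY: "topspace (subtopology X Y) = Y" using YX by auto
  have cY: "compact_space (subtopology X Y)"
    using closedin_compact_space[OF X(1) Y] by (simp add: compact_space_subtopology)
  obtain B where B: "0 < B" "\<forall>x\<in>Y. entry_norm (sY x) \<le> B"
    by (rule cont_mat_fun_bounded[OF cY sY, unfolded topY])
  obtain s0 where s0: "cont_mat_fun X n s0" "\<forall>x\<in>Y. s0 x = sY x"
    using matrix_Tietze_extension[OF norm Y sY, of B] B by (metis less_imp_le)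
  define G where "G x S \<longleftrightarrow> (\<exists>N c. 0 \<le> c \<and> posdef (dominate \<epsilon> N c (a x) (b x) S))" for x S
  have G: "open_condition X n G" unfolding G_def by (rule open_condition_dominate[OF a b])
  have GY: "G x (s0 x)" if "x \<in> Y" for x
    using domY[OF that] s0(2) that unfolding G_def by auto
  have loc: "locally_perturbable X n G x" if x: "x \<in> topspace X" "x \<notin> Y" for x
  proof -
    obtain d :: nat where d: "covdim X = enat d" "real (mrank (a x)) + (real d - 1) / 2 \<le> real (mrank (b x))"
      using rk[of x] x by blast
    \<comment> \<open>Cleared of fractions, the hypothesis is an inequality of natural numbers. It
      gives the dimension bound and, by parity, \<open>mrank (a x) \<le> mrank (b x)\<close> even
      for \<open>d = 0\<close>.\<close>
    have "2 * real (mrank (a x)) + real d \<le> 2 * real (mrank (b x)) + 1" using d(2) by argo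
    hence "real (2 * mrank (a x) + d) \<le> real (2 * mrank (b x) + 1)" by simp
    hence i: "2 * mrank (a x) + d \<le> 2 * mrank (b x) + 1" by (simp only: of_nat_le_iff)
    hence "mrank (a x) \<le> mrank (b x)" "d < 2 * (mrank (b x) + 1 - mrank (a x))" by linarith+
    from dominate_locally_perturbable[OF X covdim_eq_imp_le[OF d(1)] a b x(1) \<epsilon> this]
    show ?thesis unfolding G_def .
  qed
  obtain s where s: "cont_mat_fun X n s" "\<forall>x\<in>Y. s x = s0 x" "\<forall>x\<in>topspace X. entry_norm (s x - s0 x) < 1"
    "\<forall>x\<in>topspace X. G x (s x)"
  proof (rule relative_perturbation[OF X G Y s0(1), of 1])
    fix x assume "x \<in> Y" thus "G x (s0 x)" by (rule GY)
  next
    fix x assume "x \<in> topspace X" "x \<notin> Y" thus "locally_perturbable X n G x" by (rule loc)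
  qed (simp, rule that)
  note ca = cont_mat_funD(1)[OF a(1)] and cb = cont_mat_funD(1)[OF b(1)] and cs = cont_mat_funD(1)[OF s(1)]
  define P where "P x N c \<longleftrightarrow> 0 \<le> c \<and> posdef (dominate \<epsilon> N c (a x) (b x) (s x))" for x N c
  have "\<exists>N c. P x N c" if "x \<in> topspace X" for x using bspec[OF s(4) that] unfolding G_def P_def .
  then obtain N c where P: "\<And>x. x \<in> topspace X \<Longrightarrow> P x (N x) (c x)" by metis
  define V where "V x = {y \<in> topspace X. posdef (dominate \<epsilon> (N x) (c x) (a y) (b y) (s y))}" for x
  have V: "openin X (V x)" "x \<in> V x" if "x \<in> topspace X" for x
  proof -
    show "openin X (V x)" unfolding V_def
    proof (rule openin_posdef[OF cont_mat_fun_dominate[OF a(1) b(1) s(1)]])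
      fix y assume y: "y \<in> topspace X"
      show "mat_adjoint (dominate \<epsilon> (N x) (c x) (a y) (b y) (s y)) = dominate \<epsilon> (N x) (c x) (a y) (b y) (s y)"
        using a(2)[OF y] b(2)[OF y] by (intro dominate_hermitian[OF ca[OF y] _ cb[OF y] _ cs[OF y]]) (simp_all add: psd_def)
    qed
    show "x \<in> V x" using P[OF that] that by (simp add: V_def P_def)
  qed
  obtain F where F: "F \<subseteq> topspace X" "finite F" "topspace X \<subseteq> (\<Union>x\<in>F. V x)"
    by (rule compact_space_finite_subcover[OF X(1) V])
  define N' where "N' = Max (insert 0 (N ` F))"
  \<comment> \<open>Raising the exponent from \<open>N x\<close> to \<open>N'\<close> divides the
    constant by this power of \<open>\<epsilon>\<close>.\<close>
  define c' where "c' = Max (insert 0 ((\<lambda>x. c x / \<epsilon> ^ (2 * (N' - N x))) ` F))"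
  have N': "N x \<le> N'" if "x \<in> F" for x using F(2) that by (simp add: N'_def)
  have c'0: "0 \<le> c'" using F(2) by (simp add: c'_def)
  have "posdef (dominate \<epsilon> N' c' (a y) (b y) (s y))" if y: "y \<in> topspace X" for y
  proof -
    obtain x where x: "x \<in> F" "y \<in> V x" using F(3) y by blast
    have "posdef (dominate \<epsilon> (N x) (c x) (a y) (b y) (s y))" using x(2) by (simp add: V_def)
    from posdef_dominate_add[OF ca[OF y] a(2)[OF y] cb[OF y] b(2)[OF y] cs[OF y] \<epsilon> this, of "N' - N x"] N'[OF x(1)]
    have "posdef (dominate \<epsilon> N' (c x / \<epsilon> ^ (2 * (N' - N x))) (a y) (b y) (s y))" by simp
    moreover have "c x / \<epsilon> ^ (2 * (N' - N x)) \<le> c'" using F(2) x(1) by (simp add: c'_def)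
    ultimately show ?thesis
      by (rule posdef_dominate_mono[OF ca[OF y] a(2)[OF y] cb[OF y] b(2)[OF y] cs[OF y]])
  qed
  moreover have "\<forall>x\<in>Y. s x = sY x" using s(2) s0(2) by simp
  ultimately show thesis using that[OF s(1) _ c'0] by blast
qed

section \<open>Recursive subhomogeneous algebras\<close>

lemma stage_ext: "a \<in> rsh_stage n X X0 \<phi> k \<Longrightarrow> ext_elt n X k a"
  by (cases k) auto

lemma ext_eltD: "ext_elt n X k a \<Longrightarrow> k < j \<or> x \<notin> topspace (X j) \<Longrightarrow> a j x = 0\<^sub>m (n j) (n j)"
  by (auto simp: ext_elt_def)

lemma stage_SucD:
  assumes "a \<in> rsh_stage n X X0 \<phi> (Suc k)"
  shows "trunc n k a \<in> rsh_stage n X X0 \<phi> k" "cont_mat_fun (X (Suc k)) (n (Suc k)) (a (Suc k))"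
    "x \<in> X0 (Suc k) \<Longrightarrow> a (Suc k) x = \<phi> (Suc k) (trunc n k a) x"
  using assms by auto

lemma stage_cont:
  "a \<in> rsh_stage n X X0 \<phi> k \<Longrightarrow> j \<le> k \<Longrightarrow> cont_mat_fun (X j) (n j) (a j)"
proof (induction k arbitrary: a)
  case (Suc k)
  show ?case
  proof (cases "j = Suc k")
    case True thus ?thesis using stage_SucD(2)[OF Suc.prems(1)] by simp
  next
    case False
    hence j: "j \<le> k" using Suc.prems by simp
    hence "trunc n k a j = a j" by (simp add: trunc_def)
    thus ?thesis using Suc.IH[OF stage_SucD(1)[OF Suc.prems(1)] j] by simp
  qed
qed simp

lemma ext_carrier:
  assumes "a \<in> rsh_stage n X X0 \<phi> k" shows "a j x \<in> carrier_mat (n j) (n j)"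
proof (cases "k < j \<or> x \<notin> topspace (X j)")
  case True thus ?thesis using ext_eltD[OF stage_ext[OF assms]] by simp
next
  case False thus ?thesis using cont_mat_funD(1)[OF stage_cont[OF assms, of j]] by simp
qed

section \<open>Operations that stay inside the stages of the decomposition\<close>

locale rsh =
  fixes n :: "nat \<Rightarrow> nat" and X :: "nat \<Rightarrow> 'x topology" and X0 :: "nat \<Rightarrow> 'x set"
    and \<phi> :: "nat \<Rightarrow> 'x elt \<Rightarrow> 'x \<Rightarrow> complex mat" and l :: nat
  assumes decomp: "rsh_decomposition n X X0 \<phi> l"
begin

abbreviation "R \<equiv> rsh_stage n X X0 \<phi>"

lemma space:
  assumes "k \<le> l" shows "compact_space (X k)" "Hausdorff_space (X k)" "closedin (X k) (X0 k)" "X0 k \<subseteq> topspace (X k)"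
  using decomp assms closedin_subset[of "X k" "X0 k"] by (auto simp: rsh_decomposition_def)

lemma hom:
  assumes "Suc k \<le> l"
  shows "a \<in> R k \<Longrightarrow> cont_mat_fun (subtopology (X (Suc k)) (X0 (Suc k))) (n (Suc k)) (\<phi> (Suc k) a)"
    "a \<in> R k \<Longrightarrow> b \<in> R k \<Longrightarrow> x \<in> X0 (Suc k) \<Longrightarrow> \<phi> (Suc k) (eadd a b) x = \<phi> (Suc k) a x + \<phi> (Suc k) b x"
    "a \<in> R k \<Longrightarrow> x \<in> X0 (Suc k) \<Longrightarrow> \<phi> (Suc k) (esmult z a) x = z \<cdot>\<^sub>m \<phi> (Suc k) a x"
    "a \<in> R k \<Longrightarrow> b \<in> R k \<Longrightarrow> x \<in> X0 (Suc k) \<Longrightarrow> \<phi> (Suc k) (emult a b) x = \<phi> (Suc k) a x * \<phi> (Suc k) b x"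
    "a \<in> R k \<Longrightarrow> x \<in> X0 (Suc k) \<Longrightarrow> \<phi> (Suc k) (eadj a) x = mat_adjoint (\<phi> (Suc k) a x)"
    "x \<in> X0 (Suc k) \<Longrightarrow> \<phi> (Suc k) (eone n X k) x = 1\<^sub>m (n (Suc k))"
proof -
  have "Suc k \<in> {1..l}" using assms by simp
  hence u: "unital_star_hom (R k) (eone n X k) (X (Suc k)) (X0 (Suc k)) (n (Suc k)) (\<phi> (Suc k))"
    using decomp unfolding rsh_decomposition_def by (metis diff_Suc_1)
  note u' = u[unfolded unital_star_hom_def]
  show "a \<in> R k \<Longrightarrow> cont_mat_fun (subtopology (X (Suc k)) (X0 (Suc k))) (n (Suc k)) (\<phi> (Suc k) a)" using u'
    by simp
  show "a \<in> R k \<Longrightarrow> b \<in> R k \<Longrightarrow> x \<in> X0 (Suc k) \<Longrightarrow> \<phi> (Suc k) (eadd a b) x = \<phi> (Suc k) a x + \<phi> (Suc k) b x" using u'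
    by simp
  show "a \<in> R k \<Longrightarrow> x \<in> X0 (Suc k) \<Longrightarrow> \<phi> (Suc k) (esmult z a) x = z \<cdot>\<^sub>m \<phi> (Suc k) a x" using u' by simp
  show "a \<in> R k \<Longrightarrow> b \<in> R k \<Longrightarrow> x \<in> X0 (Suc k) \<Longrightarrow> \<phi> (Suc k) (emult a b) x = \<phi> (Suc k) a x * \<phi> (Suc k) b x" using u'
    by simp
  show "a \<in> R k \<Longrightarrow> x \<in> X0 (Suc k) \<Longrightarrow> \<phi> (Suc k) (eadj a) x = mat_adjoint (\<phi> (Suc k) a x)" using u' by simp
  show "x \<in> X0 (Suc k) \<Longrightarrow> \<phi> (Suc k) (eone n X k) x = 1\<^sub>m (n (Suc k))" using u' by simp
qed

lemma hom_carrier: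
  assumes "Suc k \<le> l" "a \<in> R k" "x \<in> X0 (Suc k)"
  shows "\<phi> (Suc k) a x \<in> carrier_mat (n (Suc k)) (n (Suc k))"
  using cont_mat_funD(1)[OF hom(1)[OF assms(1,2)]] assms(3) space(4)[OF assms(1)] by auto

lemma stage_SucI:
  assumes "ext_elt n X (Suc k) a" "trunc n k a \<in> R k" "cont_mat_fun (X (Suc k)) (n (Suc k)) (a (Suc k))"
    "\<And>x. x \<in> X0 (Suc k) \<Longrightarrow> a (Suc k) x = \<phi> (Suc k) (trunc n k a) x"
  shows "a \<in> R (Suc k)"
  using assms by simp

lemma stage_0I:
  assumes "ext_elt n X 0 a" "cont_mat_fun (X 0) (n 0) (a 0)" shows "a \<in> R 0"
  using assms by simp

lemma eadd_closed: "k \<le> l \<Longrightarrow> a \<in> R k \<Longrightarrow> b \<in> R k \<Longrightarrow> eadd a b \<in> R k"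
proof (induction k arbitrary: a b)
  case 0
  have "ext_elt n X 0 (eadd a b)" using 0 by (simp add: ext_elt_def eadd_def)
  moreover have "cont_mat_fun (X 0) (n 0) (eadd a b 0)"
    unfolding eadd_def using stage_cont[OF 0(2)] stage_cont[OF 0(3)] by (intro cont_mat_fun_add) auto
  ultimately show ?case by (rule stage_0I)
next
  case (Suc k)
  note a = stage_SucD[OF Suc.prems(2)] and b = stage_SucD[OF Suc.prems(3)]
  have t: "trunc n k (eadd a b) = eadd (trunc n k a) (trunc n k b)"
    by (auto simp: trunc_def eadd_def fun_eq_iff)
  show ?case
  proof (rule stage_SucI)
    show "ext_elt n X (Suc k) (eadd a b)"
      using stage_ext[OF Suc.prems(2)] stage_ext[OF Suc.prems(3)] by (simp add: ext_elt_def eadd_def)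
    show "trunc n k (eadd a b) \<in> R k" unfolding t using Suc a(1) b(1) by simp
    show "cont_mat_fun (X (Suc k)) (n (Suc k)) (eadd a b (Suc k))" unfolding eadd_def
      using a(2) b(2) by (rule cont_mat_fun_add)
    show "eadd a b (Suc k) x = \<phi> (Suc k) (trunc n k (eadd a b)) x" if x: "x \<in> X0 (Suc k)" for x
      unfolding t hom(2)[OF Suc.prems(1) a(1) b(1) x] using a(3)[OF x] b(3)[OF x] by (simp add: eadd_def)
  qed
qed

lemma emult_closed: "k \<le> l \<Longrightarrow> a \<in> R k \<Longrightarrow> b \<in> R k \<Longrightarrow> emult a b \<in> R k"
proof (induction k arbitrary: a b)
  case 0
  have "ext_elt n X 0 (emult a b)" using 0 by (simp add: ext_elt_def emult_def)
  moreover have "cont_mat_fun (X 0) (n 0) (emult a b 0)"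
    unfolding emult_def using stage_cont[OF 0(2)] stage_cont[OF 0(3)] by (intro cont_mat_fun_mult) auto
  ultimately show ?case by (rule stage_0I)
next
  case (Suc k)
  note a = stage_SucD[OF Suc.prems(2)] and b = stage_SucD[OF Suc.prems(3)]
  have t: "trunc n k (emult a b) = emult (trunc n k a) (trunc n k b)"
    by (auto simp: trunc_def emult_def fun_eq_iff)
  show ?case
  proof (rule stage_SucI)
    show "ext_elt n X (Suc k) (emult a b)"
      using stage_ext[OF Suc.prems(2)] stage_ext[OF Suc.prems(3)] by (simp add: ext_elt_def emult_def)
    show "trunc n k (emult a b) \<in> R k" unfolding t using Suc a(1) b(1) by simp
    show "cont_mat_fun (X (Suc k)) (n (Suc k)) (emult a b (Suc k))" unfolding emult_def
      using a(2) b(2) by (rule cont_mat_fun_mult)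
    show "emult a b (Suc k) x = \<phi> (Suc k) (trunc n k (emult a b)) x" if x: "x \<in> X0 (Suc k)" for x
      unfolding t hom(4)[OF Suc.prems(1) a(1) b(1) x] using a(3)[OF x] b(3)[OF x] by (simp add: emult_def)
  qed
qed

lemma esmult_closed: "k \<le> l \<Longrightarrow> a \<in> R k \<Longrightarrow> esmult z a \<in> R k"
proof (induction k arbitrary: a)
  case 0
  have "ext_elt n X 0 (esmult z a)" using 0 by (simp add: ext_elt_def esmult_def)
  moreover have "cont_mat_fun (X 0) (n 0) (esmult z a 0)"
    unfolding esmult_def using stage_cont[OF 0(2)] by (intro cont_mat_fun_smult) auto
  ultimately show ?case by (rule stage_0I)
next
  case (Suc k)
  note a = stage_SucD[OF Suc.prems(2)]
  have t: "trunc n k (esmult z a) = esmult z (trunc n k a)" by (auto simp: trunc_def esmult_def fun_eq_iff)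
  show ?case
  proof (rule stage_SucI)
    show "ext_elt n X (Suc k) (esmult z a)"
      using stage_ext[OF Suc.prems(2)] by (simp add: ext_elt_def esmult_def)
    show "trunc n k (esmult z a) \<in> R k" unfolding t using Suc a(1) by simp
    show "cont_mat_fun (X (Suc k)) (n (Suc k)) (esmult z a (Suc k))" unfolding esmult_def
      using a(2) by (rule cont_mat_fun_smult)
    show "esmult z a (Suc k) x = \<phi> (Suc k) (trunc n k (esmult z a)) x" if x: "x \<in> X0 (Suc k)" for x
      unfolding t hom(3)[OF Suc.prems(1) a(1) x] using a(3)[OF x] by (simp add: esmult_def)
  qed
qed

lemma eadj_closed: "k \<le> l \<Longrightarrow> a \<in> R k \<Longrightarrow> eadj a \<in> R k"
proof (induction k arbitrary: a)
  case 0
  have "ext_elt n X 0 (eadj a)" using 0 by (simp add: ext_elt_def eadj_def)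
  moreover have "cont_mat_fun (X 0) (n 0) (eadj a 0)"
    unfolding eadj_def using stage_cont[OF 0(2)] by (intro cont_mat_fun_adjoint) auto
  ultimately show ?case by (rule stage_0I)
next
  case (Suc k)
  note a = stage_SucD[OF Suc.prems(2)]
  have t: "trunc n k (eadj a) = eadj (trunc n k a)" by (auto simp: trunc_def eadj_def fun_eq_iff)
  show ?case
  proof (rule stage_SucI)
    show "ext_elt n X (Suc k) (eadj a)" using stage_ext[OF Suc.prems(2)] by (simp add: ext_elt_def eadj_def)
    show "trunc n k (eadj a) \<in> R k" unfolding t using Suc a(1) by simp
    show "cont_mat_fun (X (Suc k)) (n (Suc k)) (eadj a (Suc k))" unfolding eadj_def
      using a(2) by (rule cont_mat_fun_adjoint)
    show "eadj a (Suc k) x = \<phi> (Suc k) (trunc n k (eadj a)) x" if x: "x \<in> X0 (Suc k)" for x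
      unfolding t hom(5)[OF Suc.prems(1) a(1) x] using a(3)[OF x] by (simp add: eadj_def)
  qed
qed

lemma cont_eone: "j \<le> k \<Longrightarrow> cont_mat_fun (X j) (n j) (eone n X k j)"
  by (rule cont_mat_fun_cong[OF cont_mat_fun_const[OF one_carrier_mat]]) (simp add: eone_def)

lemma eone_closed: "k \<le> l \<Longrightarrow> eone n X k \<in> R k"
proof (induction k)
  case 0
  have "ext_elt n X 0 (eone n X 0)" by (simp add: ext_elt_def eone_def)
  thus ?case using cont_eone by (intro stage_0I) auto
next
  case (Suc k)
  have t: "trunc n k (eone n X (Suc k)) = eone n X k" by (auto simp: trunc_def eone_def fun_eq_iff)
  show ?case
  proof (rule stage_SucI)
    show "ext_elt n X (Suc k) (eone n X (Suc k))" by (simp add: ext_elt_def eone_def)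
    show "trunc n k (eone n X (Suc k)) \<in> R k" unfolding t using Suc by simp
    show "cont_mat_fun (X (Suc k)) (n (Suc k)) (eone n X (Suc k) (Suc k))" by (rule cont_eone) simp
    show "eone n X (Suc k) (Suc k) x = \<phi> (Suc k) (trunc n k (eone n X (Suc k))) x" if x: "x \<in> X0 (Suc k)" for x
      unfolding t hom(6)[OF Suc.prems x] using x space(4)[OF Suc.prems] by (auto simp: eone_def)
  qed
qed

text \<open>The value 0 off the base spaces is the convention of \<open>ext_elt\<close>.\<close>

definition einv :: "nat \<Rightarrow> 'x elt \<Rightarrow> 'x elt" where
  "einv k G = (\<lambda>j x. if j \<le> k \<and> x \<in> topspace (X j) then matinv (G j x) else 0\<^sub>m (n j) (n j))"

lemma emult_einv:
  assumes G: "G \<in> R k" and d: "\<And>j x. j \<le> k \<Longrightarrow> x \<in> topspace (X j) \<Longrightarrow> Determinant.det (G j x) \<noteq> 0"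
  shows "emult G (einv k G) = eone n X k"
proof (intro ext)
  fix j x
  show "emult G (einv k G) j x = eone n X k j x"
  proof (cases "j \<le> k \<and> x \<in> topspace (X j)")
    case True
    thus ?thesis using matinv(2)[OF ext_carrier[OF G] d] by (simp add: emult_def einv_def eone_def)
  next
    case False
    thus ?thesis using ext_carrier[OF G, of j x] by (auto simp: emult_def einv_def eone_def)
  qed
qed

text \<open>Pointwise invertibility suffices: by induction the inverse exists in the previous stage,
  and a unital multiplicative map sends it to the inverse of the image. This is the gluing condition
  on \<open>X0\<close>.\<close>

lemma einv_closed:
  "k \<le> l \<Longrightarrow> G \<in> R k \<Longrightarrow> (\<And>j x. j \<le> k \<Longrightarrow> x \<in> topspace (X j) \<Longrightarrow> Determinant.det (G j x) \<noteq> 0) \<Longrightarrow> einv k G \<in> R k"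
proof (induction k arbitrary: G)
  case 0
  have "cont_mat_fun (X 0) (n 0) (einv 0 G 0)"
    by (rule cont_mat_fun_cong[OF cont_mat_fun_inverse[OF stage_cont[OF 0(2) le_refl] 0(3)[OF le_refl]]]) (auto simp: einv_def)
  thus ?case by (intro stage_0I) (simp_all add: ext_elt_def einv_def)
next
  case (Suc k)
  note G = stage_SucD[OF Suc.prems(2)]
  have t: "trunc n k (einv (Suc k) G) = einv k (trunc n k G)" by (auto simp: trunc_def einv_def fun_eq_iff)
  have dt: "Determinant.det (trunc n k G j x) \<noteq> 0" if "j \<le> k" "x \<in> topspace (X j)" for j x
    using Suc.prems(3)[of j x] that by (simp add: trunc_def)
  have ic: "einv k (trunc n k G) \<in> R k" using Suc.IH[OF _ G(1) dt] Suc.prems(1) by simp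
  show ?case
  proof (rule stage_SucI)
    show "ext_elt n X (Suc k) (einv (Suc k) G)" by (simp add: ext_elt_def einv_def)
    show "trunc n k (einv (Suc k) G) \<in> R k" unfolding t by (rule ic)
    show "cont_mat_fun (X (Suc k)) (n (Suc k)) (einv (Suc k) G (Suc k))"
      by (rule cont_mat_fun_cong[OF cont_mat_fun_inverse[OF G(2) Suc.prems(3)[OF le_refl]]]) (auto simp: einv_def)
    fix x assume x: "x \<in> X0 (Suc k)"
    have xt: "x \<in> topspace (X (Suc k))" using x space(4)[OF Suc.prems(1)] by blast
    have "\<phi> (Suc k) (trunc n k G) x * \<phi> (Suc k) (einv k (trunc n k G)) x = \<phi> (Suc k) (emult (trunc n k G) (einv k (trunc n k G))) x"
      by (rule hom(4)[OF Suc.prems(1) G(1) ic x, symmetric])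
    also have "emult (trunc n k G) (einv k (trunc n k G)) = eone n X k" by (rule emult_einv[OF G(1) dt])
    also have "\<phi> (Suc k) (eone n X k) x = 1\<^sub>m (n (Suc k))" by (rule hom(6)[OF Suc.prems(1) x])
    finally have "matinv (\<phi> (Suc k) (trunc n k G) x) = \<phi> (Suc k) (einv k (trunc n k G)) x"
      by (rule matinv_unique(2)[OF hom_carrier[OF Suc.prems(1) G(1) x] hom_carrier[OF Suc.prems(1) ic x]])
    thus "einv (Suc k) G (Suc k) x = \<phi> (Suc k) (trunc n k (einv (Suc k) G)) x"
      unfolding t using xt G(3)[OF x] by (simp add: einv_def)
  qed
qed

text \<open>For \<open>t \<ge> 0\<close> the element \<open>G + t\<close> is invertible, so its image is; hence no eigenvalue of the image
  of \<open>G\<close> is of the form \<open>- t\<close>.\<close>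

lemma hom_posdef:
  assumes k: "Suc k \<le> l" and G: "G \<in> R k" and x: "x \<in> X0 (Suc k)"
    and p: "\<And>j x. j \<le> k \<Longrightarrow> x \<in> topspace (X j) \<Longrightarrow> posdef (G j x)"
  shows "posdef (\<phi> (Suc k) G x)"
proof -
  let ?m = "n (Suc k)"
  have kl: "k \<le> l" using k by simp
  note M = hom_carrier[OF k G x]
  have "eadj G = G"
  proof (intro ext)
    fix j y
    show "eadj G j y = G j y"
    proof (cases "j \<le> k \<and> y \<in> topspace (X j)")
      case True thus ?thesis using p by (simp add: eadj_def posdef_def)
    next
      case False
      hence "G j y = 0\<^sub>m (n j) (n j)" using ext_eltD[OF stage_ext[OF G]] by auto
      thus ?thesis by (simp add: eadj_def)
    qed
  qed
  hence h: "mat_adjoint (\<phi> (Suc k) G x) = \<phi> (Suc k) G x" using hom(5)[OF k G x] by simp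
  obtain U f where U: "unitary_mat ?m U" "\<phi> (Suc k) G x = U * diagm ?m (\<lambda>i. complex_of_real (f i)) * mat_adjoint U"
    using hermitian_diagonalization_exists[OF M h] by blast
  have f0: "0 < f i" if i: "i < ?m" for i
  proof (rule ccontr)
    assume neg: "\<not> 0 < f i"
    define G' where "G' = eadd G (esmult (complex_of_real (- f i)) (eone n X k))"
    have e: "eone n X k \<in> R k" "esmult (complex_of_real (- f i)) (eone n X k) \<in> R k"
      using eone_closed[OF kl] esmult_closed[OF kl] by auto
    have G': "G' \<in> R k" unfolding G'_def by (rule eadd_closed[OF kl G e(2)])
    have dG': "Determinant.det (G' j y) \<noteq> 0" if jy: "j \<le> k" "y \<in> topspace (X j)" for j y
    proof -
      note c = ext_carrier[OF G, of j y]
      have eq: "G' j y = G j y + complex_of_real (- f i) \<cdot>\<^sub>m 1\<^sub>m (n j)" using jy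
        by (simp add: G'_def eadd_def esmult_def eone_def)
      have c': "G' j y \<in> carrier_mat (n j) (n j)" unfolding eq using c by simp
      have "posdef (G' j y)"
        unfolding posdef_def
      proof (intro conjI ballI impI)
        have "mat_adjoint (G j y) = G j y" using p[OF jy] by (simp add: posdef_def)
        thus "mat_adjoint (G' j y) = G' j y" unfolding eq using c
          by (simp add: mat_adjoint_add[of _ "n j" "n j"])
        fix u :: "complex Matrix.vec" assume "u \<in> carrier_vec (dim_row (G' j y))" "u \<noteq> 0\<^sub>v (dim_row (G' j y))"
        hence u: "u \<in> carrier_vec (n j)" "u \<noteq> 0\<^sub>v (n j)" using c' by auto
        have s: "complex_of_real (- f i) \<cdot>\<^sub>m 1\<^sub>m (n j) \<in> carrier_mat (n j) (n j)" by simp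
        have "qform (G' j y) u = qform (G j y) u + (- f i) * nsq u"
          unfolding eq qform_add[OF c s u(1)] qform_smult[OF one_carrier_mat u(1)] qform_one[OF u(1)] ..
        moreover have "0 < qform (G j y) u" using p[OF jy] u c by (auto simp: posdef_def)
        moreover have "0 \<le> (- f i) * nsq u" using neg by (intro mult_nonneg_nonneg) auto
        ultimately show "0 < qform (G' j y) u" by linarith
      qed
      thus ?thesis by (rule posdef_det[OF c'])
    qed
    have ic: "einv k G' \<in> R k" by (rule einv_closed[OF kl G' dG'])
    have c1: "\<phi> (Suc k) G' x \<in> carrier_mat ?m ?m" by (rule hom_carrier[OF k G' x])
    have "\<phi> (Suc k) G' x * \<phi> (Suc k) (einv k G') x = \<phi> (Suc k) (emult G' (einv k G')) x"
      by (rule hom(4)[OF k G' ic x, symmetric])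
    also have "emult G' (einv k G') = eone n X k" by (rule emult_einv[OF G' dG'])
    also have "\<phi> (Suc k) (eone n X k) x = 1\<^sub>m ?m" by (rule hom(6)[OF k x])
    finally have d: "Determinant.det (\<phi> (Suc k) G' x) \<noteq> 0"
      by (rule matinv_unique(1)[OF c1 hom_carrier[OF k ic x]])
    have "\<phi> (Suc k) G' x = \<phi> (Suc k) G x + complex_of_real (- f i) \<cdot>\<^sub>m 1\<^sub>m ?m"
      unfolding G'_def hom(2)[OF k G e(2) x] hom(3)[OF k e(1) x] hom(6)[OF k x] ..
    also have "\<dots> = U * diagm ?m (\<lambda>j. complex_of_real (f j) + complex_of_real (- f i)) * mat_adjoint U"
      unfolding U(2) unitary_diag_const[OF U(1), symmetric] unitary_diag_add[OF U(1)] ..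
    finally have eq: "\<phi> (Suc k) G' x = U * diagm ?m (\<lambda>j. complex_of_real (f j) + complex_of_real (- f i)) * mat_adjoint U" .
    let ?u = "U *\<^sub>v unit_vec ?m i"
    note u = unitary_basis_vector[OF U(1) i]
    have Uc: "U \<in> carrier_mat ?m ?m" using U(1) by (simp add: unitary_mat_def)
    have "\<phi> (Suc k) G' x *\<^sub>v ?u = U *\<^sub>v (diagm ?m (\<lambda>j. complex_of_real (f j) + complex_of_real (- f i)) *\<^sub>v unit_vec ?m i)"
      unfolding eq unitary_diag_mult_vec[OF U(1) u(1)] u(2) ..
    also have "diagm ?m (\<lambda>j. complex_of_real (f j) + complex_of_real (- f i)) *\<^sub>v unit_vec ?m i = 0\<^sub>v ?m"
      by (subst diagm_mult_vec) (auto intro!: eq_vecI simp: unit_vec_def)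
    finally have "\<phi> (Suc k) G' x *\<^sub>v ?u = 0\<^sub>v ?m" using mult_mat_zero_vec[OF Uc] by simp
    thus False using det_0_iff_vec_prod_zero_field[OF c1] d u(1,3) by blast
  qed
  show ?thesis
    unfolding posdef_def
  proof (intro conjI ballI impI h)
    fix u :: "complex Matrix.vec"
    assume "u \<in> carrier_vec (dim_row (\<phi> (Suc k) G x))" "u \<noteq> 0\<^sub>v (dim_row (\<phi> (Suc k) G x))"
    hence u: "u \<in> carrier_vec ?m" "u \<noteq> 0\<^sub>v ?m" using M by auto
    have "0 < (\<Sum>i<?m. (cmod (vec_index (mat_adjoint U *\<^sub>v u) i))\<^sup>2)"
      using nsq_pos[OF u] unfolding nsq_unitary_coords[OF U(1) u(1)] .
    then obtain i where i: "i < ?m" "(cmod (vec_index (mat_adjoint U *\<^sub>v u) i))\<^sup>2 \<noteq> 0"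
      by (metis (no_types, lifting) lessThan_iff less_irrefl sum.neutral)
    show "0 < qform (\<phi> (Suc k) G x) u"
      unfolding U(2) qform_unitary_diag[OF U(1) u(1)]
    proof (rule sum_pos2[of _ i])
      show "0 < f i * (cmod (vec_index (mat_adjoint U *\<^sub>v u) i))\<^sup>2" using i f0[OF i(1)] by simp
      show "0 \<le> f q * (cmod (vec_index (mat_adjoint U *\<^sub>v u) q))\<^sup>2" if "q \<in> {..<?m}" for q
        using f0[of q] that by (simp add: less_imp_le)
    qed (use i in auto)
  qed
qed

text \<open>The index \<open>k\<close> is needed for power 0, the unit of that stage.\<close>

primrec epow :: "nat \<Rightarrow> 'x elt \<Rightarrow> nat \<Rightarrow> 'x elt" where
  "epow k a 0 = eone n X k"
| "epow k a (Suc N) = emult (epow k a N) a"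

lemma epow_closed: "k \<le> l \<Longrightarrow> a \<in> R k \<Longrightarrow> epow k a N \<in> R k"
  by (induction N) (auto intro: eone_closed emult_closed)

lemma epow_apply: "a \<in> R k \<Longrightarrow> j \<le> k \<Longrightarrow> x \<in> topspace (X j) \<Longrightarrow> epow k a N j x = a j x ^\<^sub>m N"
  using ext_carrier[of a n X X0 \<phi> k j x] by (induction N) (auto simp: eone_def emult_def)

end

section \<open>Domination within the algebra\<close>

lemma dominate_0:
  assumes A: "A \<in> carrier_mat n n" and B: "B \<in> carrier_mat n n" and S: "S \<in> carrier_mat n n"
  shows "dominate \<epsilon> 0 c A B S
    = complex_of_real c \<cdot>\<^sub>m (S * B * mat_adjoint S) + complex_of_real \<epsilon> \<cdot>\<^sub>m 1\<^sub>m n + (-1) \<cdot>\<^sub>m A"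
proof -
  have d: "dim_row A = n" using A by simp
  have c1: "S * B * mat_adjoint S \<in> carrier_mat n n" using S B by (simp add: mult_carrier_mat[of _ n n _ n])
  have "A ^\<^sub>m 0 * S * B * mat_adjoint S * A ^\<^sub>m 0 = S * B * mat_adjoint S"
    unfolding pow_mat.simps d left_mult_one_mat[OF S] right_mult_one_mat[OF c1] ..
  thus ?thesis unfolding dominate_def d using A c1 by (intro eq_matI) auto
qed

context rsh
begin

text \<open>At every point this is \<open>dominate\<close> with exponent 0, written with the
  operations of the algebra alone, so that the attaching homomorphisms can be applied to it.\<close>

definition dom_elt :: "nat \<Rightarrow> real \<Rightarrow> real \<Rightarrow> 'x elt \<Rightarrow> 'x elt \<Rightarrow> 'x elt \<Rightarrow> 'x elt" where
  "dom_elt k \<epsilon> c a b s = eadd (eadd (esmult (complex_of_real c) (emult (emult s b) (eadj s)))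
     (esmult (complex_of_real \<epsilon>) (eone n X k))) (esmult (-1) a)"

lemma dom_elt_closed: "k \<le> l \<Longrightarrow> a \<in> R k \<Longrightarrow> b \<in> R k \<Longrightarrow> s \<in> R k \<Longrightarrow> dom_elt k \<epsilon> c a b s \<in> R k"
  unfolding dom_elt_def by (intro eadd_closed esmult_closed emult_closed eadj_closed eone_closed)

lemma dom_elt_apply:
  assumes "a \<in> R k" "b \<in> R k" "s \<in> R k" "j \<le> k" "x \<in> topspace (X j)"
  shows "dom_elt k \<epsilon> c a b s j x = dominate \<epsilon> 0 c (a j x) (b j x) (s j x)"
  unfolding dominate_0[OF ext_carrier[OF assms(1)] ext_carrier[OF assms(2)] ext_carrier[OF assms(3)]]
  using assms(4,5) by (simp add: dom_elt_def eadd_def esmult_def emult_def eadj_def eone_def)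

lemma hom_dom_elt:
  assumes k: "Suc k \<le> l" and a: "a \<in> R k" and b: "b \<in> R k" and s: "s \<in> R k" and x: "x \<in> X0 (Suc k)"
  shows "\<phi> (Suc k) (dom_elt k \<epsilon> c a b s) x = dominate \<epsilon> 0 c (\<phi> (Suc k) a x) (\<phi> (Suc k) b x) (\<phi> (Suc k) s x)"
proof -
  have kl: "k \<le> l" using k by simp
  note cl = eadd_closed[OF kl] esmult_closed[OF kl] emult_closed[OF kl] eadj_closed[OF kl] eone_closed[OF kl]
  have 1: "emult s b \<in> R k" "emult (emult s b) (eadj s) \<in> R k" "eadj s \<in> R k" using a b s
    by (simp_all add: cl)
  have 2: "esmult (complex_of_real c) (emult (emult s b) (eadj s)) \<in> R k" "esmult (complex_of_real \<epsilon>) (eone n X k) \<in> R k"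
    "esmult (-1) a \<in> R k" using a 1 by (simp_all add: cl)
  have 3: "eadd (esmult (complex_of_real c) (emult (emult s b) (eadj s))) (esmult (complex_of_real \<epsilon>) (eone n X k)) \<in> R k"
    using 2 by (simp add: cl)
  show ?thesis
    unfolding dominate_0[OF hom_carrier[OF k a x] hom_carrier[OF k b x] hom_carrier[OF k s x]] dom_elt_def
      hom(2)[OF k 3 2(3) x] hom(2)[OF k 2(1,2) x] hom(3)[OF k 1(2) x] hom(3)[OF k eone_closed[OF kl] x] hom(3)[OF k a x]
      hom(4)[OF k 1(1,3) x] hom(4)[OF k s b x] hom(5)[OF k s x] hom(6)[OF k x] ..
qed

lemma trunc_apply: "j \<le> k \<Longrightarrow> trunc n k a j x = a j x"
  by (simp add: trunc_def)

text \<open>The new space may require an exponent \<open>N\<close> that the earlier spaces did not.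
  The whole glued element is therefore multiplied by the power \<open>N\<close> of \<open>a\<close>,
  which keeps it in the algebra; on the earlier spaces the exponent is raised to \<open>N\<close> at
  the cost of a larger constant.\<close>

theorem stage_dominating_element:
  assumes "k \<le> l" "a \<in> R k" "b \<in> R k" and \<epsilon>: "0 < \<epsilon>"
    and "\<And>j x. j \<le> k \<Longrightarrow> x \<in> topspace (X j) \<Longrightarrow> psd (a j x)"
    and "\<And>j x. j \<le> k \<Longrightarrow> x \<in> topspace (X j) \<Longrightarrow> psd (b j x)"
    and "\<And>j x. j \<le> k \<Longrightarrow> x \<in> topspace (X j) - X0 j \<Longrightarrow> \<exists>d::nat. covdim (X j) = enat d \<and>
      real (mrank (a j x)) + (real d - 1) / 2 \<le> real (mrank (b j x))"
  shows "\<exists>s c. s \<in> R k \<and> 0 \<le> c \<and> (\<forall>j\<le>k. \<forall>x\<in>topspace (X j). posdef (dominate \<epsilon> 0 c (a j x) (b j x) (s j x)))"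
  using assms(1-3,5-7)
proof (induction k arbitrary: a b)
  case 0
  have X00: "X0 0 = {}" using decomp by (simp add: rsh_decomposition_def)
  \<comment> \<open>Some function on the empty set \<open>X0 0\<close> has to be named as prescribed
    data; \<open>a 0\<close> is an arbitrary choice.\<close>
  have "cont_mat_fun (subtopology (X 0) (X0 0)) (n 0) (a 0)"
    by (rule cont_mat_fun_subtopology[OF stage_cont[OF 0(2) le_refl]])
  obtain s N c where s: "cont_mat_fun (X 0) (n 0) s" "\<forall>x\<in>X0 0. s x = a 0 x" "0 \<le> c"
    "\<forall>x\<in>topspace (X 0). posdef (dominate \<epsilon> N c (a 0 x) (b 0 x) (s x))"
  proof (rule dominate_extension[OF space(1,2)[OF 0(1)] stage_cont[OF 0(2) le_refl] 0(4)[OF le_refl]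
        stage_cont[OF 0(3) le_refl] 0(5)[OF le_refl] \<epsilon> space(3)[OF 0(1)] \<open>cont_mat_fun (subtopology (X 0) (X0 0)) (n 0) (a 0)\<close>])
    fix x assume "x \<in> topspace (X 0) - X0 0"
    thus "\<exists>d::nat. covdim (X 0) = enat d \<and> real (mrank (a 0 x)) + (real d - 1) / 2 \<le> real (mrank (b 0 x))"
      by (rule 0(6)[OF le_refl])
  qed (use X00 that in auto)
  define t where "t = (\<lambda>j x. if j = 0 \<and> x \<in> topspace (X j) then a j x ^\<^sub>m N * s x else 0\<^sub>m (n j) (n j))"
  have "cont_mat_fun (X 0) (n 0) (t 0)"
    by (rule cont_mat_fun_cong[OF cont_mat_fun_mult[OF cont_mat_fun_pow[OF stage_cont[OF 0(2) le_refl]] s(1)]]) (simp add: t_def)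
  hence "t \<in> R 0" by (intro stage_0I) (simp_all add: ext_elt_def t_def)
  moreover have "posdef (dominate \<epsilon> 0 c (a 0 x) (b 0 x) (t 0 x))" if x: "x \<in> topspace (X 0)" for x
  proof -
    have h: "mat_adjoint (a 0 x) = a 0 x" using 0(4)[OF le_refl x] by (simp add: psd_def)
    have "t 0 x = a 0 x ^\<^sub>m N * s x" using x by (simp add: t_def)
    thus ?thesis
      using dominate_absorb[OF ext_carrier[OF 0(2)] h ext_carrier[OF 0(3)] cont_mat_funD(1)[OF s(1) x]] bspec[OF s(4) x] by simp
  qed
  ultimately show ?case using s(3) by (intro exI[of _ t] exI[of _ c]) simp
next
  case (Suc k)
  let ?K = "Suc k"
  note kl = Suc.prems(1) and aK = stage_SucD[OF Suc.prems(2)] and bK = stage_SucD[OF Suc.prems(3)]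
  have kl': "k \<le> l" using kl by simp
  have psd_t: "psd (trunc n k a j x)" "psd (trunc n k b j x)" if "j \<le> k" "x \<in> topspace (X j)" for j x
    using Suc.prems(4,5)[of j x] that by (simp_all add: trunc_apply)
  have rk_t: "\<exists>d::nat. covdim (X j) = enat d \<and> real (mrank (trunc n k a j x)) + (real d - 1) / 2 \<le> real (mrank (trunc n k b j x))"
    if "j \<le> k" "x \<in> topspace (X j) - X0 j" for j x
    using Suc.prems(6)[of j x] that by (simp add: trunc_apply)
  obtain s' c' where s': "s' \<in> R k" "0 \<le> c'"
    "\<forall>j\<le>k. \<forall>x\<in>topspace (X j). posdef (dominate \<epsilon> 0 c' (trunc n k a j x) (trunc n k b j x) (s' j x))"
    using Suc.IH[OF kl' aK(1) bK(1) psd_t rk_t] by blast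
  define h where "h = dom_elt k \<epsilon> c' (trunc n k a) (trunc n k b) s'"
  have h: "h \<in> R k" unfolding h_def by (rule dom_elt_closed[OF kl' aK(1) bK(1) s'(1)])
  have hp: "posdef (h j x)" if "j \<le> k" "x \<in> topspace (X j)" for j x
    unfolding h_def dom_elt_apply[OF aK(1) bK(1) s'(1) that] using s'(3) that by blast
  have domY: "\<exists>c. 0 \<le> c \<and> posdef (dominate \<epsilon> 0 c (a ?K x) (b ?K x) (\<phi> ?K s' x))" if x: "x \<in> X0 ?K" for x
  proof -
    have "posdef (\<phi> ?K h x)" by (rule hom_posdef[OF kl h x hp])
    hence "posdef (dominate \<epsilon> 0 c' (a ?K x) (b ?K x) (\<phi> ?K s' x))"
      unfolding h_def hom_dom_elt[OF kl aK(1) bK(1) s'(1) x] using aK(3)[OF x] bK(3)[OF x] by simp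
    thus ?thesis using s'(2) by blast
  qed
  obtain s N c where s: "cont_mat_fun (X ?K) (n ?K) s" "\<forall>x\<in>X0 ?K. s x = \<phi> ?K s' x" "0 \<le> c"
    "\<forall>x\<in>topspace (X ?K). posdef (dominate \<epsilon> N c (a ?K x) (b ?K x) (s x))"
    by (rule dominate_extension[OF space(1,2)[OF kl] aK(2) Suc.prems(4)[OF le_refl] bK(2) Suc.prems(5)[OF le_refl] \<epsilon>
        space(3)[OF kl] hom(1)[OF kl s'(1)] domY Suc.prems(6)[OF le_refl]])
  define s0 where "s0 = (\<lambda>j x. if j = ?K \<and> x \<in> topspace (X j) then s x else s' j x)"
  have s0t: "trunc n k s0 = s'"
  proof (intro ext)
    fix j x show "trunc n k s0 j x = s' j x"
      \<comment> \<open>Beyond stage \<open>k\<close> both sides are 0, because \<open>s'\<close>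
        belongs to stage \<open>k\<close>.\<close>
      using ext_eltD[OF stage_ext[OF s'(1)], of j x] by (simp add: trunc_def s0_def)
  qed
  have s0: "s0 \<in> R ?K"
  proof (rule stage_SucI)
    show "ext_elt n X ?K s0" using ext_eltD[OF stage_ext[OF s'(1)]] by (simp add: ext_elt_def s0_def)
    show "trunc n k s0 \<in> R k" unfolding s0t by (rule s'(1))
    show "cont_mat_fun (X ?K) (n ?K) (s0 ?K)" by (rule cont_mat_fun_cong[OF s(1)]) (simp add: s0_def)
    show "s0 ?K x = \<phi> ?K (trunc n k s0) x" if "x \<in> X0 ?K" for x
      unfolding s0t using s(2) that space(4)[OF kl] by (auto simp: s0_def)
  qed
  define t where "t = emult (epow ?K a N) s0"
  have t: "t \<in> R ?K" unfolding t_def by (intro emult_closed[OF kl] epow_closed[OF kl] Suc.prems(2) s0)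
  have ta: "t j x = a j x ^\<^sub>m N * s0 j x" if "j \<le> ?K" "x \<in> topspace (X j)" for j x
    using epow_apply[OF Suc.prems(2) that] by (simp add: t_def emult_def)
  \<comment> \<open>The second entry is the price for raising the exponent from 0 to
    \<open>N\<close> on the earlier spaces.\<close>
  define C where "C = max c (c' / \<epsilon> ^ (2 * N))"
  have "posdef (dominate \<epsilon> 0 C (a j x) (b j x) (t j x))" if jx: "j \<le> ?K" "x \<in> topspace (X j)" for j x
  proof -
    note ac = ext_carrier[OF Suc.prems(2), of j x] and bc = ext_carrier[OF Suc.prems(3), of j x] and sc = ext_carrier[OF s0, of j x]
    note pa = Suc.prems(4)[OF jx] and pb = Suc.prems(5)[OF jx]
    have ha: "mat_adjoint (a j x) = a j x" using pa by (simp add: psd_def)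
    have "posdef (dominate \<epsilon> N C (a j x) (b j x) (s0 j x))"
    proof (cases "j = ?K")
      case True
      hence "posdef (dominate \<epsilon> N c (a j x) (b j x) (s0 j x))" using s(4) jx by (simp add: s0_def)
      thus ?thesis by (rule posdef_dominate_mono[OF ac pa bc pb sc]) (simp add: C_def)
    next
      case False
      hence j: "j \<le> k" using jx by simp
      have "posdef (dominate \<epsilon> 0 c' (a j x) (b j x) (s0 j x))"
        using s'(3) j jx(2) False by (simp add: trunc_apply s0_def)
      from posdef_dominate_add[OF ac pa bc pb sc \<epsilon> this, of N]
      have "posdef (dominate \<epsilon> N (c' / \<epsilon> ^ (2 * N)) (a j x) (b j x) (s0 j x))" by simp
      thus ?thesis by (rule posdef_dominate_mono[OF ac pa bc pb sc]) (simp add: C_def)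
    qed
    thus ?thesis unfolding ta[OF jx] dominate_absorb[OF ac ha bc sc] .
  qed
  thus ?case using t s(3) by (intro exI[of _ t] exI[of _ C]) (simp add: C_def le_max_iff_disj)
qed

lemma stage_bounded:
  assumes k: "k \<le> l" and a: "a \<in> R k"
  obtains M where "0 < M" "\<forall>j\<le>k. \<forall>x\<in>topspace (X j). entry_norm (a j x) \<le> M"
proof -
  have "\<exists>B. \<forall>x\<in>topspace (X j). entry_norm (a j x) \<le> B" if j: "j \<le> k" for j
    using cont_mat_fun_bounded[OF space(1) stage_cont[OF a j]] j k by (metis le_trans)
  then obtain B where B: "\<And>j x. j \<le> k \<Longrightarrow> x \<in> topspace (X j) \<Longrightarrow> entry_norm (a j x) \<le> B j" by metis
  define M where "M = Max (insert 1 (B ` {..k}))"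
  have BM: "B j \<le> M" if "j \<le> k" for j unfolding M_def by (rule Max_ge) (use that in auto)
  have "entry_norm (a j x) \<le> M" if "j \<le> k" "x \<in> topspace (X j)" for j x
    using B[OF that] BM[OF that(1)] by linarith
  moreover have "1 \<le> M" unfolding M_def by (rule Max_ge) auto
  ultimately show thesis by (intro that[of M]) auto
qed

primrec epoly :: "nat \<Rightarrow> (nat \<Rightarrow> real) \<Rightarrow> nat \<Rightarrow> 'x elt \<Rightarrow> 'x elt" where
  "epoly k c 0 a = esmult (complex_of_real (c 0)) (eone n X k)"
| "epoly k c (Suc N) a = eadd (epoly k c N a) (esmult (complex_of_real (c (Suc N))) (epow k a (Suc N)))"

lemma epoly_closed: "k \<le> l \<Longrightarrow> a \<in> R k \<Longrightarrow> epoly k c N a \<in> R k"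
  by (induction N) (auto intro: eone_closed esmult_closed eadd_closed epow_closed simp del: epow.simps)

lemma epoly_apply:
  assumes "a \<in> R k" "j \<le> k" "x \<in> topspace (X j)"
  shows "epoly k c N a j x = mpoly c N (a j x)"
proof (induction N)
  case 0
  have "dim_row (a j x) = n j" using ext_carrier[OF assms(1), of j x] by simp
  thus ?case using assms by (simp add: esmult_def eone_def)
next
  case (Suc N)
  show ?case unfolding epoly.simps mpoly.simps eadd_def esmult_def Suc epow_apply[OF assms] ..
qed

end

section \<open>From domination to Cuntz subequivalence\<close>

text \<open>The polynomials will stand on both sides of a product, so their squares matter.
  Closeness of squares follows from factoring their difference, one factor being small and the other
  bounded.\<close>

lemma square_approximation:
  fixes \<psi> :: "real \<Rightarrow> real"
  assumes \<psi>: "continuous_on {0..M} \<psi>" and \<delta>: "0 < \<delta>"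
  obtains c N where "\<forall>t\<in>{0..M}. \<bar>(\<Sum>k\<le>N. c k * t ^ k)\<^sup>2 - (\<psi> t)\<^sup>2\<bar> \<le> \<delta>"
proof -
  have "bounded (\<psi> ` {0..M})" using compact_continuous_image[OF \<psi> compact_Icc] by (rule compact_imp_bounded)
  then obtain B where B: "\<forall>y\<in>\<psi> ` {0..M}. norm y \<le> B" by (auto simp: bounded_iff)
  \<comment> \<open>\<open>min 1\<close> bounds the polynomial by the bound of \<open>\<psi>\<close>
    plus 1; \<open>max B 0\<close> covers an empty interval, for which \<open>B\<close> may be
    negative.\<close>
  define e where "e = min 1 (\<delta> / (2 * max B 0 + 1))"
  have e: "0 < e" "e \<le> 1" "e * (2 * max B 0 + 1) \<le> \<delta>"
  proof -
    have p: "0 < 2 * max B 0 + 1" by (simp add: add_nonneg_pos)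
    show "0 < e" "e \<le> 1" using \<delta> p by (simp_all add: e_def)
    have "e \<le> \<delta> / (2 * max B 0 + 1)" by (simp add: e_def)
    thus "e * (2 * max B 0 + 1) \<le> \<delta>" using p by (simp only: pos_le_divide_eq)
  qed
  obtain c N where c: "\<forall>t\<in>{0..M}. \<bar>\<psi> t - (\<Sum>k\<le>N. c k * t ^ k)\<bar> < e"
    by (rule polynomial_approximation[OF \<psi> e(1)])
  have "\<bar>(\<Sum>k\<le>N. c k * t ^ k)\<^sup>2 - (\<psi> t)\<^sup>2\<bar> \<le> \<delta>" if t: "t \<in> {0..M}" for t
  proof -
    define q where "q = (\<Sum>k\<le>N. c k * t ^ k)"
    have 1: "\<bar>q - \<psi> t\<bar> \<le> e" using bspec[OF c t] unfolding q_def by linarith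
    have "\<bar>\<psi> t\<bar> \<le> max B 0" using B t by force
    hence 2: "\<bar>q + \<psi> t\<bar> \<le> 2 * max B 0 + 1" using 1 e(2) by linarith
    have "q\<^sup>2 - (\<psi> t)\<^sup>2 = (q - \<psi> t) * (q + \<psi> t)" by (simp add: power2_eq_square algebra_simps)
    hence "\<bar>q\<^sup>2 - (\<psi> t)\<^sup>2\<bar> = \<bar>q - \<psi> t\<bar> * \<bar>q + \<psi> t\<bar>" by (simp add: abs_mult)
    also have "\<dots> \<le> e * (2 * max B 0 + 1)" using 1 2 e(1) by (intro mult_mono) auto
    finally show ?thesis using e(3) by (simp add: q_def)
  qed
  thus thesis using that by blast
qed

text \<open>Coordinatewise this is \<open>0 \<le> (2 * p - q)\<^sup>2\<close>. The weights are such
  that \<open>K\<close> can be absorbed in \<open>polynomial_cuntz_approximation\<close>.\<close>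

lemma Re_cscalar_prod_le:
  assumes "u \<in> carrier_vec n" "v \<in> carrier_vec n"
  shows "4 * Re (u \<bullet>c v) \<le> 4 * nsq u + nsq v"
proof -
  have "4 * Re (u \<bullet>c v) = (\<Sum>i<n. 4 * Re (vec_index u i * cnj (vec_index v i)))"
    unfolding cscalar_prod_sum[OF assms(2)] by (simp add: sum_distrib_left)
  also have "\<dots> \<le> (\<Sum>i<n. 4 * (cmod (vec_index u i))\<^sup>2 + (cmod (vec_index v i))\<^sup>2)"
  proof (rule sum_mono)
    fix i
    define p q where "p = cmod (vec_index u i)" and "q = cmod (vec_index v i)"
    have "Re (vec_index u i * cnj (vec_index v i)) \<le> p * q"
      using complex_Re_le_cmod[of "vec_index u i * cnj (vec_index v i)"] by (simp add: norm_mult p_def q_def)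
    moreover have "0 \<le> (2 * p - q)\<^sup>2" by simp
    ultimately show "4 * Re (vec_index u i * cnj (vec_index v i)) \<le> 4 * (cmod (vec_index u i))\<^sup>2 + (cmod (vec_index v i))\<^sup>2"
      unfolding p_def[symmetric] q_def[symmetric] by (simp add: power2_eq_square algebra_simps)
  qed
  also have "\<dots> = 4 * nsq u + nsq v" using assms by (simp add: nsq_sum[of _ n] sum.distrib sum_distrib_left)
  finally show ?thesis .
qed

lemma mpoly_hermitian:
  assumes A: "A \<in> carrier_mat n n" and h: "mat_adjoint A = A"
  shows "mat_adjoint (mpoly c N A) = mpoly c N A"
proof (induction N)
  case (Suc N)
  have "A ^\<^sub>m Suc N \<in> carrier_mat n n" by (rule pow_carrier_mat[OF A])
  thus ?case unfolding mpoly.simps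
    using Suc mpoly_carrier[OF A, of c N] pow_mat_hermitian[OF A h, of "Suc N"]
    by (simp add: mat_adjoint_add[of _ n n] del: pow_mat.simps)
qed simp

text \<open>The exact model is H/(H + \<epsilon>) placed between two square roots of A. Its defect
  is \<epsilon>/(H + \<epsilon>), and compressed by the square root of A this is at most \<epsilon>,
  because A \<le> H + \<epsilon>. Polynomials replace both functions, as they can be formed in the
  algebra; they depend on \<open>M\<close> and \<open>\<epsilon>\<close> only, not on the size
  \<open>n\<close> or the matrices.\<close>

theorem polynomial_cuntz_approximation:
  assumes \<epsilon>: "0 < \<epsilon>" and M: "0 < M"
  obtains p P g Q where "\<And>n A H v. A \<in> carrier_mat n n \<Longrightarrow> psd A \<Longrightarrow> H \<in> carrier_mat n n \<Longrightarrow> psd H \<Longrightarrow>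
    entry_norm A \<le> M \<Longrightarrow> entry_norm H \<le> M \<Longrightarrow> (\<And>u. u \<in> carrier_vec n \<Longrightarrow> qform A u \<le> qform H u + \<epsilon> * nsq u) \<Longrightarrow> v \<in> carrier_vec n \<Longrightarrow>
    nsq ((mpoly p P A * (mpoly g Q H * H * mpoly g Q H) * mpoly p P A - A) *\<^sub>v v) \<le> (5 * \<epsilon>)\<^sup>2 * nsq v"
proof -
  have c1: "continuous_on {0..M} sqrt" by (intro continuous_intros)
  obtain p P where p: "\<forall>t\<in>{0..M}. \<bar>(\<Sum>k\<le>P. p k * t ^ k)\<^sup>2 - (sqrt t)\<^sup>2\<bar> \<le> \<epsilon>"
    by (rule square_approximation[OF c1 \<epsilon>])
  have c2: "continuous_on {0..M} (\<lambda>t. 1 / sqrt (t + \<epsilon>))" using \<epsilon> by (intro continuous_intros) auto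
  \<comment> \<open>Multiplied by any \<open>t\<close> in \<open>{0..M}\<close> this is at most
    \<open>\<epsilon> / (M + \<epsilon>)\<close>, hence at most
    \<open>\<epsilon> / (t + \<epsilon>)\<close>.\<close>
  define \<delta> where "\<delta> = \<epsilon> / (M * (M + \<epsilon>))"
  have \<delta>: "0 < \<delta>" using \<epsilon> M by (simp add: \<delta>_def)
  obtain g Q where g: "\<forall>t\<in>{0..M}. \<bar>(\<Sum>k\<le>Q. g k * t ^ k)\<^sup>2 - (1 / sqrt (t + \<epsilon>))\<^sup>2\<bar> \<le> \<delta>"
    by (rule square_approximation[OF c2 \<delta>])
  define pv where "pv t = (\<Sum>k\<le>P. p k * t ^ k)" for t
  define gv where "gv t = (\<Sum>k\<le>Q. g k * t ^ k)" for t
  have pv: "\<bar>(pv t)\<^sup>2 - t\<bar> \<le> \<epsilon>" if "0 \<le> t" "t \<le> M" for t using p that by (simp add: pv_def)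
  \<comment> \<open>One \<open>\<epsilon> / (t + \<epsilon>)\<close> is the exact defect
    \<open>1 - t / (t + \<epsilon>)\<close>, the other bounds the polynomial error.\<close>
  have gv: "\<bar>1 - t * (gv t)\<^sup>2\<bar> \<le> 2 * \<epsilon> / (t + \<epsilon>)" if t: "0 \<le> t" "t \<le> M" for t
  proof -
    have te: "0 < t + \<epsilon>" using t \<epsilon> by simp
    have "\<bar>(gv t)\<^sup>2 - 1 / (t + \<epsilon>)\<bar> \<le> \<delta>"
      using bspec[OF g, of t] t te unfolding gv_def power_divide by simp
    hence "t * \<bar>(gv t)\<^sup>2 - 1 / (t + \<epsilon>)\<bar> \<le> M * \<delta>" using t \<delta> M by (intro mult_mono) auto
    hence "\<bar>t * (gv t)\<^sup>2 - t / (t + \<epsilon>)\<bar> \<le> M * \<delta>" using t by (simp add: abs_mult_pos' right_diff_distrib)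
    moreover have "M * \<delta> = \<epsilon> / (M + \<epsilon>)" using M by (simp add: \<delta>_def)
    moreover have "\<epsilon> / (M + \<epsilon>) \<le> \<epsilon> / (t + \<epsilon>)" using t te \<epsilon> M by (intro divide_left_mono) auto
    moreover have "\<epsilon> / (t + \<epsilon>) + t / (t + \<epsilon>) = 1" unfolding add_divide_distrib[symmetric] using te by simp
    moreover have "0 \<le> \<epsilon> / (t + \<epsilon>)" using te \<epsilon> by simp
    moreover have "2 * \<epsilon> / (t + \<epsilon>) = \<epsilon> / (t + \<epsilon>) + \<epsilon> / (t + \<epsilon>)" by simp
    ultimately show ?thesis by linarith
  qed
  show thesis
  proof (rule that[of p P g Q])
    fix n and A H :: "complex mat" and v :: "complex Matrix.vec"
    assume A: "A \<in> carrier_mat n n" "psd A" and H: "H \<in> carrier_mat n n" "psd H" and b: "entry_norm A \<le> M" "entry_norm H \<le> M"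
      and le: "\<And>u. u \<in> carrier_vec n \<Longrightarrow> qform A u \<le> qform H u + \<epsilon> * nsq u" and v: "v \<in> carrier_vec n"
    have hA: "mat_adjoint A = A" and hH: "mat_adjoint H = H" using A H by (simp_all add: psd_def)
    obtain V f where V: "unitary_mat n V" "A = V * diagm n (\<lambda>i. complex_of_real (f i)) * mat_adjoint V"
      using hermitian_diagonalization_exists[OF A(1) hA] by blast
    obtain U h where U: "unitary_mat n U" "H = U * diagm n (\<lambda>i. complex_of_real (h i)) * mat_adjoint U"
      using hermitian_diagonalization_exists[OF H(1) hH] by blast
    have f: "0 \<le> f i" "f i \<le> M" if "i < n" for i using psd_eigenvalue_bounds[OF V A(2) that] b(1) by auto
    have h: "0 \<le> h i" "h i \<le> M" if "i < n" for i using psd_eigenvalue_bounds[OF U H(2) that] b(2) by auto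
    define c where "c = mpoly p P A"
    define G where "G = mpoly g Q H"
    have c: "c \<in> carrier_mat n n" "mat_adjoint c = c" unfolding c_def
      using mpoly_carrier[OF A(1)] mpoly_hermitian[OF A(1) hA] by auto
    have ceq: "c = V * diagm n (\<lambda>i. complex_of_real (pv (f i))) * mat_adjoint V"
      unfolding c_def pv_def V(2) by (rule mpoly_unitary_diag[OF V(1)])
    have Geq: "G = U * diagm n (\<lambda>i. complex_of_real (gv (h i))) * mat_adjoint U"
      unfolding G_def gv_def U(2) by (rule mpoly_unitary_diag[OF U(1)])
    define T where "T = U * diagm n (\<lambda>i. complex_of_real (h i * (gv (h i))\<^sup>2)) * mat_adjoint U"
    have T: "T \<in> carrier_mat n n" unfolding T_def by (rule unitary_diag_carrier[OF U(1)])
    have Teq: "G * H * G = T"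
      unfolding Geq U(2) T_def unitary_diag_mult[OF U(1)] by (simp add: power2_eq_square mult_ac)
    have cc: "c * c = V * diagm n (\<lambda>i. complex_of_real ((pv (f i))\<^sup>2)) * mat_adjoint V"
      unfolding ceq unitary_diag_mult[OF V(1)] by (simp add: power2_eq_square)
    define D where "D = c * T * c - A"
    have cTc: "c * T * c \<in> carrier_mat n n" using c T by (simp add: mult_carrier_mat[of _ n n _ n])
    have D: "D \<in> carrier_mat n n" unfolding D_def by (rule minus_carrier_mat[OF A(1)])
    have hT: "mat_adjoint T = T"
    proof -
      have Gh: "mat_adjoint G = G" "G \<in> carrier_mat n n" unfolding G_def
        using mpoly_carrier[OF H(1)] mpoly_hermitian[OF H(1) hH] by auto
      show ?thesis unfolding Teq[symmetric] using Gh H(1) hH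
        by (simp add: mat_adjoint_mult[of _ n n _ n] assoc_mult_mat[of _ n n _ n _ n] mult_carrier_mat[of _ n n _ n])
    qed
    have hD: "mat_adjoint D = D"
      unfolding D_def mat_adjoint_minus[OF cTc A(1)] using c T hT hA
      by (simp add: mat_adjoint_mult[of _ n n _ n] assoc_mult_mat[of _ n n _ n _ n] mult_carrier_mat[of _ n n _ n])
    have bound: "\<bar>qform D u\<bar> \<le> 5 * \<epsilon> * nsq u" if u: "u \<in> carrier_vec n" for u
    proof -
      define w where "w = c *\<^sub>v u"
      have w: "w \<in> carrier_vec n" unfolding w_def by (rule mult_mat_vec_carrier[OF c(1) u])
      define y where "y i = (cmod (vec_index (mat_adjoint U *\<^sub>v w) i))\<^sup>2" for i
      have y0: "0 \<le> y i" for i by (simp add: y_def)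
      have he: "0 < h i + \<epsilon>" if "i < n" for i using h[OF that] \<epsilon> by simp
      have qT: "qform (c * T * c) u = qform T w"
        using qform_congruence[OF c(1) T u] unfolding c(2) w_def .
      have "qform T w = (\<Sum>i<n. h i * (gv (h i))\<^sup>2 * y i)"
        unfolding T_def qform_unitary_diag[OF U(1) w] y_def ..
      moreover have nw: "nsq w = (\<Sum>i<n. y i)" unfolding nsq_unitary_coords[OF U(1) w] y_def ..
      ultimately have d1: "nsq w - qform T w = (\<Sum>i<n. (1 - h i * (gv (h i))\<^sup>2) * y i)"
        by (simp add: sum_subtractf left_diff_distrib)
      \<comment> \<open>The form of the inverse of \<open>H + \<epsilon>\<close> at
        \<open>w\<close>. Bounding it by a multiple of \<open>nsq u\<close> is where the domination
        enters.\<close>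
      define K where "K = (\<Sum>i<n. y i / (h i + \<epsilon>))"
      have K1: "\<bar>nsq w - qform T w\<bar> \<le> 2 * \<epsilon> * K"
      proof -
        have "\<bar>nsq w - qform T w\<bar> \<le> (\<Sum>i<n. \<bar>(1 - h i * (gv (h i))\<^sup>2) * y i\<bar>)" unfolding d1 by (rule sum_abs)
        also have "\<dots> \<le> (\<Sum>i<n. 2 * \<epsilon> * (y i / (h i + \<epsilon>)))"
        proof (rule sum_mono)
          fix i assume "i \<in> {..<n}"
          hence "\<bar>1 - h i * (gv (h i))\<^sup>2\<bar> * y i \<le> 2 * \<epsilon> / (h i + \<epsilon>) * y i" using gv h y0
            by (intro mult_right_mono) auto
          thus "\<bar>(1 - h i * (gv (h i))\<^sup>2) * y i\<bar> \<le> 2 * \<epsilon> * (y i / (h i + \<epsilon>))"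
            using y0[of i] by (simp add: abs_mult)
        qed
        finally show ?thesis by (simp add: K_def sum_distrib_left)
      qed
      define z where "z = U * diagm n (\<lambda>i. complex_of_real (1 / (h i + \<epsilon>))) * mat_adjoint U *\<^sub>v w"
      have zc: "z \<in> carrier_vec n" unfolding z_def
        by (rule mult_mat_vec_carrier[OF unitary_diag_carrier[OF U(1)] w])
      have Kz: "K = Re (z \<bullet>c w)"
        using qform_unitary_diag[OF U(1) w, of "\<lambda>i. 1 / (h i + \<epsilon>)"] by (simp add: K_def z_def qform_def y_def)
      have yz: "(cmod (vec_index (mat_adjoint U *\<^sub>v z) i))\<^sup>2 = y i / (h i + \<epsilon>)\<^sup>2" if i: "i < n" for i
      proof -
        have Uw: "mat_adjoint U *\<^sub>v w \<in> carrier_vec n"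
          using U(1) w by (intro mult_mat_vec_carrier[of _ n n]) (simp_all add: unitary_mat_def)
        have "mat_adjoint U *\<^sub>v z = diagm n (\<lambda>i. complex_of_real (1 / (h i + \<epsilon>))) *\<^sub>v (mat_adjoint U *\<^sub>v w)"
          unfolding z_def by (rule unitary_diag_apply[OF U(1) w])
        hence "vec_index (mat_adjoint U *\<^sub>v z) i = complex_of_real (1 / (h i + \<epsilon>)) * vec_index (mat_adjoint U *\<^sub>v w) i"
          unfolding diagm_mult_vec[OF Uw] using i by simp
        hence "cmod (vec_index (mat_adjoint U *\<^sub>v z) i) = 1 / (h i + \<epsilon>) * cmod (vec_index (mat_adjoint U *\<^sub>v w) i)"
          using he[OF i] by (simp only: norm_mult norm_of_real) simp
        thus ?thesis by (simp add: y_def power_mult_distrib power_divide)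
      qed
      have qHz: "qform H z = (\<Sum>i<n. h i * (y i / (h i + \<epsilon>)\<^sup>2))"
        unfolding U(2) qform_unitary_diag[OF U(1) zc] using yz by simp
      have nz: "nsq z = (\<Sum>i<n. y i / (h i + \<epsilon>)\<^sup>2)" unfolding nsq_unitary_coords[OF U(1) zc] using yz by simp
      have ncc: "nsq (c *\<^sub>v x) = (\<Sum>i<n. (pv (f i))\<^sup>2 * (cmod (vec_index (mat_adjoint V *\<^sub>v x) i))\<^sup>2)" if "x \<in> carrier_vec n" for x
        unfolding ceq nsq_unitary_diag[OF V(1) that] by simp
      have qAx: "qform A x = (\<Sum>i<n. f i * (cmod (vec_index (mat_adjoint V *\<^sub>v x) i))\<^sup>2)" if "x \<in> carrier_vec n" for x
        unfolding V(2) by (rule qform_unitary_diag[OF V(1) that])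
      have nA: "\<bar>nsq (c *\<^sub>v x) - qform A x\<bar> \<le> \<epsilon> * nsq x" if x: "x \<in> carrier_vec n" for x
      proof -
        have "nsq (c *\<^sub>v x) - qform A x = (\<Sum>i<n. ((pv (f i))\<^sup>2 - f i) * (cmod (vec_index (mat_adjoint V *\<^sub>v x) i))\<^sup>2)"
          unfolding ncc[OF x] qAx[OF x] by (simp add: sum_subtractf left_diff_distrib)
        also have "\<bar>\<dots>\<bar> \<le> (\<Sum>i<n. \<bar>((pv (f i))\<^sup>2 - f i) * (cmod (vec_index (mat_adjoint V *\<^sub>v x) i))\<^sup>2\<bar>)"
          by (rule sum_abs)
        also have "\<dots> \<le> (\<Sum>i<n. \<epsilon> * (cmod (vec_index (mat_adjoint V *\<^sub>v x) i))\<^sup>2)"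
          using pv f by (intro sum_mono) (auto simp: abs_mult intro!: mult_right_mono)
        also have "\<dots> = \<epsilon> * nsq x" unfolding nsq_unitary_coords[OF V(1) x] by (simp add: sum_distrib_left)
        finally show ?thesis .
      qed
      \<comment> \<open>\<open>z\<close> is the image of \<open>w\<close> under the inverse of
        \<open>H + \<epsilon>\<close>, so \<open>K\<close> is the inner product of \<open>u\<close>
        with \<open>c\<close> applied to \<open>z\<close>. As forms, \<open>c * c\<close> is at most
        A + \<epsilon>, hence at most H + 2\<epsilon>, hence at most 2(H + \<epsilon>), whose value
        at \<open>z\<close> is \<open>2 * K\<close>. Thus \<open>4 * K\<close> is at most
        \<open>4 * nsq u + 2 * K\<close>.\<close>
      have K2: "K \<le> 2 * nsq u"
      proof -
        have "z \<bullet>c w = z \<bullet>c (c *\<^sub>v u)" by (simp add: w_def)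
        also have "\<dots> = (c *\<^sub>v z) \<bullet>c u" using hermitian_form_swap[OF c zc u] by simp
        also have "\<dots> = cnj (u \<bullet>c (c *\<^sub>v z))" by (rule cscalar_prod_cnj[OF u mult_mat_vec_carrier[OF c(1) zc]])
        finally have "4 * K = 4 * Re (u \<bullet>c (c *\<^sub>v z))" unfolding Kz by simp
        also have "\<dots> \<le> 4 * nsq u + nsq (c *\<^sub>v z)"
          by (rule Re_cscalar_prod_le[OF u mult_mat_vec_carrier[OF c(1) zc]])
        finally have "4 * K \<le> 4 * nsq u + nsq (c *\<^sub>v z)" .
        moreover have "nsq (c *\<^sub>v z) \<le> qform A z + \<epsilon> * nsq z" using nA[OF zc] by linarith
        moreover have "qform A z \<le> qform H z + \<epsilon> * nsq z" by (rule le[OF zc])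
        ultimately have 1: "4 * K \<le> 4 * nsq u + (qform H z + 2 * (\<epsilon> * nsq z))" by linarith
        have "qform H z + 2 * (\<epsilon> * nsq z) = (\<Sum>i<n. (h i + 2 * \<epsilon>) * (y i / (h i + \<epsilon>)\<^sup>2))"
          unfolding qHz nz by (simp only: sum_distrib_left sum.distrib distrib_right mult.assoc)
        also have "\<dots> \<le> (\<Sum>i<n. 2 * (y i / (h i + \<epsilon>)))"
        proof (rule sum_mono)
          fix i assume i: "i \<in> {..<n}"
          have p: "0 < h i + \<epsilon>" using he i by simp
          have "(h i + 2 * \<epsilon>) * (y i / (h i + \<epsilon>)\<^sup>2) \<le> (2 * (h i + \<epsilon>)) * (y i / (h i + \<epsilon>)\<^sup>2)"
            using h[of i] i y0[of i] by (intro mult_right_mono) auto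
          also have "\<dots> = 2 * (y i / (h i + \<epsilon>))"
          proof -
            have "2 * r * (w / r\<^sup>2) = 2 * (w / r)" if "0 < r" for r w :: real using that
              by (simp add: power2_eq_square)
            thus ?thesis using p .
          qed
          finally show "(h i + 2 * \<epsilon>) * (y i / (h i + \<epsilon>)\<^sup>2) \<le> 2 * (y i / (h i + \<epsilon>))" .
        qed
        also have "\<dots> = 2 * K" by (simp add: K_def sum_distrib_left)
        finally show ?thesis using 1 by linarith
      qed
      have "qform D u = qform T w - qform A u" unfolding D_def qform_minus[OF cTc A(1) u] qT ..
      hence "\<bar>qform D u\<bar> = \<bar>(nsq w - qform A u) - (nsq w - qform T w)\<bar>" by simp
      also have "\<dots> \<le> \<bar>nsq w - qform A u\<bar> + \<bar>nsq w - qform T w\<bar>" by (rule abs_triangle_ineq4)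
      also have "\<bar>nsq w - qform T w\<bar> \<le> 2 * \<epsilon> * K" by (rule K1)
      also have "2 * \<epsilon> * K \<le> 2 * \<epsilon> * (2 * nsq u)" using K2 \<epsilon> by (intro mult_left_mono) auto
      also have "\<bar>nsq w - qform A u\<bar> \<le> \<epsilon> * nsq u" unfolding w_def by (rule nA[OF u])
      finally show ?thesis by (simp add: algebra_simps)
    qed
    have "nsq (D *\<^sub>v v) \<le> (5 * \<epsilon>)\<^sup>2 * nsq v"
      by (rule hermitian_nsq_bound[OF D hD _ bound v]) (use \<epsilon> in simp)
    thus "nsq ((mpoly p P A * (mpoly g Q H * H * mpoly g Q H) * mpoly p P A - A) *\<^sub>v v) \<le> (5 * \<epsilon>)\<^sup>2 * nsq v"
      unfolding D_def Teq[symmetric] c_def G_def .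
  qed
qed

section \<open>Operator norms and the conclusion\<close>

lemma opnorm_le:
  assumes M: "M \<in> carrier_mat n n" and C: "0 \<le> C"
    and bound: "\<And>v. v \<in> carrier_vec n \<Longrightarrow> nsq (M *\<^sub>v v) \<le> C\<^sup>2 * nsq v"
  shows "opnorm M \<le> C"
  unfolding opnorm_def
proof (rule cSup_least)
  have "vnorm (0\<^sub>v n) \<le> 1" by (simp add: vnorm_def)
  hence "vnorm (M *\<^sub>v 0\<^sub>v n) \<in> {vnorm (M *\<^sub>v v) |v. v \<in> carrier_vec (dim_col M) \<and> vnorm v \<le> 1}"
    using M by (intro CollectI exI[of _ "0\<^sub>v n"]) auto
  thus "{vnorm (M *\<^sub>v v) |v. v \<in> carrier_vec (dim_col M) \<and> vnorm v \<le> 1} \<noteq> {}" by (metis empty_iff)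
next
  fix y assume "y \<in> {vnorm (M *\<^sub>v v) |v. v \<in> carrier_vec (dim_col M) \<and> vnorm v \<le> 1}"
  then obtain v where y: "y = vnorm (M *\<^sub>v v)" and v: "v \<in> carrier_vec n" "vnorm v \<le> 1" using M by auto
  have "nsq v \<le> 1" using v(2) by (simp add: vnorm_def nsq_def)
  hence "C\<^sup>2 * nsq v \<le> C\<^sup>2 * 1" by (intro mult_left_mono) auto
  hence "nsq (M *\<^sub>v v) \<le> C\<^sup>2" using bound[OF v(1)] by simp
  hence "sqrt (nsq (M *\<^sub>v v)) \<le> sqrt (C\<^sup>2)" by (rule real_sqrt_le_mono)
  thus "y \<le> C" unfolding y vnorm_def nsq_def[symmetric] using C by simp
qed

lemma sup_norm_bounds:
  assumes C: "0 \<le> C" and bound: "\<And>k x. k \<le> l \<Longrightarrow> x \<in> topspace (X k) \<Longrightarrow> opnorm (F k x) \<le> C"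
  shows "0 \<le> sup_norm X l F" "sup_norm X l F \<le> C"
proof -
  let ?S = "insert 0 {opnorm (F k x) | k x. k \<le> l \<and> x \<in> topspace (X k)}"
  have le: "y \<le> C" if "y \<in> ?S" for y using that C bound by auto
  show "0 \<le> sup_norm X l F" unfolding sup_norm_def
    by (rule cSup_upper[OF insertI1]) (rule bdd_aboveI[OF le])
  show "sup_norm X l F \<le> C" unfolding sup_norm_def by (rule cSup_least[OF insert_not_empty le])
qed

text \<open>The approximating elements will lie in the algebra itself, that is, in matrices of size
  1 over it.\<close>

lemma blockmat_1: "V 0 0 k x \<in> carrier_mat (n k) (n k) \<Longrightarrow> blockmat n 1 V k x = V 0 0 k x"
  by (intro eq_matI) (auto simp: blockmat_def)

text \<open>The entries of \<open>a\<close> and of \<open>h\<close> are bounded over all base spaces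
  together, so one pair of polynomials serves at every point, and \<open>v\<close> is formed by
  algebra operations instead of pointwise choices.\<close>

lemma (in rsh) cuntz_approximation:
  assumes \<epsilon>: "0 < \<epsilon>" and a: "a \<in> R l" and b: "b \<in> R l"
    and pa: "\<And>j x. j \<le> l \<Longrightarrow> x \<in> topspace (X j) \<Longrightarrow> psd (a j x)"
    and pb: "\<And>j x. j \<le> l \<Longrightarrow> x \<in> topspace (X j) \<Longrightarrow> psd (b j x)"
    and rk: "\<And>j x. j \<le> l \<Longrightarrow> x \<in> topspace (X j) - X0 j \<Longrightarrow>
      \<exists>d::nat. covdim (X j) = enat d \<and> real (mrank (a j x)) + (real d - 1) / 2 \<le> real (mrank (b j x))"
  shows "\<exists>v\<in>R l. \<forall>k\<le>l. \<forall>x\<in>topspace (X k). opnorm (v k x * b k x * mat_adjoint (v k x) - a k x) \<le> 5 * \<epsilon>"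
proof -
  have "\<exists>s c. s \<in> R l \<and> 0 \<le> c \<and> (\<forall>j\<le>l. \<forall>x\<in>topspace (X j). posdef (dominate \<epsilon> 0 c (a j x) (b j x) (s j x)))"
    by (rule stage_dominating_element[OF le_refl a b \<epsilon>]) (rule pa pb rk; assumption)+
  then obtain s c where s: "s \<in> R l" "0 \<le> c"
    "\<forall>j\<le>l. \<forall>x\<in>topspace (X j). posdef (dominate \<epsilon> 0 c (a j x) (b j x) (s j x))" by meson
  \<comment> \<open>The square root moves the constant into the element, so that \<open>h\<close>
    below is \<open>c\<close> times the product formed with \<open>s\<close>.\<close>
  define t where "t = esmult (complex_of_real (sqrt c)) s"
  have t: "t \<in> R l" unfolding t_def by (rule esmult_closed[OF le_refl s(1)])
  define h where "h = emult (emult t b) (eadj t)"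
  have h: "h \<in> R l" unfolding h_def by (intro emult_closed eadj_closed t b le_refl)
  obtain M1 where M1: "0 < M1" "\<forall>j\<le>l. \<forall>x\<in>topspace (X j). entry_norm (a j x) \<le> M1"
    by (rule stage_bounded[OF le_refl a])
  obtain M2 where M2: "0 < M2" "\<forall>j\<le>l. \<forall>x\<in>topspace (X j). entry_norm (h j x) \<le> M2"
    by (rule stage_bounded[OF le_refl h])
  define M where "M = max M1 M2"
  have M: "0 < M" using M1(1) by (simp add: M_def)
  obtain p P g Q where pg: "\<And>n A H v. A \<in> carrier_mat n n \<Longrightarrow> psd A \<Longrightarrow> H \<in> carrier_mat n n \<Longrightarrow> psd H \<Longrightarrow>
    entry_norm A \<le> M \<Longrightarrow> entry_norm H \<le> M \<Longrightarrow> (\<And>u. u \<in> carrier_vec n \<Longrightarrow> qform A u \<le> qform H u + \<epsilon> * nsq u) \<Longrightarrow> v \<in> carrier_vec n \<Longrightarrow>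
    nsq ((mpoly p P A * (mpoly g Q H * H * mpoly g Q H) * mpoly p P A - A) *\<^sub>v v) \<le> (5 * \<epsilon>)\<^sup>2 * nsq v"
    using polynomial_cuntz_approximation[OF \<epsilon> M] by metis
  define v where "v = emult (emult (epoly l p P a) (epoly l g Q h)) t"
  have v: "v \<in> R l" unfolding v_def by (intro emult_closed epoly_closed a h t le_refl)
  have "opnorm (v k x * b k x * mat_adjoint (v k x) - a k x) \<le> 5 * \<epsilon>" if kx: "k \<le> l" "x \<in> topspace (X k)" for k x
  proof -
    define A B T H where "A = a k x" and "B = b k x" and "T = t k x" and "H = T * B * mat_adjoint T"
    have c: "A \<in> carrier_mat (n k) (n k)" "B \<in> carrier_mat (n k) (n k)" "T \<in> carrier_mat (n k) (n k)"
      unfolding A_def B_def T_def by (rule ext_carrier[OF a] ext_carrier[OF b] ext_carrier[OF t])+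
    have psd: "psd A" "psd B" unfolding A_def B_def by (rule pa[OF kx] pb[OF kx])+
    have Heq: "h k x = H" by (simp add: h_def H_def T_def B_def emult_def eadj_def)
    have Hc: "H \<in> carrier_mat (n k) (n k)" unfolding Heq[symmetric] by (rule ext_carrier[OF h])
    have Hpsd: "psd H" using psd_congruence[OF c(2) psd(2) mat_adjoint_carrier[OF c(3)]] by (simp add: H_def)
    have bounds: "entry_norm A \<le> M" "entry_norm H \<le> M"
      unfolding A_def Heq[symmetric] M_def using mp[OF spec[OF M1(2)] kx(1)] mp[OF spec[OF M2(2)] kx(1)] kx(2)
      by (simp_all add: le_max_iff_disj)
    have qle: "qform A u \<le> qform H u + \<epsilon> * nsq u" if u: "u \<in> carrier_vec (n k)" for u
    proof -
      define S where "S = s k x"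
      have S: "S \<in> carrier_mat (n k) (n k)" unfolding S_def by (rule ext_carrier[OF s(1)])
      have w: "mat_adjoint S *\<^sub>v u \<in> carrier_vec (n k)"
        by (rule mult_mat_vec_carrier[OF mat_adjoint_carrier[OF S] u])
      have "mat_adjoint T = complex_of_real (sqrt c) \<cdot>\<^sub>m mat_adjoint S"
        unfolding T_def t_def esmult_def S_def mat_adjoint_smult by simp
      hence Tu: "mat_adjoint T *\<^sub>v u = complex_of_real (sqrt c) \<cdot>\<^sub>v (mat_adjoint S *\<^sub>v u)"
        using S u by (intro eq_vecI) (auto)
      have "qform H u = qform B (mat_adjoint T *\<^sub>v u)"
        using qform_congruence[OF mat_adjoint_carrier[OF c(3)] c(2) u] by (simp add: H_def)
      also have "\<dots> = c * qform B (mat_adjoint S *\<^sub>v u)"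
        unfolding Tu qform_smult_vec[OF c(2) w] using s(2) by simp
      finally have qH: "qform H u = c * qform B (mat_adjoint S *\<^sub>v u)" .
      have A0: "A ^\<^sub>m 0 *\<^sub>v u = u" using c(1) u by simp
      have hA: "mat_adjoint A = A" using psd(1) by (simp add: psd_def)
      have "psd (dominate \<epsilon> 0 c A B S)" unfolding A_def B_def S_def
        by (rule posdef_imp_psd) (rule bspec[OF mp[OF spec[OF s(3)] kx(1)] kx(2)])
      moreover have "dim_row (dominate \<epsilon> 0 c A B S) = n k" using c(1) by (simp add: dominate_def)
      ultimately have "0 \<le> qform (dominate \<epsilon> 0 c A B S) u" using u by (simp add: psd_def)
      thus ?thesis unfolding qform_dominate[OF c(1) hA c(2) S u] A0 qH by simp
    qed
    define p' where "p' = mpoly p P A"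
    define g' where "g' = mpoly g Q H"
    have p': "p' \<in> carrier_mat (n k) (n k)" "mat_adjoint p' = p'"
      unfolding p'_def using mpoly_carrier[OF c(1)] mpoly_hermitian[OF c(1)] psd(1) by (auto simp: psd_def)
    have g': "g' \<in> carrier_mat (n k) (n k)" "mat_adjoint g' = g'"
      unfolding g'_def using mpoly_carrier[OF Hc] mpoly_hermitian[OF Hc] Hpsd by (auto simp: psd_def)
    have veq: "v k x = p' * g' * T"
      using epoly_apply[OF a kx] epoly_apply[OF h kx] by (simp add: v_def emult_def p'_def g'_def A_def Heq T_def)
    have "v k x * b k x * mat_adjoint (v k x) = p' * (g' * H * g') * p'"
      unfolding veq B_def[symmetric] H_def using c p' g' mat_adjoint_carrier[OF c(3)]
      by (simp add: mat_adjoint_mult[of _ "n k" "n k" _ "n k"] assoc_mult_mat[of _ "n k" "n k" _ "n k" _ "n k"]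
          mult_carrier_mat[of _ "n k" "n k" _ "n k"])
    hence e: "v k x * b k x * mat_adjoint (v k x) - a k x = p' * (g' * H * g') * p' - A" by (simp add: A_def)
    show ?thesis unfolding e
    proof (rule opnorm_le)
      show "p' * (g' * H * g') * p' - A \<in> carrier_mat (n k) (n k)" by (rule minus_carrier_mat[OF c(1)])
      show "0 \<le> 5 * \<epsilon>" using \<epsilon> by simp
      fix w :: "complex Matrix.vec" assume w: "w \<in> carrier_vec (n k)"
      show "nsq ((p' * (g' * H * g') * p' - A) *\<^sub>v w) \<le> (5 * \<epsilon>)\<^sup>2 * nsq w"
        unfolding p'_def g'_def by (rule pg[OF c(1) psd(1) Hc Hpsd bounds qle w])
    qed
  qed
  thus ?thesis using v by meson
qed

theorem theorem4p6:
  fixes n :: "nat \<Rightarrow> nat" and X :: "nat \<Rightarrow> 'x topology" and X0 :: "nat \<Rightarrow> 'x set"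
    and \<phi> :: "nat \<Rightarrow> 'x elt \<Rightarrow> 'x \<Rightarrow> complex mat" and l :: nat and a b :: "'x elt"
  defines "A \<equiv> rsh_stage n X X0 \<phi> l"
  assumes decomp: "rsh_decomposition n X X0 \<phi> l"
    and sep: "separable_alg X l A"
    and pos_a: "positive_elt X l A a"
    and pos_b: "positive_elt X l A b"
    and rank_cond: "\<forall>k\<le>l. \<forall>x\<in>topspace (X k) - X0 k.
        \<exists>d::nat. covdim (X k) = enat d \<and>
          real (mrank (a k x)) + (real d - 1) / 2 \<le> real (mrank (b k x))"
  shows "cuntz_below n X l A a b"
proof -
  interpret rsh n X X0 \<phi> l by (rule rsh.intro[OF decomp])
  have a: "a \<in> rsh_stage n X X0 \<phi> l" and b: "b \<in> rsh_stage n X X0 \<phi> l"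
    using pos_a pos_b by (simp_all add: positive_elt_def A_def)
  have psd: "psd (a j x)" "psd (b j x)" if "j \<le> l" "x \<in> topspace (X j)" for j x
    using pos_a pos_b that pos_mat_psd[OF ext_carrier[OF a, of j x]] pos_mat_psd[OF ext_carrier[OF b, of j x]]
    by (simp_all add: positive_elt_def)
  have "\<exists>v\<in>A. \<forall>k\<le>l. \<forall>x\<in>topspace (X k). opnorm (v k x * b k x * mat_adjoint (v k x) - a k x) \<le> 1 / real (Suc i)" for i
  proof -
    \<comment> \<open>The parameter handed to \<open>cuntz_approximation\<close> is
      \<open>e / 5\<close>, to offset the factor 5 in its conclusion.\<close>
    define e where "e = 1 / real (Suc i)"
    have "5 * (e / 5) = e" by simp
    moreover have "\<exists>v\<in>A. \<forall>k\<le>l. \<forall>x\<in>topspace (X k). opnorm (v k x * b k x * mat_adjoint (v k x) - a k x) \<le> 5 * (e / 5)"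
      unfolding A_def by (rule cuntz_approximation[OF _ a b]) (simp add: e_def, (rule psd; assumption)+, use rank_cond in meson)
    ultimately show ?thesis by (simp only: e_def)
  qed
  then obtain v where v: "\<And>i. v i \<in> A"
    "\<And>i k x. k \<le> l \<Longrightarrow> x \<in> topspace (X k) \<Longrightarrow> opnorm (v i k x * b k x * mat_adjoint (v i k x) - a k x) \<le> 1 / real (Suc i)"
    by metis
  \<comment> \<open>The family constant in \<open>p\<close> and \<open>q\<close> stands for a 1 by 1
    matrix; with block size 1 only its entry at \<open>(0, 0)\<close> is read.\<close>
  define F where "F i k x = blockmat n 1 (\<lambda>p q. v i) k x * blockmat n 1 (corner n b) k x * mat_adjoint (blockmat n 1 (\<lambda>p q. v i) k x)
      - blockmat n 1 (corner n a) k x" for i k x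
  have F: "F i k x = v i k x * b k x * mat_adjoint (v i k x) - a k x" for i k x
  proof -
    have "blockmat n 1 (\<lambda>p q. v i) k x = v i k x"
      by (rule blockmat_1) (rule ext_carrier, use v(1)[of i] A_def in simp)
    moreover have "blockmat n 1 (corner n b) k x = b k x" "blockmat n 1 (corner n a) k x = a k x"
      by (subst blockmat_1; simp add: corner_def ext_carrier[OF a] ext_carrier[OF b])+
    ultimately show ?thesis by (simp add: F_def)
  qed
  have sn: "0 \<le> sup_norm X l (F i)" "sup_norm X l (F i) \<le> 1 / real (Suc i)" for i
    using sup_norm_bounds[of "1 / real (Suc i)" l X "F i"] v(2)[of _ _ i] unfolding F by simp_all
  have "(\<lambda>i. sup_norm X l (F i)) \<longlonglongrightarrow> 0"
  proof (rule tendsto_sandwich[OF _ _ tendsto_const])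
    show "(\<lambda>i. 1 / real (Suc i)) \<longlonglongrightarrow> 0" using LIMSEQ_inverse_real_of_nat by (simp add: inverse_eq_divide)
  qed (use sn in auto)
  thus ?thesis unfolding cuntz_below_def
    by (intro exI[of _ "\<lambda>_. 1"] exI[of _ "\<lambda>i p q. v i"]) (simp add: v(1) F_def[abs_def])
qed

end
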